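(* Let $\{X_{\boldsymbol n}\}_{\boldsymbol n\in\mathbb N^2}$ be the two-dimensional randomized Karlin model built from probability measures $\mu_1,\mu_2$ on $\mathbb N$, where for $q=1,2$ the measure $\mu_q$ satisfies the regular variation condition with index $\alpha_q\in(0,1)$ and slowly varying function $L_q$. Let $S_{\boldsymbol n}=\sum_{i_1=1}^{n_1}\sum_{i_2=1}^{n_2}X_{(i_1,i_2)}$ (empty sums are $0$). Then $$\left\{\frac{S_{(\lfloor n_1t_1\rfloor,\lfloor n_2t_2\rfloor)}}{n_1^{\alpha_1/2}n_2^{\alpha_2/2}\,(L_1(n_1)L_2(n_2))^{1/2}}\right\}_{\boldsymbol t\in[0,1]^2}\Rightarrow \sigma_{\boldsymbol\alpha}\left\{\mathbb B^{\boldsymbol\alpha/2}_{\boldsymbol t}\right\}_{\boldsymbol t\in[0,1]^2}$$ in $D([0,1]^2)$ as $\min(n_1,n_2)\to\infty$, where $\sigma_{\boldsymbol\alpha}^2=\prod_{q=1}^2\Gamma(1-\alpha_q)2^{\alpha_q-1}$ and $\mathbb B^{\boldsymbol\alpha/2}$ is a fractional Brownian sheet with Hurst index $(\alpha_1/2,\alpha_2/2)$.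
   Context: $\mathbb N=\{1,2,\dots\}$. $\Rightarrow$ denotes convergence in distribution; $D([0,1]^2)$ is the two-parameter càdlàg space with the Skorohod topology. Regular variation condition on a probability measure $\mu$ on $\mathbb N$ with index $\alpha\in(0,1)$ and function $L$: writing $p_\ell=\mu(\{\ell\})$, the sequence $(p_\ell)_{\ell\ge1}$ is non-increasing and $\max\{\ell\ge1:p_\ell\ge 1/x\}\sim x^\alpha L(x)$ as $x\to\infty$, where $L$ is slowly varying at $\infty$ and bounded away from $0$ and $\infty$ on every compact subset of $(0,\infty)$. Two-dimensional randomized Karlin model: for $q=1,2$ let $\{Y^{(q)}_n\}_{n\in\mathbb N}$ be i.i.d. with law $\mu_q$, the two sequences being independent. Put $Y^{(q)}_{n,\ell}=\sum_{i=1}^n\mathbf 1_{\{Y^{(q)}_i=\ell\}}$. Let $\{\epsilon_{\boldsymbol\ell}\}_{\boldsymbol\ell\in\mathbb N^2}$ be i.i.d. uniform on $\{-1,1\}$, independent of $Y^{(1)},Y^{(2)}$. For $\boldsymbol n=(n_1,n_2)\in\mathbb N^2$ set $$X_{\boldsymbol n}=\epsilon_{\boldsymbol\ell}\prod_{q=1}^2(-1)^{Y^{(q)}_{n_q,\ell_q}+1}\quad\text{if }(Y^{(1)}_{n_1},Y^{(2)}_{n_2})=\boldsymbol\ell=(\ell_1,\ell_2).$$ A fractional Brownian sheet with Hurst index $\boldsymbol H=(H_1,H_2)\in(0,1)^2$ is a centered Gaussian process $\{\mathbb B^{\boldsymbol H}_{\boldsymbol t}\}_{\boldsymbol t\in\mathbb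 R_+^2}$ with covariance $\mathrm{Cov}(\mathbb B^{\boldsymbol H}_{\boldsymbol s},\mathbb B^{\boldsymbol H}_{\boldsymbol t})=\prod_{q=1}^2\frac12\left(t_q^{2H_q}+s_q^{2H_q}-|t_q-s_q|^{2H_q}\right)$. *)

theory Defs
  imports
    "HOL-Probability.Probability"
    "HOL-Library.Landau_Symbols"
begin

section \<open>Regular variation\<close>

definition slowly_varying :: "(real \<Rightarrow> real) \<Rightarrow> bool" where
  "slowly_varying L \<longleftrightarrow>
     (\<forall>\<^sub>F x in at_top. L x > 0) \<and>
     (\<forall>c>0. ((\<lambda>x. L (c * x) / L x) \<longlongrightarrow> 1) at_top)"

definition prob_measure_on_posnat :: "nat measure \<Rightarrow> bool" where
  "prob_measure_on_posnat \<mu> \<longleftrightarrow> prob_space \<mu> \<and> sets \<mu> = sets (count_space {1..})"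

text \<open>
  For \<^term>\<open>x > 0\<close> the set of indices below is finite, and it is nonempty as soon as
  \<^term>\<open>x\<close> is large; hence the junk value of \<^term>\<open>Max {}\<close> does not affect the asymptotics.
\<close>

definition regular_variation_condition ::
    "nat measure \<Rightarrow> real \<Rightarrow> (real \<Rightarrow> real) \<Rightarrow> bool" where
  "regular_variation_condition \<mu> \<alpha> L \<longleftrightarrow>
     antimono_on {1..} (\<lambda>l. measure \<mu> {l}) \<and>
     (\<lambda>x::real. real (Max {l. 1 \<le> l \<and> measure \<mu> {l} \<ge> 1 / x})) \<sim>[at_top] (\<lambda>x. x powr \<alpha> * L x) \<and>
     slowly_varying L \<and>
     (\<forall>K. compact K \<and> K \<subseteq> {0<..} \<longrightarrow> (\<exists>c C. 0 < c \<and> (\<forall>x\<in>K. c \<le> L x \<and> L x \<le> C)))"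


section \<open>The randomized Karlin model\<close>

text \<open>Independence of two random elements with possibly different value types; the library's
  \<^const>\<open>prob_space.indep_var\<close> requires both to take values in the same type.\<close>

definition (in prob_space) indep_elements ::
    "'b measure \<Rightarrow> ('a \<Rightarrow> 'b) \<Rightarrow> 'c measure \<Rightarrow> ('a \<Rightarrow> 'c) \<Rightarrow> bool" where
  "indep_elements A U B V \<longleftrightarrow>
     random_variable A U \<and> random_variable B V \<and>
     indep_set {U -` S \<inter> space M | S. S \<in> sets A} {V -` S \<inter> space M | S. S \<in> sets B}"

definition occupancy :: "(nat \<Rightarrow> 'a \<Rightarrow> nat) \<Rightarrow> nat \<Rightarrow> nat \<Rightarrow> 'a \<Rightarrow> nat" where
  "occupancy Y n l \<omega> = (\<Sum>i=1..n. if Y i \<omega> = l then 1 else 0)"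

definition karlin_X ::
    "(nat \<Rightarrow> 'a \<Rightarrow> nat) \<Rightarrow> (nat \<Rightarrow> 'a \<Rightarrow> nat) \<Rightarrow> (nat \<times> nat \<Rightarrow> 'a \<Rightarrow> real) \<Rightarrow>
     nat \<Rightarrow> nat \<Rightarrow> 'a \<Rightarrow> real" where
  "karlin_X Y1 Y2 \<epsilon> n1 n2 \<omega> =
     (let l1 = Y1 n1 \<omega>; l2 = Y2 n2 \<omega> in
        \<epsilon> (l1, l2) \<omega> * ((-1) ^ (occupancy Y1 n1 l1 \<omega> + 1) * (-1) ^ (occupancy Y2 n2 l2 \<omega> + 1)))"

definition karlin_S ::
    "(nat \<Rightarrow> 'a \<Rightarrow> nat) \<Rightarrow> (nat \<Rightarrow> 'a \<Rightarrow> nat) \<Rightarrow> (nat \<times> nat \<Rightarrow> 'a \<Rightarrow> real) \<Rightarrow>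
     nat \<Rightarrow> nat \<Rightarrow> 'a \<Rightarrow> real" where
  "karlin_S Y1 Y2 \<epsilon> n1 n2 \<omega> = (\<Sum>i1=1..n1. \<Sum>i2=1..n2. karlin_X Y1 Y2 \<epsilon> i1 i2 \<omega>)"

text \<open>All index sets and value sets are the positive integers, so the functions
  \<^term>\<open>Y1\<close>, \<^term>\<open>Y2\<close>, \<^term>\<open>\<epsilon>\<close> are unconstrained (and never used) at index \<^term>\<open>0\<close>.\<close>

locale randomized_karlin_model = prob_space M for M :: "'a measure" +
  fixes \<mu>1 \<mu>2 :: "nat measure"
    and Y1 Y2 :: "nat \<Rightarrow> 'a \<Rightarrow> nat"
    and \<epsilon> :: "nat \<times> nat \<Rightarrow> 'a \<Rightarrow> real"
  assumes \<mu>1: "prob_measure_on_posnat \<mu>1"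
    and \<mu>2: "prob_measure_on_posnat \<mu>2"
    and indep_Y1: "indep_vars (\<lambda>_. count_space {1..}) Y1 {1..}"
    and law_Y1: "\<And>n. n \<ge> 1 \<Longrightarrow> distr M (count_space {1..}) (Y1 n) = \<mu>1"
    and indep_Y2: "indep_vars (\<lambda>_. count_space {1..}) Y2 {1..}"
    and law_Y2: "\<And>n. n \<ge> 1 \<Longrightarrow> distr M (count_space {1..}) (Y2 n) = \<mu>2"
    and indep_Y1_Y2:
      "indep_elements
         (\<Pi>\<^sub>M n\<in>{1..}. count_space {1..}) (\<lambda>\<omega>. \<lambda>n\<in>{1..}. Y1 n \<omega>)
         (\<Pi>\<^sub>M n\<in>{1..}. count_space {1..}) (\<lambda>\<omega>. \<lambda>n\<in>{1..}. Y2 n \<omega>)"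
    and indep_\<epsilon>: "indep_vars (\<lambda>_. count_space {-1, 1}) \<epsilon> ({1..} \<times> {1..})"
    and law_\<epsilon>: "\<And>l. l \<in> {1..} \<times> {1..} \<Longrightarrow>
      distr M (count_space {-1, 1}) (\<epsilon> l) = uniform_count_measure {-1, 1}"
    and indep_\<epsilon>_Y:
      "indep_elements
         (\<Pi>\<^sub>M l\<in>{1..} \<times> {1..}. count_space {-1, 1}) (\<lambda>\<omega>. \<lambda>l\<in>{1..} \<times> {1..}. \<epsilon> l \<omega>)
         ((\<Pi>\<^sub>M n\<in>{1..}. count_space {1..}) \<Otimes>\<^sub>M (\<Pi>\<^sub>M n\<in>{1..}. count_space {1..}))
         (\<lambda>\<omega>. (\<lambda>n\<in>{1..}. Y1 n \<omega>, \<lambda>n\<in>{1..}. Y2 n \<omega>))"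


section \<open>Gaussian processes and the fractional Brownian sheet\<close>

text \<open>Degenerate (Dirac) normal laws are included.\<close>

definition normal_law :: "real measure \<Rightarrow> bool" where
  "normal_law \<nu> \<longleftrightarrow>
     (\<exists>m. \<nu> = return borel m) \<or>
     (\<exists>m s. s > 0 \<and> \<nu> = density lborel (\<lambda>x. ennreal (normal_density m s x)))"

definition gaussian_process :: "'b measure \<Rightarrow> 't set \<Rightarrow> ('t \<Rightarrow> 'b \<Rightarrow> real) \<Rightarrow> bool" where
  "gaussian_process N T B \<longleftrightarrow>
     prob_space N \<and>
     (\<forall>t\<in>T. B t \<in> borel_measurable N) \<and>
     (\<forall>F c. finite F \<and> F \<subseteq> T \<longrightarrow> normal_law (distr N borel (\<lambda>\<omega>. \<Sum>t\<in>F. c t * B t \<omega>)))"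

definition covariance :: "'b measure \<Rightarrow> ('b \<Rightarrow> real) \<Rightarrow> ('b \<Rightarrow> real) \<Rightarrow> real" where
  "covariance N U V =
     (\<integral>\<omega>. (U \<omega> - (\<integral>\<omega>. U \<omega> \<partial>N)) * (V \<omega> - (\<integral>\<omega>. V \<omega> \<partial>N)) \<partial>N)"

definition fractional_brownian_sheet ::
    "'b measure \<Rightarrow> real \<times> real \<Rightarrow> (real \<times> real \<Rightarrow> 'b \<Rightarrow> real) \<Rightarrow> bool" where
  "fractional_brownian_sheet N H B \<longleftrightarrow>
     gaussian_process N ({0..} \<times> {0..}) B \<and>
     (\<forall>t\<in>{0..} \<times> {0..}. (\<integral>\<omega>. B t \<omega> \<partial>N) = 0) \<and>
     (\<forall>s\<in>{0..} \<times> {0..}. \<forall>t\<in>{0..} \<times> {0..}.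
        covariance N (B s) (B t) =
          (1/2 * (fst t powr (2 * fst H) + fst s powr (2 * fst H) - \<bar>fst t - fst s\<bar> powr (2 * fst H))) *
          (1/2 * (snd t powr (2 * snd H) + snd s powr (2 * snd H) - \<bar>snd t - snd s\<bar> powr (2 * snd H))))"


section \<open>The space $D([0,1]^2)$ with the Skorohod topology\<close>

abbreviation unit_square :: "(real \<times> real) set" where
  "unit_square \<equiv> {0..1} \<times> {0..1}"

definition quadrant ::
    "(real \<Rightarrow> real \<Rightarrow> bool) \<Rightarrow> (real \<Rightarrow> real \<Rightarrow> bool) \<Rightarrow> real \<times> real \<Rightarrow> (real \<times> real) set" where
  "quadrant R1 R2 t = {s \<in> unit_square. R1 (fst s) (fst t) \<and> R2 (snd s) (snd t)}"

text \<open>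
  The two-parameter cadlag functions of Neuhaus, Straf, and Bickel and Wichura: limits exist in
  each of the four quadrants at each point, and the function is continuous from the closed upper
  right quadrant. Limits along quadrants that do not accumulate at \<^term>\<open>t\<close> are vacuous.
  Functions are extensional, so that they are determined by their values on the square.
\<close>

definition skorohod_space :: "(real \<times> real \<Rightarrow> real) set" where
  "skorohod_space =
     {x \<in> extensional unit_square. \<forall>t\<in>unit_square.
        (\<forall>R1\<in>{(<), (\<ge>)}. \<forall>R2\<in>{(<), (\<ge>)}. \<exists>l. (x \<longlongrightarrow> l) (at t within quadrant R1 R2 t)) \<and>
        (x \<longlongrightarrow> x t) (at t within quadrant (\<ge>) (\<ge>) t)}"

definition time_changes :: "(real \<Rightarrow> real) set" where
  "time_changes =
     {f. continuous_on {0..1} f \<and> strict_mono_on {0..1} f \<and> f 0 = 0 \<and> f 1 = 1}"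

definition skorohod_close :: "(real \<times> real \<Rightarrow> real) \<Rightarrow> (real \<times> real \<Rightarrow> real) \<Rightarrow> real \<Rightarrow> bool" where
  "skorohod_close x y e \<longleftrightarrow>
     (\<exists>f1\<in>time_changes. \<exists>f2\<in>time_changes. \<forall>t\<in>unit_square.
        \<bar>x t - y (f1 (fst t), f2 (snd t))\<bar> \<le> e \<and> dist (f1 (fst t), f2 (snd t)) t \<le> e)"

text \<open>The value \<^term>\<open>0\<close> outside the space is only there because \<^locale>\<open>Metric_space\<close>
  asks for a globally nonnegative function.\<close>

definition skorohod_dist :: "(real \<times> real \<Rightarrow> real) \<Rightarrow> (real \<times> real \<Rightarrow> real) \<Rightarrow> real" where
  "skorohod_dist x y =
     (if x \<in> skorohod_space \<and> y \<in> skorohod_space then Inf {e. skorohod_close x y e} else 0)"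

definition skorohod_topology :: "(real \<times> real \<Rightarrow> real) topology" where
  "skorohod_topology = Metric_space.mtopology skorohod_space skorohod_dist"


section \<open>Convergence in distribution\<close>

definition borel_of :: "'c topology \<Rightarrow> 'c measure" where
  "borel_of T = sigma (topspace T) {U. openin T U}"

definition converges_in_distribution ::
    "'c topology \<Rightarrow> 'a measure \<Rightarrow> ('i \<Rightarrow> 'a \<Rightarrow> 'c) \<Rightarrow> 'b measure \<Rightarrow> ('b \<Rightarrow> 'c) \<Rightarrow> 'i filter \<Rightarrow> bool" where
  "converges_in_distribution T M X N Z F \<longleftrightarrow>
     (\<forall>i. X i \<in> measurable M (borel_of T)) \<and>
     Z \<in> measurable N (borel_of T) \<and>
     (\<forall>f. continuous_map T euclideanreal f \<and> bounded (f ` topspace T) \<longrightarrow>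
        ((\<lambda>i. \<integral>\<omega>. f (X i \<omega>) \<partial>M) \<longlongrightarrow> (\<integral>\<omega>. f (Z \<omega>) \<partial>N)) F)"


section \<open>The Skorohod distance is a metric\<close>

lemma time_change_id: "(\<lambda>t. t) \<in> time_changes"
  by (auto simp: time_changes_def strict_mono_on_def)

lemma time_change_image:
  assumes "f \<in> time_changes" shows "f ` {0..1} = {0..1}"
proof
  have c: "continuous_on {0..1} f" and m: "strict_mono_on {0..1} f" and e: "f 0 = 0" "f 1 = 1"
    using assms by (auto simp: time_changes_def)
  have mono: "f s \<le> f t" if "s \<in> {0..1}" "t \<in> {0..1}" "s \<le> t" for s t
    using strict_mono_onD[OF m that(1,2)] that(3) by (cases "s = t") auto
  show "f ` {0..1} \<subseteq> {0..1}"
    using mono[of 0] mono[of _ 1] e by force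
  show "{0..1} \<subseteq> f ` {0..1}"
  proof
    fix y :: real assume "y \<in> {0..1}"
    then obtain t where "0 \<le> t" "t \<le> 1" "f t = y"
      using IVT'[of f 0 y 1] c e by auto
    then show "y \<in> f ` {0..1}" by force
  qed
qed

lemma time_change_in: "f \<in> time_changes \<Longrightarrow> t \<in> {0..1} \<Longrightarrow> f t \<in> {0..1}"
  using time_change_image by blast

lemma time_change_comp:
  assumes "f \<in> time_changes" "g \<in> time_changes" shows "(\<lambda>t. g (f t)) \<in> time_changes"
proof -
  have f: "continuous_on {0..1} f" "strict_mono_on {0..1} f"
    and g: "continuous_on {0..1} g" "strict_mono_on {0..1} g"
    using assms by (simp_all add: time_changes_def)
  have "continuous_on {0..1} (\<lambda>t. g (f t))"
    by (rule continuous_on_compose2[OF g(1) f(1)]) (simp add: time_change_image[OF assms(1)])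
  moreover have "strict_mono_on {0..1} (\<lambda>t. g (f t))"
  proof (rule strict_mono_onI)
    fix r s :: real assume rs: "r \<in> {0..1}" "s \<in> {0..1}" "r < s"
    show "g (f r) < g (f s)"
      by (rule strict_mono_onD[OF g(2) time_change_in[OF assms(1) rs(1)]
            time_change_in[OF assms(1) rs(2)] strict_mono_onD[OF f(2) rs]])
  qed
  ultimately show ?thesis
    using assms by (auto simp: time_changes_def)
qed

lemma time_change_inverse:
  assumes "f \<in> time_changes"
  obtains g where "g \<in> time_changes" "\<And>t. t \<in> {0..1} \<Longrightarrow> f (g t) = t"
proof
  let ?g = "the_inv_into {0..1} f"
  have c: "continuous_on {0..1} f" and m: "strict_mono_on {0..1} f" and e: "f 0 = 0" "f 1 = 1"
    using assms by (auto simp: time_changes_def)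
  have inj: "inj_on f {0..1}"
    by (rule strict_mono_on_imp_inj_on[OF m])
  show fg: "f (?g t) = t" if "t \<in> {0..1}" for t
    using that time_change_image[OF assms] f_the_inv_into_f[OF inj] by blast
  have gin: "?g t \<in> {0..1}" if "t \<in> {0..1}" for t
    using that time_change_image[OF assms] the_inv_into_into[OF inj _ order_refl] by blast
  have "continuous_on (f ` {0..1}) ?g"
    using c by (rule continuous_on_inv) (auto simp: the_inv_into_f_f[OF inj])
  moreover have "strict_mono_on {0..1} ?g"
  proof (rule strict_mono_onI)
    fix r s :: real assume rs: "r \<in> {0..1}" "s \<in> {0..1}" "r < s"
    show "?g r < ?g s"
    proof (rule ccontr)
      assume "\<not> ?g r < ?g s"
      then have "f (?g s) \<le> f (?g r)"
        using strict_mono_onD[OF m gin[OF rs(2)] gin[OF rs(1)]] by (cases "?g s = ?g r") auto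
      then show False using fg rs by auto
    qed
  qed
  moreover have "?g 0 = 0" "?g 1 = 1"
    using the_inv_into_f_f[OF inj, of 0] the_inv_into_f_f[OF inj, of 1] e by auto
  ultimately show "?g \<in> time_changes"
    by (simp add: time_changes_def time_change_image[OF assms])
qed

lemma skorohod_closeI:
  assumes "f1 \<in> time_changes" "f2 \<in> time_changes"
    and "\<And>t. t \<in> unit_square \<Longrightarrow>
      \<bar>x t - y (f1 (fst t), f2 (snd t))\<bar> \<le> e \<and> dist (f1 (fst t), f2 (snd t)) t \<le> e"
  shows "skorohod_close x y e"
  unfolding skorohod_close_def
  by (rule bexI[OF _ assms(1)], rule bexI[OF _ assms(2)], rule ballI, rule assms(3))

lemma skorohod_close_nonneg: "skorohod_close x y e \<Longrightarrow> 0 \<le> e"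
  unfolding skorohod_close_def
  by (metis abs_ge_zero atLeastAtMost_iff mem_Sigma_iff order.refl order.trans zero_le_one)

lemma skorohod_close_sym:
  assumes "skorohod_close x y e" shows "skorohod_close y x e"
proof -
  obtain f1 f2 where f: "f1 \<in> time_changes" "f2 \<in> time_changes"
    and cl: "\<And>t. t \<in> unit_square \<Longrightarrow>
      \<bar>x t - y (f1 (fst t), f2 (snd t))\<bar> \<le> e \<and> dist (f1 (fst t), f2 (snd t)) t \<le> e"
    using assms unfolding skorohod_close_def by blast
  obtain g1 where g1: "g1 \<in> time_changes" "\<And>t. t \<in> {0..1} \<Longrightarrow> f1 (g1 t) = t"
    by (rule time_change_inverse[OF f(1)]) blast
  obtain g2 where g2: "g2 \<in> time_changes" "\<And>t. t \<in> {0..1} \<Longrightarrow> f2 (g2 t) = t"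
    by (rule time_change_inverse[OF f(2)]) blast
  have "\<bar>y t - x (g1 (fst t), g2 (snd t))\<bar> \<le> e \<and> dist (g1 (fst t), g2 (snd t)) t \<le> e"
    if t: "t \<in> unit_square" for t
  proof -
    have mem: "(g1 (fst t), g2 (snd t)) \<in> unit_square"
      using t time_change_in[OF g1(1)] time_change_in[OF g2(1)] by (auto simp: mem_Times_iff)
    have "f1 (g1 (fst t)) = fst t" "f2 (g2 (snd t)) = snd t"
      using t g1(2) g2(2) by (auto simp: mem_Times_iff)
    with cl[OF mem] show ?thesis
      by (simp add: abs_minus_commute dist_commute)
  qed
  note * = this
  show ?thesis
    by (rule skorohod_closeI[OF g1(1) g2(1)]) (rule *)
qed

lemma skorohod_close_trans:
  assumes "skorohod_close x y a" "skorohod_close y z b" shows "skorohod_close x z (a + b)"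
proof -
  obtain f1 f2 where f: "f1 \<in> time_changes" "f2 \<in> time_changes"
    and cf: "\<And>t. t \<in> unit_square \<Longrightarrow>
      \<bar>x t - y (f1 (fst t), f2 (snd t))\<bar> \<le> a \<and> dist (f1 (fst t), f2 (snd t)) t \<le> a"
    using assms(1) unfolding skorohod_close_def by blast
  obtain g1 g2 where g: "g1 \<in> time_changes" "g2 \<in> time_changes"
    and cg: "\<And>t. t \<in> unit_square \<Longrightarrow>
      \<bar>y t - z (g1 (fst t), g2 (snd t))\<bar> \<le> b \<and> dist (g1 (fst t), g2 (snd t)) t \<le> b"
    using assms(2) unfolding skorohod_close_def by blast
  have "\<bar>x t - z (g1 (f1 (fst t)), g2 (f2 (snd t)))\<bar> \<le> a + b \<and>
      dist (g1 (f1 (fst t)), g2 (f2 (snd t))) t \<le> a + b"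
    if t: "t \<in> unit_square" for t
  proof -
    have mem: "(f1 (fst t), f2 (snd t)) \<in> unit_square"
      using t time_change_in[OF f(1)] time_change_in[OF f(2)] by (auto simp: mem_Times_iff)
    have "dist (g1 (f1 (fst t)), g2 (f2 (snd t))) t
        \<le> dist (g1 (f1 (fst t)), g2 (f2 (snd t))) (f1 (fst t), f2 (snd t))
          + dist (f1 (fst t), f2 (snd t)) t"
      by (rule dist_triangle)
    moreover note cf[OF t] cg[OF mem, unfolded fst_conv snd_conv]
    ultimately show ?thesis by linarith
  qed
  note * = this
  show ?thesis
    by (rule skorohod_closeI[OF time_change_comp[OF f(1) g(1)] time_change_comp[OF f(2) g(2)]]) (rule *)
qed

lemma skorohod_space_bounded:
  assumes x: "x \<in> skorohod_space"
  obtains C where "\<And>t. t \<in> unit_square \<Longrightarrow> \<bar>x t\<bar> \<le> C"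
proof -
  have loc: "\<exists>U C. open U \<and> t \<in> U \<and> (\<forall>s\<in>U \<inter> unit_square. \<bar>x s\<bar> \<le> C)"
    if t: "t \<in> unit_square" for t
  proof -
    have q: "\<exists>U C. open U \<and> t \<in> U \<and> (\<forall>s\<in>U \<inter> quadrant R1 R2 t. s \<noteq> t \<longrightarrow> \<bar>x s\<bar> \<le> C)"
      if R: "R1 \<in> {(<), (\<ge>)}" "R2 \<in> {(<), (\<ge>)}" for R1 R2
    proof -
      obtain l where "(x \<longlongrightarrow> l) (at t within quadrant R1 R2 t)"
        using x t R unfolding skorohod_space_def by blast
      then have "\<forall>\<^sub>F s in at t within quadrant R1 R2 t. dist (x s) l < 1"
        by (rule tendstoD) simp
      then obtain U where "open U" "t \<in> U"
        and U: "\<forall>s\<in>U. s \<noteq> t \<longrightarrow> s \<in> quadrant R1 R2 t \<longrightarrow> dist (x s) l < 1"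
        unfolding eventually_at_topological by blast
      moreover have "\<bar>x s\<bar> \<le> \<bar>l\<bar> + 1" if "dist (x s) l < 1" for s
        using that by (auto simp: dist_real_def)
      ultimately show ?thesis
        by (intro exI[of _ U] exI[of _ "\<bar>l\<bar> + 1"]) auto
    qed
    obtain U1 C1 where 1: "open U1" "t \<in> U1" "\<And>s. s \<in> U1 \<Longrightarrow> s \<in> quadrant (<) (<) t \<Longrightarrow> s \<noteq> t \<Longrightarrow> \<bar>x s\<bar> \<le> C1"
      using q[of "(<)" "(<)"] by blast
    obtain U2 C2 where 2: "open U2" "t \<in> U2" "\<And>s. s \<in> U2 \<Longrightarrow> s \<in> quadrant (<) (\<ge>) t \<Longrightarrow> s \<noteq> t \<Longrightarrow> \<bar>x s\<bar> \<le> C2"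
      using q[of "(<)" "(\<ge>)"] by blast
    obtain U3 C3 where 3: "open U3" "t \<in> U3" "\<And>s. s \<in> U3 \<Longrightarrow> s \<in> quadrant (\<ge>) (<) t \<Longrightarrow> s \<noteq> t \<Longrightarrow> \<bar>x s\<bar> \<le> C3"
      using q[of "(\<ge>)" "(<)"] by blast
    obtain U4 C4 where 4: "open U4" "t \<in> U4" "\<And>s. s \<in> U4 \<Longrightarrow> s \<in> quadrant (\<ge>) (\<ge>) t \<Longrightarrow> s \<noteq> t \<Longrightarrow> \<bar>x s\<bar> \<le> C4"
      using q[of "(\<ge>)" "(\<ge>)"] by blast
    define C where "C = Max {C1, C2, C3, C4, \<bar>x t\<bar>}"
    have C: "C1 \<le> C" "C2 \<le> C" "C3 \<le> C" "C4 \<le> C" "\<bar>x t\<bar> \<le> C"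
      unfolding C_def by (simp_all add: le_max_iff_disj)
    have "\<bar>x s\<bar> \<le> C" if s: "s \<in> U1 \<inter> U2 \<inter> U3 \<inter> U4" "s \<in> unit_square" for s
    proof (cases "s = t")
      case False
      have "s \<in> quadrant (<) (<) t \<or> s \<in> quadrant (<) (\<ge>) t \<or> s \<in> quadrant (\<ge>) (<) t \<or> s \<in> quadrant (\<ge>) (\<ge>) t"
        using s(2) unfolding quadrant_def by auto
      then show ?thesis
        using False s(1) 1(3)[of s] 2(3)[of s] 3(3)[of s] 4(3)[of s] C by auto
    qed (use C in simp)
    then show ?thesis
      using 1(1,2) 2(1,2) 3(1,2) 4(1,2)
      by (intro exI[of _ "U1 \<inter> U2 \<inter> U3 \<inter> U4"] exI[of _ C]) auto
  qed
  let ?F = "{U. open U \<and> bounded (x ` (U \<inter> unit_square))}"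
  have cover: "unit_square \<subseteq> \<Union>?F"
  proof
    fix t assume "t \<in> unit_square"
    from loc[OF this] obtain U C where "open U" "t \<in> U" "\<forall>s\<in>U \<inter> unit_square. \<bar>x s\<bar> \<le> C"
      by blast
    moreover from this have "bounded (x ` (U \<inter> unit_square))"
      unfolding bounded_iff real_norm_def by blast
    ultimately show "t \<in> \<Union>?F" by blast
  qed
  have "compact unit_square"
    by (intro compact_Times compact_Icc)
  then obtain G where G: "G \<subseteq> ?F" "finite G" "unit_square \<subseteq> \<Union>G"
    by (rule compactE[OF _ cover]) auto
  have "bounded (\<Union>U\<in>G. x ` (U \<inter> unit_square))"
    using G(1,2) by (intro bounded_UN) auto
  moreover have "x ` unit_square \<subseteq> (\<Union>U\<in>G. x ` (U \<inter> unit_square))"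
    using G(3) by blast
  ultimately have "bounded (x ` unit_square)"
    by (rule bounded_subset)
  then obtain C where "\<forall>y\<in>x ` unit_square. norm y \<le> C"
    unfolding bounded_iff by blast
  then show ?thesis
    unfolding real_norm_def by (intro that[of C]) blast
qed

lemma skorohod_close_exists:
  assumes "x \<in> skorohod_space" "y \<in> skorohod_space"
  shows "\<exists>e. skorohod_close x y e"
proof -
  obtain C where C: "\<And>t. t \<in> unit_square \<Longrightarrow> \<bar>x t\<bar> \<le> C"
    by (rule skorohod_space_bounded[OF assms(1)]) blast
  obtain C' where C': "\<And>t. t \<in> unit_square \<Longrightarrow> \<bar>y t\<bar> \<le> C'"
    by (rule skorohod_space_bounded[OF assms(2)]) blast
  have "\<bar>x t - y (fst t, snd t)\<bar> \<le> C + C' \<and> dist (fst t, snd t) t \<le> C + C'" if t: "t \<in> unit_square" for t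
    using C[OF t] C'[OF t] by auto
  note * = this
  have "skorohod_close x y (C + C')"
    by (rule skorohod_closeI[OF time_change_id time_change_id]) (rule *)
  then show ?thesis ..
qed

lemma skorohod_close_all_imp_eq:
  assumes x: "x \<in> skorohod_space" and y: "y \<in> skorohod_space"
    and cl: "\<And>e. e > 0 \<Longrightarrow> skorohod_close x y e"
  shows "x = y"
proof (rule extensionalityI[of _ unit_square])
  show "x \<in> extensional unit_square" "y \<in> extensional unit_square"
    using x y by (auto simp: skorohod_space_def)
  fix t assume t: "t \<in> unit_square"
  show "x t = y t"
  proof (rule ccontr)
    assume "x t \<noteq> y t"
    define e where "e = \<bar>x t - y t\<bar> / 3"
    have e: "e > 0" using \<open>x t \<noteq> y t\<close> by (simp add: e_def)
    let ?Q = "quadrant (\<ge>) (\<ge>) t"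
    have near: "\<exists>d>0. \<forall>s\<in>?Q. dist s t < d \<longrightarrow> \<bar>z s - z t\<bar> < e" if "z \<in> skorohod_space" for z
    proof -
      have "(z \<longlongrightarrow> z t) (at t within ?Q)"
        using that t unfolding skorohod_space_def by blast
      from tendstoD[OF this e] obtain d where "d > 0"
        and d: "\<forall>s\<in>?Q. s \<noteq> t \<and> dist s t < d \<longrightarrow> dist (z s) (z t) < e"
        unfolding eventually_at by blast
      then show ?thesis
        using e by (intro exI[of _ d]) (auto simp: dist_real_def)
    qed
    obtain d1 where d1: "d1 > 0" "\<And>s. s \<in> ?Q \<Longrightarrow> dist s t < d1 \<Longrightarrow> \<bar>x s - x t\<bar> < e"
      using near[OF x] by blast
    obtain d2 where d2: "d2 > 0" "\<And>s. s \<in> ?Q \<Longrightarrow> dist s t < d2 \<Longrightarrow> \<bar>y s - y t\<bar> < e"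
      using near[OF y] by blast
    define d where "d = min d1 d2"
    have d: "d > 0" using d1 d2 by (simp add: d_def)
    have step: "\<exists>r h. r \<in> {0..1} \<and> u \<le> r \<and> \<bar>r - u\<bar> < d / 4 \<and> h > 0 \<and>
        (\<forall>f\<in>time_changes. \<bar>f r - r\<bar> < h \<longrightarrow> u \<le> f r)" if u: "u \<in> {0..1}" for u :: real
    proof (cases "u = 1")
      case True
      then show ?thesis
        using d by (intro exI[of _ 1] exI[of _ 1]) (auto simp: time_changes_def)
    next
      case False
      define h where "h = min (d / 8) (1 - u)"
      have "h > 0" "h < d / 4" "u + h \<le> 1" using False u d by (auto simp: h_def min_def)
      then show ?thesis
        using u by (intro exI[of _ "u + h"] exI[of _ h]) auto
    qed
    have t1: "fst t \<in> {0..1}" and t2: "snd t \<in> {0..1}" using t by (auto simp: mem_Times_iff)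
    obtain r1 h1 where r1: "r1 \<in> {0..1}" "fst t \<le> r1" "\<bar>r1 - fst t\<bar> < d / 4" "h1 > 0"
      "\<And>f. f \<in> time_changes \<Longrightarrow> \<bar>f r1 - r1\<bar> < h1 \<Longrightarrow> fst t \<le> f r1"
      using step[OF t1] by blast
    obtain r2 h2 where r2: "r2 \<in> {0..1}" "snd t \<le> r2" "\<bar>r2 - snd t\<bar> < d / 4" "h2 > 0"
      "\<And>f. f \<in> time_changes \<Longrightarrow> \<bar>f r2 - r2\<bar> < h2 \<Longrightarrow> snd t \<le> f r2"
      using step[OF t2] by blast
    define k where "k = Min {e, h1 / 2, h2 / 2, d / 4}"
    have k: "k > 0" "k \<le> e" "k < h1" "k < h2" "k \<le> d / 4"
      using e r1 r2 d by (auto simp: k_def min_less_iff_disj)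
    obtain f1 f2 where f: "f1 \<in> time_changes" "f2 \<in> time_changes"
      and cf: "\<And>t. t \<in> unit_square \<Longrightarrow>
        \<bar>x t - y (f1 (fst t), f2 (snd t))\<bar> \<le> k \<and> dist (f1 (fst t), f2 (snd t)) t \<le> k"
      using cl[OF k(1)] unfolding skorohod_close_def by blast
    have r: "(r1, r2) \<in> unit_square" using r1 r2 by simp
    have dd: "dist (a, b) t \<le> \<bar>a - fst t\<bar> + \<bar>b - snd t\<bar>" for a b
      using sqrt_sum_squares_le_sum_abs[of "a - fst t" "b - snd t"]
      by (cases t) (simp add: dist_Pair_Pair dist_real_def)
    have fr: "\<bar>f1 r1 - r1\<bar> \<le> k" "\<bar>f2 r2 - r2\<bar> \<le> k"
      using cf[OF r] dist_fst_le[of "(f1 r1, f2 r2)" "(r1, r2)"] dist_snd_le[of "(f1 r1, f2 r2)" "(r1, r2)"]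
      by (auto simp: dist_real_def)
    have "(r1, r2) \<in> ?Q" using r r1 r2 by (auto simp: quadrant_def)
    moreover have "dist (r1, r2) t < d" using dd[of r1 r2] r1(3) r2(3) d by linarith
    ultimately have xx: "\<bar>x (r1, r2) - x t\<bar> < e" using d1(2) by (simp add: d_def)
    have "(f1 r1, f2 r2) \<in> ?Q"
      using r1(5)[OF f(1)] r2(5)[OF f(2)] fr k time_change_in[OF f(1) r1(1)] time_change_in[OF f(2) r2(1)]
      by (auto simp: quadrant_def)
    moreover have "dist (f1 r1, f2 r2) t < d"
      using dd[of "f1 r1" "f2 r2"] r1(3) r2(3) fr k(5) by linarith
    ultimately have yy: "\<bar>y (f1 r1, f2 r2) - y t\<bar> < e" using d2(2) by (simp add: d_def)
    have "\<bar>x (r1, r2) - y (f1 r1, f2 r2)\<bar> \<le> e" using cf[OF r] k(2) by auto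
    with xx yy have "\<bar>x t - y t\<bar> < 3 * e" by linarith
    then show False by (simp add: e_def)
  qed
qed

lemma Metric_space_skorohod: "Metric_space skorohod_space skorohod_dist"
proof
  have bdd: "bdd_below {e. skorohod_close x y e}" for x y
    using skorohod_close_nonneg by (intro bdd_belowI[of _ 0]) auto
  have ne: "{e. skorohod_close x y e} \<noteq> {}" if "x \<in> skorohod_space" "y \<in> skorohod_space" for x y
    using skorohod_close_exists[OF that] by blast
  have lt: "\<exists>a. skorohod_close x y a \<and> a < skorohod_dist x y + e"
    if "x \<in> skorohod_space" "y \<in> skorohod_space" "e > 0" for x y e
    using cInf_lessD[OF ne[OF that(1,2)], of "skorohod_dist x y + e"] that
    by (auto simp: skorohod_dist_def)
  have le: "skorohod_dist x y \<le> a"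
    if "x \<in> skorohod_space" "y \<in> skorohod_space" "skorohod_close x y a" for x y a
    using that by (auto simp: skorohod_dist_def intro: cInf_lower bdd)
  show nonneg: "0 \<le> skorohod_dist x y" for x y
    using ne[of x y] skorohod_close_nonneg by (auto simp: skorohod_dist_def intro!: cInf_greatest)
  show "skorohod_dist x y = skorohod_dist y x" for x y
  proof -
    have "skorohod_close x y = skorohod_close y x"
      using skorohod_close_sym by blast
    then show ?thesis by (auto simp: skorohod_dist_def)
  qed
  show "skorohod_dist x y = 0 \<longleftrightarrow> x = y" if xy: "x \<in> skorohod_space" "y \<in> skorohod_space" for x y
  proof
    assume 0: "skorohod_dist x y = 0"
    have "skorohod_close x y e" if e: "e > 0" for e
    proof -
      obtain a where a: "skorohod_close x y a" "a < e" using lt[OF xy e] 0 by auto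
      then show ?thesis unfolding skorohod_close_def by (meson less_imp_le order.trans)
    qed
    then show "x = y" by (rule skorohod_close_all_imp_eq[OF xy])
  next
    assume "x = y"
    have "skorohod_close x x 0"
      by (rule skorohod_closeI[OF time_change_id time_change_id]) simp
    then have "skorohod_dist x x \<le> 0" using le xy by blast
    then show "skorohod_dist x y = 0" using nonneg[of x x] \<open>x = y\<close> by auto
  qed
  show "skorohod_dist x z \<le> skorohod_dist x y + skorohod_dist y z"
    if xyz: "x \<in> skorohod_space" "y \<in> skorohod_space" "z \<in> skorohod_space" for x y z
  proof (rule field_le_epsilon)
    fix e :: real assume "e > 0"
    then obtain a b where "skorohod_close x y a" "a < skorohod_dist x y + e / 2"
      "skorohod_close y z b" "b < skorohod_dist y z + e / 2"
      using lt[OF xyz(1,2), of "e / 2"] lt[OF xyz(2,3), of "e / 2"] by auto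
    with le[OF xyz(1,3) skorohod_close_trans[of x y a z b]]
    show "skorohod_dist x z \<le> skorohod_dist x y + skorohod_dist y z + e" by linarith
  qed
qed

lemma topspace_skorohod_topology: "topspace skorohod_topology = skorohod_space"
  unfolding skorohod_topology_def by (rule Metric_space.topspace_mtopology[OF Metric_space_skorohod])

end

theory Submission
  imports Defs
begin

text \<open>
  Every pair of a row box and a column box contributes its sign exactly when both boxes are
  occupied an odd number of times, so given the occupancies the partial sums are Rademacher sums.
  Their conditional covariances are polynomials in the numbers of odd boxes of blocks of
  the two sequences. These numbers concentrate in \<open>L\<^sup>1\<close>, because the parities of two boxes
  are negatively correlated, and their means are of order \<open>\<Gamma>(1 - \<alpha>) 2\<^bsup>\<alpha>-1\<^esup> n\<^sup>\<alpha> L(n)\<close> by an integral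
  representation and Potter bounds; expanding the cosine then gives the Gaussian limit of the
  finite-dimensional distributions. For tightness, high moments of rectangular increments are
  products of moments of odd box counts, hence at most powers of the side lengths, and a two-step
  dyadic chaining bounds the modulus of continuity on the dyadic scale. Lipschitz test functions
  on the Skorohod space only see a path up to the uniform distance, so they are approximated by
  functions of finitely many coordinates, and those by trigonometric polynomials.
\<close>

section \<open>Regularly varying frequencies\<close>

text \<open>The sheet \<open>B\<close> is assumed to have paths in the Skorohod space, but neither
  continuity nor a modulus. Its discretization error is therefore bounded through the prelimit:
  oscillations over a finite dyadic grid depend on finitely many coordinates, so the bound for the
  partial sums passes to \<open>B\<close> there, and refinement together with right continuity
  extends it to the whole square. High moments are forced by the small indices: a block of relative
  length 2^(-k) carries roughly a fraction 2^(-\<alpha> k) of the odd boxes, while chaining asks for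
  a decay 4^(-k), one factor 2^(-k) for the number of blocks and one for the weights and the
  summation. In the limit constant, 2^\<alpha> and 1/2 have one origin: a Poisson count with mean y
  is odd with probability (1 - exp (-2 y)) / 2, so the mean number of odd boxes at time n is
  compared with half an occupancy function at time 2 n. Negative correlation of parities is proved
  for an odd number of balls; even blocks give up one ball.\<close>

lemma eventually_at_top_ge_pos: "\<forall>\<^sub>F x in at_top. P x \<Longrightarrow> \<exists>x0::real>0. \<forall>x\<ge>x0. P x"
  unfolding eventually_at_top_linorder
  by (metis max.bounded_iff max.cobounded2 less_le_trans zero_less_one)

text \<open>Monotonicity from some index on is enough for a comparison over all pairs, at the cost
  of a constant: the ratio of the largest to the smallest of the finitely many initial terms.
  Positivity keeps that ratio finite.\<close>

lemma eventually_incseq_bound: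
  fixes a :: "nat \<Rightarrow> real"
  assumes pos: "\<And>j. a j > 0" and inc: "\<And>j. j \<ge> j0 \<Longrightarrow> a j \<le> a (Suc j)"
  shows "\<exists>C>0. \<forall>i j. i \<le> j \<longrightarrow> a i \<le> C * a j"
proof -
  define b where "b = Max (a ` {..j0})"
  define c where "c = Min (a ` {..j0})"
  have b: "a i \<le> b" if "i \<le> j0" for i unfolding b_def using that by (intro Max_ge) auto
  have c: "c \<le> a i" if "i \<le> j0" for i unfolding c_def using that by (intro Min_le) auto
  have cpos: "c > 0" unfolding c_def using pos by (subst Min_gr_iff) auto
  have bc: "b \<ge> c" using b[of 0] c[of 0] by simp
  have inc': "a i \<le> a j" if "j0 \<le> i" "i \<le> j" for i j
    using that(2)
  proof (induction j rule: dec_induct)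
    case (step n) then show ?case using inc[of n] that by simp
  qed simp
  have "a i \<le> (b/c) * a j" if "i \<le> j" for i j
  proof (cases "i \<le> j0")
    case True
    have "c \<le> a j" using c[of j] inc'[of j0 j] c[of j0] by (cases "j \<le> j0") auto
    then have "(b/c) * c \<le> (b/c) * a j" using cpos bc by (intro mult_left_mono) auto
    then have "b \<le> (b/c) * a j" using cpos by simp
    then show ?thesis using b[OF True] by linarith
  next
    case False
    then have "a i \<le> a j" using inc'[of i j] that by simp
    also have "\<dots> \<le> (b/c) * a j" using bc cpos pos[of j] by (simp add: field_simps)
    finally show ?thesis .
  qed
  then show ?thesis using cpos bc by (intro exI[of _ "b/c"]) auto
qed

locale karlin_law =
  fixes \<mu> :: "nat measure" and \<alpha> :: real and L :: "real \<Rightarrow> real"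
  assumes prob_posnat: "prob_measure_on_posnat \<mu>" and \<alpha>: "0 < \<alpha>" "\<alpha> < 1"
    and regvar: "regular_variation_condition \<mu> \<alpha> L"
begin

definition p :: "nat \<Rightarrow> real" where "p l = measure \<mu> {l}"
text \<open>Karlin's counting function. A cardinality replaces the \<open>Max\<close> of the
  hypothesis because it is monotone in x, harmless when the set is empty, and appears by itself when
  the level sets of \<open>p\<close> are integrated out.\<close>

definition \<nu> :: "real \<Rightarrow> real" where "\<nu> x = real (card {l. 1 \<le> l \<and> 1 / x \<le> p l})"
definition r :: "real \<Rightarrow> real" where "r x = x powr \<alpha> * L x"

sublocale \<mu>: prob_space \<mu> using prob_posnat by (simp add: prob_measure_on_posnat_def)

lemma sets_\<mu>: "sets \<mu> = sets (count_space {1..})"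
  using prob_posnat by (simp add: prob_measure_on_posnat_def)

lemma space_\<mu>: "space \<mu> = {1..}"
  using sets_eq_imp_space_eq[OF sets_\<mu>] by simp

lemma p_nonneg [simp]: "p l \<ge> 0" by (simp add: p_def)
lemma p_le_1: "p l \<le> 1" by (simp add: p_def)

lemma p_0 [simp]: "p 0 = 0"
  unfolding p_def by (rule measure_notin_sets) (simp add: sets_\<mu>)

lemma p_sums: "p sums 1"
proof -
  have "(\<lambda>i. measure \<mu> ({i} \<inter> {1..})) sums measure \<mu> (\<Union>i. {i} \<inter> {1..})"
    by (intro \<mu>.finite_measure_UNION) (auto simp: sets_\<mu> disjoint_family_on_def)
  moreover have "(\<Union>i. {i} \<inter> {1..}) = space \<mu>" by (auto simp: space_\<mu>)
  moreover have "measure \<mu> ({i} \<inter> {1..}) = p i" for i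
    using p_0 by (cases "i = 0") (auto simp: p_def)
  ultimately show ?thesis by (simp add: \<mu>.prob_space)
qed

lemma summable_p: "summable p" using p_sums by (rule sums_summable)

lemma p_antimono: "1 \<le> l \<Longrightarrow> l \<le> l' \<Longrightarrow> p l' \<le> p l"
  using regvar unfolding regular_variation_condition_def p_def monotone_on_def by auto

lemma p_1_pos: "p 1 > 0"
proof (rule ccontr)
  assume "\<not> p 1 > 0"
  then have "p l = 0" for l
    using p_antimono[of 1 l] p_nonneg[of l] p_0 by (cases "l = 0") (force, linarith)
  then have "p = (\<lambda>_. 0)" by auto
  with p_sums show False using sums_unique2[of "\<lambda>_. 0::real" 0 1] by auto
qed

lemma finite_level: "x > 0 \<Longrightarrow> finite {l. 1 \<le> l \<and> 1 / x \<le> p l}"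
proof -
  assume x: "x > 0"
  have "p \<longlonglongrightarrow> 0" using summable_p by (rule summable_LIMSEQ_zero)
  then have "\<forall>\<^sub>F l in sequentially. p l < 1 / x" using x by (intro order_tendstoD) auto
  then obtain N where "\<And>l. l \<ge> N \<Longrightarrow> p l < 1/x" unfolding eventually_sequentially by auto
  then have "l \<le> N" if "1 / x \<le> p l" for l using that by (meson linorder_not_le nat_le_linear)
  then have "{l. 1 \<le> l \<and> 1 / x \<le> p l} \<subseteq> {..N}" by auto
  then show ?thesis using finite_subset by blast
qed

lemma \<nu>_mono: "0 < x \<Longrightarrow> x \<le> y \<Longrightarrow> \<nu> x \<le> \<nu> y"
  unfolding \<nu>_def
  by (intro of_nat_mono card_mono finite_level) (auto intro: order_trans[rotated] simp: frac_le)

lemma \<nu>_nonneg [simp]: "\<nu> x \<ge> 0" by (simp add: \<nu>_def)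

lemma \<nu>_ge_1: "x \<ge> 1 / p 1 \<Longrightarrow> \<nu> x \<ge> 1"
proof -
  assume x: "x \<ge> 1 / p 1"
  have x0: "x > 0" using x p_1_pos by (meson divide_pos_pos less_le_trans zero_less_one)
  have "1 / x \<le> p 1" using x x0 p_1_pos by (simp add: field_simps)
  then have "{1} \<subseteq> {l. 1 \<le> l \<and> 1 / x \<le> p l}" by auto
  from card_mono[OF finite_level[OF x0] this] show ?thesis by (simp add: \<nu>_def)
qed

text \<open>Frequencies decrease from index 1 on, so the level set is the initial segment up to its
  maximum. The condition on x puts 1 into it, which keeps \<open>Max\<close> away from the empty
  set.\<close>

lemma Max_eq_\<nu>: "x \<ge> 1 / p 1 \<Longrightarrow> real (Max {l. 1 \<le> l \<and> measure \<mu> {l} \<ge> 1 / x}) = \<nu> x"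
proof -
  assume x: "x \<ge> 1 / p 1"
  have x0: "x > 0" using x p_1_pos by (meson divide_pos_pos less_le_trans zero_less_one)
  define A where "A = {l. 1 \<le> l \<and> 1 / x \<le> p l}"
  have fin: "finite A" unfolding A_def by (rule finite_level[OF x0])
  have "1 / x \<le> p 1" using x x0 p_1_pos by (simp add: field_simps)
  then have ne: "A \<noteq> {}" unfolding A_def by blast
  have "A = {1..Max A}"
  proof
    show "A \<subseteq> {1..Max A}" using fin by (auto simp: A_def)
    show "{1..Max A} \<subseteq> A"
    proof
      fix l assume l: "l \<in> {1..Max A}"
      have "Max A \<in> A" using Max_in fin ne by blast
      then show "l \<in> A" using l p_antimono[of l "Max A"] unfolding A_def by auto
    qed
  qed
  then have "card A = Max A" by (metis card_atLeastAtMost diff_Suc_1)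
  then show ?thesis unfolding \<nu>_def A_def p_def by simp
qed

lemma r_pos: "x > 0 \<Longrightarrow> r x > 0"
proof -
  assume x: "x > 0"
  then have "compact {x} \<and> {x} \<subseteq> {0<..}" by auto
  then obtain c C where "0 < c" "\<forall>y\<in>{x}. c \<le> L y \<and> L y \<le> C"
    using regvar unfolding regular_variation_condition_def by blast
  then show ?thesis using x by (auto simp: r_def)
qed

lemma \<nu>_div_r: "((\<lambda>x. \<nu> x / r x) \<longlongrightarrow> 1) at_top"
proof -
  have "(\<lambda>x::real. real (Max {l. 1 \<le> l \<and> measure \<mu> {l} \<ge> 1 / x})) \<sim>[at_top] r"
    using regvar unfolding regular_variation_condition_def r_def by simp
  moreover have "\<forall>\<^sub>F x in at_top. real (Max {l. 1 \<le> l \<and> measure \<mu> {l} \<ge> 1 / x}) = \<nu> x"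
    using eventually_ge_at_top[of "1 / p 1"] by eventually_elim (rule Max_eq_\<nu>)
  ultimately have "\<nu> \<sim>[at_top] r"
    by (subst (asm) asymp_equiv_cong[of _ \<nu> at_top r r]) auto
  moreover have "\<forall>\<^sub>F x in at_top. \<nu> x \<noteq> 0 \<or> r x \<noteq> 0"
    using eventually_gt_at_top[of 0] by eventually_elim (use r_pos in force)
  ultimately show ?thesis by (rule asymp_equivD_strong)
qed

lemma r_scale: "c > 0 \<Longrightarrow> ((\<lambda>x. r (c * x) / r x) \<longlongrightarrow> c powr \<alpha>) at_top"
proof -
  assume c: "c > 0"
  have "((\<lambda>x. L (c * x) / L x) \<longlongrightarrow> 1) at_top"
    using regvar c unfolding regular_variation_condition_def slowly_varying_def by blast
  then have "((\<lambda>x. c powr \<alpha> * (L (c * x) / L x)) \<longlongrightarrow> c powr \<alpha> * 1) at_top"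
    by (intro tendsto_intros)
  moreover have "\<forall>\<^sub>F x in at_top. c powr \<alpha> * (L (c * x) / L x) = r (c * x) / r x"
    using eventually_gt_at_top[of 0] by eventually_elim (use c in \<open>auto simp: r_def powr_mult\<close>)
  ultimately show ?thesis by (simp only: tendsto_cong mult_1_right)
qed

lemma \<nu>_scale: "c > 0 \<Longrightarrow> ((\<lambda>x. \<nu> (c * x) / \<nu> x) \<longlongrightarrow> c powr \<alpha>) at_top"
proof -
  assume c: "c > 0"
  have "filterlim (\<lambda>x. c * x) at_top at_top"
    by (rule filterlim_tendsto_pos_mult_at_top[OF tendsto_const c filterlim_ident])
  then have "((\<lambda>x. \<nu> (c * x) / r (c * x)) \<longlongrightarrow> 1) at_top"
    by (rule filterlim_compose[OF \<nu>_div_r])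
  then have "((\<lambda>x. (\<nu> (c * x) / r (c * x)) * (r (c * x) / r x) / (\<nu> x / r x)) \<longlongrightarrow> 1 * c powr \<alpha> / 1) at_top"
    by (intro tendsto_intros \<nu>_div_r r_scale c) auto
  moreover have "\<forall>\<^sub>F x in at_top. (\<nu> (c * x) / r (c * x)) * (r (c * x) / r x) / (\<nu> x / r x) = \<nu> (c * x) / \<nu> x"
    using eventually_gt_at_top[of 0]
  proof eventually_elim
    case (elim x)
    have "r x > 0" "r (c * x) > 0" using elim c by (auto intro!: r_pos)
    then show ?case by simp
  qed
  ultimately show ?thesis by (simp only: tendsto_cong mult_1_left div_by_1)
qed

section \<open>Potter-type bounds and growth of the counting function\<close>

lemma \<nu>_eventually_pos: "\<forall>\<^sub>F x in at_top. \<nu> x > 0"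
  using eventually_ge_at_top[of "1 / p 1"] by eventually_elim (use \<nu>_ge_1 in force)

text \<open>Doubling x multiplies \<open>\<nu>\<close> by a factor tending to
  \<open>2 powr \<alpha>\<close>, hence eventually below \<open>2 powr \<gamma>\<close>; iterate.
  Rounding \<open>log 2 (y / x)\<close> up to an integer costs at most one more doubling, which is
  the leading factor \<open>2 powr \<gamma>\<close>.\<close>

lemma potter_upper:
  assumes \<gamma>: "\<gamma> > \<alpha>"
  obtains x0 where "x0 > 0" "\<And>x y. x0 \<le> x \<Longrightarrow> x \<le> y \<Longrightarrow> \<nu> y \<le> 2 powr \<gamma> * (y / x) powr \<gamma> * \<nu> x"
proof -
  have "\<forall>\<^sub>F x in at_top. \<nu> (2 * x) / \<nu> x < 2 powr \<gamma>"
    by (rule order_tendstoD(2)[OF \<nu>_scale[of 2]]) (use \<gamma> in auto)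
  with \<nu>_eventually_pos have "\<forall>\<^sub>F x in at_top. \<nu> (2 * x) \<le> 2 powr \<gamma> * \<nu> x"
    by eventually_elim (auto simp: field_simps)
  from eventually_at_top_ge_pos[OF this] obtain x0
    where x0: "x0 > 0" "\<And>x. x \<ge> x0 \<Longrightarrow> \<nu> (2 * x) \<le> 2 powr \<gamma> * \<nu> x" by blast
  have iter: "\<nu> (2 ^ k * x) \<le> (2 powr \<gamma>) ^ k * \<nu> x" if "x \<ge> x0" for x k
  proof (induction k)
    case (Suc k)
    have "1 * x \<le> 2 ^ k * x" using that x0(1) by (intro mult_right_mono) auto
    with that have "x0 \<le> 2 ^ k * x" by linarith
    from x0(2)[OF this] have "\<nu> (2 ^ Suc k * x) \<le> 2 powr \<gamma> * \<nu> (2 ^ k * x)" by (simp add: mult.assoc)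
    also have "\<dots> \<le> 2 powr \<gamma> * ((2 powr \<gamma>) ^ k * \<nu> x)" by (intro mult_left_mono Suc) auto
    finally show ?case by simp
  qed simp
  show ?thesis
  proof
    show "x0 > 0" by fact
    fix x y assume xy: "x0 \<le> x" "x \<le> y"
    have x: "x > 0" using x0 xy by simp
    define k where "k = nat \<lceil>log 2 (y / x)\<rceil>"
    have l0: "log 2 (y/x) \<ge> 0" using xy x by (simp add: field_simps)
    have k1: "log 2 (y/x) \<le> real k" and k2: "real k \<le> 1 + log 2 (y/x)"
      using l0 by (auto simp: k_def) linarith
    have "y / x = 2 powr (log 2 (y/x))" using xy x by (subst powr_log_cancel) auto
    also have "\<dots> \<le> 2 powr real k" using k1 by (intro powr_mono) auto
    finally have "y \<le> 2 ^ k * x" using x by (simp add: field_simps powr_realpow)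
    then have "\<nu> y \<le> \<nu> (2 ^ k * x)" using x xy by (intro \<nu>_mono) auto
    also have "\<dots> \<le> (2 powr \<gamma>) ^ k * \<nu> x" by (rule iter[OF xy(1)])
    also have "(2 powr \<gamma>) ^ k = (2 powr real k) powr \<gamma>"
      by (simp add: powr_powr powr_realpow[symmetric] powr_powr mult.commute)
    also have "(2 powr real k) powr \<gamma> \<le> (2 powr (1 + log 2 (y/x))) powr \<gamma>"
      using k2 \<gamma> \<alpha> by (intro powr_mono2 powr_mono) auto
    also have "2 powr (1 + log 2 (y/x)) = 2 * (y/x)" using xy x by (subst powr_add) (auto simp: powr_log_cancel)
    also have "(2 * (y/x)) powr \<gamma> = 2 powr \<gamma> * (y / x) powr \<gamma>" using xy x by (intro powr_mult)
    finally show "\<nu> y \<le> 2 powr \<gamma> * (y / x) powr \<gamma> * \<nu> x" by (auto simp: mult_right_mono)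
  qed
qed

text \<open>Once \<open>\<nu>\<close> gains at least the factor \<open>2 powr \<gamma>\<close> per
  doubling, the rescaled sequence \<open>a\<close> increases. The maximum with 1 keeps
  \<open>a\<close> positive at levels where \<open>\<nu>\<close> may still vanish, so the bound
  covers all pairs. It supplies the geometric decay of block moments in the chaining.\<close>

lemma dyadic_lower:
  assumes \<gamma>: "\<gamma> < \<alpha>"
  obtains C where "C > 0"
    "\<And>i j. i \<le> j \<Longrightarrow> max 1 (\<nu> (2 ^ i)) \<le> C * 2 powr - (\<gamma> * real (j - i)) * max 1 (\<nu> (2 ^ j))"
proof -
  define a where "a j = max 1 (\<nu> (2 ^ j)) * 2 powr - (\<gamma> * real j)" for j :: nat
  have apos: "a j > 0" for j unfolding a_def by auto
  have "\<forall>\<^sub>F x in at_top. \<nu> (2 * x) / \<nu> x > 2 powr \<gamma>"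
    by (rule order_tendstoD(1)[OF \<nu>_scale[of 2]]) (use \<gamma> in auto)
  with eventually_ge_at_top[of "1 / p 1"]
  have "\<forall>\<^sub>F x in at_top. \<nu> (2 * x) \<ge> 2 powr \<gamma> * \<nu> x \<and> \<nu> x \<ge> 1"
  proof eventually_elim
    case (elim x) then show ?case using \<nu>_ge_1[of x] by (auto simp: field_simps)
  qed
  from eventually_at_top_ge_pos[OF this] obtain x0 where x0: "x0 > 0"
    "\<And>x. x \<ge> x0 \<Longrightarrow> \<nu> (2 * x) \<ge> 2 powr \<gamma> * \<nu> x" "\<And>x. x \<ge> x0 \<Longrightarrow> \<nu> x \<ge> 1" by blast
  obtain j0 where j0: "x0 < 2 ^ j0" using real_arch_pow[of 2 x0] by auto
  have "a j \<le> a (Suc j)" if "j \<ge> j0" for j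
  proof -
    have x: "(2::real) ^ j \<ge> x0" using j0 that power_increasing[of j0 j "2::real"] by linarith
    have x2: "(2::real) ^ Suc j \<ge> x0" using x by simp (use x0 in linarith)
    have "a j = \<nu> (2^j) * 2 powr - (\<gamma> * real j)" using x0(3)[OF x] by (simp add: a_def)
    also have "\<dots> = 2 powr \<gamma> * \<nu> (2^j) * 2 powr - (\<gamma> * real (Suc j))"
      by (simp add: powr_diff powr_minus ring_distribs powr_add field_simps)
    also have "\<dots> \<le> \<nu> (2 * 2^j) * 2 powr - (\<gamma> * real (Suc j))"
      by (intro mult_right_mono x0(2) x) auto
    also have "\<dots> = a (Suc j)" using x0(3)[OF x2] by (simp add: a_def)
    finally show ?thesis .
  qed
  from eventually_incseq_bound[of a, OF apos this] obtain C where C: "C > 0" "\<And>i j. i \<le> j \<Longrightarrow> a i \<le> C * a j"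
    by blast
  show ?thesis
  proof
    show "C > 0" by fact
    fix i j :: nat assume ij: "i \<le> j"
    have "max 1 (\<nu> (2 ^ i)) = a i * 2 powr (\<gamma> * real i)" by (simp add: a_def powr_minus field_simps)
    also have "\<dots> \<le> C * a j * 2 powr (\<gamma> * real i)" using C(2)[OF ij] by (intro mult_right_mono) auto
    also have "\<dots> = C * 2 powr - (\<gamma> * real (j - i)) * max 1 (\<nu> (2 ^ j))"
      using ij by (simp add: a_def of_nat_diff powr_diff powr_minus ring_distribs powr_add field_simps)
    finally show "max 1 (\<nu> (2 ^ i)) \<le> C * 2 powr - (\<gamma> * real (j - i)) * max 1 (\<nu> (2 ^ j))" .
  qed
qed

lemma \<nu>_at_top: "filterlim \<nu> at_top at_top"
proof -
  define \<gamma> where "\<gamma> = \<alpha> / 2"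
  have \<gamma>: "0 < \<gamma>" "\<gamma> < \<alpha>" using \<alpha> by (auto simp: \<gamma>_def)
  obtain C where C: "C > 0"
    "\<And>i j. i \<le> j \<Longrightarrow> max 1 (\<nu> (2 ^ i)) \<le> C * 2 powr - (\<gamma> * real (j - i)) * max 1 (\<nu> (2 ^ j))"
    using dyadic_lower[OF \<gamma>(2)] by blast
  have low: "(2 powr \<gamma>) ^ j \<le> C * max 1 (\<nu> (2 ^ j))" for j
  proof -
    have "1 \<le> max 1 (\<nu> (2 ^ 0))" by simp
    also have "\<dots> \<le> C * 2 powr - (\<gamma> * real (j - 0)) * max 1 (\<nu> (2 ^ j))" by (rule C(2)) simp
    finally have "1 * 2 powr (\<gamma> * real j) \<le> C * 2 powr - (\<gamma> * real (j - 0)) * max 1 (\<nu> (2 ^ j)) * 2 powr (\<gamma> * real j)"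
      by (intro mult_right_mono) auto
    then show ?thesis by (simp add: powr_minus field_simps powr_powr[symmetric] powr_realpow)
  qed
  show ?thesis unfolding filterlim_at_top
  proof
    fix Z
    obtain j where j: "C * max 1 Z < (2 powr \<gamma>) ^ j" using real_arch_pow[of "2 powr \<gamma>"] \<gamma> by auto
    then have "C * max 1 Z < C * max 1 (\<nu> (2 ^ j))" using low[of j] by linarith
    then have "Z \<le> \<nu> (2 ^ j)" using C(1) by auto
    show "\<forall>\<^sub>F x in at_top. Z \<le> \<nu> x"
      using eventually_ge_at_top[of "2 ^ j"]
    proof eventually_elim
      case (elim x)
      show ?case by (rule order_trans[OF \<open>Z \<le> \<nu> (2 ^ j)\<close> \<nu>_mono]) (use elim in auto)
    qed
  qed
qed

lemma r_at_top: "filterlim r at_top at_top"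
proof -
  have "((\<lambda>x. inverse (\<nu> x / r x)) \<longlongrightarrow> inverse 1) at_top" by (intro tendsto_inverse \<nu>_div_r) simp
  then have "filterlim (\<lambda>x. inverse (\<nu> x / r x) * \<nu> x) at_top at_top"
    by (rule filterlim_tendsto_pos_mult_at_top[OF _ _ \<nu>_at_top]) simp
  moreover have "\<forall>\<^sub>F x in at_top. inverse (\<nu> x / r x) * \<nu> x = r x"
    using \<nu>_eventually_pos by eventually_elim auto
  ultimately show ?thesis by (rule filterlim_cong[OF refl refl, THEN iffD1, rotated])
qed

text \<open>Chaining replaces the index range up to n by one up to a power of two that is at most
  \<open>2 * n\<close>; measured against \<open>r\<close> this enlargement costs only a
  constant.\<close>

lemma \<nu>_dyadic_le_r:
  obtains C where "C > 0" "\<forall>\<^sub>F n in sequentially. \<forall>M. 2 ^ M \<le> 2 * n \<longrightarrow> max 1 (\<nu> (2 ^ M)) \<le> C * r (real n)"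
proof
  show "2 powr \<alpha> * 1 + 1 > (0::real)" by (simp add: add_pos_pos)
  have "((\<lambda>x. (\<nu> (2 * x) / \<nu> x) * (\<nu> x / r x)) \<longlongrightarrow> 2 powr \<alpha> * 1) at_top"
    by (intro tendsto_intros \<nu>_scale \<nu>_div_r) auto
  then have "\<forall>\<^sub>F x in at_top. (\<nu> (2 * x) / \<nu> x) * (\<nu> x / r x) < 2 powr \<alpha> * 1 + 1"
    by (rule order_tendstoD) simp
  with eventually_ge_at_top[of "1 / p 1"] \<nu>_eventually_pos eventually_gt_at_top[of 0]
  have "\<forall>\<^sub>F x in at_top. 1 \<le> \<nu> (2 * x) \<and> \<nu> (2 * x) \<le> (2 powr \<alpha> * 1 + 1) * r x"
  proof eventually_elim
    case (elim x)
    have "1 \<le> \<nu> x" using elim \<nu>_ge_1 by auto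
    moreover have "\<nu> x \<le> \<nu> (2 * x)" using elim by (intro \<nu>_mono) auto
    ultimately show ?case using elim r_pos[of x] by (auto simp: field_simps)
  qed
  then have "\<forall>\<^sub>F n in sequentially. 1 \<le> \<nu> (2 * real n) \<and> \<nu> (2 * real n) \<le> (2 powr \<alpha> * 1 + 1) * r (real n)"
    by (rule eventually_compose_filterlim[OF _ filterlim_real_sequentially])
  then show "\<forall>\<^sub>F n in sequentially. \<forall>M. 2 ^ M \<le> 2 * n \<longrightarrow> max 1 (\<nu> (2 ^ M)) \<le> (2 powr \<alpha> * 1 + 1) * r (real n)"
  proof eventually_elim
    case (elim n)
    show ?case
    proof (intro allI impI)
      fix M :: nat assume "2 ^ M \<le> 2 * n"
      then have "real (2 ^ M) \<le> real (2 * n)" by (rule of_nat_mono)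
      then have "\<nu> (2 ^ M) \<le> \<nu> (2 * real n)" by (intro \<nu>_mono) auto
      then show "max 1 (\<nu> (2 ^ M)) \<le> (2 powr \<alpha> * 1 + 1) * r (real n)" using elim by linarith
    qed
  qed
qed

end

section \<open>Expected number of odd boxes\<close>

context karlin_law begin

text \<open>Expected number of occupied boxes when a Poisson number of balls with mean x is thrown.
  It is tractable because the box counts are then independent Poisson variables, and at time 2 n it
  approximates twice the mean number of odd boxes after n throws.\<close>

definition \<Psi> :: "real \<Rightarrow> real" where "\<Psi> x = (\<Sum>l. 1 - exp (- (x * p l)))"

lemma summable_\<Psi>: "x \<ge> 0 \<Longrightarrow> summable (\<lambda>l. 1 - exp (- (x * p l)))"
proof (rule summable_comparison_test'[of "\<lambda>l. x * p l" 0])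
  show "summable (\<lambda>l. x * p l)" by (intro summable_mult summable_p)
  fix l assume "x \<ge> 0"
  then have "0 \<le> x * p l" by simp
  then show "norm (1 - exp (- (x * p l))) \<le> x * p l"
    using exp_ge_add_one_self[of "- (x * p l)"] by simp
qed

lemma \<Psi>_nonneg: "x \<ge> 0 \<Longrightarrow> \<Psi> x \<ge> 0"
  unfolding \<Psi>_def by (intro suminf_nonneg summable_\<Psi>) auto

lemma \<Psi>_le: "x \<ge> 0 \<Longrightarrow> \<Psi> x \<le> x"
proof -
  assume x: "x \<ge> 0"
  have "\<Psi> x \<le> (\<Sum>l. x * p l)" unfolding \<Psi>_def
  proof (intro suminf_le summable_\<Psi> x summable_mult summable_p)
    show "1 - exp (- (x * p l)) \<le> x * p l" for l using exp_ge_add_one_self[of "- (x * p l)"] by simp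
  qed
  also have "\<dots> = x" using suminf_mult[OF summable_p, of x] sums_unique[OF p_sums] by simp
  finally show ?thesis .
qed

text \<open>Since 1 - exp (-y) is the integral of exp (-u) over [0, y], interchanging sum and
  integral turns \<open>\<Psi>\<close> into an integral of \<open>exp (- u) * \<nu> (x / u)\<close>.
  Values in \<open>ennreal\<close> make the interchange unconditional.\<close>

definition level_sum :: "real \<Rightarrow> real \<Rightarrow> ennreal" where
  "level_sum x u = (\<Sum>l. ennreal (exp (- u)) * indicator {0..x * p l} u)"

lemma level_sum_measurable [measurable]: "level_sum x \<in> borel_measurable borel"
  unfolding level_sum_def[abs_def] by measurable

lemma level_sum_eq:
  assumes x: "x > 0" and u: "u > 0"
  shows "level_sum x u = ennreal (exp (- u) * \<nu> (x / u))"
proof -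
  define A where "A = {l. 1 \<le> l \<and> 1 / (x / u) \<le> p l}"
  have fin: "finite A" unfolding A_def using x u by (intro finite_level) auto
  have iff: "u \<in> {0..x * p l} \<longleftrightarrow> l \<in> A" for l
    using x u p_0 by (cases "l = 0") (auto simp: A_def field_simps)
  have "level_sum x u = (\<Sum>l\<in>A. ennreal (exp (- u)))"
    unfolding level_sum_def using iff by (subst suminf_finite[OF fin]) (auto simp: indicator_def)
  also have "\<dots> = ennreal (exp (- u) * \<nu> (x / u))"
    unfolding \<nu>_def A_def[symmetric] by (simp add: ennreal_mult'' ennreal_of_nat_eq_real_of_nat mult.commute)
  finally show ?thesis .
qed

lemma nn_integral_level_sum: "x > 0 \<Longrightarrow> (\<integral>\<^sup>+u. level_sum x u \<partial>lborel) = ennreal (\<Psi> x)"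
proof -
  assume x: "x > 0"
  have "(\<integral>\<^sup>+u. level_sum x u \<partial>lborel) = (\<Sum>l. \<integral>\<^sup>+u. ennreal (exp (- u)) * indicator {0..x * p l} u \<partial>lborel)"
    unfolding level_sum_def by (intro nn_integral_suminf) auto
  also have "\<dots> = (\<Sum>l. ennreal (1 - exp (- (x * p l))))"
  proof (intro suminf_cong)
    fix l
    have "(\<integral>\<^sup>+u. ennreal (exp (- u)) * indicator {0..x * p l} u \<partial>lborel)
      = ennreal ((- exp (- (x * p l))) - (- exp (- 0)))"
      using x by (intro nn_integral_FTC_Icc) (auto intro!: derivative_eq_intros)
    then show "(\<integral>\<^sup>+u. ennreal (exp (- u)) * indicator {0..x * p l} u \<partial>lborel) = ennreal (1 - exp (- (x * p l)))"
      by simp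
  qed
  also have "\<dots> = ennreal (\<Psi> x)" unfolding \<Psi>_def
    using x by (intro suminf_ennreal2 summable_\<Psi>) auto
  finally show ?thesis .
qed

text \<open>For positive x the point u = 0 lies in every interval \<open>{0..x * p l}\<close>, so
  \<open>level_sum\<close> is infinite there; the indicator removes this null set.\<close>

definition level_int :: "real \<Rightarrow> real \<Rightarrow> real" where
  "level_int x u = enn2real (level_sum x u) * indicator {0<..} u"

lemma level_int_eq: "x > 0 \<Longrightarrow> level_int x u = exp (- u) * \<nu> (x / u) * indicator {0<..} u"
  by (auto simp: level_int_def level_sum_eq indicator_def)

lemma level_int_measurable [measurable]: "level_int x \<in> borel_measurable borel"
  unfolding level_int_def[abs_def] by measurable

lemma \<Psi>_eq_integral: "x > 0 \<Longrightarrow> \<Psi> x = (\<integral>u. level_int x u \<partial>lborel)"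
proof -
  assume x: "x > 0"
  have "(\<integral>\<^sup>+u. ennreal (level_int x u) \<partial>lborel) = (\<integral>\<^sup>+u. level_sum x u \<partial>lborel)"
  proof (intro nn_integral_cong_AE)
    have "AE u in lborel. u \<noteq> (0::real)" by (rule AE_lborel_singleton)
    then show "AE u in lborel. ennreal (level_int x u) = level_sum x u"
    proof eventually_elim
      case (elim u)
      show ?case
      proof (cases "u > 0")
        case True then show ?thesis using x by (simp add: level_int_eq level_sum_eq)
      next
        case False
        then have "level_sum x u = 0" unfolding level_sum_def using elim by (auto simp: indicator_def)
        then show ?thesis using False by (simp add: level_int_def)
      qed
    qed
  qed
  then have "(\<integral>u. level_int x u \<partial>lborel) = enn2real (ennreal (\<Psi> x))"
    by (subst integral_eq_nn_integral) (auto simp: nn_integral_level_sum x level_int_def)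
  then show ?thesis using \<Psi>_nonneg x by simp
qed

lemma gamma_integrand:
  assumes "0 < s"
  defines "g \<equiv> \<lambda>t::real. exp (- t) * t powr (s - 1) * indicator {0<..} t"
  shows "integrable lborel g" "(\<integral>t. g t \<partial>lborel) = Gamma s"
proof -
  have [measurable]: "g \<in> borel_measurable borel" unfolding g_def by measurable
  have "(\<integral>\<^sup>+t. ennreal (g t) \<partial>lborel) = (\<integral>\<^sup>+t. ennreal (indicator {0..} t * t powr (s - 1) / exp t) \<partial>lborel)"
    by (intro nn_integral_cong) (auto simp: g_def indicator_def exp_minus field_simps)
  also have "\<dots> = ennreal (Gamma s)" using Gamma_conv_nn_integral_real[OF assms(1)] by simp
  finally have *: "(\<integral>\<^sup>+t. ennreal (g t) \<partial>lborel) = ennreal (Gamma s)" .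
  show "integrable lborel g"
    by (rule integrableI_nonneg) (simp_all add: *, simp add: g_def)
  show "(\<integral>t. g t \<partial>lborel) = Gamma s"
    using Gamma_real_pos[OF assms(1)]
    by (subst integral_eq_nn_integral) (simp_all add: *, simp add: g_def)
qed

text \<open>An Abelian theorem: the integrand divided by \<open>\<nu> x\<close> tends to exp (-u)
  u^(-\<alpha>), whose integral is the Gamma value. For u <= 1 the Potter bound dominates it by a
  multiple of u^(-\<gamma>), integrable at 0 because \<gamma> < 1; for u > 1 monotonicity of
  \<open>\<nu>\<close> gives the bound exp (-u).\<close>

lemma \<Psi>_div_\<nu>: "((\<lambda>x. \<Psi> x / \<nu> x) \<longlongrightarrow> Gamma (1 - \<alpha>)) at_top"
proof -
  define \<gamma> where "\<gamma> = (\<alpha> + 1) / 2"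
  have \<gamma>: "\<alpha> < \<gamma>" "\<gamma> < 1" "0 < \<gamma>" using \<alpha> by (auto simp: \<gamma>_def)
  obtain x0 where x0: "x0 > 0" "\<And>x y. x0 \<le> x \<Longrightarrow> x \<le> y \<Longrightarrow> \<nu> y \<le> 2 powr \<gamma> * (y / x) powr \<gamma> * \<nu> x"
    using potter_upper[OF \<gamma>(1)] by blast
  define s where "s x u = level_int x u / \<nu> x" for x u
  define f where "f u = exp (- u) * u powr ((1 - \<alpha>) - 1) * indicator {0<..} u" for u :: real
  define w where "w u = 2 powr \<gamma> * (exp (- u) * u powr ((1 - \<gamma>) - 1) * indicator {0<..} u)
      + exp (- u) * u powr (1 - 1) * indicator {0<..} u" for u :: real
  have "((\<lambda>x. integral\<^sup>L lborel (s x)) \<longlongrightarrow> integral\<^sup>L lborel f) at_top"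
  proof (rule integral_dominated_convergence_at_top[where w = w])
    show "f \<in> borel_measurable lborel" unfolding f_def by measurable
    show "\<And>t. s t \<in> borel_measurable lborel" unfolding s_def[abs_def] by measurable
    show "integrable lborel w" unfolding w_def
      using \<gamma> by (intro Bochner_Integration.integrable_add integrable_mult_right gamma_integrand) auto
    show "AE u in lborel. ((\<lambda>x. s x u) \<longlongrightarrow> f u) at_top"
    proof (rule AE_I2)
      fix u :: real
      show "((\<lambda>x. s x u) \<longlongrightarrow> f u) at_top"
      proof (cases "u > 0")
        case True
        have "((\<lambda>x. exp (- u) * (\<nu> ((1 / u) * x) / \<nu> x)) \<longlongrightarrow> exp (- u) * (1 / u) powr \<alpha>) at_top"
          using True by (intro tendsto_intros \<nu>_scale) auto
        moreover have "\<forall>\<^sub>F x in at_top. exp (- u) * (\<nu> ((1 / u) * x) / \<nu> x) = s x u"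
          using eventually_gt_at_top[of 0] by eventually_elim (use True in \<open>auto simp: s_def level_int_eq\<close>)
        moreover have "exp (- u) * (1 / u) powr \<alpha> = f u"
          using True by (simp add: f_def powr_divide powr_minus field_simps)
        ultimately show ?thesis by (simp only: tendsto_cong)
      next
        case False
        then show ?thesis by (simp add: s_def f_def level_int_def)
      qed
    qed
    show "\<forall>\<^sub>F x in at_top. AE u in lborel. norm (s x u) \<le> w u"
      using eventually_ge_at_top[of x0] \<nu>_eventually_pos eventually_gt_at_top[of 0]
    proof eventually_elim
      case (elim x)
      show ?case
      proof (rule AE_I2)
        fix u :: real
        show "norm (s x u) \<le> w u"
        proof (cases "u > 0")
          case True
          have eq: "norm (s x u) = exp (- u) * (\<nu> (x / u) / \<nu> x)"
            using True elim by (simp add: s_def level_int_eq)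
          have "\<nu> (x / u) / \<nu> x \<le> 2 powr \<gamma> * u powr - \<gamma> + 1"
          proof (cases "u \<le> 1")
            case u1: True
            have "x * u \<le> x * 1" using elim u1 by (intro mult_left_mono) auto
            then have "x \<le> x / u" using True by (simp add: field_simps)
            from x0(2)[OF elim(1) this] elim True have "\<nu> (x / u) / \<nu> x \<le> 2 powr \<gamma> * (x / u / x) powr \<gamma>"
              by (simp add: field_simps)
            also have "x / u / x = 1 / u" using elim by simp
            also have "(1 / u) powr \<gamma> = u powr - \<gamma>" using True by (simp add: powr_divide powr_minus field_simps)
            finally show ?thesis by simp
          next
            case u1: False
            have "\<nu> (x / u) \<le> \<nu> x" using u1 elim True by (intro \<nu>_mono) (auto simp: field_simps)
            then have "\<nu> (x / u) / \<nu> x \<le> 1" using elim by simp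
            then show ?thesis by (simp add: add_increasing)
          qed
          then have "exp (- u) * (\<nu> (x / u) / \<nu> x) \<le> exp (- u) * (2 powr \<gamma> * u powr - \<gamma> + 1)"
            by (intro mult_left_mono) auto
          also have "\<dots> = w u" using True by (simp add: w_def algebra_simps)
          finally show ?thesis using eq by simp
        next
          case False
          then show ?thesis by (simp add: s_def w_def level_int_def)
        qed
      qed
    qed
  qed
  moreover have "integral\<^sup>L lborel f = Gamma (1 - \<alpha>)"
    unfolding f_def using \<alpha> by (intro gamma_integrand) auto
  moreover have "\<forall>\<^sub>F x in at_top. integral\<^sup>L lborel (s x) = \<Psi> x / \<nu> x"
    using eventually_gt_at_top[of 0] by eventually_elim (simp add: s_def[abs_def] \<Psi>_eq_integral)
  ultimately show ?thesis by (simp only: tendsto_cong)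
qed

section \<open>Mean number of odd boxes after n throws\<close>

text \<open>The summand is the probability that a binomial variable with parameters n and
  \<open>p l\<close> is odd, so the series is the mean in question
  (\<open>expectation_num_odd\<close>).\<close>

definition V :: "nat \<Rightarrow> real" where "V n = (\<Sum>l. (1 - (1 - 2 * p l) ^ n) / 2)"

lemma abs_1_2p_le: "\<bar>1 - 2 * p l\<bar> \<le> 1"
  using p_nonneg[of l] p_le_1[of l] by (auto simp: abs_le_iff)

lemma odd_prob_bounds: "0 \<le> (1 - (1 - 2 * p l) ^ n) / 2" "(1 - (1 - 2 * p l) ^ n) / 2 \<le> real n * p l"
proof -
  have "\<bar>(1 - 2 * p l) ^ n\<bar> \<le> 1" using abs_1_2p_le by (simp add: power_abs power_le_one)
  then show "0 \<le> (1 - (1 - 2 * p l) ^ n) / 2" by auto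
  have "norm (1 ^ n - (1 - 2 * p l) ^ n) \<le> real n * norm (1 - (1 - 2 * p l))"
    using abs_1_2p_le by (intro norm_power_diff) auto
  then show "(1 - (1 - 2 * p l) ^ n) / 2 \<le> real n * p l" by simp
qed

lemma summable_V: "summable (\<lambda>l. (1 - (1 - 2 * p l) ^ n) / 2)"
proof (rule summable_comparison_test'[of "\<lambda>l. real n * p l" 0])
  show "summable (\<lambda>l. real n * p l)" by (intro summable_mult summable_p)
qed (use odd_prob_bounds in auto)

lemma V_nonneg: "V n \<ge> 0"
  unfolding V_def by (intro suminf_nonneg summable_V odd_prob_bounds)

lemma V_0 [simp]: "V 0 = 0" by (simp add: V_def)

text \<open>The error has to be summable over the boxes and small against \<open>\<Psi>\<close>. For
  x <= 1/2 the factorization of a difference of powers leaves an error of relative size 1/n against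
  1 - exp (-2 n x). For x > 1/2 the base is negative and the trivial bound 2 <= 4 x is used; over
  all boxes the terms 4 x add up to 4.\<close>

lemma power_exp_diff:
  assumes "0 \<le> x" "x \<le> 1" "n \<ge> 1"
  shows "\<bar>(1 - 2 * x) ^ n - exp (- (2 * real n * x))\<bar> \<le> 2 * exp 2 / real n * (1 - exp (- (2 * real n * x))) + 4 * x"
proof (cases "x \<le> 1 / 2")
  case False
  have "\<bar>(1 - 2 * x) ^ n\<bar> \<le> 1" using assms by (auto simp: power_abs intro!: power_le_one)
  moreover have "0 \<le> exp (- (2 * real n * x))" "exp (- (2 * real n * x)) \<le> 1" using assms by auto
  ultimately have "\<bar>(1 - 2 * x) ^ n - exp (- (2 * real n * x))\<bar> \<le> 2" by linarith
  also have "\<dots> \<le> 4 * x" using False by simp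
  also have "\<dots> \<le> 2 * exp 2 / real n * (1 - exp (- (2 * real n * x))) + 4 * x" using assms by simp
  finally show ?thesis .
next
  case True
  define y where "y = exp (- (2 * x))"
  have y: "1 - 2 * x \<le> y" using exp_ge_add_one_self[of "- (2 * x)"] by (simp add: y_def)
  have en: "exp (- (2 * real n * x)) = y ^ n" by (simp add: y_def exp_of_nat_mult[symmetric] mult_ac)
  define z where "z = real n * x"
  have z0: "z \<ge> 0" using assms by (simp add: z_def)
  have diff: "y - (1 - 2 * x) \<le> 2 * x\<^sup>2"
  proof -
    have "exp (- (2 * x)) \<le> 1 / (1 + 2 * x + (2 * x)\<^sup>2 / 2)"
      using exp_lower_Taylor_quadratic[of "2 * x"] assms
      by (simp add: exp_minus inverse_eq_divide frac_le add_pos_nonneg)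
    also have "\<dots> \<le> 1 - 2 * x + 2 * x\<^sup>2"
    proof -
      have "1 \<le> (1 - 2 * x + 2 * x\<^sup>2) * (1 + 2 * x + (2 * x)\<^sup>2 / 2)"
        using assms by (simp add: algebra_simps power2_eq_square)
      then show ?thesis using assms by (simp add: divide_le_eq add_pos_nonneg)
    qed
    finally show ?thesis by (simp add: y_def)
  qed
  have "y ^ n - (1 - 2 * x) ^ n = (y - (1 - 2 * x)) * (\<Sum>i<n. (1 - 2 * x) ^ (n - Suc i) * y ^ i)"
    by (rule power_diff_sumr2)
  also have "\<dots> \<le> (2 * x\<^sup>2) * (\<Sum>i<n. y ^ (n - 1))"
  proof (intro mult_mono diff sum_mono sum_nonneg)
    fix i assume i: "i \<in> {..<n}"
    have "(1 - 2 * x) ^ (n - Suc i) * y ^ i \<le> y ^ (n - Suc i) * y ^ i"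
      using y True by (intro mult_right_mono power_mono) (auto simp: y_def)
    also have "\<dots> = y ^ (n - 1)" using i by (simp add: power_add[symmetric])
    finally show "(1 - 2 * x) ^ (n - Suc i) * y ^ i \<le> y ^ (n - 1)" .
  qed (use True in \<open>auto simp: y_def\<close>)
  also have "\<dots> = 2 * x * z * y ^ (n - 1)" by (simp add: z_def power2_eq_square)
  also have "y ^ (n - 1) = y ^ n * exp (2 * x)"
    using assms(3) by (cases n) (auto simp: y_def exp_minus field_simps)
  also have "2 * x * z * (y ^ n * exp (2 * x)) \<le> 2 * x * z * (y ^ n * exp 2)"
    using assms z0 by (intro mult_left_mono mult_nonneg_nonneg) (auto simp: y_def)
  also have "\<dots> = 2 * exp 2 / real n * (z * z * y ^ n)"
    using assms(3) by (simp add: z_def)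
  also have "\<dots> \<le> 2 * exp 2 / real n * (1 - y ^ n)"
  proof (intro mult_left_mono)
    have yn: "y ^ n = exp (- z) * exp (- z)" using en by (simp add: z_def exp_add[symmetric] mult_ac)
    \<comment> \<open>With w = exp (-z) the claim reads (z w)^2 <= 1 - w^2. From 1 + z <= exp z one
      gets z w <= 1 - w <= 1, hence (z w)^2 <= 1 - w, and 1 - w <= (1 - w) (1 + w).\<close>
    define w where "w = exp (- z)"
    have zw: "z * w \<le> 1 - w"
      using exp_ge_add_one_self[of z] by (simp add: w_def exp_minus field_simps)
    have w: "0 \<le> w" "w \<le> 1" using z0 by (auto simp: w_def)
    have "(z * w) * (z * w) \<le> (1 - w) * 1" using zw w z0 by (intro mult_mono) auto
    also have "\<dots> \<le> (1 - w) * (1 + w)" using w by (intro mult_left_mono) auto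
    finally show "z * z * y ^ n \<le> 1 - y ^ n" by (simp add: yn w_def[symmetric] algebra_simps)
  qed auto
  finally have u: "y ^ n - (1 - 2 * x) ^ n \<le> 2 * exp 2 / real n * (1 - y ^ n)" .
  have "(1 - 2 * x) ^ n \<le> y ^ n" using y True by (intro power_mono) auto
  with u have "\<bar>(1 - 2 * x) ^ n - y ^ n\<bar> \<le> 2 * exp 2 / real n * (1 - y ^ n)" by simp
  also have "\<dots> \<le> 2 * exp 2 / real n * (1 - y ^ n) + 4 * x" using assms by simp
  finally show ?thesis by (simp add: en)
qed

lemma V_\<Psi>:
  assumes "n \<ge> 1"
  shows "\<bar>2 * V n - \<Psi> (2 * real n)\<bar> \<le> 2 * exp 2 / real n * \<Psi> (2 * real n) + 4"
proof -
  let ?b = "\<lambda>l. 1 - exp (- (2 * real n * p l))"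
  let ?a = "\<lambda>l. 2 * ((1 - (1 - 2 * p l) ^ n) / 2)"
  have sb: "summable ?b" using summable_\<Psi>[of "2 * real n"] by simp
  have sa: "summable ?a" by (intro summable_mult summable_V)
  have bd: "summable (\<lambda>l. 2 * exp 2 / real n * ?b l + 4 * p l)"
    by (intro summable_add summable_mult sb summable_p)
  have le: "\<bar>?a l - ?b l\<bar> \<le> 2 * exp 2 / real n * ?b l + 4 * p l" for l
  proof -
    have "?a l - ?b l = - ((1 - 2 * p l) ^ n - exp (- (2 * real n * p l)))" by (simp add: field_simps)
    then show ?thesis using power_exp_diff[OF p_nonneg p_le_1 assms, of l] by (simp only: abs_minus_cancel)
  qed
  have sabs: "summable (\<lambda>l. \<bar>?a l - ?b l\<bar>)"
    by (rule summable_comparison_test'[OF bd, of 0]) (use le in auto)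
  have eq: "2 * V n - \<Psi> (2 * real n) = (\<Sum>l. ?a l - ?b l)"
    unfolding V_def \<Psi>_def by (subst suminf_mult[OF summable_V, symmetric]) (rule suminf_diff[OF sa sb])
  have "\<bar>2 * V n - \<Psi> (2 * real n)\<bar> \<le> (\<Sum>l. \<bar>?a l - ?b l\<bar>)"
    unfolding eq by (rule summable_rabs[OF sabs])
  also have "\<dots> \<le> (\<Sum>l. 2 * exp 2 / real n * ?b l + 4 * p l)" by (rule suminf_le[OF le sabs bd])
  also have "\<dots> = 2 * exp 2 / real n * \<Psi> (2 * real n) + 4 * suminf p"
    unfolding \<Psi>_def suminf_add[OF summable_mult[OF sb] summable_mult[OF summable_p], symmetric]
    by (simp only: suminf_mult[OF sb] suminf_mult[OF summable_p])
  also have "suminf p = 1" using p_sums by (rule sums_unique[symmetric])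
  finally show ?thesis by simp
qed

text \<open>The factor \<open>2 powr \<alpha>\<close> is the growth of \<open>\<nu>\<close> from n
  to 2 n, the time at which \<open>\<Psi>\<close> is evaluated; the remaining 1/2 is the one in the
  probability of an odd count.\<close>

definition c :: real where "c = Gamma (1 - \<alpha>) * 2 powr (\<alpha> - 1)"

lemma c_pos: "c > 0" unfolding c_def using \<alpha> by (intro mult_pos_pos Gamma_real_pos) auto

lemma V_div_\<nu>: "(\<lambda>n. V n / \<nu> (real n)) \<longlonglongrightarrow> c"
proof -
  have nn: "filterlim (\<lambda>n. 2 * real n) at_top sequentially"
    by (rule filterlim_tendsto_pos_mult_at_top[OF tendsto_const _ filterlim_real_sequentially]) simp
  have "(\<lambda>n. (\<Psi> (2 * real n) / \<nu> (2 * real n)) * (\<nu> (2 * real n) / \<nu> (real n))) \<longlonglongrightarrow> Gamma (1 - \<alpha>) * 2 powr \<alpha>"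
    by (intro tendsto_mult filterlim_compose[OF \<Psi>_div_\<nu> nn] filterlim_compose[OF \<nu>_scale filterlim_real_sequentially]) auto
  moreover have "\<forall>\<^sub>F n in sequentially. (\<Psi> (2 * real n) / \<nu> (2 * real n)) * (\<nu> (2 * real n) / \<nu> (real n)) = \<Psi> (2 * real n) / \<nu> (real n)"
    using eventually_compose_filterlim[OF \<nu>_eventually_pos nn] by eventually_elim auto
  ultimately have L: "(\<lambda>n. \<Psi> (2 * real n) / \<nu> (real n)) \<longlonglongrightarrow> Gamma (1 - \<alpha>) * 2 powr \<alpha>"
    by (simp only: tendsto_cong)
  have nu: "filterlim (\<lambda>n. \<nu> (real n)) at_top sequentially"
    by (rule filterlim_compose[OF \<nu>_at_top filterlim_real_sequentially])
  have z: "(\<lambda>n. 2 * exp 2 / real n * (\<Psi> (2 * real n) / \<nu> (real n)) + 4 / \<nu> (real n)) \<longlonglongrightarrow> 0 * (Gamma (1 - \<alpha>) * 2 powr \<alpha>) + 0"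
    by (intro tendsto_add tendsto_mult L tendsto_divide_0[OF tendsto_const] filterlim_at_top_imp_at_infinity nu filterlim_real_sequentially)
  have "(\<lambda>n. (2 * V n - \<Psi> (2 * real n)) / \<nu> (real n)) \<longlonglongrightarrow> 0"
  proof (rule Lim_null_comparison)
    show "(\<lambda>n. 2 * exp 2 / real n * (\<Psi> (2 * real n) / \<nu> (real n)) + 4 / \<nu> (real n)) \<longlonglongrightarrow> 0" using z by simp
    show "\<forall>\<^sub>F n in sequentially. norm ((2 * V n - \<Psi> (2 * real n)) / \<nu> (real n)) \<le> 2 * exp 2 / real n * (\<Psi> (2 * real n) / \<nu> (real n)) + 4 / \<nu> (real n)"
      using eventually_ge_at_top[of 1]
    proof eventually_elim
      case (elim n)
      have "norm ((2 * V n - \<Psi> (2 * real n)) / \<nu> (real n)) \<le> (2 * exp 2 / real n * \<Psi> (2 * real n) + 4) / \<nu> (real n)"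
        using V_\<Psi>[OF elim] by (simp add: divide_right_mono)
      then show ?case by (simp add: add_divide_distrib)
    qed
  qed
  from tendsto_add[OF this L] have "(\<lambda>n. (1/2) * ((2 * V n - \<Psi> (2 * real n)) / \<nu> (real n) + \<Psi> (2 * real n) / \<nu> (real n))) \<longlonglongrightarrow> (1/2) * (0 + Gamma (1 - \<alpha>) * 2 powr \<alpha>)"
    by (intro tendsto_mult tendsto_const)
  moreover have "(1/2) * (0 + Gamma (1 - \<alpha>) * 2 powr \<alpha>) = c" by (simp add: c_def powr_diff)
  moreover have "(\<lambda>n. (1/2) * ((2 * V n - \<Psi> (2 * real n)) / \<nu> (real n) + \<Psi> (2 * real n) / \<nu> (real n))) = (\<lambda>n. V n / \<nu> (real n))"
    by (simp add: diff_divide_distrib)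
  ultimately show ?thesis by simp
qed

section \<open>Regular variation along integer sequences\<close>

text \<open>Regular variation is given for fixed multiples, while here the multiple only converges.
  Monotonicity of \<open>\<nu>\<close> places it between fixed multiples on either side of
  \<open>\<tau>\<close>, in lieu of uniform convergence on compact sets.\<close>

lemma \<nu>_ratio:
  assumes k: "(\<lambda>n. real (k n) / real n) \<longlonglongrightarrow> \<tau>" and \<tau>: "\<tau> > 0"
  shows "(\<lambda>n. \<nu> (real (k n)) / \<nu> (real n)) \<longlonglongrightarrow> \<tau> powr \<alpha>"
proof (rule order_tendstoI)
  have cont: "((\<lambda>s. s powr \<alpha>) \<longlongrightarrow> \<tau> powr \<alpha>) (at \<tau>)"
    using \<tau> by (intro tendsto_intros) auto
  have sc: "(\<lambda>n. \<nu> (s * real n) / \<nu> (real n)) \<longlonglongrightarrow> s powr \<alpha>" if "s > 0" for s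
    by (rule filterlim_compose[OF \<nu>_scale filterlim_real_sequentially]) fact
  have pos: "\<forall>\<^sub>F n in sequentially. \<nu> (real n) > 0"
    by (rule eventually_compose_filterlim[OF \<nu>_eventually_pos filterlim_real_sequentially])
  {
    fix a assume "a < \<tau> powr \<alpha>"
    then have "\<forall>\<^sub>F s in at_left \<tau>. a < s powr \<alpha>"
      using order_tendstoD(1)[OF cont] by (auto simp: eventually_at_split)
    moreover have "\<forall>\<^sub>F s in at_left \<tau>. s \<in> {0<..<\<tau>}" by (rule eventually_at_leftI[OF _ \<tau>]) auto
    ultimately have "\<exists>s. a < s powr \<alpha> \<and> s \<in> {0<..<\<tau>}"
      using eventually_happens'[OF _ eventually_conj] by (metis (no_types, lifting) trivial_limit_at_left_real)
    then obtain s where s: "a < s powr \<alpha>" "0 < s" "s < \<tau>" by auto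
    show "\<forall>\<^sub>F n in sequentially. a < \<nu> (real (k n)) / \<nu> (real n)"
      using order_tendstoD(1)[OF sc[OF s(2)] s(1)] order_tendstoD(1)[OF k s(3)] pos eventually_gt_at_top[of 0]
    proof eventually_elim
      case (elim n)
      have "\<nu> (s * real n) \<le> \<nu> (real (k n))" using elim s by (intro \<nu>_mono) (auto simp: field_simps)
      then have "\<nu> (s * real n) / \<nu> (real n) \<le> \<nu> (real (k n)) / \<nu> (real n)" by (simp add: divide_right_mono)
      then show ?case using elim by linarith
    qed
  }
  {
    fix a assume "a > \<tau> powr \<alpha>"
    then have "\<forall>\<^sub>F s in at_right \<tau>. a > s powr \<alpha>"
      using order_tendstoD(2)[OF cont] by (auto simp: eventually_at_split)
    moreover have "\<forall>\<^sub>F s in at_right \<tau>. s \<in> {\<tau><..<\<tau>+1}" by (rule eventually_at_rightI[of _ "\<tau>+1"]) auto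
    ultimately have "\<exists>s. a > s powr \<alpha> \<and> s \<in> {\<tau><..<\<tau>+1}"
      using eventually_happens'[OF _ eventually_conj] by (metis (no_types, lifting) trivial_limit_at_right_real)
    then obtain s where s: "a > s powr \<alpha>" "\<tau> < s" by auto
    have s0: "s > 0" using s \<tau> by simp
    show "\<forall>\<^sub>F n in sequentially. a > \<nu> (real (k n)) / \<nu> (real n)"
      using order_tendstoD(2)[OF sc[OF s0] s(1)] order_tendstoD(2)[OF k s(2)] order_tendstoD(1)[OF k \<tau>] pos eventually_gt_at_top[of 0]
    proof eventually_elim
      case (elim n)
      have "\<nu> (s * real n) \<ge> \<nu> (real (k n))" using elim s by (intro \<nu>_mono) (auto simp: field_simps zero_less_divide_iff)
      then have "\<nu> (s * real n) / \<nu> (real n) \<ge> \<nu> (real (k n)) / \<nu> (real n)" by (simp add: divide_right_mono)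
      then show ?case using elim by linarith
    qed
  }
qed

lemma V_lim:
  assumes k: "(\<lambda>n. real (k n) / real n) \<longlonglongrightarrow> \<tau>" and \<tau>: "\<tau> > 0"
  shows "(\<lambda>n. V (k n) / r (real n)) \<longlonglongrightarrow> c * \<tau> powr \<alpha>"
proof -
  have kt: "filterlim (\<lambda>n. real (k n)) at_top sequentially"
  proof -
    have "filterlim (\<lambda>n. real (k n) / real n * real n) at_top sequentially"
      by (rule filterlim_tendsto_pos_mult_at_top[OF k \<tau> filterlim_real_sequentially])
    moreover have "\<forall>\<^sub>F n in sequentially. real (k n) / real n * real n = real (k n)"
      using eventually_gt_at_top[of 0] by eventually_elim auto
    ultimately show ?thesis by (rule filterlim_cong[OF refl refl, THEN iffD1, rotated])
  qed
  then have kt': "filterlim k at_top sequentially"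
    by (subst (asm) filterlim_sequentially_iff_filterlim_real[symmetric])
  have "(\<lambda>n. (V (k n) / \<nu> (real (k n))) * (\<nu> (real (k n)) / \<nu> (real n)) * (\<nu> (real n) / r (real n))) \<longlonglongrightarrow> c * \<tau> powr \<alpha> * 1"
    by (intro tendsto_mult filterlim_compose[OF V_div_\<nu> kt'] \<nu>_ratio[OF k \<tau>] filterlim_compose[OF \<nu>_div_r filterlim_real_sequentially])
  moreover have "\<forall>\<^sub>F n in sequentially. (V (k n) / \<nu> (real (k n))) * (\<nu> (real (k n)) / \<nu> (real n)) * (\<nu> (real n) / r (real n)) = V (k n) / r (real n)"
    using eventually_compose_filterlim[OF \<nu>_eventually_pos filterlim_real_sequentially]
      eventually_compose_filterlim[OF \<nu>_eventually_pos kt] by eventually_elim auto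
  ultimately show ?thesis by (simp only: tendsto_cong mult_1_right)
qed

section \<open>Total mass of the rare boxes\<close>

definition tail_mass :: "real \<Rightarrow> real" where "tail_mass x = (\<Sum>l. if p l < 1 / x then p l else 0)"

lemma summable_tail: "summable (\<lambda>l. if p l < 1 / x then p l else 0)"
  by (rule summable_comparison_test'[OF summable_p, of 0]) auto

lemma tail_mass_nonneg: "tail_mass x \<ge> 0"
  unfolding tail_mass_def by (intro suminf_nonneg summable_tail) auto

text \<open>On a rare box y = \<open>x * p l\<close> is below 1, and there y / 2 <= 1 - exp
  (-y).\<close>

lemma tail_mass_\<Psi>: "x > 0 \<Longrightarrow> x * tail_mass x \<le> 2 * \<Psi> x"
proof -
  assume x: "x > 0"
  have "x * tail_mass x = (\<Sum>l. x * (if p l < 1 / x then p l else 0))"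
    unfolding tail_mass_def by (rule suminf_mult[OF summable_tail, symmetric])
  also have "\<dots> \<le> (\<Sum>l. 2 * (1 - exp (- (x * p l))))"
  proof (intro suminf_le summable_mult summable_tail summable_\<Psi>)
    fix l
    show "x * (if p l < 1 / x then p l else 0) \<le> 2 * (1 - exp (- (x * p l)))"
    proof (cases "p l < 1 / x")
      case True
      define y where "y = x * p l"
      have y: "0 \<le> y" "y < 1" using True x by (auto simp: y_def field_simps)
      have "exp (- y) \<le> 1 / (1 + y)"
        using exp_ge_add_one_self[of y] y by (simp add: exp_minus inverse_eq_divide frac_le)
      also have "\<dots> \<le> 1 - y / 2"
      proof -
        have "1 \<le> (1 - y / 2) * (1 + y)" using y mult_left_mono[of y 1 y] by (simp add: algebra_simps)
        then show ?thesis using y by (simp add: divide_le_eq)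
      qed
      finally show ?thesis using True by (simp add: y_def)
    qed (use x in auto)
  qed (use x in auto)
  also have "\<dots> = 2 * \<Psi> x" unfolding \<Psi>_def using x by (intro suminf_mult summable_\<Psi>) auto
  finally show ?thesis .
qed

text \<open>For large n this holds because \<open>\<Psi>\<close> is of the order of
  \<open>\<nu>\<close>; below the threshold \<open>x0\<close> the crude bound
  \<open>\<Psi> x \<le> x\<close> and the maximum with 1 take over.\<close>

lemma tail_mass_bound:
  obtains C where "C > 0" "\<And>n. n \<ge> 1 \<Longrightarrow> real n * tail_mass (real n) \<le> C * max 1 (\<nu> (real n))"
proof -
  have "\<forall>\<^sub>F x in at_top. \<Psi> x / \<nu> x < Gamma (1 - \<alpha>) + 1"
    by (rule order_tendstoD(2)[OF \<Psi>_div_\<nu>]) simp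
  with \<nu>_eventually_pos have "\<forall>\<^sub>F x in at_top. \<Psi> x \<le> (Gamma (1 - \<alpha>) + 1) * \<nu> x"
    by eventually_elim (auto simp: field_simps)
  from eventually_at_top_ge_pos[OF this] obtain x0 where x0: "x0 > 0" "\<And>x. x \<ge> x0 \<Longrightarrow> \<Psi> x \<le> (Gamma (1 - \<alpha>) + 1) * \<nu> x"
    by blast
  define G where "G = Gamma (1 - \<alpha>) + 1"
  have G: "G > 0" using Gamma_real_pos[of "1 - \<alpha>"] \<alpha> unfolding G_def by linarith
  show ?thesis
  proof
    show "2 * (G + x0) > 0" using G x0 by simp
    fix n :: nat assume n: "n \<ge> 1"
    have "\<Psi> (real n) \<le> (G + x0) * max 1 (\<nu> (real n))"
    proof (cases "real n \<ge> x0")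
      case True
      have "\<Psi> (real n) \<le> G * \<nu> (real n)" using x0(2)[OF True] by (simp add: G_def)
      also have "\<dots> \<le> (G + x0) * max 1 (\<nu> (real n))" using G x0 by (intro mult_mono) auto
      finally show ?thesis .
    next
      case False
      have "\<Psi> (real n) \<le> real n" by (rule \<Psi>_le) simp
      also have "\<dots> \<le> (G + x0) * 1" using False G by simp
      also have "\<dots> \<le> (G + x0) * max 1 (\<nu> (real n))" using G x0 by (intro mult_left_mono) auto
      finally show ?thesis .
    qed
    moreover have "real n * tail_mass (real n) \<le> 2 * \<Psi> (real n)" using n by (intro tail_mass_\<Psi>) simp
    ultimately show "real n * tail_mass (real n) \<le> 2 * (G + x0) * max 1 (\<nu> (real n))"
      by (simp only: mult.assoc)
  qed
qed

end

section \<open>Odd box counts\<close>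

definition occ :: "(nat \<Rightarrow> nat) \<Rightarrow> nat set \<Rightarrow> nat \<Rightarrow> nat" where
  "occ y I l = card {i\<in>I. y i = l}"

definition odds :: "(nat \<Rightarrow> nat) \<Rightarrow> nat set \<Rightarrow> nat set" where
  "odds y I = {l. odd (occ y I l)}"

definition parity :: "(nat \<Rightarrow> nat) \<Rightarrow> nat set \<Rightarrow> nat \<Rightarrow> real" where
  "parity y I l = of_bool (l \<in> odds y I)"

definition num_odd :: "(nat \<Rightarrow> nat) \<Rightarrow> nat set \<Rightarrow> real" where
  "num_odd y I = real (card (odds y I))"

lemma odds_subset: "odds y I \<subseteq> y ` I"
proof
  fix l assume "l \<in> odds y I"
  then have "occ y I l \<noteq> 0" by (auto simp: odds_def intro: Nat.gr0I)
  then have "{i\<in>I. y i = l} \<noteq> {}" unfolding occ_def by (metis card.empty)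
  then show "l \<in> y ` I" by auto
qed

lemma finite_odds: "finite I \<Longrightarrow> finite (odds y I)"
  using odds_subset finite_subset by blast

lemma num_odd_le: "finite I \<Longrightarrow> num_odd y I \<le> real (card I)"
  unfolding num_odd_def
  by (intro of_nat_mono order_trans[OF card_mono[OF _ odds_subset] card_image_le]) auto

lemma num_odd_nonneg [simp]: "num_odd y I \<ge> 0" by (simp add: num_odd_def)

lemma occ_Un: "finite I \<Longrightarrow> finite J \<Longrightarrow> I \<inter> J = {} \<Longrightarrow> occ y (I \<union> J) l = occ y I l + occ y J l"
proof -
  assume *: "finite I" "finite J" "I \<inter> J = {}"
  have "{i \<in> I \<union> J. y i = l} = {i\<in>I. y i = l} \<union> {i\<in>J. y i = l}" by auto
  then show ?thesis unfolding occ_def using * by (simp add: card_Un_disjoint disjoint_iff)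
qed

text \<open>Counts over disjoint index sets add, so parities add modulo 2. Hence the change of
  parity over a block is governed by the balls of that block alone.\<close>

lemma odds_Un: "finite I \<Longrightarrow> finite J \<Longrightarrow> I \<inter> J = {} \<Longrightarrow>
    odds y (I \<union> J) = (odds y I - odds y J) \<union> (odds y J - odds y I)"
  unfolding odds_def by (auto simp: occ_Un)

text \<open>The sign (-1)^occ is a product with one factor per ball, which lets expectations factor
  by independence and reduces measurability to single balls.\<close>

lemma parity_eq: "finite I \<Longrightarrow> parity y I l = (1 - (\<Prod>i\<in>I. 1 - 2 * of_bool (y i = l))) / 2"
proof -
  assume fin: "finite I"
  have "(\<Prod>i\<in>I. 1 - 2 * of_bool (y i = l) :: real) = (\<Prod>i\<in>I. if y i = l then -1 else 1)"
    by (intro prod.cong) auto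
  also have "\<dots> = (-1) ^ occ y I l"
    unfolding occ_def using fin by (subst prod.If_cases) (auto simp: Int_def)
  finally show ?thesis by (auto simp: parity_def odds_def)
qed

lemma parity_cong: "(\<And>i. i \<in> I \<Longrightarrow> y i = y' i) \<Longrightarrow> odds y I = odds y' I"
  unfolding odds_def occ_def by (simp cong: conj_cong)

text \<open>A series over all boxes, instead of the cardinality of a random set, can be integrated
  term by term and inherits measurability.\<close>

lemma num_odd_suminf: "finite I \<Longrightarrow> ennreal (num_odd y I) = (\<Sum>l. ennreal (parity y I l))"
proof -
  assume fin: "finite I"
  have "(\<Sum>l. ennreal (parity y I l)) = (\<Sum>l\<in>odds y I. ennreal (parity y I l))"
    by (rule suminf_finite[OF finite_odds[OF fin]]) (auto simp: parity_def)
  then show ?thesis by (simp add: parity_def num_odd_def ennreal_of_nat_eq_real_of_nat)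
qed

text \<open>One more ball flips the parity of exactly one box. This links even and odd numbers of
  balls.\<close>

lemma num_odd_insert: "finite I \<Longrightarrow> i \<notin> I \<Longrightarrow> \<bar>num_odd y (insert i I) - num_odd y I\<bar> \<le> 1"
proof -
  assume *: "finite I" "i \<notin> I"
  have o: "odds y {i} = {y i}"
  proof -
    have "{j. j = i \<and> y i = y i} = {i}" by auto
    have "occ y {i} l = of_bool (y i = l)" for l
    proof (cases "y i = l")
      case True then have "{j\<in>{i}. y j = l} = {i}" by auto
      then show ?thesis using True by (simp add: occ_def)
    next
      case False then have "{j\<in>{i}. y j = l} = {}" by auto
      then show ?thesis using False by (simp only: occ_def) simp
    qed
    then show ?thesis by (auto simp: odds_def)
  qed
  have "odds y (insert i I) = (odds y I - {y i}) \<union> ({y i} - odds y I)"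
    using odds_Un[of I "{i}" y] * o by simp
  moreover have "finite (odds y I)" using * finite_odds by blast
  ultimately show ?thesis
    by (cases "y i \<in> odds y I") (auto simp: num_odd_def insert_absorb card_Diff_singleton card_gt_0_iff of_nat_diff Suc_le_eq)
qed

text \<open>The product of parities at two times is recovered from the parities of single blocks,
  so all second-order statistics reduce to the number of odd boxes of one block.\<close>

lemma parity_prod:
  assumes "finite I" "finite J" "I \<inter> J = {}"
  shows "parity y I l * parity y (I \<union> J) l = (parity y I l + parity y (I \<union> J) l - parity y J l) / 2"
  using odds_Un[OF assms, of y] by (auto simp: parity_def)

lemma parity_diff:
  assumes "finite I" "finite J" "I \<inter> J = {}"
  shows "\<bar>parity y (I \<union> J) l - parity y I l\<bar> = parity y J l"
  using odds_Un[OF assms, of y] by (auto simp: parity_def)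

lemma sum_parity: "finite I \<Longrightarrow> finite F \<Longrightarrow> odds y I \<subseteq> F \<Longrightarrow> (\<Sum>l\<in>F. parity y I l) = num_odd y I"
proof -
  assume *: "finite I" "finite F" "odds y I \<subseteq> F"
  have "(\<Sum>l\<in>F. parity y I l) = (\<Sum>l\<in>odds y I. parity y I l)"
    using * by (intro sum.mono_neutral_right) (auto simp: parity_def)
  then show ?thesis by (simp add: parity_def num_odd_def)
qed

lemma power_le_fact_exp: "(x::real) \<ge> 0 \<Longrightarrow> x ^ m \<le> fact m * exp x"
proof -
  assume x: "x \<ge> 0"
  have "x ^ m /\<^sub>R fact m \<le> (\<Sum>n. x ^ n /\<^sub>R fact n)"
    using sum_le_suminf[OF summable_exp_generic[of x], of "{m}"] x by simp
  then show ?thesis by (simp add: exp_def field_simps)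
qed

context karlin_law begin

lemma measure_sums: "A \<subseteq> {1..} \<Longrightarrow> (\<lambda>l. if l \<in> A then p l else 0) sums measure \<mu> A"
proof -
  assume A: "A \<subseteq> {1..}"
  have "(\<lambda>i. measure \<mu> ({i} \<inter> A)) sums measure \<mu> (\<Union>i. {i} \<inter> A)"
    using A by (intro \<mu>.finite_measure_UNION) (auto simp: sets_\<mu> disjoint_family_on_def)
  moreover have "(\<Union>i. {i} \<inter> A) = A" by auto
  moreover have "measure \<mu> ({i} \<inter> A) = (if i \<in> A then p i else 0)" for i
    by (auto simp: p_def)
  ultimately show ?thesis by simp
qed

lemma measure_finite_sum: "finite A \<Longrightarrow> measure \<mu> (A \<inter> {1..}) = (\<Sum>l\<in>A. p l)"
proof -
  assume fin: "finite A"
  have "(\<lambda>l. if l \<in> A \<inter> {1..} then p l else 0) sums (\<Sum>l\<in>A \<inter> {1..}. p l)"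
    using sums_If_finite_set[of "A \<inter> {1..}" p] fin by auto
  then have "measure \<mu> (A \<inter> {1..}) = (\<Sum>l\<in>A \<inter> {1..}. p l)"
    using measure_sums[of "A \<inter> {1..}"] sums_unique2 by blast
  also have "\<dots> = (\<Sum>l\<in>A. p l)"
  proof (intro sum.mono_neutral_left ballI)
    fix i assume "i \<in> A - A \<inter> {1..}"
    then have "i = 0" by auto
    then show "p i = 0" by simp
  qed (use fin in auto)
  finally show ?thesis .
qed

end

section \<open>One random sequence: means and mean concentration of odd box counts\<close>

locale karlin_sequence = prob_space M + karlin_law \<mu> \<alpha> L
  for M :: "'a measure" and \<mu> \<alpha> L +
  fixes Y :: "nat \<Rightarrow> 'a \<Rightarrow> nat"
  assumes indep_Y: "indep_vars (\<lambda>_. count_space {1..}) Y {1..}"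
    and law_Y: "\<And>n. n \<ge> 1 \<Longrightarrow> distr M (count_space {1..}) (Y n) = \<mu>"
begin

abbreviation path :: "'a \<Rightarrow> nat \<Rightarrow> nat" where "path \<omega> \<equiv> \<lambda>i. Y i \<omega>"

lemma Y_rv: "n \<ge> 1 \<Longrightarrow> Y n \<in> M \<rightarrow>\<^sub>M count_space {1..}"
  using indep_Y unfolding indep_vars_def by auto

lemma Y_rv_UNIV: "n \<ge> 1 \<Longrightarrow> Y n \<in> M \<rightarrow>\<^sub>M count_space UNIV"
  using Y_rv by (rule measurable_compose) auto

lemma integral_Y:
  fixes g :: "nat \<Rightarrow> real"
  assumes "n \<ge> 1"
  shows "expectation (\<lambda>\<omega>. g (Y n \<omega>)) = (\<integral>l. g l \<partial>\<mu>)"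
proof -
  have "(\<integral>l. g l \<partial>\<mu>) = (\<integral>l. g l \<partial>distr M (count_space {1..}) (Y n))" using law_Y[OF assms] by simp
  also have "\<dots> = expectation (\<lambda>\<omega>. g (Y n \<omega>))" by (rule integral_distr[OF Y_rv[OF assms]]) auto
  finally show ?thesis by simp
qed

lemma expectation_prod:
  fixes g :: "nat \<Rightarrow> real"
  assumes I: "finite I" "I \<subseteq> {1..}" and g: "\<And>l. \<bar>g l\<bar> \<le> C"
  shows "expectation (\<lambda>\<omega>. \<Prod>i\<in>I. g (Y i \<omega>)) = (\<integral>l. g l \<partial>\<mu>) ^ card I"
proof -
  have ind: "indep_vars (\<lambda>_. borel) (\<lambda>i \<omega>. g (Y i \<omega>)) I"
    using indep_vars_compose2[OF indep_vars_subset[OF indep_Y I(2)], of "\<lambda>_. g" "\<lambda>_. borel"] by simp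
  have meas: "(\<lambda>\<omega>. g (Y i \<omega>)) \<in> borel_measurable M" if "i \<in> I" for i
    using Y_rv_UNIV[of i] that I(2) by (auto intro: measurable_compose)
  have "expectation (\<lambda>\<omega>. \<Prod>i\<in>I. g (Y i \<omega>)) = (\<Prod>i\<in>I. expectation (\<lambda>\<omega>. g (Y i \<omega>)))"
    by (rule indep_vars_lebesgue_integral[OF I(1) ind])
       (rule integrable_const_bound[where B = C], use g meas in auto)
  also have "\<dots> = (\<Prod>i\<in>I. \<integral>l. g l \<partial>\<mu>)" using I(2) by (intro prod.cong refl integral_Y) auto
  finally show ?thesis by simp
qed

lemma parity_measurable:
  assumes "finite I" "I \<subseteq> {1..}"
  shows "(\<lambda>\<omega>. parity (path \<omega>) I l) \<in> borel_measurable M"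
proof -
  have "(\<lambda>\<omega>. of_bool (Y i \<omega> = l) :: real) \<in> borel_measurable M" if "i \<in> I" for i
    using Y_rv_UNIV[of i] that assms(2) by (auto intro: measurable_compose)
  then show ?thesis unfolding parity_eq[OF assms(1)] by measurable
qed

lemma num_odd_measurable:
  assumes "finite I" "I \<subseteq> {1..}"
  shows "(\<lambda>\<omega>. num_odd (path \<omega>) I) \<in> borel_measurable M"
proof -
  have "(\<lambda>\<omega>. enn2real (\<Sum>l. ennreal (parity (path \<omega>) I l))) \<in> borel_measurable M"
    using parity_measurable[OF assms] by measurable
  then show ?thesis using assms(1) by (simp add: num_odd_suminf[symmetric])
qed

lemma integral_indicator_\<mu>:
  assumes "finite A"
  shows "(\<integral>l. 1 - 2 * indicator A l \<partial>\<mu>) = 1 - 2 * (\<Sum>l\<in>A. p l)"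
proof -
  have "(\<integral>l. 1 - 2 * indicator A l \<partial>\<mu>) = (\<integral>l. 1 - 2 * indicator (A \<inter> {1..}) l \<partial>\<mu>)"
    by (intro Bochner_Integration.integral_cong) (auto simp: space_\<mu> indicator_def)
  also have "\<dots> = 1 - 2 * measure \<mu> (A \<inter> {1..})"
  proof -
    have m: "A \<inter> {1..} \<in> sets \<mu>" by (simp add: sets_\<mu>)
    then have "integrable \<mu> (indicator (A \<inter> {1..}) :: nat \<Rightarrow> real)"
      by (intro integrable_real_indicator) (auto simp: \<mu>.emeasure_eq_measure)
    then show ?thesis using m \<mu>.prob_space by simp
  qed
  finally show ?thesis using measure_finite_sum[OF assms] by simp
qed

lemma expectation_sign:
  assumes "finite I" "I \<subseteq> {1..}" "finite A"
  shows "expectation (\<lambda>\<omega>. \<Prod>i\<in>I. 1 - 2 * indicator A (Y i \<omega>)) = (1 - 2 * (\<Sum>l\<in>A. p l)) ^ card I"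
  using expectation_prod[OF assms(1,2), of "\<lambda>l. 1 - 2 * indicator A l" 1] integral_indicator_\<mu>[OF assms(3)]
  by (simp add: indicator_def)

lemma sign_integrable:
  assumes "finite I" "I \<subseteq> {1..}"
  shows "integrable M (\<lambda>\<omega>. \<Prod>i\<in>I. 1 - 2 * indicator A (Y i \<omega>) :: real)"
proof (rule integrable_const_bound[where B = 1])
  have "(\<lambda>\<omega>. indicator A (Y i \<omega>) :: real) \<in> borel_measurable M" if "i \<in> I" for i
    using Y_rv_UNIV[of i] that assms(2) by (auto intro: measurable_compose)
  then show "(\<lambda>\<omega>. \<Prod>i\<in>I. 1 - 2 * indicator A (Y i \<omega>) :: real) \<in> borel_measurable M" by measurable
  show "AE \<omega> in M. norm (\<Prod>i\<in>I. 1 - 2 * indicator A (Y i \<omega>) :: real) \<le> 1"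
    by (intro AE_I2) (auto simp: abs_prod indicator_def intro!: prod_le_1)
qed

lemma parity_sign: "finite I \<Longrightarrow> parity y I l = (1 - (\<Prod>i\<in>I. 1 - 2 * indicator {l} (y i))) / 2"
  by (subst parity_eq) (auto simp: indicator_def of_bool_def intro!: prod.cong)

lemma expectation_parity:
  assumes "finite I" "I \<subseteq> {1..}"
  shows "expectation (\<lambda>\<omega>. parity (path \<omega>) I l) = (1 - (1 - 2 * p l) ^ card I) / 2"
  using expectation_sign[OF assms, of "{l}"] sign_integrable[OF assms, of "{l}"]
  by (simp add: parity_sign[OF assms(1)] prob_space)

text \<open>A ball cannot fall into both boxes, so the product of their two signs is the sign of the
  two-point set, which a ball hits with probability \<open>p l + p l'\<close>. This is why
  \<open>expectation_sign\<close> is stated for sets.\<close>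

lemma expectation_parity2:
  assumes "finite I" "I \<subseteq> {1..}" "l \<noteq> l'"
  shows "expectation (\<lambda>\<omega>. parity (path \<omega>) I l * parity (path \<omega>) I l') =
    (1 - (1 - 2 * p l) ^ card I - (1 - 2 * p l') ^ card I + (1 - 2 * p l - 2 * p l') ^ card I) / 4"
proof -
  let ?s = "\<lambda>A \<omega>. \<Prod>i\<in>I. 1 - 2 * indicator A (Y i \<omega>) :: real"
  have "?s {l} \<omega> * ?s {l'} \<omega> = ?s {l, l'} \<omega>" for \<omega>
    unfolding prod.distrib[symmetric] using assms(3) by (intro prod.cong) (auto simp: indicator_def)
  then have eq: "parity (path \<omega>) I l * parity (path \<omega>) I l' = (1 - ?s {l} \<omega> - ?s {l'} \<omega> + ?s {l,l'} \<omega>) / 4" for \<omega>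
    by (simp add: parity_sign[OF assms(1)] field_simps)
  have "expectation (\<lambda>\<omega>. (1 - ?s {l} \<omega> - ?s {l'} \<omega> + ?s {l,l'} \<omega>) / 4)
    = (1 - expectation (?s {l}) - expectation (?s {l'}) + expectation (?s {l,l'})) / 4"
    by (simp add: sign_integrable[OF assms(1,2)] prob_space)
  then show ?thesis unfolding eq using assms(3) by (simp add: expectation_sign[OF assms(1,2)] algebra_simps)
qed

lemma parity_bounds: "0 \<le> parity y I l" "parity y I l \<le> 1"
  by (auto simp: parity_def)

lemma nn_parity:
  assumes "finite I" "I \<subseteq> {1..}"
  shows "(\<integral>\<^sup>+\<omega>. ennreal (parity (path \<omega>) I l) \<partial>M) = ennreal ((1 - (1 - 2 * p l) ^ card I) / 2)"
proof -
  have "(\<integral>\<^sup>+\<omega>. ennreal (parity (path \<omega>) I l) \<partial>M) = ennreal (expectation (\<lambda>\<omega>. parity (path \<omega>) I l))"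
  proof (rule nn_integral_eq_integral)
    show "integrable M (\<lambda>\<omega>. parity (path \<omega>) I l)"
      using parity_measurable[OF assms(1,2)]
      by (intro integrable_const_bound[where B = 1]) (auto simp: parity_def)
  qed (use parity_bounds in auto)
  then show ?thesis by (simp only: expectation_parity[OF assms])
qed

lemma nn_parity2:
  assumes "finite I" "I \<subseteq> {1..}" "l \<noteq> l'"
  shows "(\<integral>\<^sup>+\<omega>. ennreal (parity (path \<omega>) I l * parity (path \<omega>) I l') \<partial>M) =
    ennreal ((1 - (1 - 2 * p l) ^ card I - (1 - 2 * p l') ^ card I + (1 - 2 * p l - 2 * p l') ^ card I) / 4)"
proof -
  have "(\<integral>\<^sup>+\<omega>. ennreal (parity (path \<omega>) I l * parity (path \<omega>) I l') \<partial>M) = ennreal (expectation (\<lambda>\<omega>. parity (path \<omega>) I l * parity (path \<omega>) I l'))"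
  proof (rule nn_integral_eq_integral)
    show "integrable M (\<lambda>\<omega>. parity (path \<omega>) I l * parity (path \<omega>) I l')"
      using parity_measurable[OF assms(1,2)]
      by (intro integrable_const_bound[where B = 1]) (auto simp: parity_def)
  qed (use parity_bounds in auto)
  then show ?thesis by (simp only: expectation_parity2[OF assms])
qed

lemma nn_num_odd:
  assumes "finite I" "I \<subseteq> {1..}"
  shows "(\<integral>\<^sup>+\<omega>. ennreal (num_odd (path \<omega>) I) \<partial>M) = ennreal (V (card I))"
proof -
  have "(\<integral>\<^sup>+\<omega>. ennreal (num_odd (path \<omega>) I) \<partial>M) = (\<Sum>l. \<integral>\<^sup>+\<omega>. ennreal (parity (path \<omega>) I l) \<partial>M)"
    unfolding num_odd_suminf[OF assms(1)] using parity_measurable[OF assms] by (intro nn_integral_suminf) auto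
  also have "\<dots> = ennreal (V (card I))"
    unfolding nn_parity[OF assms] V_def by (intro suminf_ennreal2 summable_V odd_prob_bounds)
  finally show ?thesis .
qed

text \<open>For an odd number of balls the power map is monotone, which makes the parities of two
  distinct boxes negatively correlated.\<close>

lemma nn_num_odd_sq:
  assumes "finite I" "I \<subseteq> {1..}" "odd (card I)"
  shows "(\<integral>\<^sup>+\<omega>. ennreal ((num_odd (path \<omega>) I)\<^sup>2) \<partial>M) \<le> ennreal ((V (card I))\<^sup>2 + V (card I))"
proof -
  let ?k = "card I"
  define a where "a l = (1 - (1 - 2 * p l) ^ ?k) / 2" for l
  have a0: "a l \<ge> 0" for l unfolding a_def by (rule odd_prob_bounds)
  note [measurable] = parity_measurable[OF assms(1,2)]
  have pair: "(\<integral>\<^sup>+\<omega>. ennreal (parity (path \<omega>) I l) * ennreal (parity (path \<omega>) I l') \<partial>M)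
      \<le> ennreal (a l) * ennreal (a l') + (if l' = l then ennreal (a l) else 0)" for l l'
  proof (cases "l' = l")
    case True
    have "(\<integral>\<^sup>+\<omega>. ennreal (parity (path \<omega>) I l) * ennreal (parity (path \<omega>) I l) \<partial>M)
       = (\<integral>\<^sup>+\<omega>. ennreal (parity (path \<omega>) I l) \<partial>M)"
      by (intro nn_integral_cong) (auto simp: parity_def)
    then show ?thesis using True nn_parity[OF assms(1,2)] by (simp add: a_def)
  next
    case False
    have "(1 - 2 * p l - 2 * p l') ^ ?k \<le> ((1 - 2 * p l) * (1 - 2 * p l')) ^ ?k"
      using assms(3) by (intro power_mono_odd) (auto simp: algebra_simps)
    then have "(1 - (1 - 2 * p l) ^ ?k - (1 - 2 * p l') ^ ?k + (1 - 2 * p l - 2 * p l') ^ ?k) / 4 \<le> a l * a l'"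
      unfolding a_def power_mult_distrib by (simp add: field_simps)
    then have "ennreal ((1 - (1 - 2 * p l) ^ ?k - (1 - 2 * p l') ^ ?k + (1 - 2 * p l - 2 * p l') ^ ?k) / 4) \<le> ennreal (a l * a l')"
      by (rule ennreal_leI)
    with nn_parity2[OF assms(1,2), of l l'] False show ?thesis
      by (simp add: ennreal_mult' a0 parity_bounds)
  qed
  have sa: "(\<Sum>l. ennreal (a l)) = ennreal (V ?k)"
    unfolding a_def V_def by (intro suminf_ennreal2 summable_V odd_prob_bounds)
  have "(\<integral>\<^sup>+\<omega>. ennreal ((num_odd (path \<omega>) I)\<^sup>2) \<partial>M)
     = (\<integral>\<^sup>+\<omega>. (\<Sum>l. \<Sum>l'. ennreal (parity (path \<omega>) I l) * ennreal (parity (path \<omega>) I l')) \<partial>M)"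
    by (intro nn_integral_cong)
       (simp add: power2_eq_square ennreal_mult' num_odd_suminf[OF assms(1)] ennreal_suminf_cmult ennreal_suminf_multc)
  also have "\<dots> = (\<Sum>l. \<Sum>l'. \<integral>\<^sup>+\<omega>. ennreal (parity (path \<omega>) I l) * ennreal (parity (path \<omega>) I l') \<partial>M)"
    by (subst nn_integral_suminf, measurable) (simp add: nn_integral_suminf del: ennreal_suminf_cmult)
  also have "\<dots> \<le> (\<Sum>l. \<Sum>l'. ennreal (a l) * ennreal (a l') + (if l' = l then ennreal (a l) else 0))"
    by (intro suminf_le pair) auto
  also have "\<dots> = (\<Sum>l. ennreal (a l) * ennreal (V ?k) + ennreal (a l))"
  proof (intro suminf_cong)
    fix l
    have "(\<Sum>l'. ennreal (a l) * ennreal (a l') + (if l' = l then ennreal (a l) else 0))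
      = (\<Sum>l'. ennreal (a l) * ennreal (a l')) + (\<Sum>l'. if l' = l then ennreal (a l) else 0)"
      by (intro suminf_add[symmetric]) auto
    also have "(\<Sum>l'. if l' = l then ennreal (a l) else 0) = ennreal (a l)"
      by (subst suminf_finite[of "{l}"]) auto
    finally show "(\<Sum>l'. ennreal (a l) * ennreal (a l') + (if l' = l then ennreal (a l) else 0)) =
        ennreal (a l) * ennreal (V ?k) + ennreal (a l)" by (simp add: ennreal_suminf_cmult sa)
  qed
  also have "\<dots> = ennreal (V ?k) * ennreal (V ?k) + ennreal (V ?k)"
    by (subst suminf_add[symmetric]) (auto simp: ennreal_suminf_multc sa)
  also have "\<dots> = ennreal ((V ?k)\<^sup>2 + V ?k)"
    using V_nonneg by (simp add: ennreal_mult ennreal_plus power2_eq_square)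
  finally show ?thesis .
qed

lemma num_odd_integrable:
  assumes "finite I" "I \<subseteq> {1..}"
  shows "integrable M (\<lambda>\<omega>. num_odd (path \<omega>) I ^ k)"
  using num_odd_measurable[OF assms] num_odd_le[OF assms(1)]
  by (intro integrable_const_bound[where B = "real (card I) ^ k"]) (auto intro!: power_mono)

lemma expectation_num_odd:
  assumes "finite I" "I \<subseteq> {1..}"
  shows "expectation (\<lambda>\<omega>. num_odd (path \<omega>) I) = V (card I)"
  using nn_num_odd[OF assms] V_nonneg num_odd_integrable[OF assms, of 1]
  by (simp add: nn_integral_eq_integral)

lemma L1_num_odd_odd:
  assumes "finite I" "I \<subseteq> {1..}" "odd (card I)"
  shows "expectation (\<lambda>\<omega>. \<bar>num_odd (path \<omega>) I - V (card I)\<bar>) \<le> 2 * sqrt (V (card I) + 1)"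
proof -
  let ?D = "\<lambda>\<omega>. num_odd (path \<omega>) I" and ?v = "V (card I)"
  have int1: "integrable M ?D" using num_odd_integrable[OF assms(1,2), of 1] by simp
  note int2 = num_odd_integrable[OF assms(1,2), of 2]
  have "ennreal (expectation (\<lambda>\<omega>. (?D \<omega>)\<^sup>2)) \<le> ennreal (?v\<^sup>2 + ?v)"
    using nn_num_odd_sq[OF assms] int2 by (simp add: nn_integral_eq_integral)
  then have sq: "expectation (\<lambda>\<omega>. (?D \<omega>)\<^sup>2) \<le> ?v\<^sup>2 + ?v"
    by (rule ennreal_le_iff[THEN iffD1, rotated]) (simp add: V_nonneg)
  have var: "expectation (\<lambda>\<omega>. (?D \<omega> - ?v)\<^sup>2) \<le> ?v"
  proof -
    have "expectation (\<lambda>\<omega>. (?D \<omega> - ?v)\<^sup>2) = expectation (\<lambda>\<omega>. (?D \<omega>)\<^sup>2 - 2 * ?v * ?D \<omega> + ?v\<^sup>2)"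
      by (simp add: power2_diff algebra_simps)
    also have "\<dots> = expectation (\<lambda>\<omega>. (?D \<omega>)\<^sup>2) - 2 * ?v * ?v + ?v\<^sup>2"
      using int1 int2 expectation_num_odd[OF assms(1,2)] by (simp add: prob_space)
    finally show ?thesis using sq by (simp add: power2_eq_square)
  qed
  \<comment> \<open>The pointwise bound |x| <= x^2 / s + s stands in for the Cauchy-Schwarz
    inequality. Taking s of the size of the bound on the standard deviation balances both terms; the
    added 1 keeps s positive when the mean vanishes.\<close>
  define s where "s = sqrt (?v + 1)"
  have s: "s > 0" "s\<^sup>2 = ?v + 1" using V_nonneg[of "card I"] by (auto simp: s_def)
  have int3: "integrable M (\<lambda>\<omega>. (?D \<omega> - ?v)\<^sup>2)"
    using int1 int2 by (simp add: power2_diff)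
  have "expectation (\<lambda>\<omega>. \<bar>?D \<omega> - ?v\<bar>) \<le> expectation (\<lambda>\<omega>. (?D \<omega> - ?v)\<^sup>2 / s + s)"
  proof (rule integral_mono)
    show "integrable M (\<lambda>\<omega>. \<bar>?D \<omega> - ?v\<bar>)" using int1 by auto
    show "integrable M (\<lambda>\<omega>. (?D \<omega> - ?v)\<^sup>2 / s + s)" using int3 by auto
    fix \<omega>
    have "\<bar>x\<bar> \<le> x\<^sup>2 / s + s" for x :: real
    proof -
      have "\<bar>x\<bar> * s \<le> x\<^sup>2 + s\<^sup>2" using sum_squares_bound[of "\<bar>x\<bar>" s] mult_nonneg_nonneg[of "\<bar>x\<bar>" s] s(1)
        unfolding mult.assoc power2_abs by linarith
      then show ?thesis using s(1) by (simp add: field_simps power2_eq_square)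
    qed
    then show "\<bar>?D \<omega> - ?v\<bar> \<le> (?D \<omega> - ?v)\<^sup>2 / s + s" .
  qed
  also have "\<dots> = expectation (\<lambda>\<omega>. (?D \<omega> - ?v)\<^sup>2) / s + s" using int3 by (simp add: prob_space)
  also have "\<dots> \<le> s\<^sup>2 / s + s" using var s by (intro add_right_mono divide_right_mono) auto
  also have "\<dots> = 2 * s" using s(1) by (simp add: power2_eq_square)
  finally show ?thesis by (simp add: s_def)
qed

text \<open>An even nonempty block loses one ball. Count and mean both change by at most 1, which
  explains the additive 2 outside the root and the 2 in place of 1 under it.\<close>

lemma L1_num_odd:
  assumes "finite I" "I \<subseteq> {1..}"
  shows "expectation (\<lambda>\<omega>. \<bar>num_odd (path \<omega>) I - V (card I)\<bar>) \<le> 2 * sqrt (V (card I) + 2) + 2"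
proof (cases "odd (card I)")
  case True
  have "sqrt (V (card I) + 1) \<le> sqrt (V (card I) + 2)" by simp
  then show ?thesis using L1_num_odd_odd[OF assms True] by linarith
next
  case False
  show ?thesis
  proof (cases "I = {}")
    case True
    then show ?thesis using V_nonneg by (simp add: num_odd_def odds_def occ_def)
  next
    case ne: False
    then obtain i J where J: "I = insert i J" "i \<notin> J" by (meson mk_disjoint_insert ex_in_conv)
    have fJ: "finite J" "J \<subseteq> {1..}" using J assms by auto
    have cJ: "card I = Suc (card J)" using J fJ by simp
    then have oJ: "odd (card J)" using False by simp
    have intI: "integrable M (\<lambda>\<omega>. num_odd (path \<omega>) I)" and intJ: "integrable M (\<lambda>\<omega>. num_odd (path \<omega>) J)"
      using num_odd_integrable[OF assms, of 1] num_odd_integrable[OF fJ, of 1] by auto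
    have d1: "\<bar>num_odd (path \<omega>) I - num_odd (path \<omega>) J\<bar> \<le> 1" for \<omega>
      unfolding J(1) by (rule num_odd_insert[OF fJ(1) J(2)])
    have "\<bar>V (card I) - V (card J)\<bar> = \<bar>expectation (\<lambda>\<omega>. num_odd (path \<omega>) I - num_odd (path \<omega>) J)\<bar>"
      using intI intJ expectation_num_odd[OF assms] expectation_num_odd[OF fJ] by simp
    also have "\<dots> \<le> expectation (\<lambda>\<omega>. \<bar>num_odd (path \<omega>) I - num_odd (path \<omega>) J\<bar>)"
      by (rule integral_abs_bound)
    also have "\<dots> \<le> expectation (\<lambda>\<omega>. 1)"
      using intI intJ d1 by (intro integral_mono) auto
    finally have dV: "\<bar>V (card I) - V (card J)\<bar> \<le> 1" by (simp add: prob_space)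
    have "expectation (\<lambda>\<omega>. \<bar>num_odd (path \<omega>) I - V (card I)\<bar>)
      \<le> expectation (\<lambda>\<omega>. \<bar>num_odd (path \<omega>) J - V (card J)\<bar> + 2)"
    proof (rule integral_mono)
      show "\<bar>num_odd (path \<omega>) I - V (card I)\<bar> \<le> \<bar>num_odd (path \<omega>) J - V (card J)\<bar> + 2" for \<omega>
        using d1[of \<omega>] dV by linarith
    qed (use intI intJ in auto)
    also have "\<dots> = expectation (\<lambda>\<omega>. \<bar>num_odd (path \<omega>) J - V (card J)\<bar>) + 2"
      using intJ by (simp add: prob_space)
    also have "\<dots> \<le> 2 * sqrt (V (card J) + 1) + 2" using L1_num_odd_odd[OF fJ oJ] by simp
    also have "\<dots> \<le> 2 * sqrt (V (card I) + 2) + 2" using dV by simp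
    finally show ?thesis .
  qed
qed

section \<open>Moments of odd box counts\<close>

text \<open>Odd boxes are occupied. Frequent boxes are counted as boxes, rare ones through the balls
  that fall into them; the second part is a sum of independent indicators, whose exponential moments
  are explicit.\<close>

lemma num_odd_le_level:
  assumes "finite I" "I \<subseteq> {1..}" "I \<noteq> {}" "\<And>i. i \<in> I \<Longrightarrow> y i \<ge> 1"
  shows "num_odd y I \<le> \<nu> (real (card I)) + (\<Sum>i\<in>I. of_bool (p (y i) < 1 / real (card I)))"
proof -
  let ?h = "real (card I)"
  have h: "?h > 0" using assms by (simp add: card_gt_0_iff)
  define A where "A = {l. 1 \<le> l \<and> 1 / ?h \<le> p l}"
  define J where "J = {i\<in>I. p (y i) < 1 / ?h}"
  have fin: "finite A" "finite J" unfolding A_def J_def using finite_level[OF h] assms by auto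
  have "odds y I \<subseteq> A \<union> y ` J"
    using odds_subset[of y I] assms(4) by (fastforce simp: A_def J_def not_less)
  then have "card (odds y I) \<le> card (A \<union> y ` J)" using fin by (intro card_mono) auto
  also have "\<dots> \<le> card A + card (y ` J)" by (rule card_Un_le)
  also have "\<dots> \<le> card A + card J" using card_image_le[OF fin(2)] by simp
  finally have le: "num_odd y I \<le> real (card A + card J)" unfolding num_odd_def by (rule of_nat_mono)
  have "real (card J) = (\<Sum>i\<in>I. of_bool (p (y i) < 1 / ?h))"
    unfolding J_def using assms(1) by (simp add: sum.If_cases of_bool_def Int_def)
  with le show ?thesis unfolding \<nu>_def A_def of_nat_add by simp
qed

text \<open>Each ball contributes the factor 1 + (exp t - 1) \<open>tail_mass x\<close>; on [0, 1]
  the estimate exp t <= 1 + t + t^2 gives exp t - 1 <= 2 t.\<close>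

lemma expectation_exp_tail:
  assumes "finite I" "I \<subseteq> {1..}" "0 \<le> t" "t \<le> 1"
  shows "expectation (\<lambda>\<omega>. exp (t * (\<Sum>i\<in>I. of_bool (p (Y i \<omega>) < 1 / x)))) \<le> exp (2 * t * (real (card I) * tail_mass x))"
proof -
  define A where "A = {l. 1 \<le> l \<and> p l < 1 / x}"
  have mA: "measure \<mu> A = tail_mass x"
  proof -
    have "(\<lambda>l. if l \<in> A then p l else 0) sums measure \<mu> A" by (rule measure_sums) (auto simp: A_def)
    moreover have "(\<lambda>l. if l \<in> A then p l else 0) = (\<lambda>l. if p l < 1 / x then p l else 0)"
      using p_0 by (auto simp: A_def fun_eq_iff not_less_eq_eq)
    ultimately show ?thesis unfolding tail_mass_def by (simp add: sums_unique)
  qed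
  have A: "A \<in> sets \<mu>" by (auto simp: sets_\<mu> A_def)
  define g where "g l = exp (t * of_bool (p l < 1 / x))" for l :: nat
  have gb: "\<bar>g l\<bar> \<le> exp t" for l using assms by (auto simp: g_def)
  have "(\<integral>l. g l \<partial>\<mu>) = (\<integral>l. 1 + (exp t - 1) * indicator A l \<partial>\<mu>)"
    by (intro Bochner_Integration.integral_cong) (auto simp: g_def A_def space_\<mu>)
  also have "\<dots> = 1 + (exp t - 1) * tail_mass x"
  proof -
    have "integrable \<mu> (indicator A :: nat \<Rightarrow> real)"
      using A by (intro integrable_real_indicator) (auto simp: \<mu>.emeasure_eq_measure)
    then show ?thesis using A \<mu>.prob_space by (simp add: mA)
  qed
  also have "\<dots> \<le> 1 + 2 * t * tail_mass x"
  proof -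
    have "exp t \<le> 1 + t + t\<^sup>2" using assms by (intro exp_bound) auto
    also have "t\<^sup>2 \<le> t" using assms by (simp add: power2_eq_square mult_left_le)
    finally show ?thesis using tail_mass_nonneg by (intro add_left_mono mult_right_mono) auto
  qed
  also have "\<dots> \<le> exp (2 * t * tail_mass x)" by (rule exp_ge_add_one_self)
  finally have g1: "(\<integral>l. g l \<partial>\<mu>) \<le> exp (2 * t * tail_mass x)" .
  have g0: "0 \<le> (\<integral>l. g l \<partial>\<mu>)" by (intro integral_nonneg_AE) (auto simp: g_def)
  have "expectation (\<lambda>\<omega>. exp (t * (\<Sum>i\<in>I. of_bool (p (Y i \<omega>) < 1 / x)))) = expectation (\<lambda>\<omega>. \<Prod>i\<in>I. g (Y i \<omega>))"
    by (simp only: g_def exp_sum[OF assms(1)] sum_distrib_left)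
  also have "\<dots> = (\<integral>l. g l \<partial>\<mu>) ^ card I" by (rule expectation_prod[OF assms(1,2) gb])
  also have "\<dots> \<le> exp (2 * t * tail_mass x) ^ card I" by (intro power_mono g1 g0)
  also have "\<dots> = exp (2 * t * (real (card I) * tail_mass x))" by (simp add: exp_of_nat_mult[symmetric] mult_ac)
  finally show ?thesis .
qed

text \<open>Chaining needs moments of high order comparable to powers of \<open>\<nu>\<close>, with
  one constant for all blocks. They follow from exponential moments through x^m <= m! exp x.\<close>

lemma num_odd_moment:
  obtains K where "K > 0" "\<And>I. finite I \<Longrightarrow> I \<subseteq> {1..} \<Longrightarrow>
      expectation (\<lambda>\<omega>. num_odd (path \<omega>) I ^ m) \<le> K * (max 1 (\<nu> (real (card I)))) ^ m"
proof -
  obtain C where C: "C > 0" "\<And>n. n \<ge> 1 \<Longrightarrow> real n * tail_mass (real n) \<le> C * max 1 (\<nu> (real n))"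
    using tail_mass_bound by blast
  define K where "K = fact m * (1 + C) ^ m * exp 3"
  have K: "K > 0" using C by (simp add: K_def)
  have K1: "K \<ge> 1"
  proof -
    have "1 * 1 * 1 \<le> K" unfolding K_def using C by (intro mult_mono one_le_power) (auto simp: fact_ge_1)
    then show ?thesis by simp
  qed
  show ?thesis
  proof (rule that[OF K])
    fix I :: "nat set" assume I: "finite I" "I \<subseteq> {1..}"
    let ?D = "\<lambda>\<omega>. num_odd (path \<omega>) I" and ?h = "card I"
    define N where "N = max 1 (\<nu> (real ?h))"
    have N: "N \<ge> 1" "\<nu> (real ?h) \<le> N" by (auto simp: N_def)
    show "expectation (\<lambda>\<omega>. ?D \<omega> ^ m) \<le> K * (max 1 (\<nu> (real (card I)))) ^ m"
    proof (cases "I = {}")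
      case True
      have "num_odd y {} = 0" for y by (simp add: num_odd_def odds_def occ_def)
      then have "expectation (\<lambda>\<omega>. ?D \<omega> ^ m) \<le> 1" using True by (simp add: prob_space power_0_left)
      moreover have "1 * 1 \<le> K * (max 1 (\<nu> (real (card I)))) ^ m" using K1 K by (intro mult_mono one_le_power) auto
      ultimately show ?thesis by linarith
    next
      case ne: False
      have h1: "?h \<ge> 1" using ne I by (simp add: Suc_le_eq card_gt_0_iff)
      \<comment> \<open>This t makes both \<open>t * N\<close> and \<open>t * (C * N)\<close> at
        most 1: the frequent boxes then contribute exp 1 and the balls in rare boxes exp 2, which is
        the exp 3 in \<open>K\<close>. The 1 inside \<open>N\<close> guarantees t <= 1.\<close>
      define t where "t = 1 / (N * (1 + C))"
      have NC: "N * (1 + C) \<ge> 1" using N C(1) mult_mono[of 1 N 1 "1 + C"] by simp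
      have t: "0 < t" "t \<le> 1" using N C NC by (auto simp: t_def)
      have "t * N = 1 / (1 + C)" "t * (C * N) = C / (1 + C)" using N by (auto simp: t_def)
      then have tN: "t * N \<le> 1" and tC: "t * (C * N) \<le> 1" using C(1) by auto
      define B where "B \<omega> = (\<Sum>i\<in>I. of_bool (p (Y i \<omega>) < 1 / real ?h) :: real)" for \<omega>
      have Bm: "B \<in> borel_measurable M"
      proof -
        have "(\<lambda>\<omega>. of_bool (p (Y i \<omega>) < 1 / real ?h) :: real) \<in> borel_measurable M" if "i \<in> I" for i
          using Y_rv_UNIV[of i] that I(2) by (auto intro: measurable_compose)
        then show ?thesis unfolding B_def[abs_def] by measurable
      qed
      have Bb: "B \<omega> \<le> real ?h" "0 \<le> B \<omega>" for \<omega>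
        unfolding B_def using sum_mono[of I "\<lambda>i. of_bool (p (Y i \<omega>) < 1 / real ?h)" "\<lambda>_. 1::real"]
        by (auto intro: sum_nonneg)
      have intB: "integrable M (\<lambda>\<omega>. exp (t * B \<omega>))"
        using Bm Bb t by (intro integrable_const_bound[where B = "exp (t * real ?h)"]) auto
      have pt: "?D \<omega> ^ m \<le> fact m * (1 + C) ^ m * N ^ m * exp 1 * exp (t * B \<omega>)" if \<omega>: "\<omega> \<in> space M" for \<omega>
      proof -
        have "Y i \<omega> \<ge> 1" if "i \<in> I" for i
          using measurable_space[OF Y_rv \<omega>, of i] that I(2) by auto
        then have "?D \<omega> \<le> \<nu> (real ?h) + B \<omega>" unfolding B_def by (intro num_odd_le_level I ne) auto
        then have "t * ?D \<omega> \<le> t * (N + B \<omega>)" using t N by (intro mult_left_mono) auto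
        then have le: "t * ?D \<omega> \<le> 1 + t * B \<omega>" using tN by (simp add: distrib_left)
        have "(t * ?D \<omega>) ^ m \<le> fact m * exp (t * ?D \<omega>)" using t by (intro power_le_fact_exp) auto
        also have "\<dots> \<le> fact m * exp (1 + t * B \<omega>)" using le by simp
        finally have "(N * (1 + C)) ^ m * (t * ?D \<omega>) ^ m \<le> (N * (1 + C)) ^ m * (fact m * exp (1 + t * B \<omega>))"
          using NC by (intro mult_left_mono) auto
        moreover have "(N * (1 + C)) ^ m * (t * ?D \<omega>) ^ m = (N * (1 + C) * (t * ?D \<omega>)) ^ m"
          by (rule power_mult_distrib[symmetric])
        moreover have "N * (1 + C) * (t * ?D \<omega>) = ?D \<omega>" using N C(1) by (simp add: t_def)
        ultimately have "?D \<omega> ^ m \<le> (N * (1 + C)) ^ m * (fact m * exp (1 + t * B \<omega>))" by (simp only:)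
        then show ?thesis by (simp add: exp_add power_mult_distrib mult_ac)
      qed
      have "expectation (\<lambda>\<omega>. ?D \<omega> ^ m) \<le> expectation (\<lambda>\<omega>. fact m * (1 + C) ^ m * N ^ m * exp 1 * exp (t * B \<omega>))"
        by (rule integral_mono) (use pt intB num_odd_integrable[OF I] in auto)
      also have "\<dots> = fact m * (1 + C) ^ m * N ^ m * exp 1 * expectation (\<lambda>\<omega>. exp (t * B \<omega>))" by simp
      also have "expectation (\<lambda>\<omega>. exp (t * B \<omega>)) \<le> exp 2"
      proof -
        have "expectation (\<lambda>\<omega>. exp (t * B \<omega>)) \<le> exp (2 * t * (real ?h * tail_mass (real ?h)))"
          unfolding B_def using t by (intro expectation_exp_tail I) auto
        also have "2 * t * (real ?h * tail_mass (real ?h)) \<le> 2 * t * (C * N)"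
          unfolding N_def using t C(2)[OF h1] by (intro mult_left_mono) auto
        also have "\<dots> \<le> 2" using tC by simp
        finally show ?thesis by simp
      qed
      also have "fact m * (1 + C) ^ m * N ^ m * exp 1 * exp 2 = K * N ^ m"
        using exp_add[of 1 "2::real"] by (simp add: K_def mult_ac)
      finally show ?thesis using C N by (simp add: N_def)
    qed
  qed
qed

end

section \<open>Rademacher sums\<close>

text \<open>Both functions agree with 1 - x^2 / 2 up to a quartic error. Summed over boxes, fourth
  powers of weights are at most the squared maximal weight times the sum of squares, and the maximal
  weight tends to 0.\<close>

lemma cos_exp_diff: "\<bar>cos x - exp (- (x\<^sup>2 / 2))\<bar> \<le> (x::real) ^ 4"
proof -
  obtain t where "cos x = (\<Sum>m<4. cos_coeff m * x ^ m) + (cos (t + 1/2 * real 4 * pi) / fact 4) * x ^ 4"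
    using Maclaurin_cos_expansion[of x 4] by blast
  moreover have "(\<Sum>m<4. cos_coeff m * x ^ m) = 1 - x\<^sup>2 / 2"
  proof -
    have "{..<4} = {0, 1, 2, 3::nat}" by auto
    then show ?thesis by (simp add: cos_coeff_def)
  qed
  ultimately have c: "cos x = 1 - x\<^sup>2 / 2 + (cos (t + 1/2 * real 4 * pi) / fact 4) * x ^ 4" by simp
  have "\<bar>(cos (t + 1/2 * real 4 * pi) / fact 4) * x ^ 4\<bar> \<le> (1 / fact 4) * x ^ 4"
    unfolding abs_mult by (intro mult_mono) (auto simp: divide_right_mono)
  then have c': "\<bar>cos x - (1 - x\<^sup>2 / 2)\<bar> \<le> x ^ 4 / 24" using c by (simp add: fact_numeral)
  define z where "z = x\<^sup>2 / 2"
  have z: "z \<ge> 0" by (simp add: z_def)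
  have e1: "1 - z \<le> exp (- z)" using exp_ge_add_one_self[of "-z"] by simp
  have "exp (- z) \<le> 1 / (1 + z + z\<^sup>2 / 2)"
    using exp_lower_Taylor_quadratic[OF z] z
    by (simp add: exp_minus inverse_eq_divide frac_le add_pos_nonneg)
  also have "\<dots> \<le> 1 - z + z\<^sup>2 / 2"
  proof -
    have "1 \<le> (1 - z + z\<^sup>2 / 2) * (1 + z + z\<^sup>2 / 2)"
      using z by (simp add: algebra_simps power2_eq_square)
    then show ?thesis using z by (simp add: divide_le_eq add_pos_nonneg)
  qed
  finally have e2: "exp (- z) \<le> 1 - z + z\<^sup>2 / 2" .
  have "z\<^sup>2 / 2 = x ^ 4 / 8" by (simp add: z_def power_divide)
  moreover have "x ^ 4 \<ge> 0" by simp
  ultimately show ?thesis using c' e1 e2 unfolding z_def abs_le_iff by linarith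
qed

text \<open>The sub-Gaussian bound for one Rademacher sign: the case of probability 1/2 and
  parameter 2 x in the estimate behind Hoeffding's lemma.\<close>

lemma cosh_le_exp_sq: "(exp x + exp (- x)) / 2 \<le> exp (x\<^sup>2 / (2::real))"
proof -
  have *: "(exp x + exp (- x)) / 2 \<le> exp (x\<^sup>2 / 2)" if x: "x \<ge> 0" for x :: real
  proof -
    have "- (2 * x) * (1/2) + ln (1 + (1/2) * (exp (2 * x) - 1)) \<le> (2 * x)\<^sup>2 / 8"
      by (rule Hoeffdings_lemma_aux) (use x in auto)
    then have "ln ((1 + exp (2 * x)) / 2) \<le> x\<^sup>2 / 2 + x"
      by (simp add: field_simps power2_eq_square)
    then have "(1 + exp (2 * x)) / 2 \<le> exp (x\<^sup>2 / 2 + x)"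
      using exp_le_cancel_iff[of "ln ((1 + exp (2 * x)) / 2)" "x\<^sup>2 / 2 + x"]
      by (subst (asm) exp_ln) (auto simp: add_pos_pos)
    then have "exp (- x) * ((1 + exp (2 * x)) / 2) \<le> exp (- x) * exp (x\<^sup>2 / 2 + x)" by (intro mult_left_mono) auto
    then show ?thesis by (simp add: field_simps exp_add[symmetric])
  qed
  show ?thesis using *[of x] *[of "-x"] by (cases "x \<ge> 0") (auto simp: add.commute)
qed

lemma abs_prod_diff_le:
  fixes a b :: "'i \<Rightarrow> real"
  assumes "finite F" "\<And>i. i \<in> F \<Longrightarrow> \<bar>a i\<bar> \<le> 1" "\<And>i. i \<in> F \<Longrightarrow> \<bar>b i\<bar> \<le> 1"
  shows "\<bar>(\<Prod>i\<in>F. a i) - (\<Prod>i\<in>F. b i)\<bar> \<le> (\<Sum>i\<in>F. \<bar>a i - b i\<bar>)"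
  using norm_prod_diff[of F a b] assms by simp

locale rademacher = prob_space M for M :: "'a measure" +
  fixes e :: "'i \<Rightarrow> 'a \<Rightarrow> real" and I :: "'i set"
  assumes indep_e: "indep_vars (\<lambda>_. count_space {-1, 1}) e I"
    and law_e: "\<And>l. l \<in> I \<Longrightarrow> distr M (count_space {-1, 1}) (e l) = uniform_count_measure {-1, 1}"
begin

lemma e_rv: "l \<in> I \<Longrightarrow> e l \<in> M \<rightarrow>\<^sub>M count_space {-1, 1}"
  using indep_e unfolding indep_vars_def by auto

lemma e_borel: "l \<in> I \<Longrightarrow> e l \<in> borel_measurable M"
  by (rule measurable_compose[OF e_rv]) auto

lemma e_abs: "l \<in> I \<Longrightarrow> \<omega> \<in> space M \<Longrightarrow> \<bar>e l \<omega>\<bar> = 1"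
  using measurable_space[OF e_rv] by fastforce

lemma expectation_e:
  fixes g :: "real \<Rightarrow> 'b :: {banach, second_countable_topology}"
  assumes "l \<in> I"
  shows "(\<integral>\<omega>. g (e l \<omega>) \<partial>M) = (1/2) *\<^sub>R (g (-1) + g 1)"
proof -
  have "(\<integral>\<omega>. g (e l \<omega>) \<partial>M) = (\<integral>x. g x \<partial>distr M (count_space {-1, 1}) (e l))"
    by (rule integral_distr[symmetric, OF e_rv[OF assms]]) auto
  also have "\<dots> = (\<integral>x. g x \<partial>point_measure {-1, 1} (\<lambda>_. ennreal (1 / 2)))"
    unfolding law_e[OF assms] uniform_count_measure_def by simp
  also have "\<dots> = (\<Sum>a\<in>{-1, 1}. (1/2) *\<^sub>R g a)"
    by (rule lebesgue_integral_point_measure_finite) auto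
  finally show ?thesis by (simp add: scaleR_add_right)
qed

lemma expectation_prod_e:
  fixes g :: "'i \<Rightarrow> real \<Rightarrow> 'b :: {real_normed_field, banach, second_countable_topology}"
  assumes F: "finite F" "F \<subseteq> I"
  shows "(\<integral>\<omega>. (\<Prod>l\<in>F. g l (e l \<omega>)) \<partial>M) = (\<Prod>l\<in>F. (1/2) *\<^sub>R (g l (-1) + g l 1))"
proof -
  have ind: "indep_vars (\<lambda>_. borel) (\<lambda>l \<omega>. g l (e l \<omega>)) F"
    using indep_vars_compose2[OF indep_vars_subset[OF indep_e F(2)], of g "\<lambda>_. borel"] by simp
  have "(\<integral>\<omega>. (\<Prod>l\<in>F. g l (e l \<omega>)) \<partial>M) = (\<Prod>l\<in>F. \<integral>\<omega>. g l (e l \<omega>) \<partial>M)"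
  proof (rule indep_vars_lebesgue_integral[OF F(1) ind])
    fix l assume l: "l \<in> F"
    show "integrable M (\<lambda>\<omega>. g l (e l \<omega>))"
    proof (rule integrable_const_bound[where B = "max (norm (g l 1)) (norm (g l (-1)))"])
      show "AE \<omega> in M. norm (g l (e l \<omega>)) \<le> max (norm (g l 1)) (norm (g l (- 1)))"
        using measurable_space[OF e_rv, of l] l F(2) by (intro AE_I2) fastforce
      show "(\<lambda>\<omega>. g l (e l \<omega>)) \<in> borel_measurable M"
        by (rule measurable_compose[OF e_rv]) (use l F(2) in auto)
    qed
  qed
  also have "\<dots> = (\<Prod>l\<in>F. (1/2) *\<^sub>R (g l (-1) + g l 1))"
    using F(2) by (intro prod.cong refl expectation_e) auto
  finally show ?thesis .
qed

text \<open>The phase b lets a single real formula carry the whole characteristic function: b =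
  -pi/2 turns the cosine into a sine. By symmetry of the signs each complex factor has a real
  mean.\<close>

lemma expectation_cos:
  assumes F: "finite F" "F \<subseteq> I"
  shows "expectation (\<lambda>\<omega>. cos ((\<Sum>l\<in>F. w l * e l \<omega>) + b)) = cos b * (\<Prod>l\<in>F. cos (w l))"
proof -
  have "(\<integral>\<omega>. (\<Prod>l\<in>F. cis (w l * e l \<omega>)) \<partial>M) = (\<Prod>l\<in>F. (1/2) *\<^sub>R (cis (w l * (-1)) + cis (w l * 1)))"
    by (rule expectation_prod_e[OF F])
  also have "\<dots> = (\<Prod>l\<in>F. complex_of_real (cos (w l)))"
    by (intro prod.cong refl) (simp add: complex_eq_iff)
  finally have *: "(\<integral>\<omega>. (\<Prod>l\<in>F. cis (w l * e l \<omega>)) \<partial>M) = complex_of_real (\<Prod>l\<in>F. cos (w l))" by simp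
  have m: "(\<lambda>\<omega>. (\<Sum>l\<in>F. w l * e l \<omega>) + b) \<in> borel_measurable M"
    using F e_borel by (intro borel_measurable_add borel_measurable_sum borel_measurable_times) auto
  have eq: "cis ((\<Sum>l\<in>F. w l * e l \<omega>) + b) = cis b * (\<Prod>l\<in>F. cis (w l * e l \<omega>))" for \<omega>
    using F(1) by (induction F rule: finite_induct) (auto simp: cis_mult[symmetric] mult_ac)
  have "integrable M (\<lambda>\<omega>. cis ((\<Sum>l\<in>F. w l * e l \<omega>) + b))"
    using m by (intro integrable_const_bound[where B = 1])
      (auto intro!: measurable_compose[OF m] borel_measurable_continuous_onI continuous_intros)
  then have "expectation (\<lambda>\<omega>. Re (cis ((\<Sum>l\<in>F. w l * e l \<omega>) + b))) = Re (\<integral>\<omega>. cis ((\<Sum>l\<in>F. w l * e l \<omega>) + b) \<partial>M)"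
    by (rule integral_Re)
  also have "(\<integral>\<omega>. cis ((\<Sum>l\<in>F. w l * e l \<omega>) + b) \<partial>M) = cis b * complex_of_real (\<Prod>l\<in>F. cos (w l))"
    unfolding eq by (simp add: *)
  finally show ?thesis by (simp del: of_real_prod)
qed

lemma expectation_exp:
  assumes F: "finite F" "F \<subseteq> I"
  shows "expectation (\<lambda>\<omega>. exp (t * (\<Sum>l\<in>F. w l * e l \<omega>))) \<le> exp (t\<^sup>2 * (\<Sum>l\<in>F. (w l)\<^sup>2) / 2)"
proof -
  have "expectation (\<lambda>\<omega>. exp (t * (\<Sum>l\<in>F. w l * e l \<omega>))) = expectation (\<lambda>\<omega>. \<Prod>l\<in>F. exp (t * w l * e l \<omega>))"
    using F(1) by (simp add: exp_sum sum_distrib_left mult.assoc)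
  also have "\<dots> = (\<Prod>l\<in>F. (1/2) *\<^sub>R (exp (t * w l * (-1)) + exp (t * w l * 1)))"
    by (rule expectation_prod_e[OF F])
  also have "\<dots> \<le> (\<Prod>l\<in>F. exp ((t * w l)\<^sup>2 / 2))"
    using cosh_le_exp_sq[of "t * w _"] by (intro prod_mono) (auto simp: add.commute add_nonneg_nonneg)
  also have "\<dots> = exp (t\<^sup>2 * (\<Sum>l\<in>F. (w l)\<^sup>2) / 2)"
    using F(1) by (simp add: exp_sum[symmetric] sum_distrib_left sum_divide_distrib power_mult_distrib)
  finally show ?thesis .
qed

lemma sum_e_bound:
  assumes "F \<subseteq> I" "\<omega> \<in> space M"
  shows "\<bar>\<Sum>l\<in>F. w l * e l \<omega>\<bar> \<le> (\<Sum>l\<in>F. \<bar>w l\<bar>)"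
proof -
  have "\<bar>\<Sum>l\<in>F. w l * e l \<omega>\<bar> \<le> (\<Sum>l\<in>F. \<bar>w l * e l \<omega>\<bar>)" by (rule sum_abs)
  also have "\<dots> = (\<Sum>l\<in>F. \<bar>w l\<bar>)"
    using assms e_abs by (intro sum.cong refl) (auto simp: abs_mult)
  finally show ?thesis .
qed

text \<open>Khinchine's inequality with the constant 2 (2 m)! e. After scaling to unit variance,
  x^(2 m) <= (2 m)! exp |x| <= (2 m)! (exp x + exp (-x)), and both exponentials have sub-Gaussian
  means. The scaling is why zero variance is a separate case.\<close>

lemma expectation_even_power:
  assumes F: "finite F" "F \<subseteq> I" and m: "m \<ge> 1"
  shows "expectation (\<lambda>\<omega>. (\<Sum>l\<in>F. w l * e l \<omega>) ^ (2 * m)) \<le> 2 * fact (2 * m) * exp 1 * (\<Sum>l\<in>F. (w l)\<^sup>2) ^ m"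
proof (cases "(\<Sum>l\<in>F. (w l)\<^sup>2) = 0")
  case True
  then have "\<forall>l\<in>F. w l = 0" using F(1) by (subst (asm) sum_nonneg_eq_0_iff) auto
  then show ?thesis using m by (simp add: power_0_left)
next
  case False
  define W where "W = (\<Sum>l\<in>F. (w l)\<^sup>2)"
  have W: "W > 0" using False sum_nonneg[of F "\<lambda>l. (w l)\<^sup>2"] unfolding W_def by simp
  define t where "t = 1 / sqrt W"
  have t: "t > 0" "t\<^sup>2 = 1 / W" using W by (auto simp: t_def power_divide)
  let ?S = "\<lambda>\<omega>. \<Sum>l\<in>F. w l * e l \<omega>"
  have m1: "?S \<in> borel_measurable M"
    using F e_borel by (intro borel_measurable_sum borel_measurable_times) auto
  have iexp: "integrable M (\<lambda>\<omega>. exp (s * ?S \<omega>))" for s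
  proof (rule integrable_const_bound[where B = "exp (\<bar>s\<bar> * (\<Sum>l\<in>F. \<bar>w l\<bar>))"])
    show "AE \<omega> in M. norm (exp (s * ?S \<omega>)) \<le> exp (\<bar>s\<bar> * (\<Sum>l\<in>F. \<bar>w l\<bar>))"
    proof (intro AE_I2)
      fix \<omega> assume "\<omega> \<in> space M"
      have "s * ?S \<omega> \<le> \<bar>s * ?S \<omega>\<bar>" by simp
      also have "\<dots> \<le> \<bar>s\<bar> * (\<Sum>l\<in>F. \<bar>w l\<bar>)"
        unfolding abs_mult[of s] using sum_e_bound[OF F(2) \<open>\<omega> \<in> space M\<close>, of w] by (intro mult_left_mono) auto
      finally show "norm (exp (s * ?S \<omega>)) \<le> exp (\<bar>s\<bar> * (\<Sum>l\<in>F. \<bar>w l\<bar>))" by simp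
    qed
  qed (use m1 in measurable)
  have ipow: "integrable M (\<lambda>\<omega>. ?S \<omega> ^ (2 * m))"
  proof (rule integrable_const_bound[where B = "(\<Sum>l\<in>F. \<bar>w l\<bar>) ^ (2 * m)"])
    show "AE \<omega> in M. norm (?S \<omega> ^ (2 * m)) \<le> (\<Sum>l\<in>F. \<bar>w l\<bar>) ^ (2 * m)"
    proof (intro AE_I2)
      fix \<omega> assume "\<omega> \<in> space M"
      then show "norm (?S \<omega> ^ (2 * m)) \<le> (\<Sum>l\<in>F. \<bar>w l\<bar>) ^ (2 * m)"
        unfolding real_norm_def power_abs by (intro power_mono sum_e_bound F) auto
    qed
  qed (use m1 in measurable)
  have pt: "?S \<omega> ^ (2 * m) \<le> fact (2 * m) * W ^ m * (exp (t * ?S \<omega>) + exp (- t * ?S \<omega>))" for \<omega>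
  proof -
    let ?s = "?S \<omega>"
    have "(t * ?s) ^ (2 * m) = \<bar>t * ?s\<bar> ^ (2 * m)" by (rule power_even_abs[symmetric]) simp
    also have "\<dots> \<le> fact (2 * m) * exp \<bar>t * ?s\<bar>" by (rule power_le_fact_exp) simp
    also have "\<dots> \<le> fact (2 * m) * (exp (t * ?s) + exp (- t * ?s))"
      by (intro mult_left_mono) (auto simp: abs_if)
    finally have "W ^ m * (t * ?s) ^ (2 * m) \<le> W ^ m * (fact (2 * m) * (exp (t * ?s) + exp (- t * ?s)))"
      using W by (intro mult_left_mono) auto
    moreover have "W ^ m * (t * ?s) ^ (2 * m) = ?s ^ (2 * m)"
    proof -
      have "(t * ?s) ^ (2 * m) = (t\<^sup>2) ^ m * ?s ^ (2 * m)" by (simp add: power_mult_distrib power_mult)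
      also have "W ^ m * \<dots> = ?s ^ (2 * m)" using W t(2) by (simp add: power_divide)
      finally show ?thesis .
    qed
    ultimately show ?thesis by (simp only: mult_ac)
  qed
  have "expectation (\<lambda>\<omega>. ?S \<omega> ^ (2 * m)) \<le>
      expectation (\<lambda>\<omega>. fact (2 * m) * W ^ m * (exp (t * ?S \<omega>) + exp (- t * ?S \<omega>)))"
    by (rule integral_mono) (use pt ipow iexp[of t] iexp[of "-t"] in auto)
  also have "\<dots> = fact (2 * m) * W ^ m * (expectation (\<lambda>\<omega>. exp (t * ?S \<omega>)) + expectation (\<lambda>\<omega>. exp (- t * ?S \<omega>)))"
    using iexp[of t] iexp[of "-t"] by simp
  also have "\<dots> \<le> fact (2 * m) * W ^ m * (exp 1 + exp 1)"
  proof (intro mult_left_mono add_mono)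
    have "s\<^sup>2 * W / 2 \<le> 1" if "s = t \<or> s = - t" for s using that t W by auto
    then have "expectation (\<lambda>\<omega>. exp (s * ?S \<omega>)) \<le> exp 1" if "s = t \<or> s = - t" for s
      using that by (intro order_trans[OF expectation_exp[OF F]]) (simp add: W_def)
    then show "expectation (\<lambda>\<omega>. exp (t * ?S \<omega>)) \<le> exp 1" "expectation (\<lambda>\<omega>. exp (- t * ?S \<omega>)) \<le> exp 1" by blast+
  qed (use W in auto)
  finally show ?thesis by (simp add: W_def mult_ac)
qed

end

context prob_space begin

text \<open>Fubini for an independent pair, stated on \<open>M\<close> itself: freezing V at a
  second sample point plays the role of conditioning on V. The second claim gives the measurability
  under which the inner expectation is integrated.\<close>

lemma indep_elements_decouple:
  fixes h :: "'b \<times> 'c \<Rightarrow> real"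
  assumes ind: "indep_elements A U B V" and h: "h \<in> borel_measurable (A \<Otimes>\<^sub>M B)"
    and bd: "\<And>z. z \<in> space (A \<Otimes>\<^sub>M B) \<Longrightarrow> \<bar>h z\<bar> \<le> C"
  shows "expectation (\<lambda>\<omega>. h (U \<omega>, V \<omega>)) = expectation (\<lambda>\<omega>'. expectation (\<lambda>\<omega>. h (U \<omega>, V \<omega>')))"
    and "(\<lambda>\<omega>'. expectation (\<lambda>\<omega>. h (U \<omega>, V \<omega>'))) \<in> borel_measurable M"
proof -
  have U [measurable]: "U \<in> M \<rightarrow>\<^sub>M A" and V [measurable]: "V \<in> M \<rightarrow>\<^sub>M B"
    and ind': "\<And>S T. S \<in> sets A \<Longrightarrow> T \<in> sets B \<Longrightarrow>
      prob ((U -` S \<inter> space M) \<inter> (V -` T \<inter> space M)) = prob (U -` S \<inter> space M) * prob (V -` T \<inter> space M)"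
    using ind unfolding indep_elements_def indep_sets2_eq by blast+
  let ?P = "distr M A U" and ?Q = "distr M B V"
  interpret P: prob_space ?P by (rule prob_space_distr[OF U])
  interpret Q: prob_space ?Q by (rule prob_space_distr[OF V])
  interpret PQ: pair_prob_space ?P ?Q ..
  have eq: "?P \<Otimes>\<^sub>M ?Q = distr M (A \<Otimes>\<^sub>M B) (\<lambda>\<omega>. (U \<omega>, V \<omega>))"
  proof (rule pair_measure_eqI)
    show "sigma_finite_measure ?P" "sigma_finite_measure ?Q" by unfold_locales
    show "sets (?P \<Otimes>\<^sub>M ?Q) = sets (distr M (A \<Otimes>\<^sub>M B) (\<lambda>\<omega>. (U \<omega>, V \<omega>)))"
      by (simp cong: sets_pair_measure_cong)
    fix S T assume "S \<in> sets ?P" "T \<in> sets ?Q"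
    then have ST: "S \<in> sets A" "T \<in> sets B" by auto
    have "(\<lambda>\<omega>. (U \<omega>, V \<omega>)) -` (S \<times> T) \<inter> space M = (U -` S \<inter> space M) \<inter> (V -` T \<inter> space M)" by auto
    then show "emeasure ?P S * emeasure ?Q T = emeasure (distr M (A \<Otimes>\<^sub>M B) (\<lambda>\<omega>. (U \<omega>, V \<omega>))) (S \<times> T)"
      using ST ind'[OF ST] by (simp add: emeasure_distr emeasure_eq_measure ennreal_mult[symmetric])
  qed
  have h': "h \<in> borel_measurable (?P \<Otimes>\<^sub>M ?Q)" using h by (simp cong: measurable_cong_sets sets_pair_measure_cong)
  have hs: "(\<lambda>z. h (snd z, fst z)) \<in> borel_measurable (B \<Otimes>\<^sub>M A)"
    using h by measurable
  have inner: "expectation (\<lambda>\<omega>. h (U \<omega>, v)) = (\<integral>u. h (u, v) \<partial>?P)" if "v \<in> space B" for v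
    using h that by (subst integral_distr[OF U]) (auto intro: measurable_compose)
  have innerm: "(\<lambda>v. \<integral>u. h (u, v) \<partial>?P) \<in> borel_measurable B"
    using hs by (intro P.borel_measurable_lebesgue_integral) (simp add: split_beta' cong: measurable_cong_sets sets_pair_measure_cong)
  have "expectation (\<lambda>\<omega>. h (U \<omega>, V \<omega>)) = (\<integral>z. h z \<partial>distr M (A \<Otimes>\<^sub>M B) (\<lambda>\<omega>. (U \<omega>, V \<omega>)))"
    using h by (subst integral_distr) auto
  also have "\<dots> = (\<integral>z. h z \<partial>(?P \<Otimes>\<^sub>M ?Q))" by (simp only: eq)
  also have "\<dots> = (\<integral>v. (\<integral>u. h (u, v) \<partial>?P) \<partial>?Q)"
  proof -
    have "integrable (?P \<Otimes>\<^sub>M ?Q) h"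
      using h' bd by (intro PQ.integrable_const_bound[where B = C] AE_I2) (auto simp: space_pair_measure)
    then have "integrable (?P \<Otimes>\<^sub>M ?Q) (\<lambda>(x, y). h (x, y))" by simp
    from PQ.integral_snd[OF this] show ?thesis by simp
  qed
  also have "\<dots> = expectation (\<lambda>\<omega>'. \<integral>u. h (u, V \<omega>') \<partial>?P)"
    by (subst integral_distr[OF V]) (use innerm in auto)
  also have "\<dots> = expectation (\<lambda>\<omega>'. expectation (\<lambda>\<omega>. h (U \<omega>, V \<omega>')))"
    using measurable_space[OF V] by (intro Bochner_Integration.integral_cong) (auto simp: inner)
  finally show "expectation (\<lambda>\<omega>. h (U \<omega>, V \<omega>)) = expectation (\<lambda>\<omega>'. expectation (\<lambda>\<omega>. h (U \<omega>, V \<omega>')))" .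
  have "(\<lambda>\<omega>'. \<integral>u. h (u, V \<omega>') \<partial>?P) \<in> borel_measurable M" using innerm V by measurable
  then show "(\<lambda>\<omega>'. expectation (\<lambda>\<omega>. h (U \<omega>, V \<omega>'))) \<in> borel_measurable M"
    using measurable_space[OF V] by (subst measurable_cong) (auto simp: inner)
qed

end

section \<open>The partial sums as signed sums over boxes\<close>

text \<open>The count in the exponent includes the current ball, so successive balls of one box
  contribute +f, -f, +f and so on. They cancel in pairs, and a single +f survives exactly when the
  count is odd.\<close>

lemma signed_sum_odds:
  fixes f :: "nat \<Rightarrow> real"
  shows "(\<Sum>i=1..n. (-1) ^ (occ y {1..i} (y i) + 1) * f (y i)) = (\<Sum>l\<in>odds y {1..n}. f l)"
proof (induction n)
  case 0
  then show ?case by (simp add: odds_def occ_def)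
next
  case (Suc n)
  let ?k = "y (Suc n)"
  have o1: "occ y {Suc n} l = of_bool (?k = l)" for l
  proof -
    have "{i \<in> {Suc n}. y i = l} = (if ?k = l then {Suc n} else {})" by auto
    then show ?thesis by (simp add: occ_def)
  qed
  have "odds y {Suc n} = {?k}" by (auto simp: odds_def o1)
  then have od: "odds y {1..Suc n} = (odds y {1..n} - {?k}) \<union> ({?k} - odds y {1..n})"
    using odds_Un[of "{1..n}" "{Suc n}" y] by (simp add: atLeastAtMostSuc_conv)
  have oc: "occ y {1..Suc n} ?k = occ y {1..n} ?k + 1"
    using occ_Un[of "{1..n}" "{Suc n}" y ?k] by (simp add: o1 atLeastAtMostSuc_conv)
  have fin: "finite (odds y {1..n})" by (simp add: finite_odds)
  show ?case
  proof (cases "?k \<in> odds y {1..n}")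
    case True
    then have "even (occ y {1..Suc n} ?k)" unfolding oc by (simp add: odds_def)
    then show ?thesis using Suc True fin unfolding od by (simp add: sum_diff1 insert_absorb)
  next
    case False
    then have "odd (occ y {1..Suc n} ?k)" unfolding oc by (simp add: odds_def)
    then show ?thesis using Suc False fin unfolding od by simp
  qed
qed

text \<open>The partial sum as a function of the sign field and the two paths. In this form signs
  and paths can be taken at different sample points.\<close>

definition ksum :: "(nat \<times> nat \<Rightarrow> real) \<Rightarrow> (nat \<Rightarrow> nat) \<Rightarrow> (nat \<Rightarrow> nat) \<Rightarrow> nat \<Rightarrow> nat \<Rightarrow> real" where
  "ksum e y1 y2 n1 n2 = (\<Sum>l\<in>odds y1 {1..n1} \<times> odds y2 {1..n2}. e l)"

text \<open>The index set of \<open>ksum\<close> depends on the paths; here the sums run over fixed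
  ranges of times. This links \<open>ksum\<close> to \<open>karlin_S\<close> and is the form from
  which measurability is read off.\<close>

lemma ksum_signed:
  "ksum e y1 y2 n1 n2 = (\<Sum>i=1..n1. \<Sum>j=1..n2.
     (-1) ^ (occ y1 {1..i} (y1 i) + 1) * (-1) ^ (occ y2 {1..j} (y2 j) + 1) * e (y1 i, y2 j))"
proof -
  have "ksum e y1 y2 n1 n2 = (\<Sum>l1\<in>odds y1 {1..n1}. \<Sum>l2\<in>odds y2 {1..n2}. e (l1, l2))"
    unfolding ksum_def by (simp add: sum.cartesian_product)
  also have "\<dots> = (\<Sum>i=1..n1. (-1) ^ (occ y1 {1..i} (y1 i) + 1) *
      (\<Sum>j=1..n2. (-1) ^ (occ y2 {1..j} (y2 j) + 1) * e (y1 i, y2 j)))"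
    unfolding signed_sum_odds[symmetric] by (rule refl)
  finally show ?thesis by (simp only: sum_distrib_left mult.assoc)
qed

lemma occupancy_eq: "occupancy Y n l \<omega> = occ (\<lambda>i. Y i \<omega>) {1..n} l"
  unfolding occupancy_def occ_def by (simp add: sum.If_cases Int_def)

lemma karlin_S_eq_ksum:
  "karlin_S Y1 Y2 \<epsilon> n1 n2 \<omega> = ksum (\<lambda>l. \<epsilon> l \<omega>) (\<lambda>i. Y1 i \<omega>) (\<lambda>i. Y2 i \<omega>) n1 n2"
  unfolding karlin_S_def karlin_X_def ksum_signed occupancy_eq Let_def by (simp only: mult_ac)

text \<open>A common index rectangle lets sums taken at several times be added coefficient by
  coefficient.\<close>

lemma ksum_parity:
  assumes "finite F1" "finite F2" "odds y1 {1..n1} \<subseteq> F1" "odds y2 {1..n2} \<subseteq> F2"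
  shows "ksum e y1 y2 n1 n2 = (\<Sum>l\<in>F1 \<times> F2. parity y1 {1..n1} (fst l) * parity y2 {1..n2} (snd l) * e l)"
proof -
  have "(\<Sum>l\<in>F1 \<times> F2. parity y1 {1..n1} (fst l) * parity y2 {1..n2} (snd l) * e l)
      = (\<Sum>l\<in>odds y1 {1..n1} \<times> odds y2 {1..n2}. parity y1 {1..n1} (fst l) * parity y2 {1..n2} (snd l) * e l)"
    using assms by (intro sum.mono_neutral_right) (auto simp: parity_def)
  also have "\<dots> = ksum e y1 y2 n1 n2"
    unfolding ksum_def by (intro sum.cong refl) (auto simp: parity_def)
  finally show ?thesis by simp
qed

lemma ksum_bound:
  assumes "\<And>l. l \<in> {1..} \<times> {1..} \<Longrightarrow> \<bar>e l\<bar> \<le> 1" "\<And>i. i \<ge> 1 \<Longrightarrow> y1 i \<ge> 1" "\<And>i. i \<ge> 1 \<Longrightarrow> y2 i \<ge> 1"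
  shows "\<bar>ksum e y1 y2 n1 n2\<bar> \<le> real n1 * real n2"
proof -
  have "\<bar>ksum e y1 y2 n1 n2\<bar> \<le> (\<Sum>l\<in>odds y1 {1..n1} \<times> odds y2 {1..n2}. \<bar>e l\<bar>)"
    unfolding ksum_def by (rule sum_abs)
  also have "\<dots> \<le> (\<Sum>l\<in>odds y1 {1..n1} \<times> odds y2 {1..n2}. 1)"
  proof (intro sum_mono assms(1))
    fix l assume "l \<in> odds y1 {1..n1} \<times> odds y2 {1..n2}"
    then have "fst l \<in> odds y1 {1..n1}" "snd l \<in> odds y2 {1..n2}" by (simp_all only: mem_Times_iff)
    then have "fst l \<in> y1 ` {1..n1}" "snd l \<in> y2 ` {1..n2}" by (simp_all only: subsetD[OF odds_subset])
    moreover have "y1 ` {1..n1} \<subseteq> {1..}" "y2 ` {1..n2} \<subseteq> {1..}" using assms(2,3) by auto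
    ultimately show "l \<in> {1..} \<times> {1..}" unfolding mem_Times_iff by blast
  qed
  also have "\<dots> = num_odd y1 {1..n1} * num_odd y2 {1..n2}" by (simp add: num_odd_def card_cartesian_product)
  also have "\<dots> \<le> real n1 * real n2"
    using num_odd_le[of "{1..n1}" y1] num_odd_le[of "{1..n2}" y2] by (intro mult_mono) auto
  finally show ?thesis .
qed

text \<open>The model leaves index 0 free, and the laws live on restricted functions. The boxes that
  occur are positive, so only positive arguments matter.\<close>

lemma ksum_cong:
  assumes "\<And>l. l \<in> {1..} \<times> {1..} \<Longrightarrow> e l = e' l" "\<And>i. i \<ge> 1 \<Longrightarrow> y1 i = y1' i" "\<And>i. i \<ge> 1 \<Longrightarrow> y2 i = y2' i"
    "\<And>i. i \<ge> 1 \<Longrightarrow> y1 i \<ge> 1" "\<And>i. i \<ge> 1 \<Longrightarrow> y2 i \<ge> 1"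
  shows "ksum e y1 y2 n1 n2 = ksum e' y1' y2' n1 n2"
proof -
  have "odds y1 {1..n1} = odds y1' {1..n1}" "odds y2 {1..n2} = odds y2' {1..n2}"
    using assms by (auto intro!: parity_cong)
  moreover have "e l = e' l" if "l \<in> odds y1 {1..n1} \<times> odds y2 {1..n2}" for l
  proof (rule assms(1))
    have "fst l \<in> odds y1 {1..n1}" "snd l \<in> odds y2 {1..n2}" using that by (simp_all only: mem_Times_iff)
    then have "fst l \<in> y1 ` {1..n1}" "snd l \<in> y2 ` {1..n2}" by (simp_all only: subsetD[OF odds_subset])
    moreover have "y1 ` {1..n1} \<subseteq> {1..}" "y2 ` {1..n2} \<subseteq> {1..}" using assms(4,5) by auto
    ultimately show "l \<in> {1..} \<times> {1..}" unfolding mem_Times_iff by blast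
  qed
  ultimately show ?thesis unfolding ksum_def by (auto intro!: sum.cong)
qed

section \<open>The model: integrating out the signs\<close>

locale karlin_sheet = randomized_karlin_model M \<mu>1 \<mu>2 Y1 Y2 \<epsilon>
  for M :: "'a measure" and \<mu>1 \<mu>2 Y1 Y2 \<epsilon> +
  fixes \<alpha>1 \<alpha>2 :: real and L1 L2 :: "real \<Rightarrow> real"
  assumes \<alpha>1: "0 < \<alpha>1" "\<alpha>1 < 1" and \<alpha>2: "0 < \<alpha>2" "\<alpha>2 < 1"
    and rv1: "regular_variation_condition \<mu>1 \<alpha>1 L1"
    and rv2: "regular_variation_condition \<mu>2 \<alpha>2 L2"
begin

sublocale K1: karlin_sequence M \<mu>1 \<alpha>1 L1 Y1
  by unfold_locales (use \<mu>1 \<alpha>1 rv1 indep_Y1 law_Y1 in auto)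

sublocale K2: karlin_sequence M \<mu>2 \<alpha>2 L2 Y2
  by unfold_locales (use \<mu>2 \<alpha>2 rv2 indep_Y2 law_Y2 in auto)

sublocale R: rademacher M \<epsilon> "{1..} \<times> {1..}"
  by unfold_locales (use indep_\<epsilon> law_\<epsilon> in auto)

abbreviation "S n1 n2 \<omega> \<equiv> karlin_S Y1 Y2 \<epsilon> n1 n2 \<omega>"

definition signs_space :: "(nat \<times> nat \<Rightarrow> real) measure" where
  "signs_space = (\<Pi>\<^sub>M l\<in>{1..} \<times> {1..}. count_space {-1, 1})"
definition path_space :: "(nat \<Rightarrow> nat) measure" where
  "path_space = (\<Pi>\<^sub>M n\<in>{1..}. count_space {1..})"
definition signs :: "'a \<Rightarrow> nat \<times> nat \<Rightarrow> real" where
  "signs \<omega> = (\<lambda>l\<in>{1..} \<times> {1..}. \<epsilon> l \<omega>)"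
definition paths :: "'a \<Rightarrow> (nat \<Rightarrow> nat) \<times> (nat \<Rightarrow> nat)" where
  "paths \<omega> = (\<lambda>n\<in>{1..}. Y1 n \<omega>, \<lambda>n\<in>{1..}. Y2 n \<omega>)"

lemma indep_signs_paths: "indep_elements signs_space signs (path_space \<Otimes>\<^sub>M path_space) paths"
  using indep_\<epsilon>_Y unfolding signs_space_def path_space_def signs_def[abs_def] paths_def[abs_def] .

lemma Y_pos: "\<omega> \<in> space M \<Longrightarrow> i \<ge> 1 \<Longrightarrow> Y1 i \<omega> \<ge> 1" "\<omega> \<in> space M \<Longrightarrow> i \<ge> 1 \<Longrightarrow> Y2 i \<omega> \<ge> 1"
  using measurable_space[OF K1.Y_rv, of i \<omega>] measurable_space[OF K2.Y_rv, of i \<omega>] by auto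

lemma S_eq:
  "\<omega> \<in> space M \<Longrightarrow> S n1 n2 \<omega> = ksum (signs \<omega>) (fst (paths \<omega>)) (snd (paths \<omega>)) n1 n2"
  unfolding karlin_S_eq_ksum by (rule ksum_cong) (use Y_pos in \<open>auto simp: signs_def paths_def\<close>)

lemma ksum_measurable:
  "(\<lambda>z. ksum (fst z) (fst (snd z)) (snd (snd z)) n1 n2)
     \<in> borel_measurable (signs_space \<Otimes>\<^sub>M (path_space \<Otimes>\<^sub>M path_space))"
proof -
  let ?W = "signs_space \<Otimes>\<^sub>M (path_space \<Otimes>\<^sub>M path_space)"
  have comp: "(\<lambda>y. y i) \<in> path_space \<rightarrow>\<^sub>M count_space {1..}" if "i \<ge> 1" for i
    unfolding path_space_def by (rule measurable_component_singleton) (use that in auto)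
  have ecomp: "(\<lambda>e. e l) \<in> borel_measurable signs_space" if "l \<in> {1..} \<times> {1..}" for l
    unfolding signs_space_def
    by (rule measurable_compose[OF measurable_component_singleton[OF that]]) auto
  have c1: "(\<lambda>z. fst (snd z) i) \<in> ?W \<rightarrow>\<^sub>M count_space {1..}" if "i \<ge> 1" for i
    by (rule measurable_compose[OF measurable_compose[OF measurable_snd measurable_fst] comp[OF that]])
  have c2: "(\<lambda>z. snd (snd z) i) \<in> ?W \<rightarrow>\<^sub>M count_space {1..}" if "i \<ge> 1" for i
    by (rule measurable_compose[OF measurable_compose[OF measurable_snd measurable_snd] comp[OF that]])
  \<comment> \<open>The sign field is evaluated at a random box. Boxes are countable, so fixing
    first the row and then the column reduces this to coordinate maps.\<close>
  have ee: "(\<lambda>z. fst z (fst (snd z) i, snd (snd z) j)) \<in> borel_measurable ?W" if "i \<ge> 1" "j \<ge> 1" for i j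
  proof (rule measurable_compose_countable'[where f = "\<lambda>l1 z. fst z (l1, snd (snd z) j)", OF _ c1[OF that(1)]])
    fix l1 :: nat assume l1: "l1 \<in> {1..}"
    show "(\<lambda>z. fst z (l1, snd (snd z) j)) \<in> borel_measurable ?W"
    proof (rule measurable_compose_countable'[where f = "\<lambda>l2 z. fst z (l1, l2)", OF _ c2[OF that(2)]])
      fix l2 :: nat assume l2: "l2 \<in> {1..}"
      show "(\<lambda>z. fst z (l1, l2)) \<in> borel_measurable ?W"
        by (rule measurable_compose[OF measurable_fst ecomp]) (use l1 l2 in auto)
    qed auto
  qed auto
  \<comment> \<open>A power with random exponent becomes a product of factors that each compare two
    balls, which are measurable one by one.\<close>
  have occ_alt: "(-1::real) ^ (occ y {1..i} (y i) + 1) = - (\<Prod>j\<in>{1..i}. 1 - 2 * of_bool (y j = y i))" for y i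
  proof -
    have "(\<Prod>j\<in>{1..i}. 1 - 2 * of_bool (y j = y i) :: real) = (\<Prod>j\<in>{1..i}. if y j = y i then -1 else 1)"
      by (intro prod.cong) auto
    also have "\<dots> = (-1) ^ occ y {1..i} (y i)"
      unfolding occ_def by (subst prod.If_cases) (auto simp: Int_def)
    finally show ?thesis by simp
  qed
  have s1: "(\<lambda>z. - (\<Prod>j\<in>{1..i}. 1 - 2 * of_bool (fst (snd z) j = fst (snd z) i)) :: real) \<in> borel_measurable ?W"
    if "i \<ge> 1" for i
  proof -
    have "(\<lambda>z. of_bool (fst (snd z) j = fst (snd z) i) :: real) \<in> borel_measurable ?W" if "j \<in> {1..i}" for j
    proof (rule measurable_compose_countable'[where f = "\<lambda>l z. of_bool (l = fst (snd z) i)", OF _ c1])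
      show "(\<lambda>z. of_bool (l = fst (snd z) i) :: real) \<in> borel_measurable ?W" for l
        by (rule measurable_compose[OF c1[OF \<open>i \<ge> 1\<close>], of "\<lambda>k. of_bool (l = k)"]) auto
    qed (use that in auto)
    then show ?thesis by measurable
  qed
  have s2: "(\<lambda>z. - (\<Prod>j\<in>{1..i}. 1 - 2 * of_bool (snd (snd z) j = snd (snd z) i)) :: real) \<in> borel_measurable ?W"
    if "i \<ge> 1" for i
  proof -
    have "(\<lambda>z. of_bool (snd (snd z) j = snd (snd z) i) :: real) \<in> borel_measurable ?W" if "j \<in> {1..i}" for j
    proof (rule measurable_compose_countable'[where f = "\<lambda>l z. of_bool (l = snd (snd z) i)", OF _ c2])
      show "(\<lambda>z. of_bool (l = snd (snd z) i) :: real) \<in> borel_measurable ?W" for l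
        by (rule measurable_compose[OF c2[OF \<open>i \<ge> 1\<close>], of "\<lambda>k. of_bool (l = k)"]) auto
    qed (use that in auto)
    then show ?thesis by measurable
  qed
  show ?thesis unfolding ksum_signed occ_alt
    by (intro borel_measurable_sum borel_measurable_times s1 s2 ee) auto
qed

lemma space_W:
  assumes "z \<in> space (signs_space \<Otimes>\<^sub>M (path_space \<Otimes>\<^sub>M path_space))"
  shows "l \<in> {1..} \<times> {1..} \<Longrightarrow> \<bar>fst z l\<bar> \<le> 1" "i \<ge> 1 \<Longrightarrow> fst (snd z) i \<ge> 1" "i \<ge> 1 \<Longrightarrow> snd (snd z) i \<ge> 1"
proof -
  have z: "fst z \<in> (\<Pi>\<^sub>E l\<in>{1..} \<times> {1..}. {-1, 1})" "fst (snd z) \<in> (\<Pi>\<^sub>E n\<in>{1..}. {1..})"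
      "snd (snd z) \<in> (\<Pi>\<^sub>E n\<in>{1..}. {1..})"
    using assms by (simp_all add: space_pair_measure signs_space_def path_space_def space_PiM mem_Times_iff)
  show "\<bar>fst z l\<bar> \<le> 1" if "l \<in> {1..} \<times> {1..}" using PiE_mem[OF z(1) that] by auto
  show "fst (snd z) i \<ge> 1" if "i \<ge> 1" using PiE_mem[OF z(2), of i] that by auto
  show "snd (snd z) i \<ge> 1" if "i \<ge> 1" using PiE_mem[OF z(3), of i] that by auto
qed

text \<open>Coefficient of the sign of box l in the combination of
  \<open>u t * S (k1 t) (k2 t)\<close> over T. Given the paths, the combination is a Rademacher sum
  with these weights.\<close>

definition weight :: "'t set \<Rightarrow> ('t \<Rightarrow> real) \<Rightarrow> ('t \<Rightarrow> nat) \<Rightarrow> ('t \<Rightarrow> nat) \<Rightarrow> 'a \<Rightarrow> nat \<times> nat \<Rightarrow> real" where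
  "weight T u k1 k2 \<omega> l = (\<Sum>t\<in>T. u t * (parity (K1.path \<omega>) {1..k1 t} (fst l) * parity (K2.path \<omega>) {1..k2 t} (snd l)))"

text \<open>A finite rectangle containing every box of nonzero weight, the same for all times up to
  K; odd boxes are among those that have been hit.\<close>

definition boxes :: "nat \<Rightarrow> 'a \<Rightarrow> (nat \<times> nat) set" where
  "boxes K \<omega> = K1.path \<omega> ` {1..K} \<times> K2.path \<omega> ` {1..K}"

lemma boxes_pos: "\<omega> \<in> space M \<Longrightarrow> boxes K \<omega> \<subseteq> {1..} \<times> {1..}"
  using Y_pos unfolding boxes_def by auto

lemma finite_boxes: "finite (boxes K \<omega>)" by (simp add: boxes_def)

lemma combination_eq:
  assumes "finite T" "\<forall>t\<in>T. k1 t \<le> K" "\<forall>t\<in>T. k2 t \<le> K" "\<omega>' \<in> space M"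
  shows "(\<Sum>t\<in>T. u t * ksum (signs \<omega>) (fst (paths \<omega>')) (snd (paths \<omega>')) (k1 t) (k2 t))
    = (\<Sum>l\<in>boxes K \<omega>'. weight T u k1 k2 \<omega>' l * \<epsilon> l \<omega>)"
proof -
  have "ksum (signs \<omega>) (fst (paths \<omega>')) (snd (paths \<omega>')) (k1 t) (k2 t) =
    (\<Sum>l\<in>boxes K \<omega>'. parity (K1.path \<omega>') {1..k1 t} (fst l) * parity (K2.path \<omega>') {1..k2 t} (snd l) * \<epsilon> l \<omega>)"
    if t: "t \<in> T" for t
  proof -
    have "ksum (signs \<omega>) (fst (paths \<omega>')) (snd (paths \<omega>')) (k1 t) (k2 t) =
        ksum (\<lambda>l. \<epsilon> l \<omega>) (K1.path \<omega>') (K2.path \<omega>') (k1 t) (k2 t)"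
      by (rule ksum_cong[symmetric]) (use Y_pos assms(4) in \<open>auto simp: signs_def paths_def\<close>)
    also have "\<dots> = (\<Sum>l\<in>boxes K \<omega>'. parity (K1.path \<omega>') {1..k1 t} (fst l) * parity (K2.path \<omega>') {1..k2 t} (snd l) * \<epsilon> l \<omega>)"
    proof -
      have "odds (K1.path \<omega>') {1..k1 t} \<subseteq> K1.path \<omega>' ` {1..K}"
        by (rule order_trans[OF odds_subset image_mono]) (use assms(2) t in auto)
      moreover have "odds (K2.path \<omega>') {1..k2 t} \<subseteq> K2.path \<omega>' ` {1..K}"
        by (rule order_trans[OF odds_subset image_mono]) (use assms(3) t in auto)
      ultimately show ?thesis unfolding boxes_def by (intro ksum_parity) auto
    qed
    finally show ?thesis .
  qed
  then have "(\<Sum>t\<in>T. u t * ksum (signs \<omega>) (fst (paths \<omega>')) (snd (paths \<omega>')) (k1 t) (k2 t))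
    = (\<Sum>t\<in>T. \<Sum>l\<in>boxes K \<omega>'. u t * (parity (K1.path \<omega>') {1..k1 t} (fst l) * parity (K2.path \<omega>') {1..k2 t} (snd l) * \<epsilon> l \<omega>))"
    by (simp add: sum_distrib_left)
  also have "\<dots> = (\<Sum>l\<in>boxes K \<omega>'. \<Sum>t\<in>T. u t * (parity (K1.path \<omega>') {1..k1 t} (fst l) * parity (K2.path \<omega>') {1..k2 t} (snd l) * \<epsilon> l \<omega>))"
    by (rule sum.swap)
  also have "\<dots> = (\<Sum>l\<in>boxes K \<omega>'. weight T u k1 k2 \<omega>' l * \<epsilon> l \<omega>)"
    unfolding weight_def by (simp add: sum_distrib_right mult.assoc)
  finally show ?thesis .
qed

lemma S_measurable: "S n1 n2 \<in> borel_measurable M"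
proof -
  have "signs \<in> M \<rightarrow>\<^sub>M signs_space" "paths \<in> M \<rightarrow>\<^sub>M path_space \<Otimes>\<^sub>M path_space"
    using indep_signs_paths unfolding indep_elements_def by auto
  then have "(\<lambda>\<omega>. (signs \<omega>, paths \<omega>)) \<in> M \<rightarrow>\<^sub>M signs_space \<Otimes>\<^sub>M (path_space \<Otimes>\<^sub>M path_space)" by (rule measurable_Pair)
  from measurable_compose[OF this ksum_measurable]
  have "(\<lambda>\<omega>. ksum (signs \<omega>) (fst (paths \<omega>)) (snd (paths \<omega>)) n1 n2) \<in> borel_measurable M" by simp
  then show ?thesis by (subst measurable_cong[OF S_eq])
qed

lemma S_bound: "\<omega> \<in> space M \<Longrightarrow> \<bar>S n1 n2 \<omega>\<bar> \<le> real n1 * real n2"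
  unfolding karlin_S_eq_ksum using Y_pos R.e_abs by (intro ksum_bound) auto

text \<open>Freezing the paths leaves a Rademacher sum, hence a product of cosines. Its index set is
  random, so the measurability of \<open>g\<close> is taken from the decoupling and not from the
  product.\<close>

lemma expectation_cos_combination:
  fixes u :: "'t \<Rightarrow> real" and b :: real
  assumes T: "finite T" "\<forall>t\<in>T. k1 t \<le> K" "\<forall>t\<in>T. k2 t \<le> K"
  defines "g \<equiv> \<lambda>\<omega>. cos b * (\<Prod>l\<in>boxes K \<omega>. cos (weight T u k1 k2 \<omega> l))"
  shows "expectation (\<lambda>\<omega>. cos ((\<Sum>t\<in>T. u t * S (k1 t) (k2 t) \<omega>) + b)) = expectation g"
    and "g \<in> borel_measurable M"
proof -
  define h where "h z = cos ((\<Sum>t\<in>T. u t * ksum (fst z) (fst (snd z)) (snd (snd z)) (k1 t) (k2 t)) + b)"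
    for z :: "(nat \<times> nat \<Rightarrow> real) \<times> (nat \<Rightarrow> nat) \<times> (nat \<Rightarrow> nat)"
  have hm: "h \<in> borel_measurable (signs_space \<Otimes>\<^sub>M (path_space \<Otimes>\<^sub>M path_space))"
    unfolding h_def[abs_def] using ksum_measurable
    by (intro measurable_compose[OF _ borel_measurable_cos] borel_measurable_add borel_measurable_sum borel_measurable_times) auto
  have hb: "\<bar>h z\<bar> \<le> 1" for z by (simp add: h_def)
  note dec = indep_elements_decouple[OF indep_signs_paths hm hb]
  have inner: "expectation (\<lambda>\<omega>. h (signs \<omega>, paths \<omega>')) = g \<omega>'" if w: "\<omega>' \<in> space M" for \<omega>'
    unfolding h_def g_def fst_conv snd_conv combination_eq[OF T w]
    by (rule R.expectation_cos[OF finite_boxes boxes_pos[OF w]])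
  have "expectation (\<lambda>\<omega>. cos ((\<Sum>t\<in>T. u t * S (k1 t) (k2 t) \<omega>) + b)) = expectation (\<lambda>\<omega>. h (signs \<omega>, paths \<omega>))"
    by (intro Bochner_Integration.integral_cong refl) (simp add: h_def S_eq)
  also have "\<dots> = expectation g"
    unfolding dec(1) by (intro Bochner_Integration.integral_cong refl inner)
  finally show "expectation (\<lambda>\<omega>. cos ((\<Sum>t\<in>T. u t * S (k1 t) (k2 t) \<omega>) + b)) = expectation g" .
  show "g \<in> borel_measurable M" using dec(2) by (subst measurable_cong[OF inner[symmetric]])
qed

text \<open>Khinchine's inequality with frozen paths; the sum of squared weights is the variance
  given the paths.\<close>

lemma expectation_power_combination:
  assumes T: "finite T" "\<forall>t\<in>T. k1 t \<le> K" "\<forall>t\<in>T. k2 t \<le> K" and m: "m \<ge> 1"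
    and int: "integrable M (\<lambda>\<omega>. (\<Sum>l\<in>boxes K \<omega>. (weight T u k1 k2 \<omega> l)\<^sup>2) ^ m)"
  shows "expectation (\<lambda>\<omega>. (\<Sum>t\<in>T. u t * S (k1 t) (k2 t) \<omega>) ^ (2 * m))
     \<le> 2 * fact (2 * m) * exp 1 * expectation (\<lambda>\<omega>. (\<Sum>l\<in>boxes K \<omega>. (weight T u k1 k2 \<omega> l)\<^sup>2) ^ m)"
proof -
  define h where "h z = (\<Sum>t\<in>T. u t * ksum (fst z) (fst (snd z)) (snd (snd z)) (k1 t) (k2 t)) ^ (2 * m)"
    for z :: "(nat \<times> nat \<Rightarrow> real) \<times> (nat \<Rightarrow> nat) \<times> (nat \<Rightarrow> nat)"
  \<comment> \<open>A deterministic bound from the number of summands; it serves integrability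
    only.\<close>
  let ?C = "(\<Sum>t\<in>T. \<bar>u t\<bar> * (real (k1 t) * real (k2 t))) ^ (2 * m)"
  let ?q = "\<lambda>\<omega>. (\<Sum>l\<in>boxes K \<omega>. (weight T u k1 k2 \<omega> l)\<^sup>2) ^ m"
  have hm: "h \<in> borel_measurable (signs_space \<Otimes>\<^sub>M (path_space \<Otimes>\<^sub>M path_space))"
    unfolding h_def[abs_def] using ksum_measurable
    by (intro borel_measurable_power borel_measurable_sum borel_measurable_times) auto
  have hb: "\<bar>h z\<bar> \<le> ?C" if "z \<in> space (signs_space \<Otimes>\<^sub>M (path_space \<Otimes>\<^sub>M path_space))" for z
    unfolding h_def power_abs
  proof (intro power_mono order_trans[OF sum_abs] sum_mono)
    fix t
    show "\<bar>u t * ksum (fst z) (fst (snd z)) (snd (snd z)) (k1 t) (k2 t)\<bar> \<le> \<bar>u t\<bar> * (real (k1 t) * real (k2 t))"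
      unfolding abs_mult using space_W[OF that] by (intro mult_left_mono ksum_bound) auto
  qed auto
  note dec = indep_elements_decouple[OF indep_signs_paths hm hb]
  have hbs: "\<bar>h (signs \<omega>, paths \<omega>')\<bar> \<le> ?C" if "\<omega> \<in> space M" "\<omega>' \<in> space M" for \<omega> \<omega>'
  proof (rule hb)
    have "signs \<in> M \<rightarrow>\<^sub>M signs_space" "paths \<in> M \<rightarrow>\<^sub>M path_space \<Otimes>\<^sub>M path_space"
      using indep_signs_paths unfolding indep_elements_def by auto
    then show "(signs \<omega>, paths \<omega>') \<in> space (signs_space \<Otimes>\<^sub>M (path_space \<Otimes>\<^sub>M path_space))"
      using that by (auto simp: space_pair_measure dest: measurable_space)
  qed
  have inner: "expectation (\<lambda>\<omega>. h (signs \<omega>, paths \<omega>')) \<le> 2 * fact (2 * m) * exp 1 * ?q \<omega>'" if w: "\<omega>' \<in> space M" for \<omega>'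
    unfolding h_def fst_conv snd_conv combination_eq[OF T w]
    by (rule R.expectation_even_power[OF finite_boxes boxes_pos[OF w] m])
  have "expectation (\<lambda>\<omega>. (\<Sum>t\<in>T. u t * S (k1 t) (k2 t) \<omega>) ^ (2 * m)) = expectation (\<lambda>\<omega>. h (signs \<omega>, paths \<omega>))"
    by (intro Bochner_Integration.integral_cong refl) (simp add: h_def S_eq)
  also have "\<dots> = expectation (\<lambda>\<omega>'. expectation (\<lambda>\<omega>. h (signs \<omega>, paths \<omega>')))" by (rule dec(1))
  also have "\<dots> \<le> expectation (\<lambda>\<omega>'. 2 * fact (2 * m) * exp 1 * ?q \<omega>')"
  proof (rule integral_mono)
    show "integrable M (\<lambda>\<omega>'. expectation (\<lambda>\<omega>. h (signs \<omega>, paths \<omega>')))"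
    proof (rule integrable_const_bound[where B = ?C, OF AE_I2 dec(2)])
      fix \<omega>' assume w: "\<omega>' \<in> space M"
      have m: "signs \<in> M \<rightarrow>\<^sub>M signs_space" "paths \<in> M \<rightarrow>\<^sub>M path_space \<Otimes>\<^sub>M path_space"
        using indep_signs_paths unfolding indep_elements_def by auto
      have "(\<lambda>\<omega>. (signs \<omega>, paths \<omega>')) \<in> M \<rightarrow>\<^sub>M signs_space \<Otimes>\<^sub>M (path_space \<Otimes>\<^sub>M path_space)"
        by (rule measurable_Pair[OF m(1) measurable_const[OF measurable_space[OF m(2) w]]])
      from measurable_compose[OF this hm] have i: "integrable M (\<lambda>\<omega>. h (signs \<omega>, paths \<omega>'))"
        using hbs[OF _ w] by (intro integrable_const_bound[where B = ?C] AE_I2) auto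
      have "\<bar>expectation (\<lambda>\<omega>. h (signs \<omega>, paths \<omega>'))\<bar> \<le> expectation (\<lambda>\<omega>. \<bar>h (signs \<omega>, paths \<omega>')\<bar>)"
        by (rule integral_abs_bound)
      also have "\<dots> \<le> ?C" using i hbs[OF _ w] by (intro integral_le_const AE_I2) auto
      finally show "norm (expectation (\<lambda>\<omega>. h (signs \<omega>, paths \<omega>'))) \<le> ?C" by simp
    qed
  qed (use inner int in auto)
  finally show ?thesis by simp
qed

end

section \<open>Finite-dimensional distributions\<close>

text \<open>Number of boxes that are odd at both times: the size of an intersection is half of the
  two sizes minus that of the symmetric difference, and the latter is the odd set of the block
  between the times. The three terms become those of the covariance of fractional Brownian
  motion.\<close>

definition ip :: "(nat \<Rightarrow> nat) \<Rightarrow> nat \<Rightarrow> nat \<Rightarrow> real" where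
  "ip y k k' = (num_odd y {1..k} + num_odd y {1..k'} - num_odd y {Suc (min k k')..max k k'}) / 2"

lemma sum_parity_prod:
  assumes F: "finite F" "odds y {1..k} \<subseteq> F" "odds y {1..k'} \<subseteq> F"
  shows "(\<Sum>l\<in>F. parity y {1..k} l * parity y {1..k'} l) = ip y k k'"
proof -
  have *: "(\<Sum>l\<in>F. parity y {1..k} l * parity y {1..k'} l) = ip y k k'"
    if le: "k \<le> k'" and F: "finite F" "odds y {1..k} \<subseteq> F" "odds y {1..k'} \<subseteq> F" for k k'
  proof -
    have I: "finite {1..k}" "finite {Suc k..k'}" "{1..k} \<inter> {Suc k..k'} = {}" by auto
    have U: "{1..k} \<union> {Suc k..k'} = {1..k'}" using le by auto
    have J: "odds y {Suc k..k'} \<subseteq> F" using odds_Un[OF I, of y] F unfolding U by blast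
    have "(\<Sum>l\<in>F. parity y {1..k} l * parity y {1..k'} l) =
      (\<Sum>l\<in>F. (parity y {1..k} l + parity y {1..k'} l - parity y {Suc k..k'} l) / 2)"
      by (simp only: parity_prod[OF I, of y, unfolded U])
    also have "\<dots> = ip y k k'"
      using sum_parity[OF I(1) F(1,2)] sum_parity[OF _ F(1) F(3)] sum_parity[OF I(2) F(1) J] le
      by (simp add: ip_def sum_divide_distrib[symmetric] sum.distrib sum_subtractf)
    finally show ?thesis .
  qed
  have sym: "ip y k k' = ip y k' k" by (simp add: ip_def min.commute max.commute)
  show ?thesis
  proof (cases "k \<le> k'")
    case True then show ?thesis by (rule *[OF _ F])
  next
    case False
    then have "(\<Sum>l\<in>F. parity y {1..k'} l * parity y {1..k} l) = ip y k' k" by (intro * F) auto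
    then show ?thesis by (simp only: sym mult.commute)
  qed
qed

lemma nat_floor_div_tendsto:
  assumes "t \<ge> 0"
  shows "(\<lambda>n. real (nat \<lfloor>real n * t\<rfloor>) / real n) \<longlonglongrightarrow> t"
proof (rule tendsto_sandwich)
  show "\<forall>\<^sub>F n in sequentially. t - 1 / real n \<le> real (nat \<lfloor>real n * t\<rfloor>) / real n"
    using eventually_gt_at_top[of 0]
  proof eventually_elim
    case (elim n)
    have "real n * t - 1 \<le> real (nat \<lfloor>real n * t\<rfloor>)" using assms by linarith
    then have "(real n * t - 1) / real n \<le> real (nat \<lfloor>real n * t\<rfloor>) / real n" by (rule divide_right_mono) simp
    then show ?case using elim by (simp add: diff_divide_distrib)
  qed
  show "\<forall>\<^sub>F n in sequentially. real (nat \<lfloor>real n * t\<rfloor>) / real n \<le> t"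
    using eventually_gt_at_top[of 0]
  proof eventually_elim
    case (elim n)
    have "0 \<le> real n * t" using assms by simp
    then have "real (nat \<lfloor>real n * t\<rfloor>) \<le> real n * t" by linarith
    then show ?case using elim by (simp add: field_simps)
  qed
  have "(\<lambda>n. t - 1 / real n) \<longlonglongrightarrow> t - 0"
    by (intro tendsto_intros lim_1_over_n)
  then show "(\<lambda>n. t - 1 / real n) \<longlonglongrightarrow> t" by simp
qed simp

section \<open>Limits of odd box counts for one sequence\<close>

context karlin_sequence begin

text \<open>\<open>V_lim\<close> requires a positive limit. The limit 0 arises at time 0 and between
  equal times, where the block is empty for every n.\<close>

lemma L1_block:
  assumes m: "(\<lambda>n. real (b n - a n) / real n) \<longlonglongrightarrow> \<tau>" and \<tau>: "\<tau> > 0 \<or> (\<forall>n. b n \<le> a n) \<and> \<tau> = 0"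
  shows "(\<lambda>n. expectation (\<lambda>\<omega>. \<bar>num_odd (path \<omega>) {Suc (a n)..b n} / r (real n) - c * \<tau> powr \<alpha>\<bar>)) \<longlonglongrightarrow> 0"
proof -
  have Vl: "(\<lambda>n. V (b n - a n) / r (real n)) \<longlonglongrightarrow> c * \<tau> powr \<alpha>"
  proof (cases "\<tau> > 0")
    case True then show ?thesis by (rule V_lim[OF m])
  next
    case False
    then have "b n - a n = 0" "\<tau> = 0" for n using \<tau> by auto
    then show ?thesis by simp
  qed
  have rt: "filterlim (\<lambda>n. r (real n)) at_top sequentially"
    by (rule filterlim_compose[OF r_at_top filterlim_real_sequentially])
  have ri: "(\<lambda>n. k / r (real n)) \<longlonglongrightarrow> 0" for k
    by (rule real_tendsto_divide_at_top[OF tendsto_const rt])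
  have rp: "\<forall>\<^sub>F n in sequentially. r (real n) > 0"
    using eventually_gt_at_top[of 0] by eventually_elim (auto intro: r_pos)
  \<comment> \<open>\<open>L1_num_odd\<close> divided by \<open>r\<close>: the root over r is
    written as the root of (V / r + 2 / r) (1 / r), which tends to 0 since V / r converges and 1 / r
    vanishes.\<close>
  let ?B = "\<lambda>n. 2 * sqrt ((V (b n - a n) / r (real n) + 2 / r (real n)) * (1 / r (real n))) + 2 / r (real n)
     + \<bar>V (b n - a n) / r (real n) - c * \<tau> powr \<alpha>\<bar>"
  have "?B \<longlonglongrightarrow> 2 * sqrt ((c * \<tau> powr \<alpha> + 0) * 0) + 0 + \<bar>c * \<tau> powr \<alpha> - c * \<tau> powr \<alpha>\<bar>"
    by (intro tendsto_intros Vl ri)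
  then have B: "?B \<longlonglongrightarrow> 0" by simp
  show ?thesis
  proof (rule Lim_null_comparison[OF _ B])
    show "\<forall>\<^sub>F n in sequentially. norm (expectation (\<lambda>\<omega>. \<bar>num_odd (path \<omega>) {Suc (a n)..b n} / r (real n) - c * \<tau> powr \<alpha>\<bar>)) \<le> ?B n"
      using rp
    proof eventually_elim
      case (elim n)
      let ?I = "{Suc (a n)..b n}" and ?v = "V (b n - a n)" and ?r = "r (real n)"
      have I: "finite ?I" "?I \<subseteq> {1..}" and cI: "card ?I = b n - a n" by auto
      have int: "integrable M (\<lambda>\<omega>. num_odd (path \<omega>) ?I)" using num_odd_integrable[OF I, of 1] by simp
      have "expectation (\<lambda>\<omega>. \<bar>num_odd (path \<omega>) ?I / ?r - c * \<tau> powr \<alpha>\<bar>)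
        \<le> expectation (\<lambda>\<omega>. \<bar>num_odd (path \<omega>) ?I - ?v\<bar> / ?r + \<bar>?v / ?r - c * \<tau> powr \<alpha>\<bar>)"
      proof (rule integral_mono)
        fix \<omega>
        have "\<bar>num_odd (path \<omega>) ?I / ?r - c * \<tau> powr \<alpha>\<bar> \<le> \<bar>num_odd (path \<omega>) ?I / ?r - ?v / ?r\<bar> + \<bar>?v / ?r - c * \<tau> powr \<alpha>\<bar>"
          by linarith
        also have "\<bar>num_odd (path \<omega>) ?I / ?r - ?v / ?r\<bar> = \<bar>num_odd (path \<omega>) ?I - ?v\<bar> / ?r"
          using elim by (simp add: diff_divide_distrib[symmetric])
        finally show "\<bar>num_odd (path \<omega>) ?I / ?r - c * \<tau> powr \<alpha>\<bar> \<le> \<bar>num_odd (path \<omega>) ?I - ?v\<bar> / ?r + \<bar>?v / ?r - c * \<tau> powr \<alpha>\<bar>" .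
      qed (use int in auto)
      also have "\<dots> = expectation (\<lambda>\<omega>. \<bar>num_odd (path \<omega>) ?I - ?v\<bar>) / ?r + \<bar>?v / ?r - c * \<tau> powr \<alpha>\<bar>"
        using int by (simp add: prob_space)
      also have "expectation (\<lambda>\<omega>. \<bar>num_odd (path \<omega>) ?I - ?v\<bar>) / ?r \<le> (2 * sqrt (?v + 2) + 2) / ?r"
        using L1_num_odd[OF I] elim unfolding cI by (intro divide_right_mono) auto
      also have "(2 * sqrt (?v + 2) + 2) / ?r = 2 * sqrt ((?v / ?r + 2 / ?r) * (1 / ?r)) + 2 / ?r"
        using elim by (simp add: add_divide_distrib[symmetric] real_sqrt_divide)
      finally show ?case by simp
    qed
  qed
qed

definition cov_fbm :: "real \<Rightarrow> real \<Rightarrow> real" where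
  "cov_fbm s t = 1/2 * (t powr \<alpha> + s powr \<alpha> - \<bar>t - s\<bar> powr \<alpha>)"

abbreviation idx :: "nat \<Rightarrow> real \<Rightarrow> nat" where "idx n t \<equiv> nat \<lfloor>real n * t\<rfloor>"

text \<open>Each of the three blocks in \<open>ip\<close> concentrates at the power \<alpha> of its
  own relative length: s, t and the distance between them.\<close>

lemma L1_ip:
  assumes st: "s \<ge> 0" "t \<ge> 0"
  shows "(\<lambda>n. expectation (\<lambda>\<omega>. \<bar>ip (path \<omega>) (idx n s) (idx n t) / r (real n) - c * cov_fbm s t\<bar>)) \<longlonglongrightarrow> 0"
proof -
  have base: "(\<lambda>n. expectation (\<lambda>\<omega>. \<bar>num_odd (path \<omega>) {1..idx n s} / r (real n) - c * s powr \<alpha>\<bar>)) \<longlonglongrightarrow> 0"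
    if "s \<ge> 0" for s
    using L1_block[of "\<lambda>n. idx n s" "\<lambda>_. 0" s] nat_floor_div_tendsto[OF that] that by fastforce
  have mm: "real (max (idx n s) (idx n t) - min (idx n s) (idx n t)) = \<bar>real (idx n t) - real (idx n s)\<bar>" for n
    by (simp add: max_def min_def of_nat_diff)
  have "(\<lambda>n. \<bar>real (idx n t) / real n - real (idx n s) / real n\<bar>) \<longlonglongrightarrow> \<bar>t - s\<bar>"
    by (intro tendsto_intros nat_floor_div_tendsto st)
  then have "(\<lambda>n. real (max (idx n s) (idx n t) - min (idx n s) (idx n t)) / real n) \<longlonglongrightarrow> \<bar>t - s\<bar>"
    unfolding mm by (simp add: diff_divide_distrib[symmetric])
  then have diff: "(\<lambda>n. expectation (\<lambda>\<omega>. \<bar>num_odd (path \<omega>) {Suc (min (idx n s) (idx n t))..max (idx n s) (idx n t)} / r (real n)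
      - c * \<bar>t - s\<bar> powr \<alpha>\<bar>)) \<longlonglongrightarrow> 0"
    by (rule L1_block) auto
  let ?A = "\<lambda>n \<omega>. num_odd (path \<omega>) {1..idx n s} / r (real n) - c * s powr \<alpha>"
  let ?B = "\<lambda>n \<omega>. num_odd (path \<omega>) {1..idx n t} / r (real n) - c * t powr \<alpha>"
  let ?C = "\<lambda>n \<omega>. num_odd (path \<omega>) {Suc (min (idx n s) (idx n t))..max (idx n s) (idx n t)} / r (real n) - c * \<bar>t - s\<bar> powr \<alpha>"
  have int: "integrable M (\<lambda>\<omega>. num_odd (path \<omega>) {Suc a..b})" for a b
    using num_odd_integrable[of "{Suc a..b}" 1] by auto
  have int1: "integrable M (\<lambda>\<omega>. num_odd (path \<omega>) {1..b})" for b using int[of 0 b] by simp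
  have "(\<lambda>n. expectation (\<lambda>\<omega>. \<bar>?A n \<omega>\<bar>) + expectation (\<lambda>\<omega>. \<bar>?B n \<omega>\<bar>) + expectation (\<lambda>\<omega>. \<bar>?C n \<omega>\<bar>)) \<longlonglongrightarrow> 0 + 0 + 0"
    by (intro tendsto_add base diff st)
  then have lim: "(\<lambda>n. expectation (\<lambda>\<omega>. \<bar>?A n \<omega>\<bar>) + expectation (\<lambda>\<omega>. \<bar>?B n \<omega>\<bar>) + expectation (\<lambda>\<omega>. \<bar>?C n \<omega>\<bar>)) \<longlonglongrightarrow> 0"
    by simp
  show ?thesis
  proof (rule Lim_null_comparison[OF _ lim], intro always_eventually allI)
    fix n
    have eq: "ip (path \<omega>) (idx n s) (idx n t) / r (real n) - c * cov_fbm s t = (?A n \<omega> + ?B n \<omega> - ?C n \<omega>) / 2" for \<omega>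
      by (simp add: ip_def cov_fbm_def algebra_simps add_divide_distrib diff_divide_distrib)
    have "expectation (\<lambda>\<omega>. \<bar>(?A n \<omega> + ?B n \<omega> - ?C n \<omega>) / 2\<bar>) \<le> expectation (\<lambda>\<omega>. \<bar>?A n \<omega>\<bar> + \<bar>?B n \<omega>\<bar> + \<bar>?C n \<omega>\<bar>)"
    proof (rule integral_mono)
      have "\<bar>(x + y - z) / 2\<bar> \<le> \<bar>x\<bar> + \<bar>y\<bar> + \<bar>z\<bar>" for x y z :: real
      proof -
        have "\<bar>(x + y - z) / 2\<bar> \<le> \<bar>x + y - z\<bar>" by simp
        also have "\<dots> \<le> \<bar>x\<bar> + \<bar>y\<bar> + \<bar>z\<bar>"
          by (rule order_trans[OF abs_triangle_ineq4 add_right_mono[OF abs_triangle_ineq]])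
        finally show ?thesis .
      qed
      then show "\<bar>(?A n \<omega> + ?B n \<omega> - ?C n \<omega>) / 2\<bar> \<le> \<bar>?A n \<omega>\<bar> + \<bar>?B n \<omega>\<bar> + \<bar>?C n \<omega>\<bar>" for \<omega> .
    qed (use int int1 in auto)
    also have "\<dots> = expectation (\<lambda>\<omega>. \<bar>?A n \<omega>\<bar>) + expectation (\<lambda>\<omega>. \<bar>?B n \<omega>\<bar>) + expectation (\<lambda>\<omega>. \<bar>?C n \<omega>\<bar>)"
      using int int1 by simp
    finally have *: "expectation (\<lambda>\<omega>. \<bar>(?A n \<omega> + ?B n \<omega> - ?C n \<omega>) / 2\<bar>)
        \<le> expectation (\<lambda>\<omega>. \<bar>?A n \<omega>\<bar>) + expectation (\<lambda>\<omega>. \<bar>?B n \<omega>\<bar>) + expectation (\<lambda>\<omega>. \<bar>?C n \<omega>\<bar>)" .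
    have "0 \<le> expectation (\<lambda>\<omega>. \<bar>(?A n \<omega> + ?B n \<omega> - ?C n \<omega>) / 2\<bar>)"
      by (rule integral_nonneg_AE, rule AE_I2, rule abs_ge_zero)
    with * show "norm (expectation (\<lambda>\<omega>. \<bar>ip (path \<omega>) (idx n s) (idx n t) / r (real n) - c * cov_fbm s t\<bar>))
        \<le> expectation (\<lambda>\<omega>. \<bar>?A n \<omega>\<bar>) + expectation (\<lambda>\<omega>. \<bar>?B n \<omega>\<bar>) + expectation (\<lambda>\<omega>. \<bar>?C n \<omega>\<bar>)"
      unfolding eq real_norm_def by (simp only: abs_of_nonneg)
  qed
qed

end

lemma (in prob_space) indep_elements_expectation_mult:
  fixes f :: "'b \<Rightarrow> real" and g :: "'c \<Rightarrow> real"
  assumes ind: "indep_elements A U B V" and f: "f \<in> borel_measurable A" and g: "g \<in> borel_measurable B"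
    and fb: "\<And>x. x \<in> space A \<Longrightarrow> \<bar>f x\<bar> \<le> C" and gb: "\<And>x. x \<in> space B \<Longrightarrow> \<bar>g x\<bar> \<le> C'"
  shows "expectation (\<lambda>\<omega>. f (U \<omega>) * g (V \<omega>)) = expectation (\<lambda>\<omega>. f (U \<omega>)) * expectation (\<lambda>\<omega>. g (V \<omega>))"
proof -
  have h: "(\<lambda>z. f (fst z) * g (snd z)) \<in> borel_measurable (A \<Otimes>\<^sub>M B)" using f g by measurable
  have b: "\<bar>f (fst z) * g (snd z)\<bar> \<le> \<bar>C\<bar> * \<bar>C'\<bar>" if "z \<in> space (A \<Otimes>\<^sub>M B)" for z
    unfolding abs_mult using fb[of "fst z"] gb[of "snd z"] that
    by (intro mult_mono) (auto simp: space_pair_measure intro: order_trans[OF _ abs_ge_self])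
  show ?thesis using indep_elements_decouple(1)[OF ind h b] by simp
qed

definition pair_filter :: "(nat \<times> nat) filter" where
  "pair_filter = filtercomap (\<lambda>(n1, n2). min n1 n2) at_top"

lemma eventually_pair_filter:
  "eventually P pair_filter \<longleftrightarrow> (\<exists>K. \<forall>n1\<ge>K. \<forall>n2\<ge>K. P (n1, n2))"
  unfolding pair_filter_def eventually_filtercomap eventually_at_top_linorder
proof safe
  fix Q N assume "\<forall>n\<ge>N. Q n" "\<forall>x. Q (case x of (n1, n2) \<Rightarrow> min n1 n2) \<longrightarrow> P x"
  then show "\<exists>K. \<forall>n1\<ge>K. \<forall>n2\<ge>K. P (n1, n2)" by (intro exI[of _ N]) auto
next
  fix K assume "\<forall>n1\<ge>K. \<forall>n2\<ge>K. P (n1, n2)"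
  then show "\<exists>Q. (\<exists>N. \<forall>n\<ge>N. Q n) \<and> (\<forall>x. Q (case x of (n1, n2) \<Rightarrow> min n1 n2) \<longrightarrow> P x)"
    by (intro exI[of _ "\<lambda>n. n \<ge> K"]) auto
qed

lemma filterlim_fst_pair: "filterlim fst at_top pair_filter"
  unfolding filterlim_at_top eventually_pair_filter by auto

lemma filterlim_snd_pair: "filterlim snd at_top pair_filter"
  unfolding filterlim_at_top eventually_pair_filter by auto

lemma pair_filter_nonbot: "pair_filter \<noteq> bot"
  unfolding trivial_limit_def eventually_pair_filter by auto

section \<open>Covariances given the paths, and characteristic functions\<close>

context karlin_sheet begin

lemma num_odd_path_measurable:
  assumes I: "finite I" "I \<subseteq> {1..}"
  shows "(\<lambda>y. num_odd y I) \<in> borel_measurable path_space"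
proof -
  have "(\<lambda>y. of_bool (y i = l) :: real) \<in> borel_measurable path_space" if "i \<in> I" for i l
    unfolding path_space_def
    by (rule measurable_compose[OF measurable_component_singleton]) (use that I in auto)
  then have p: "(\<lambda>y. parity y I l) \<in> borel_measurable path_space" for l
    unfolding parity_eq[OF I(1)] by measurable
  have "(\<lambda>y. enn2real (\<Sum>l. ennreal (parity y I l))) \<in> borel_measurable path_space"
    using p by measurable
  then show ?thesis using I(1) by (simp add: num_odd_suminf[symmetric])
qed

lemma ip_path_measurable: "(\<lambda>y. ip y k k') \<in> borel_measurable path_space"
  unfolding ip_def using num_odd_path_measurable[of "{1.._}"] num_odd_path_measurable[of "{Suc _.._}"]
  by (intro borel_measurable_divide borel_measurable_diff borel_measurable_add) auto

lemma num_odd_restrict: "I \<subseteq> {1..} \<Longrightarrow> num_odd (\<lambda>n\<in>{1..}. y n) I = num_odd y I"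
  unfolding num_odd_def using parity_cong[of I "\<lambda>n\<in>{1..}. y n" y] by (auto simp: subset_eq)

lemma ip_restrict: "ip (\<lambda>n\<in>{1..}. y n) k k' = ip y k k'"
proof -
  have *: "num_odd (\<lambda>n\<in>{1..}. y n) {Suc a..b} = num_odd y {Suc a..b}" for a b
    by (rule num_odd_restrict) auto
  show ?thesis unfolding ip_def using *[of 0] * by simp
qed

lemma ip_abs_le: "\<bar>ip y k k'\<bar> \<le> real (k + k')"
proof -
  have "num_odd y {1..k} \<le> real k" "num_odd y {1..k'} \<le> real k'"
    "num_odd y {Suc (min k k')..max k k'} \<le> real (max k k')"
    using num_odd_le[of "{1..k}" y] num_odd_le[of "{1..k'}" y] num_odd_le[of "{Suc (min k k')..max k k'}" y]
    by (auto simp: le_diff_conv)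
  moreover have "real (max k k') \<le> real k + real k'" by auto
  moreover have "\<bar>(a + b - d) / 2\<bar> \<le> real k + real k'"
    if "0 \<le> a" "0 \<le> b" "0 \<le> d" "a \<le> real k" "b \<le> real k'" "d \<le> m" "m \<le> real k + real k'" for a b d m
    using that by (simp add: abs_le_iff)
  ultimately show ?thesis unfolding ip_def of_nat_add by (meson num_odd_nonneg)
qed

text \<open>Independence is given for the paths restricted to positive times, hence the requirement
  that f and g do not see the value at 0.\<close>

lemma expectation_indep_mult:
  fixes f g :: "(nat \<Rightarrow> nat) \<Rightarrow> real"
  assumes "f \<in> borel_measurable path_space" "g \<in> borel_measurable path_space"
    and "\<And>y. \<bar>f y\<bar> \<le> C" "\<And>y. \<bar>g y\<bar> \<le> C'"
    and "\<And>y. f (\<lambda>n\<in>{1..}. y n) = f y" "\<And>y. g (\<lambda>n\<in>{1..}. y n) = g y"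
  shows "expectation (\<lambda>\<omega>. f (K1.path \<omega>) * g (K2.path \<omega>)) = expectation (\<lambda>\<omega>. f (K1.path \<omega>)) * expectation (\<lambda>\<omega>. g (K2.path \<omega>))"
  using indep_elements_expectation_mult[OF indep_Y1_Y2[folded path_space_def] assms(1,2), of C C'] assms(3-6)
  by simp

definition norming :: "nat \<Rightarrow> nat \<Rightarrow> real" where
  "norming n1 n2 = sqrt (K1.r (real n1) * K2.r (real n2))"

lemma norming_eq:
  "real n1 powr (\<alpha>1 / 2) * real n2 powr (\<alpha>2 / 2) * (L1 (real n1) * L2 (real n2)) powr (1 / 2) = norming n1 n2"
proof (cases "n1 = 0 \<or> n2 = 0")
  \<comment> \<open>Both sides are 0, because \<open>0 powr a\<close> is 0 whatever the slowly
    varying functions do there. The identity is used at every index, since the processes are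
    identified as functions of all n.\<close>
  case True
  then show ?thesis using \<alpha>1 \<alpha>2 by (auto simp: norming_def K1.r_def K2.r_def)
next
  case False
  then have "K1.r (real n1) > 0" "K2.r (real n2) > 0" by (auto intro!: K1.r_pos K2.r_pos)
  then have L: "L1 (real n1) > 0" "L2 (real n2) > 0"
    using False by (auto simp: K1.r_def K2.r_def zero_less_mult_iff)
  have "real n powr (a / 2) = sqrt (real n powr a)" if "n \<noteq> 0" for n a
    using that by (simp add: powr_half_sqrt[symmetric] powr_powr)
  then show ?thesis using False L
    by (simp add: norming_def K1.r_def K2.r_def powr_half_sqrt real_sqrt_mult)
qed

definition X :: "nat \<times> nat \<Rightarrow> real \<times> real \<Rightarrow> 'a \<Rightarrow> real" where
  "X n t \<omega> = S (nat \<lfloor>real (fst n) * fst t\<rfloor>) (nat \<lfloor>real (snd n) * snd t\<rfloor>) \<omega> / norming (fst n) (snd n)"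

definition cov_sheet :: "real \<times> real \<Rightarrow> real \<times> real \<Rightarrow> real" where
  "cov_sheet s t = (K1.c * K1.cov_fbm (fst s) (fst t)) * (K2.c * K2.cov_fbm (snd s) (snd t))"

text \<open>For positive n, the covariance of \<open>X n s\<close> and \<open>X n t\<close> given
  the paths: the signs are orthonormal, so it is the number of boxes odd at both times, a row count
  times a column count, over the squared norming.\<close>

definition cond_cov :: "nat \<times> nat \<Rightarrow> real \<times> real \<Rightarrow> real \<times> real \<Rightarrow> 'a \<Rightarrow> real" where
  "cond_cov n s t \<omega> = (ip (K1.path \<omega>) (K1.idx (fst n) (fst s)) (K1.idx (fst n) (fst t)) / K1.r (real (fst n))) *
     (ip (K2.path \<omega>) (K2.idx (snd n) (snd s)) (K2.idx (snd n) (snd t)) / K2.r (real (snd n)))"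

lemma ip_measurable1 [measurable]: "(\<lambda>\<omega>. ip (K1.path \<omega>) k k') \<in> borel_measurable M"
  unfolding ip_def using K1.num_odd_measurable[of "{1.._}"] K1.num_odd_measurable[of "{Suc _.._}"]
  by (intro borel_measurable_divide borel_measurable_diff borel_measurable_add) auto

lemma ip_measurable2 [measurable]: "(\<lambda>\<omega>. ip (K2.path \<omega>) k k') \<in> borel_measurable M"
  unfolding ip_def using K2.num_odd_measurable[of "{1.._}"] K2.num_odd_measurable[of "{Suc _.._}"]
  by (intro borel_measurable_divide borel_measurable_diff borel_measurable_add) auto

lemma cond_cov_integrable: "integrable M (cond_cov n s t)"
proof -
  let ?k = "\<lambda>u. K1.idx (fst n) (fst u)" and ?k' = "\<lambda>u. K2.idx (snd n) (snd u)"
  have "integrable M (\<lambda>\<omega>. ip (K1.path \<omega>) (?k s) (?k t) * ip (K2.path \<omega>) (?k' s) (?k' t))"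
    by (rule integrable_const_bound[where B = "real (?k s + ?k t) * real (?k' s + ?k' t)"])
       (auto simp: abs_mult intro!: mult_mono ip_abs_le simp del: of_nat_add)
  then have "integrable M (\<lambda>\<omega>. (ip (K1.path \<omega>) (?k s) (?k t) * ip (K2.path \<omega>) (?k' s) (?k' t)) / (K1.r (real (fst n)) * K2.r (real (snd n))))"
    by simp
  then show ?thesis unfolding cond_cov_def[abs_def] by simp
qed

text \<open>Use A B - a b = (A - a) B + a (B - b). Rows and columns are independent, so the mean of
  |A - a| |B| factors and convergence in mean of A and B is enough.\<close>

lemma cond_cov_L1:
  assumes "s \<in> {0..} \<times> {0..}" "t \<in> {0..} \<times> {0..}"
  shows "((\<lambda>n. expectation (\<lambda>\<omega>. \<bar>cond_cov n s t \<omega> - cov_sheet s t\<bar>)) \<longlongrightarrow> 0) pair_filter"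
proof -
  define A where "A n y = ip y (K1.idx n (fst s)) (K1.idx n (fst t)) / K1.r (real n)" for n y
  define B where "B n y = ip y (K2.idx n (snd s)) (K2.idx n (snd t)) / K2.r (real n)" for n y
  define a where "a = K1.c * K1.cov_fbm (fst s) (fst t)"
  define b where "b = K2.c * K2.cov_fbm (snd s) (snd t)"
  have st: "fst s \<ge> 0" "snd s \<ge> 0" "fst t \<ge> 0" "snd t \<ge> 0" using assms by auto
  define f where "f n = expectation (\<lambda>\<omega>. \<bar>A n (K1.path \<omega>) - a\<bar>)" for n
  define g where "g n = expectation (\<lambda>\<omega>. \<bar>B n (K2.path \<omega>) - b\<bar>)" for n
  have f0: "f \<longlonglongrightarrow> 0" unfolding f_def A_def a_def by (rule K1.L1_ip) (use st in auto)
  have g0: "g \<longlonglongrightarrow> 0" unfolding g_def B_def b_def by (rule K2.L1_ip) (use st in auto)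
  have F: "((\<lambda>n. f (fst n)) \<longlongrightarrow> 0) pair_filter" by (rule filterlim_compose[OF f0 filterlim_fst_pair])
  have G: "((\<lambda>n. g (snd n)) \<longlongrightarrow> 0) pair_filter" by (rule filterlim_compose[OF g0 filterlim_snd_pair])
  have mA: "A n \<in> borel_measurable path_space" and mB: "B n \<in> borel_measurable path_space" for n
    unfolding A_def[abs_def] B_def[abs_def] using ip_path_measurable by auto
  have bA: "\<bar>A n y\<bar> \<le> real (K1.idx n (fst s) + K1.idx n (fst t)) / \<bar>K1.r (real n)\<bar>" for n y
    unfolding A_def abs_divide by (intro divide_right_mono ip_abs_le) auto
  have bB: "\<bar>B n y\<bar> \<le> real (K2.idx n (snd s) + K2.idx n (snd t)) / \<bar>K2.r (real n)\<bar>" for n y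
    unfolding B_def abs_divide by (intro divide_right_mono ip_abs_le) auto
  have rA: "A n (\<lambda>i\<in>{1..}. y i) = A n y" and rB: "B n (\<lambda>i\<in>{1..}. y i) = B n y" for n y
    unfolding A_def B_def by (simp_all only: ip_restrict)
  have mA' [measurable]: "(\<lambda>\<omega>. A n (K1.path \<omega>)) \<in> borel_measurable M" for n unfolding A_def by measurable
  have mB' [measurable]: "(\<lambda>\<omega>. B n (K2.path \<omega>)) \<in> borel_measurable M" for n unfolding B_def by measurable
  have iA: "integrable M (\<lambda>\<omega>. A n (K1.path \<omega>))" for n
    using bA by (intro integrable_const_bound AE_I2) auto
  have iB: "integrable M (\<lambda>\<omega>. B n (K2.path \<omega>))" for n
    using bB by (intro integrable_const_bound AE_I2) auto
  have lim: "((\<lambda>n. f (fst n) * (g (snd n) + \<bar>b\<bar>) + \<bar>a\<bar> * g (snd n)) \<longlongrightarrow> 0 * (0 + \<bar>b\<bar>) + \<bar>a\<bar> * 0) pair_filter"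
    by (intro tendsto_intros F G)
  show ?thesis
  proof (rule Lim_null_comparison)
    show "((\<lambda>n. f (fst n) * (g (snd n) + \<bar>b\<bar>) + \<bar>a\<bar> * g (snd n)) \<longlongrightarrow> 0) pair_filter" using lim by simp
    show "\<forall>\<^sub>F n in pair_filter. norm (expectation (\<lambda>\<omega>. \<bar>cond_cov n s t \<omega> - cov_sheet s t\<bar>))
       \<le> f (fst n) * (g (snd n) + \<bar>b\<bar>) + \<bar>a\<bar> * g (snd n)"
    proof (intro always_eventually allI)
      fix n :: "nat \<times> nat"
      let ?A = "\<lambda>\<omega>. A (fst n) (K1.path \<omega>)" and ?B = "\<lambda>\<omega>. B (snd n) (K2.path \<omega>)"
      have cc: "cond_cov n s t \<omega> = ?A \<omega> * ?B \<omega>" for \<omega> by (simp add: cond_cov_def A_def B_def)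
      have prodE: "expectation (\<lambda>\<omega>. \<bar>?A \<omega> - a\<bar> * \<bar>?B \<omega>\<bar>) = f (fst n) * expectation (\<lambda>\<omega>. \<bar>?B \<omega>\<bar>)"
        unfolding f_def
      proof (rule expectation_indep_mult)
        show "(\<lambda>y. \<bar>A (fst n) y - a\<bar>) \<in> borel_measurable path_space" "(\<lambda>y. \<bar>B (snd n) y\<bar>) \<in> borel_measurable path_space"
          using mA mB by measurable
        show "\<bar>\<bar>A (fst n) y - a\<bar>\<bar> \<le> real (K1.idx (fst n) (fst s) + K1.idx (fst n) (fst t)) / \<bar>K1.r (real (fst n))\<bar> + \<bar>a\<bar>" for y
          using bA[of "fst n" y] by linarith
        show "\<bar>\<bar>B (snd n) y\<bar>\<bar> \<le> real (K2.idx (snd n) (snd s) + K2.idx (snd n) (snd t)) / \<bar>K2.r (real (snd n))\<bar>" for y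
          using bB[of "snd n" y] by simp
      qed (simp_all only: rA rB)
      have i1: "integrable M (\<lambda>\<omega>. \<bar>?A \<omega> - a\<bar> * \<bar>?B \<omega>\<bar>)"
      proof (rule integrable_const_bound[where B = "(real (K1.idx (fst n) (fst s) + K1.idx (fst n) (fst t)) / \<bar>K1.r (real (fst n))\<bar> + \<bar>a\<bar>) * (real (K2.idx (snd n) (snd s) + K2.idx (snd n) (snd t)) / \<bar>K2.r (real (snd n))\<bar>)"], rule AE_I2)
        fix \<omega>
        have "\<bar>?A \<omega> - a\<bar> \<le> real (K1.idx (fst n) (fst s) + K1.idx (fst n) (fst t)) / \<bar>K1.r (real (fst n))\<bar> + \<bar>a\<bar>"
          by (rule order_trans[OF abs_triangle_ineq4 add_right_mono[OF bA]])
        then show "norm (\<bar>?A \<omega> - a\<bar> * \<bar>?B \<omega>\<bar>) \<le> (real (K1.idx (fst n) (fst s) + K1.idx (fst n) (fst t)) / \<bar>K1.r (real (fst n))\<bar> + \<bar>a\<bar>) * (real (K2.idx (snd n) (snd s) + K2.idx (snd n) (snd t)) / \<bar>K2.r (real (snd n))\<bar>)"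
          unfolding real_norm_def abs_mult abs_idempotent
          by (intro mult_mono bB add_nonneg_nonneg divide_nonneg_nonneg abs_ge_zero of_nat_0_le_iff)
      qed measurable
      have "expectation (\<lambda>\<omega>. \<bar>cond_cov n s t \<omega> - cov_sheet s t\<bar>) \<le> expectation (\<lambda>\<omega>. \<bar>?A \<omega> - a\<bar> * \<bar>?B \<omega>\<bar> + \<bar>a\<bar> * \<bar>?B \<omega> - b\<bar>)"
      proof (rule integral_mono)
        show "integrable M (\<lambda>\<omega>. \<bar>cond_cov n s t \<omega> - cov_sheet s t\<bar>)" using cond_cov_integrable by auto
        show "integrable M (\<lambda>\<omega>. \<bar>?A \<omega> - a\<bar> * \<bar>?B \<omega>\<bar> + \<bar>a\<bar> * \<bar>?B \<omega> - b\<bar>)" using i1 iB by auto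
        fix \<omega>
        have "cond_cov n s t \<omega> - cov_sheet s t = (?A \<omega> - a) * ?B \<omega> + a * (?B \<omega> - b)"
          unfolding cc cov_sheet_def a_def[symmetric] b_def[symmetric] by (simp add: algebra_simps)
        then show "\<bar>cond_cov n s t \<omega> - cov_sheet s t\<bar> \<le> \<bar>?A \<omega> - a\<bar> * \<bar>?B \<omega>\<bar> + \<bar>a\<bar> * \<bar>?B \<omega> - b\<bar>"
          by (metis abs_mult abs_triangle_ineq)
      qed
      also have "\<dots> = f (fst n) * expectation (\<lambda>\<omega>. \<bar>?B \<omega>\<bar>) + \<bar>a\<bar> * g (snd n)"
        using i1 iB by (simp add: prodE g_def)
      also have "\<dots> \<le> f (fst n) * (g (snd n) + \<bar>b\<bar>) + \<bar>a\<bar> * g (snd n)"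
      proof (intro add_right_mono mult_left_mono)
        have "expectation (\<lambda>\<omega>. \<bar>?B \<omega>\<bar>) \<le> expectation (\<lambda>\<omega>. \<bar>?B \<omega> - b\<bar> + \<bar>b\<bar>)"
          using iB by (intro integral_mono) auto
        then show "expectation (\<lambda>\<omega>. \<bar>?B \<omega>\<bar>) \<le> g (snd n) + \<bar>b\<bar>" using iB by (simp add: g_def prob_space)
      qed (simp add: f_def)
      finally show "norm (expectation (\<lambda>\<omega>. \<bar>cond_cov n s t \<omega> - cov_sheet s t\<bar>))
        \<le> f (fst n) * (g (snd n) + \<bar>b\<bar>) + \<bar>a\<bar> * g (snd n)" by simp
    qed
  qed
qed

text \<open>The left side is the variance of the combination given the paths. Parities multiply over
  rows and columns and the boxes form a rectangle, so each term splits into a row sum and a column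
  sum.\<close>

lemma boxes_weight_sq:
  assumes T: "finite T" "\<forall>t\<in>T. k1 t \<le> K" "\<forall>t\<in>T. k2 t \<le> K"
  shows "(\<Sum>l\<in>boxes K \<omega>. (weight T u k1 k2 \<omega> l)\<^sup>2) =
    (\<Sum>s\<in>T. \<Sum>t\<in>T. u s * u t * (ip (K1.path \<omega>) (k1 s) (k1 t) * ip (K2.path \<omega>) (k2 s) (k2 t)))"
proof -
  let ?p1 = "\<lambda>t l. parity (K1.path \<omega>) {1..k1 t} l" and ?p2 = "\<lambda>t l. parity (K2.path \<omega>) {1..k2 t} l"
  let ?F1 = "K1.path \<omega> ` {1..K}" and ?F2 = "K2.path \<omega> ` {1..K}"
  have od1: "odds (K1.path \<omega>) {1..k1 t} \<subseteq> ?F1" if "t \<in> T" for t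
    by (rule order_trans[OF odds_subset image_mono]) (use T(2) that in auto)
  have od2: "odds (K2.path \<omega>) {1..k2 t} \<subseteq> ?F2" if "t \<in> T" for t
    by (rule order_trans[OF odds_subset image_mono]) (use T(3) that in auto)
  have "(\<Sum>l\<in>boxes K \<omega>. (weight T u k1 k2 \<omega> l)\<^sup>2) =
    (\<Sum>l\<in>boxes K \<omega>. \<Sum>s\<in>T. \<Sum>t\<in>T. u s * u t * ((?p1 s (fst l) * ?p1 t (fst l)) * (?p2 s (snd l) * ?p2 t (snd l))))"
    unfolding weight_def power2_eq_square sum_product by (intro sum.cong refl) (simp add: mult_ac)
  also have "\<dots> = (\<Sum>s\<in>T. \<Sum>l\<in>boxes K \<omega>. \<Sum>t\<in>T. u s * u t * ((?p1 s (fst l) * ?p1 t (fst l)) * (?p2 s (snd l) * ?p2 t (snd l))))"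
    by (rule sum.swap)
  also have "\<dots> = (\<Sum>s\<in>T. \<Sum>t\<in>T. \<Sum>l\<in>boxes K \<omega>. u s * u t * ((?p1 s (fst l) * ?p1 t (fst l)) * (?p2 s (snd l) * ?p2 t (snd l))))"
    by (intro sum.cong refl sum.swap)
  also have "\<dots> = (\<Sum>s\<in>T. \<Sum>t\<in>T. u s * u t * (ip (K1.path \<omega>) (k1 s) (k1 t) * ip (K2.path \<omega>) (k2 s) (k2 t)))"
  proof (intro sum.cong refl)
    fix s t assume st: "s \<in> T" "t \<in> T"
    have "(\<Sum>l\<in>boxes K \<omega>. u s * u t * ((?p1 s (fst l) * ?p1 t (fst l)) * (?p2 s (snd l) * ?p2 t (snd l))))
      = u s * u t * (\<Sum>l\<in>?F1 \<times> ?F2. (?p1 s (fst l) * ?p1 t (fst l)) * (?p2 s (snd l) * ?p2 t (snd l)))"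
      unfolding boxes_def by (simp only: sum_distrib_left)
    also have "(\<Sum>l\<in>?F1 \<times> ?F2. (?p1 s (fst l) * ?p1 t (fst l)) * (?p2 s (snd l) * ?p2 t (snd l)))
      = (\<Sum>l1\<in>?F1. ?p1 s l1 * ?p1 t l1) * (\<Sum>l2\<in>?F2. ?p2 s l2 * ?p2 t l2)"
      unfolding sum_product sum.cartesian_product by (intro sum.cong refl) auto
    also have "\<dots> = ip (K1.path \<omega>) (k1 s) (k1 t) * ip (K2.path \<omega>) (k2 s) (k2 t)"
    proof -
      have "(\<Sum>l1\<in>?F1. ?p1 s l1 * ?p1 t l1) = ip (K1.path \<omega>) (k1 s) (k1 t)"
        by (rule sum_parity_prod[OF _ od1 od1]) (use st in auto)
      moreover have "(\<Sum>l2\<in>?F2. ?p2 s l2 * ?p2 t l2) = ip (K2.path \<omega>) (k2 s) (k2 t)"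
        by (rule sum_parity_prod[OF _ od2 od2]) (use st in auto)
      ultimately show ?thesis by simp
    qed
    finally show "(\<Sum>l\<in>boxes K \<omega>. u s * u t * ((?p1 s (fst l) * ?p1 t (fst l)) * (?p2 s (snd l) * ?p2 t (snd l))))
      = u s * u t * (ip (K1.path \<omega>) (k1 s) (k1 t) * ip (K2.path \<omega>) (k2 s) (k2 t))" .
  qed
  finally show ?thesis .
qed

lemma weight_abs_le: "\<bar>weight T u k1 k2 \<omega> l\<bar> \<le> (\<Sum>t\<in>T. \<bar>u t\<bar>)"
  unfolding weight_def
proof (intro order_trans[OF sum_abs] sum_mono)
  fix t show "\<bar>u t * (parity (K1.path \<omega>) {1..k1 t} (fst l) * parity (K2.path \<omega>) {1..k2 t} (snd l))\<bar> \<le> \<bar>u t\<bar>"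
    by (auto simp: parity_def)
qed

definition form :: "(real \<times> real) set \<Rightarrow> (real \<times> real \<Rightarrow> real) \<Rightarrow> real" where
  "form T u = (\<Sum>s\<in>T. \<Sum>t\<in>T. u s * u t * cov_sheet s t)"

definition cond_form :: "nat \<times> nat \<Rightarrow> (real \<times> real) set \<Rightarrow> (real \<times> real \<Rightarrow> real) \<Rightarrow> 'a \<Rightarrow> real" where
  "cond_form n T u \<omega> = (\<Sum>s\<in>T. \<Sum>t\<in>T. u s * u t * cond_cov n s t \<omega>)"

lemma cond_form_integrable: "integrable M (cond_form n T u)"
  unfolding cond_form_def[abs_def] by (intro Bochner_Integration.integrable_sum integrable_mult_right cond_cov_integrable)

lemma cond_form_L1:
  assumes T: "finite T" "T \<subseteq> {0..} \<times> {0..}"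
  shows "((\<lambda>n. expectation (\<lambda>\<omega>. \<bar>cond_form n T u \<omega> - form T u\<bar>)) \<longlongrightarrow> 0) pair_filter"
proof (rule Lim_null_comparison)
  let ?B = "\<lambda>n. \<Sum>s\<in>T. \<Sum>t\<in>T. \<bar>u s * u t\<bar> * expectation (\<lambda>\<omega>. \<bar>cond_cov n s t \<omega> - cov_sheet s t\<bar>)"
  have "(?B \<longlongrightarrow> (\<Sum>s\<in>T. \<Sum>t\<in>T. \<bar>u s * u t\<bar> * 0)) pair_filter"
    by (intro tendsto_sum tendsto_mult tendsto_const cond_cov_L1) (use T(2) in auto)
  then show "(?B \<longlongrightarrow> 0) pair_filter" by simp
  show "\<forall>\<^sub>F n in pair_filter. norm (expectation (\<lambda>\<omega>. \<bar>cond_form n T u \<omega> - form T u\<bar>)) \<le> ?B n"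
  proof (intro always_eventually allI)
    fix n
    have i: "integrable M (\<lambda>\<omega>. \<bar>cond_cov n s t \<omega> - cov_sheet s t\<bar>)" for s t
      using cond_cov_integrable[of n s t] by auto
    have "expectation (\<lambda>\<omega>. \<bar>cond_form n T u \<omega> - form T u\<bar>)
      \<le> expectation (\<lambda>\<omega>. \<Sum>s\<in>T. \<Sum>t\<in>T. \<bar>u s * u t\<bar> * \<bar>cond_cov n s t \<omega> - cov_sheet s t\<bar>)"
    proof (rule integral_mono)
      show "integrable M (\<lambda>\<omega>. \<bar>cond_form n T u \<omega> - form T u\<bar>)" using cond_form_integrable[of n T u] by auto
      show "integrable M (\<lambda>\<omega>. \<Sum>s\<in>T. \<Sum>t\<in>T. \<bar>u s * u t\<bar> * \<bar>cond_cov n s t \<omega> - cov_sheet s t\<bar>)"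
        by (intro Bochner_Integration.integrable_sum integrable_mult_right i)
      fix \<omega>
      have eq: "cond_form n T u \<omega> - form T u = (\<Sum>s\<in>T. \<Sum>t\<in>T. u s * u t * (cond_cov n s t \<omega> - cov_sheet s t))"
        unfolding cond_form_def form_def by (simp add: sum_subtractf right_diff_distrib)
      show "\<bar>cond_form n T u \<omega> - form T u\<bar> \<le> (\<Sum>s\<in>T. \<Sum>t\<in>T. \<bar>u s * u t\<bar> * \<bar>cond_cov n s t \<omega> - cov_sheet s t\<bar>)"
        unfolding eq abs_mult[symmetric, of "u _ * u _"] by (intro order_trans[OF sum_abs] sum_mono order_refl)
    qed
    also have "\<dots> = ?B n" by (simp add: i)
    finally show "norm (expectation (\<lambda>\<omega>. \<bar>cond_form n T u \<omega> - form T u\<bar>)) \<le> ?B n" by simp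
  qed
qed

lemma norming_at_top: "filterlim (\<lambda>n. norming (fst n) (snd n)) at_top pair_filter"
proof -
  have r1: "filterlim (\<lambda>n. K1.r (real n)) at_top sequentially"
    by (rule filterlim_compose[OF K1.r_at_top filterlim_real_sequentially])
  have r2: "filterlim (\<lambda>n. K2.r (real n)) at_top sequentially"
    by (rule filterlim_compose[OF K2.r_at_top filterlim_real_sequentially])
  have "filterlim (\<lambda>n. K1.r (real (fst n)) * K2.r (real (snd n))) at_top pair_filter"
    by (intro filterlim_at_top_mult_at_top filterlim_compose[OF r1 filterlim_fst_pair] filterlim_compose[OF r2 filterlim_snd_pair])
  then show ?thesis unfolding norming_def by (rule filterlim_compose[OF sqrt_at_top])
qed

lemma eventually_pos_pair: "\<forall>\<^sub>F n in pair_filter. fst n > 0 \<and> snd n > 0"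
  unfolding eventually_pair_filter by (intro exI[of _ 1]) auto

lemma X_combination:
  "(\<Sum>t\<in>T. u t * X n t \<omega>) = (\<Sum>t\<in>T. (u t / norming (fst n) (snd n)) *
     S (nat \<lfloor>real (fst n) * fst t\<rfloor>) (nat \<lfloor>real (snd n) * snd t\<rfloor>) \<omega>)"
  unfolding X_def by simp

lemma weight_sq_cond_form:
  assumes T: "finite T" "\<forall>t\<in>T. nat \<lfloor>real (fst n) * fst t\<rfloor> \<le> K" "\<forall>t\<in>T. nat \<lfloor>real (snd n) * snd t\<rfloor> \<le> K"
    and n: "fst n > 0" "snd n > 0"
  shows "(\<Sum>l\<in>boxes K \<omega>. (weight T (\<lambda>t. u t / norming (fst n) (snd n)) (\<lambda>t. nat \<lfloor>real (fst n) * fst t\<rfloor>)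
     (\<lambda>t. nat \<lfloor>real (snd n) * snd t\<rfloor>) \<omega> l)\<^sup>2) = cond_form n T u \<omega>"
proof -
  let ?N = "norming (fst n) (snd n)"
  have r: "K1.r (real (fst n)) > 0" "K2.r (real (snd n)) > 0" using n by (auto intro!: K1.r_pos K2.r_pos)
  have N: "?N * ?N = K1.r (real (fst n)) * K2.r (real (snd n))" using r by (simp add: norming_def)
  show ?thesis
    unfolding boxes_weight_sq[OF T] cond_form_def cond_cov_def
    by (intro sum.cong refl) (simp add: N)
qed

lemma expectation_cond_form:
  assumes T: "finite T" "T \<subseteq> {0..} \<times> {0..}"
  shows "((\<lambda>n. expectation (cond_form n T u)) \<longlongrightarrow> form T u) pair_filter"
proof -
  have "((\<lambda>n. expectation (cond_form n T u) - form T u) \<longlongrightarrow> 0) pair_filter"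
  proof (rule Lim_null_comparison[OF _ cond_form_L1[OF T, of u]], intro always_eventually allI)
    fix n
    have "\<bar>expectation (\<lambda>\<omega>. cond_form n T u \<omega> - form T u)\<bar> \<le> expectation (\<lambda>\<omega>. \<bar>cond_form n T u \<omega> - form T u\<bar>)"
      by (rule integral_abs_bound)
    then show "norm (expectation (cond_form n T u) - form T u) \<le> expectation (\<lambda>\<omega>. \<bar>cond_form n T u \<omega> - form T u\<bar>)"
      using cond_form_integrable[of n T u] by (simp add: prob_space)
  qed
  from tendsto_add[OF this tendsto_const[of "form T u"]] show ?thesis by simp
qed

lemma cond_form_nonneg:
  assumes T: "finite T" and n: "fst n > 0 \<and> snd n > 0"
  shows "0 \<le> expectation (cond_form n T u)"
proof -
  define K where "K = Max (insert 0 ((\<lambda>t. nat \<lfloor>real (fst n) * fst t\<rfloor>) ` T \<union> (\<lambda>t. nat \<lfloor>real (snd n) * snd t\<rfloor>) ` T))"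
  have K: "\<forall>t\<in>T. nat \<lfloor>real (fst n) * fst t\<rfloor> \<le> K" "\<forall>t\<in>T. nat \<lfloor>real (snd n) * snd t\<rfloor> \<le> K"
    unfolding K_def using T by (auto intro!: Max_ge)
  have "0 \<le> cond_form n T u \<omega>" for \<omega>
    unfolding weight_sq_cond_form[OF T K conjunct1[OF n] conjunct2[OF n], symmetric] by (intro sum_nonneg) auto
  then show ?thesis by (intro integral_nonneg_AE) auto
qed

text \<open>Khinchine's inequality at a single time with m = 1; boundedness is what counts, not the
  constant. It later controls the mass outside large cubes.\<close>

lemma X_second_moment:
  assumes t: "t \<in> {0..} \<times> {0..}"
  obtains C where "\<forall>\<^sub>F n in pair_filter. expectation (\<lambda>\<omega>. (X n t \<omega>)\<^sup>2) \<le> C"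
proof -
  define T where "T = {t}"
  have T: "finite T" "T \<subseteq> {0..} \<times> {0..}" using t by (auto simp: T_def)
  let ?u = "\<lambda>_::real \<times> real. 1 :: real"
  have "\<forall>\<^sub>F n in pair_filter. expectation (cond_form n T ?u) < form T ?u + 1"
    by (rule order_tendstoD(2)[OF expectation_cond_form[OF T]]) simp
  with eventually_pos_pair
  have "\<forall>\<^sub>F n in pair_filter. expectation (\<lambda>\<omega>. (X n t \<omega>)\<^sup>2) \<le> 2 * fact 2 * exp 1 * (form T ?u + 1)"
  proof eventually_elim
    case (elim n)
    let ?k1 = "\<lambda>t::real \<times> real. nat \<lfloor>real (fst n) * fst t\<rfloor>" and ?k2 = "\<lambda>t::real \<times> real. nat \<lfloor>real (snd n) * snd t\<rfloor>"
    define K where "K = max (?k1 t) (?k2 t)"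
    have K: "\<forall>t\<in>T. ?k1 t \<le> K" "\<forall>t\<in>T. ?k2 t \<le> K" by (auto simp: T_def K_def)
    let ?v = "\<lambda>t::real \<times> real. 1 / norming (fst n) (snd n)"
    have W: "(\<Sum>l\<in>boxes K \<omega>. (weight T ?v ?k1 ?k2 \<omega> l)\<^sup>2) = cond_form n T ?u \<omega>" for \<omega>
      by (rule weight_sq_cond_form[OF T(1) K]) (use elim in auto)
    have "expectation (\<lambda>\<omega>. (\<Sum>t\<in>T. ?v t * S (?k1 t) (?k2 t) \<omega>) ^ (2 * 1))
      \<le> 2 * fact (2 * 1) * exp 1 * expectation (\<lambda>\<omega>. (\<Sum>l\<in>boxes K \<omega>. (weight T ?v ?k1 ?k2 \<omega> l)\<^sup>2) ^ 1)"
      by (rule expectation_power_combination[OF T(1) K]) (use cond_form_integrable[of n T ?u] in \<open>auto simp: W\<close>)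
    also have "\<dots> = 2 * fact 2 * exp 1 * expectation (cond_form n T ?u)" by (simp add: W)
    also have "\<dots> \<le> 2 * fact 2 * exp 1 * (form T ?u + 1)" using elim by (intro mult_left_mono) auto
    finally show ?case by (simp add: T_def X_def)
  qed
  then show ?thesis by (rule that)
qed

text \<open>Given the paths, the mean is a product of cosines. Every weight is at most
  \<open>U\<close> over the norming, so the product differs from exp (-Q / 2) by at most the squared
  maximal weight times Q, where Q is the variance given the paths; and Q converges to
  \<open>form T u\<close> in mean.\<close>

lemma fdd_cos:
  assumes T: "finite T" "T \<subseteq> {0..} \<times> {0..}"
  shows "((\<lambda>n. expectation (\<lambda>\<omega>. cos ((\<Sum>t\<in>T. u t * X n t \<omega>) + b))) \<longlongrightarrow> cos b * exp (- (form T u / 2))) pair_filter"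
proof -
  define q where "q = form T u"
  define U where "U = (\<Sum>t\<in>T. \<bar>u t\<bar>)"
  define e where "e n = expectation (\<lambda>\<omega>. \<bar>cond_form n T u \<omega> - q\<bar>)" for n
  have e0: "(e \<longlongrightarrow> 0) pair_filter" unfolding e_def q_def by (rule cond_form_L1[OF T])
  have "((\<lambda>n. (1 / norming (fst n) (snd n))) \<longlongrightarrow> 0) pair_filter"
    by (rule real_tendsto_divide_at_top[OF tendsto_const norming_at_top])
  then have lim: "((\<lambda>n. (U * (1 / norming (fst n) (snd n)))\<^sup>2 * (\<bar>q\<bar> + e n) + e n) \<longlongrightarrow> (U * 0)\<^sup>2 * (\<bar>q\<bar> + 0) + 0) pair_filter"
    by (intro tendsto_intros e0)
  have "((\<lambda>n. expectation (\<lambda>\<omega>. cos ((\<Sum>t\<in>T. u t * X n t \<omega>) + b)) - cos b * exp (- (q / 2))) \<longlongrightarrow> 0) pair_filter"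
  proof (rule Lim_null_comparison)
    show "((\<lambda>n. (U * (1 / norming (fst n) (snd n)))\<^sup>2 * (\<bar>q\<bar> + e n) + e n) \<longlongrightarrow> 0) pair_filter" using lim by simp
    show "\<forall>\<^sub>F n in pair_filter. norm (expectation (\<lambda>\<omega>. cos ((\<Sum>t\<in>T. u t * X n t \<omega>) + b)) - cos b * exp (- (q / 2)))
       \<le> (U * (1 / norming (fst n) (snd n)))\<^sup>2 * (\<bar>q\<bar> + e n) + e n"
      using eventually_pos_pair
    proof eventually_elim
      case (elim n)
      let ?N = "norming (fst n) (snd n)"
      have r: "K1.r (real (fst n)) > 0" "K2.r (real (snd n)) > 0" using elim by (auto intro!: K1.r_pos K2.r_pos)
      have N: "?N > 0" using r by (simp add: norming_def)
      define k1 where "k1 t = nat \<lfloor>real (fst n) * fst t\<rfloor>" for t :: "real \<times> real"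
      define k2 where "k2 t = nat \<lfloor>real (snd n) * snd t\<rfloor>" for t :: "real \<times> real"
      define K where "K = Max (insert 0 (k1 ` T \<union> k2 ` T))"
      have K: "\<forall>t\<in>T. k1 t \<le> K" "\<forall>t\<in>T. k2 t \<le> K" unfolding K_def using T(1) by (auto intro!: Max_ge)
      define v where "v t = u t / ?N" for t
      define W where "W \<omega> = weight T v k1 k2 \<omega>" for \<omega>
      have W2: "(\<Sum>l\<in>boxes K \<omega>. (W \<omega> l)\<^sup>2) = cond_form n T u \<omega>" for \<omega>
        using weight_sq_cond_form[OF T(1), of n K u \<omega>] K elim
        unfolding W_def v_def[abs_def] k1_def[abs_def] k2_def[abs_def] by simp
      have Wb: "\<bar>W \<omega> l\<bar> \<le> U * (1 / ?N)" for \<omega> l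
      proof -
        have "\<bar>W \<omega> l\<bar> \<le> (\<Sum>t\<in>T. \<bar>v t\<bar>)" unfolding W_def by (rule weight_abs_le)
        also have "\<dots> = U * (1 / ?N)" using N by (simp add: v_def U_def sum_divide_distrib[symmetric])
        finally show ?thesis .
      qed
      define g where "g \<omega> = cos b * (\<Prod>l\<in>boxes K \<omega>. cos (W \<omega> l))" for \<omega>
      have Eg: "expectation (\<lambda>\<omega>. cos ((\<Sum>t\<in>T. u t * X n t \<omega>) + b)) = expectation g" and gm: "g \<in> borel_measurable M"
        using expectation_cos_combination[OF T(1) K, where u = v and b = b]
        unfolding X_combination g_def[abs_def] W_def v_def[abs_def] k1_def[abs_def] k2_def[abs_def] by simp_all
      have gb: "\<bar>g \<omega>\<bar> \<le> 1" for \<omega>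
        unfolding g_def abs_mult abs_prod by (intro mult_le_one prod_le_1) (auto intro: prod_nonneg)
      have gi: "integrable M g" using gm gb by (intro integrable_const_bound[where B = 1] AE_I2) auto
      have ci: "integrable M (cond_form n T u)" by (rule cond_form_integrable)
      have pt: "\<bar>g \<omega> - cos b * exp (- (q / 2))\<bar> \<le> (U * (1 / ?N))\<^sup>2 * cond_form n T u \<omega> + \<bar>cond_form n T u \<omega> - q\<bar>" (is "_ \<le> ?R")
        if "q \<ge> 0" for \<omega>
      proof -
        let ?Q = "cond_form n T u \<omega>"
        have Q0: "?Q \<ge> 0" unfolding W2[symmetric] by (intro sum_nonneg) auto
        have "\<bar>(\<Prod>l\<in>boxes K \<omega>. cos (W \<omega> l)) - (\<Prod>l\<in>boxes K \<omega>. exp (- ((W \<omega> l)\<^sup>2 / 2)))\<bar>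
          \<le> (\<Sum>l\<in>boxes K \<omega>. \<bar>cos (W \<omega> l) - exp (- ((W \<omega> l)\<^sup>2 / 2))\<bar>)"
          by (rule abs_prod_diff_le[OF finite_boxes]) auto
        also have "\<dots> \<le> (\<Sum>l\<in>boxes K \<omega>. (U * (1 / ?N))\<^sup>2 * (W \<omega> l)\<^sup>2)"
        proof (intro sum_mono order_trans[OF cos_exp_diff])
          fix l
          have "(W \<omega> l)\<^sup>2 \<le> (U * (1 / ?N))\<^sup>2" using Wb[of \<omega> l] by (metis abs_ge_zero power2_abs power_mono)
          then have "(W \<omega> l)\<^sup>2 * (W \<omega> l)\<^sup>2 \<le> (U * (1 / ?N))\<^sup>2 * (W \<omega> l)\<^sup>2" by (intro mult_right_mono) auto
          then show "W \<omega> l ^ 4 \<le> (U * (1 / ?N))\<^sup>2 * (W \<omega> l)\<^sup>2" by (simp add: power_add[symmetric])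
        qed
        also have "\<dots> = (U * (1 / ?N))\<^sup>2 * ?Q" unfolding W2[symmetric] by (simp only: sum_distrib_left)
        also have "(\<Prod>l\<in>boxes K \<omega>. exp (- ((W \<omega> l)\<^sup>2 / 2))) = exp (- (?Q / 2))"
          unfolding W2[symmetric] by (simp add: exp_sum[OF finite_boxes, symmetric] sum_negf sum_divide_distrib)
        finally have 1: "\<bar>(\<Prod>l\<in>boxes K \<omega>. cos (W \<omega> l)) - exp (- (?Q / 2))\<bar> \<le> (U * (1 / ?N))\<^sup>2 * ?Q" .
        have lip: "exp (- x) - exp (- y) \<le> \<bar>y - x\<bar>" if "0 \<le> x" "0 \<le> y" for x y :: real
        proof -
          have "exp (- x) - exp (- y) = exp (- x) * (1 - exp (- (y - x)))" by (simp add: algebra_simps exp_add[symmetric])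
          also have "\<dots> \<le> exp (- x) * \<bar>y - x\<bar>"
          proof (rule mult_left_mono)
            show "1 - exp (- (y - x)) \<le> \<bar>y - x\<bar>"
              using exp_ge_add_one_self[of "- (y - x)"] abs_ge_self[of "y - x"] by linarith
          qed simp
          also have "\<dots> \<le> 1 * \<bar>y - x\<bar>" using that by (intro mult_right_mono) auto
          finally show ?thesis by simp
        qed
        have "\<bar>exp (- (?Q / 2)) - exp (- (q / 2))\<bar> \<le> \<bar>q / 2 - ?Q / 2\<bar>"
          using lip[of "?Q / 2" "q / 2"] lip[of "q / 2" "?Q / 2"] Q0 that by (simp add: abs_le_iff abs_minus_commute)
        also have "\<dots> \<le> \<bar>?Q - q\<bar>" by (simp add: diff_divide_distrib[symmetric] abs_minus_commute)
        finally have 2: "\<bar>exp (- (?Q / 2)) - exp (- (q / 2))\<bar> \<le> \<bar>?Q - q\<bar>" .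
        have "\<bar>g \<omega> - cos b * exp (- (q / 2))\<bar> = \<bar>cos b\<bar> * \<bar>(\<Prod>l\<in>boxes K \<omega>. cos (W \<omega> l)) - exp (- (q / 2))\<bar>"
          unfolding g_def abs_mult[symmetric] by (simp add: right_diff_distrib)
        also have "\<dots> \<le> 1 * \<bar>(\<Prod>l\<in>boxes K \<omega>. cos (W \<omega> l)) - exp (- (q / 2))\<bar>"
          by (intro mult_right_mono) auto
        also have "\<dots> \<le> \<bar>(\<Prod>l\<in>boxes K \<omega>. cos (W \<omega> l)) - exp (- (?Q / 2))\<bar> + \<bar>exp (- (?Q / 2)) - exp (- (q / 2))\<bar>"
          by simp
        also have "\<dots> \<le> ?R" by (rule add_mono[OF 1 2])
        finally show ?thesis .
      qed
      \<comment> \<open>Nonnegativity of the limit form is inherited from the prelimit, where it is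
        the mean of a sum of squares. The Lipschitz bound for exp (-x) holds on x >= 0.\<close>
      have q0: "q \<ge> 0"
      proof (rule tendsto_lowerbound)
        show "((\<lambda>n. expectation (cond_form n T u)) \<longlongrightarrow> q) pair_filter"
          unfolding q_def by (rule expectation_cond_form[OF T])
        show "\<forall>\<^sub>F n in pair_filter. 0 \<le> expectation (cond_form n T u)"
          using eventually_pos_pair by eventually_elim (use cond_form_nonneg[OF T(1)] in auto)
      qed (rule pair_filter_nonbot)
      have EQ: "expectation (cond_form n T u) \<le> \<bar>q\<bar> + e n"
      proof -
        have "expectation (cond_form n T u) \<le> expectation (\<lambda>\<omega>. \<bar>cond_form n T u \<omega> - q\<bar> + \<bar>q\<bar>)"
          using ci by (intro integral_mono) auto
        then show ?thesis using ci by (simp add: e_def prob_space)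
      qed
      have "\<bar>expectation g - cos b * exp (- (q / 2))\<bar> = \<bar>expectation (\<lambda>\<omega>. g \<omega> - cos b * exp (- (q / 2)))\<bar>"
        using gi by (simp add: prob_space)
      also have "\<dots> \<le> expectation (\<lambda>\<omega>. \<bar>g \<omega> - cos b * exp (- (q / 2))\<bar>)" by (rule integral_abs_bound)
      also have "\<dots> \<le> expectation (\<lambda>\<omega>. (U * (1 / ?N))\<^sup>2 * cond_form n T u \<omega> + \<bar>cond_form n T u \<omega> - q\<bar>)"
        by (rule integral_mono) (use gi ci pt[OF q0] in auto)
      also have "\<dots> = (U * (1 / ?N))\<^sup>2 * expectation (cond_form n T u) + e n"
        using ci by (simp add: e_def)
      also have "\<dots> \<le> (U * (1 / ?N))\<^sup>2 * (\<bar>q\<bar> + e n) + e n"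
        using EQ by (intro add_right_mono mult_left_mono) auto
      finally show ?case unfolding Eg real_norm_def .
    qed
  qed
  from tendsto_add[OF this tendsto_const[of "cos b * exp (- (q / 2))"]] show ?thesis by (simp add: q_def)
qed

end

section \<open>Chaining\<close>

lemma power_le_base: "x ^ q \<le> y ^ q \<Longrightarrow> 0 \<le> x \<Longrightarrow> 0 \<le> y \<Longrightarrow> q > 0 \<Longrightarrow> x \<le> (y::real)"
  by (simp add: power_mono_iff)

text \<open>A form of Hoelder's inequality with geometric weights: the weighted sum of powers
  dominates each of its terms, so \<open>\<Delta> k\<close> is at most \<rho>^k times its q-th root,
  and the \<rho>^k are summable.\<close>

lemma sum_power_weighted_le:
  fixes \<Delta> :: "nat \<Rightarrow> real"
  assumes K: "finite K" and \<Delta>: "\<And>k. k \<in> K \<Longrightarrow> 0 \<le> \<Delta> k" and \<rho>: "0 < \<rho>" "\<rho> < 1" and q: "q > 0"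
  shows "(\<Sum>k\<in>K. \<Delta> k) ^ q \<le> (1 / (1 - \<rho>)) ^ q * (\<Sum>k\<in>K. \<Delta> k ^ q / (\<rho> ^ q) ^ k)"
proof -
  define A where "A = (\<Sum>k\<in>K. \<Delta> k ^ q / (\<rho> ^ q) ^ k)"
  have A0: "A \<ge> 0" unfolding A_def using \<Delta> \<rho> by (intro sum_nonneg) auto
  define a where "a = root q A"
  have a: "a \<ge> 0" "a ^ q = A" using A0 q by (auto simp: a_def)
  have le: "\<Delta> k \<le> \<rho> ^ k * a" if "k \<in> K" for k
  proof -
    have "\<Delta> k ^ q / (\<rho> ^ q) ^ k \<le> A"
      unfolding A_def using \<Delta> \<rho> by (intro member_le_sum[OF that _ K]) auto
    then have "\<Delta> k ^ q \<le> (\<rho> ^ q) ^ k * a ^ q" using \<rho> by (simp add: a(2) field_simps)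
    also have "\<dots> = (\<rho> ^ k * a) ^ q" by (simp add: power_mult_distrib power_mult[symmetric] mult.commute)
    finally show ?thesis by (rule power_le_base) (use \<rho> a q \<Delta>[OF that] in auto)
  qed
  have geo: "(\<Sum>k\<in>K. \<rho> ^ k) \<le> 1 / (1 - \<rho>)"
  proof -
    have "(\<Sum>k\<in>K. \<rho> ^ k) \<le> (\<Sum>k. \<rho> ^ k)" using \<rho> K by (intro sum_le_suminf summable_geometric) auto
    also have "\<dots> = 1 / (1 - \<rho>)" using \<rho> by (intro suminf_geometric) auto
    finally show ?thesis .
  qed
  have "(\<Sum>k\<in>K. \<Delta> k) \<le> (\<Sum>k\<in>K. \<rho> ^ k) * a" unfolding sum_distrib_right by (intro sum_mono le)
  also have "\<dots> \<le> 1 / (1 - \<rho>) * a" using geo a by (intro mult_right_mono)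
  finally have "(\<Sum>k\<in>K. \<Delta> k) ^ q \<le> (1 / (1 - \<rho>) * a) ^ q" using \<Delta> by (intro power_mono sum_nonneg) auto
  then show ?thesis by (simp only: power_mult_distrib a(2) A_def)
qed

text \<open>Level k has 2^k blocks of length 2^(M - k). Rounding down to level m instead of level m
  + 1 moves the rounded index by at most one block of level m + 1, so the errors telescope.\<close>

lemma dyadic_chain:
  fixes g :: "nat \<Rightarrow> real"
  assumes \<Delta>: "\<And>k j. k \<le> M \<Longrightarrow> j < 2 ^ k \<Longrightarrow> \<bar>g (Suc j * 2 ^ (M - k)) - g (j * 2 ^ (M - k))\<bar> \<le> \<Delta> k"
    and i: "i \<le> 2 ^ M" and m: "m \<le> M"
  shows "\<bar>g i - g (i div 2 ^ (M - m) * 2 ^ (M - m))\<bar> \<le> (\<Sum>k\<in>{m<..M}. \<Delta> k)"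
  using m
proof (induction rule: inc_induct)
  case base
  then show ?case by simp
next
  case (step m)
  have \<Delta>0: "0 \<le> \<Delta> k" if "k \<le> M" for k using \<Delta>[OF that, of 0] abs_ge_zero order_trans by fastforce
  define h :: nat where "h = 2 ^ (M - Suc m)"
  have h2: "2 ^ (M - m) = 2 * h" using step(2) by (simp add: h_def Suc_diff_Suc[symmetric] flip: power_Suc)
  define j where "j = i div (2 * h)"
  have h0: "h > 0" by (simp add: h_def)
  have ij: "i div h = 2 * j \<or> i div h = Suc (2 * j)"
  proof -
    have "i div h div 2 = j" by (simp add: j_def div_mult2_eq mult.commute)
    moreover have "x div 2 = j \<Longrightarrow> x = 2 * j \<or> x = Suc (2 * j)" for x by presburger
    ultimately show ?thesis by blast
  qed
  have "\<bar>g (i div h * h) - g (j * (2 * h))\<bar> \<le> \<Delta> (Suc m)"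
    using ij
  proof
    assume "i div h = 2 * j"
    then show ?thesis using \<Delta>0[of "Suc m"] step(2) by (simp add: mult_ac)
  next
    assume e: "i div h = Suc (2 * j)"
    have "i div h * h \<le> i" by (rule div_times_less_eq_dividend)
    also have "\<dots> \<le> 2 ^ Suc m * h" using i step(2) by (simp add: h_def power_add[symmetric] flip: power_Suc)
    finally have "Suc (2 * j) \<le> 2 ^ Suc m" unfolding e using h0 by (simp only: mult_le_cancel2)
    then have "2 * j < 2 ^ Suc m" by simp
    from \<Delta>[OF _ this] step(2) show ?thesis unfolding e h_def[symmetric] by (simp only: mult_ac)
  qed
  moreover have "\<bar>g i - g (i div h * h)\<bar> \<le> (\<Sum>k\<in>{Suc m<..M}. \<Delta> k)" using step.IH by (simp add: h_def)
  ultimately have "\<bar>g i - g (j * (2 * h))\<bar> \<le> \<Delta> (Suc m) + (\<Sum>k\<in>{Suc m<..M}. \<Delta> k)" by linarith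
  also have "\<dots> = (\<Sum>k\<in>{m<..M}. \<Delta> k)"
  proof -
    have "{m<..M} = insert (Suc m) {Suc m<..M}" using step(2) by auto
    then show ?thesis by simp
  qed
  finally show ?case unfolding h2 j_def .
qed

text \<open>Two indices at most one block of level m apart round to the same or to neighbouring
  points of that level. This makes two chains and one block increment; starting the sum at m instead
  of m + 1 pays for the increment.\<close>

lemma dyadic_modulus:
  fixes g :: "nat \<Rightarrow> real"
  assumes \<Delta>: "\<And>k j. k \<le> M \<Longrightarrow> j < 2 ^ k \<Longrightarrow> \<bar>g (Suc j * 2 ^ (M - k)) - g (j * 2 ^ (M - k))\<bar> \<le> \<Delta> k"
    and i: "i \<le> i'" "i' \<le> 2 ^ M" "i' \<le> i + 2 ^ (M - m)" and m: "m \<le> M"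
  shows "\<bar>g i - g i'\<bar> \<le> 2 * (\<Sum>k\<in>{m..M}. \<Delta> k)"
proof -
  have \<Delta>0: "0 \<le> \<Delta> k" if "k \<le> M" for k using \<Delta>[OF that, of 0] abs_ge_zero order_trans by fastforce
  define h :: nat where "h = 2 ^ (M - m)"
  have h0: "h > 0" by (simp add: h_def)
  have c: "\<bar>g i - g (i div h * h)\<bar> \<le> (\<Sum>k\<in>{m<..M}. \<Delta> k)" "\<bar>g i' - g (i' div h * h)\<bar> \<le> (\<Sum>k\<in>{m<..M}. \<Delta> k)"
    unfolding h_def using i by (auto intro!: dyadic_chain[OF \<Delta>] m)
  have "i div h \<le> i' div h" using i(1) by (rule div_le_mono)
  moreover have "i' div h \<le> (i + h) div h" using i(3) unfolding h_def by (rule div_le_mono)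
  then have "i' div h \<le> Suc (i div h)" using h0 by simp
  ultimately have "i' div h = i div h \<or> i' div h = Suc (i div h)" by auto
  then have d: "\<bar>g (i div h * h) - g (i' div h * h)\<bar> \<le> \<Delta> m"
  proof
    assume "i' div h = i div h" then show ?thesis using \<Delta>0[OF m] by simp
  next
    assume e: "i' div h = Suc (i div h)"
    have "i' div h * h \<le> i'" by (rule div_times_less_eq_dividend)
    also have "\<dots> \<le> 2 ^ m * h" using i(2) m by (simp add: h_def power_add[symmetric])
    finally have "Suc (i div h) \<le> 2 ^ m" unfolding e using h0 by (simp only: mult_le_cancel2)
    then have "i div h < 2 ^ m" by simp
    from \<Delta>[OF m this] show ?thesis unfolding e h_def[symmetric] by (simp only: abs_minus_commute)
  qed
  have "{m..M} = insert m {m<..M}" using m by auto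
  then have s: "(\<Sum>k\<in>{m..M}. \<Delta> k) = \<Delta> m + (\<Sum>k\<in>{m<..M}. \<Delta> k)" by simp
  have "\<bar>g i - g i'\<bar> \<le> \<bar>g i - g (i div h * h)\<bar> + \<bar>g (i div h * h) - g (i' div h * h)\<bar> + \<bar>g i' - g (i' div h * h)\<bar>"
    by linarith
  also have "\<dots> \<le> (\<Sum>k\<in>{m<..M}. \<Delta> k) + \<Delta> m + (\<Sum>k\<in>{m<..M}. \<Delta> k)" by (intro add_mono c d)
  also have "\<dots> \<le> 2 * (\<Sum>k\<in>{m..M}. \<Delta> k)" unfolding s using \<Delta>0[OF m] by simp
  finally show ?thesis .
qed

section \<open>Chaining in two parameters\<close>

definition rect_inc :: "(nat \<Rightarrow> nat \<Rightarrow> real) \<Rightarrow> nat \<Rightarrow> nat \<Rightarrow> nat \<Rightarrow> nat \<Rightarrow> real" where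
  "rect_inc s i i' j j' = (s i' j' - s i j') - (s i' j - s i j)"

definition block_inc :: "(nat \<Rightarrow> nat \<Rightarrow> real) \<Rightarrow> nat \<Rightarrow> nat \<Rightarrow> nat \<Rightarrow> nat \<Rightarrow> nat \<Rightarrow> nat \<Rightarrow> real" where
  "block_inc s M1 M2 k j k' j' =
     rect_inc s (j * 2 ^ (M1 - k)) (Suc j * 2 ^ (M1 - k)) (j' * 2 ^ (M2 - k')) (Suc j' * 2 ^ (M2 - k'))"

text \<open>The random variable dominating the modulus of continuity in the first direction: increments
  over dyadic blocks of level k enter with weight b^(-k), and the supremum over the second
  coordinate is itself bounded by a dyadic sum.\<close>

definition modulus_sum :: "nat \<Rightarrow> real \<Rightarrow> (nat \<Rightarrow> nat \<Rightarrow> real) \<Rightarrow> nat \<Rightarrow> nat \<Rightarrow> nat \<Rightarrow> real" where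
  "modulus_sum q b s M1 M2 m =
     (\<Sum>k\<in>{m..M1}. \<Sum>j<2 ^ k. \<Sum>k'\<le>M2. \<Sum>j'<2 ^ k'. \<bar>block_inc s M1 M2 k j k' j'\<bar> ^ q / b ^ k' / b ^ k)"

text \<open>An outer chain in the first coordinate at fixed j; each of its increments, as a function
  \<open>z\<close> of the second coordinate, is bounded by an inner chain starting from the axis,
  where \<open>s\<close> vanishes. The choice of \<open>\<rho>\<close> makes
  \<open>\<rho> ^ q\<close> equal to b.\<close>

lemma modulus_sum_bound:
  fixes s :: "nat \<Rightarrow> nat \<Rightarrow> real"
  assumes b: "0 < b" "b < 1" and q: "q > 0" and s0: "\<And>i. s i 0 = 0"
    and i: "i \<le> i'" "i' \<le> 2 ^ M1" "i' \<le> i + 2 ^ (M1 - m)" and m: "m \<le> M1" and j: "j \<le> 2 ^ M2"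
  defines "\<rho> \<equiv> root q b"
  shows "\<bar>s i j - s i' j\<bar> ^ q \<le> 2 ^ q * ((1 / (1 - \<rho>)) ^ q * (1 / (1 - \<rho>)) ^ q) * modulus_sum q b s M1 M2 m"
proof -
  have \<rho>: "0 < \<rho>" "\<rho> < 1" "\<rho> ^ q = b" using b q by (auto simp: \<rho>_def)
  define c where "c = (1 / (1 - \<rho>)) ^ q"
  have c: "c \<ge> 0" using \<rho> by (simp add: c_def)
  define R where "R k l = (\<Sum>k'\<le>M2. \<Sum>j'<2 ^ k'. \<bar>block_inc s M1 M2 k l k' j'\<bar> ^ q / b ^ k')" for k l
  have R0: "R k l \<ge> 0" for k l unfolding R_def using b by (intro sum_nonneg) auto
  \<comment> \<open>The root of a sum of q-th powers over blocks majorizes the maximum over blocks,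
    and the expectation of its q-th power is a sum of moments.\<close>
  define \<Delta> where "\<Delta> k = root q (c * (\<Sum>l<2 ^ k. R k l))" for k
  have \<Delta>q: "\<Delta> k ^ q = c * (\<Sum>l<2 ^ k. R k l)" for k
    unfolding \<Delta>_def using q c R0 by (intro real_root_pow_pos2 mult_nonneg_nonneg sum_nonneg) auto
  have \<Delta>0: "\<Delta> k \<ge> 0" for k unfolding \<Delta>_def using q c R0
    by (intro real_root_ge_zero mult_nonneg_nonneg sum_nonneg) auto
  have inc: "\<bar>s (Suc l * 2 ^ (M1 - k)) j - s (l * 2 ^ (M1 - k)) j\<bar> \<le> \<Delta> k" if k: "k \<le> M1" "l < 2 ^ k" for k l
  proof -
    define z where "z n = s (Suc l * 2 ^ (M1 - k)) n - s (l * 2 ^ (M1 - k)) n" for n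
    define d where "d k' = root q (\<Sum>j'<2 ^ k'. \<bar>block_inc s M1 M2 k l k' j'\<bar> ^ q)" for k'
    have dq: "d k' ^ q = (\<Sum>j'<2 ^ k'. \<bar>block_inc s M1 M2 k l k' j'\<bar> ^ q)" for k'
      unfolding d_def using q by (intro real_root_pow_pos2 sum_nonneg) auto
    have d0: "d k' \<ge> 0" for k' unfolding d_def using q by (intro real_root_ge_zero sum_nonneg) auto
    have zd: "\<bar>z (Suc j' * 2 ^ (M2 - k')) - z (j' * 2 ^ (M2 - k'))\<bar> \<le> d k'" if "k' \<le> M2" "j' < 2 ^ k'" for k' j'
    proof -
      have "\<bar>block_inc s M1 M2 k l k' j'\<bar> ^ q \<le> d k' ^ q"
        unfolding dq using that by (intro member_le_sum[where f = "\<lambda>j'. \<bar>block_inc s M1 M2 k l k' j'\<bar> ^ q"]) auto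
      then have "\<bar>block_inc s M1 M2 k l k' j'\<bar> \<le> d k'" by (rule power_le_base) (use q d0 in auto)
      then show ?thesis by (simp add: block_inc_def rect_inc_def z_def)
    qed
    have "\<bar>z j\<bar> \<le> (\<Sum>k'\<le>M2. d k')"
    \<comment> \<open>Rounding down to level 0 sends every j below \<open>2 ^ M2\<close> to the axis
      but fixes \<open>2 ^ M2\<close>, which is the far end of the single block of level 0.\<close>
    proof (cases "j = 2 ^ M2")
      case True
      have "\<bar>z j\<bar> \<le> d 0" using zd[of 0 0] by (simp add: True z_def s0)
      also have "\<dots> \<le> (\<Sum>k'\<le>M2. d k')" using d0 by (intro member_le_sum) auto
      finally show ?thesis .
    next
      case False
      have "\<bar>z j - z (j div 2 ^ (M2 - 0) * 2 ^ (M2 - 0))\<bar> \<le> (\<Sum>k'\<in>{0<..M2}. d k')"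
        by (rule dyadic_chain[OF zd j]) auto
      then have "\<bar>z j\<bar> \<le> (\<Sum>k'\<in>{0<..M2}. d k')" using False \<open>j \<le> 2 ^ M2\<close> by (simp add: z_def s0)
      also have "\<dots> \<le> (\<Sum>k'\<le>M2. d k')" using d0 by (intro sum_mono2) auto
      finally show ?thesis .
    qed
    then have "\<bar>z j\<bar> ^ q \<le> (\<Sum>k'\<le>M2. d k') ^ q" by (intro power_mono) auto
    also have "\<dots> \<le> c * (\<Sum>k'\<le>M2. d k' ^ q / (\<rho> ^ q) ^ k')"
      unfolding c_def by (rule sum_power_weighted_le) (use d0 \<rho> q in auto)
    also have "\<dots> = c * R k l" unfolding R_def dq \<rho>(3) by (simp add: sum_divide_distrib)
    also have "\<dots> \<le> c * (\<Sum>l<2 ^ k. R k l)" using k R0 c by (intro mult_left_mono member_le_sum) auto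
    also have "\<dots> = \<Delta> k ^ q" by (rule \<Delta>q[symmetric])
    finally have "\<bar>z j\<bar> \<le> \<Delta> k" by (rule power_le_base) (use q \<Delta>0 in auto)
    then show ?thesis by (simp add: z_def)
  qed
  have "\<bar>s i j - s i' j\<bar> \<le> 2 * (\<Sum>k\<in>{m..M1}. \<Delta> k)"
    by (rule dyadic_modulus[where g = "\<lambda>i. s i j", OF inc i m]) auto
  then have "\<bar>s i j - s i' j\<bar> ^ q \<le> (2 * (\<Sum>k\<in>{m..M1}. \<Delta> k)) ^ q" by (intro power_mono) auto
  also have "\<dots> = 2 ^ q * (\<Sum>k\<in>{m..M1}. \<Delta> k) ^ q" by (rule power_mult_distrib)
  also have "\<dots> \<le> 2 ^ q * (c * (\<Sum>k\<in>{m..M1}. \<Delta> k ^ q / (\<rho> ^ q) ^ k))"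
    unfolding c_def by (intro mult_left_mono sum_power_weighted_le) (use \<Delta>0 \<rho> q in auto)
  also have "(\<Sum>k\<in>{m..M1}. \<Delta> k ^ q / (\<rho> ^ q) ^ k) = c * modulus_sum q b s M1 M2 m"
    unfolding \<Delta>q \<rho>(3) modulus_sum_def R_def
    by (simp add: sum_divide_distrib sum_distrib_left)
  finally show ?thesis by (simp add: c_def mult_ac)
qed

text \<open>The 2^k blocks of level k absorb the 1/2 in b^2 / 2, the weight b^(-k) absorbs one b,
  and a summable b^k with tail of order b^m remains. The second direction works alike, summed over
  all levels.\<close>

lemma (in prob_space) modulus_sum_expectation:
  fixes s :: "nat \<Rightarrow> nat \<Rightarrow> 'a \<Rightarrow> real"
  assumes b: "0 < b" "b < 1"
    and int: "\<And>k j k' j'. k \<le> M1 \<Longrightarrow> j < 2 ^ k \<Longrightarrow> k' \<le> M2 \<Longrightarrow> j' < 2 ^ k' \<Longrightarrow>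
       integrable M (\<lambda>\<omega>. \<bar>block_inc (\<lambda>i j. s i j \<omega>) M1 M2 k j k' j'\<bar> ^ q)"
    and mom: "\<And>k j k' j'. k \<le> M1 \<Longrightarrow> j < 2 ^ k \<Longrightarrow> k' \<le> M2 \<Longrightarrow> j' < 2 ^ k' \<Longrightarrow>
       expectation (\<lambda>\<omega>. \<bar>block_inc (\<lambda>i j. s i j \<omega>) M1 M2 k j k' j'\<bar> ^ q) \<le> B * (b\<^sup>2 / 2) ^ k * (b\<^sup>2 / 2) ^ k'"
    and B: "B \<ge> 0"
  shows "integrable M (\<lambda>\<omega>. modulus_sum q b (\<lambda>i j. s i j \<omega>) M1 M2 m)"
    and "expectation (\<lambda>\<omega>. modulus_sum q b (\<lambda>i j. s i j \<omega>) M1 M2 m) \<le> B * (1 / (1 - b)) * (1 / (1 - b)) * b ^ m"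
proof -
  let ?D = "\<lambda>k j k' j' \<omega>. \<bar>block_inc (\<lambda>i j. s i j \<omega>) M1 M2 k j k' j'\<bar> ^ q"
  have hbi: "has_bochner_integral M (\<lambda>\<omega>. modulus_sum q b (\<lambda>i j. s i j \<omega>) M1 M2 m)
    (\<Sum>k\<in>{m..M1}. \<Sum>j<2 ^ k. \<Sum>k'\<le>M2. \<Sum>j'<2 ^ k'. expectation (?D k j k' j') / b ^ k' / b ^ k)"
    unfolding modulus_sum_def
    by (intro has_bochner_integral_sum has_bochner_integral_divide has_bochner_integral_integrable int) auto
  then show "integrable M (\<lambda>\<omega>. modulus_sum q b (\<lambda>i j. s i j \<omega>) M1 M2 m)"
    by (rule integrable.intros)
  have "expectation (\<lambda>\<omega>. modulus_sum q b (\<lambda>i j. s i j \<omega>) M1 M2 m)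
    = (\<Sum>k\<in>{m..M1}. \<Sum>j<2 ^ k. \<Sum>k'\<le>M2. \<Sum>j'<2 ^ k'. expectation (?D k j k' j') / b ^ k' / b ^ k)"
    using hbi by (rule has_bochner_integral_integral_eq)
  also have "\<dots> \<le> (\<Sum>k\<in>{m..M1}. \<Sum>j\<in>{..<2 ^ k :: nat}. \<Sum>k'\<le>M2. \<Sum>j'\<in>{..<2 ^ k' :: nat}. B * (b\<^sup>2 / 2) ^ k * (b\<^sup>2 / 2) ^ k' / b ^ k' / b ^ k)"
    using b by (intro sum_mono divide_right_mono mom) auto
  also have "\<dots> = (\<Sum>k\<in>{m..M1}. \<Sum>k'\<le>M2. B * b ^ k * b ^ k')"
  proof (rule sum.cong[OF refl])
    fix k
    have e: "(2::real) ^ k * (b\<^sup>2 / 2) ^ k / b ^ k = b ^ k" for k :: nat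
      using b by (simp add: power_divide power2_eq_square power_mult_distrib)
    have "(\<Sum>j\<in>{..<2 ^ k :: nat}. \<Sum>k'\<le>M2. \<Sum>j'\<in>{..<2 ^ k' :: nat}. B * (b\<^sup>2 / 2) ^ k * (b\<^sup>2 / 2) ^ k' / b ^ k' / b ^ k)
      = (\<Sum>k'\<le>M2. B * (2 ^ k * (b\<^sup>2 / 2) ^ k / b ^ k) * (2 ^ k' * (b\<^sup>2 / 2) ^ k' / b ^ k'))"
      by (simp add: sum_distrib_left mult_ac)
    then show "(\<Sum>j\<in>{..<2 ^ k :: nat}. \<Sum>k'\<le>M2. \<Sum>j'\<in>{..<2 ^ k' :: nat}. B * (b\<^sup>2 / 2) ^ k * (b\<^sup>2 / 2) ^ k' / b ^ k' / b ^ k)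
      = (\<Sum>k'\<le>M2. B * b ^ k * b ^ k')" by (simp only: e)
  qed
  also have "\<dots> = B * (\<Sum>k\<in>{m..M1}. b ^ k) * (\<Sum>k'\<le>M2. b ^ k')"
    by (simp add: sum_distrib_left sum_distrib_right mult_ac)
  also have "\<dots> \<le> B * (b ^ m * (1 / (1 - b))) * (1 / (1 - b))"
  proof -
    have g: "(\<Sum>k\<in>K. b ^ k) \<le> 1 / (1 - b)" if "finite K" for K
    proof -
      have "(\<Sum>k\<in>K. b ^ k) \<le> (\<Sum>k. b ^ k)" using b that by (intro sum_le_suminf summable_geometric) auto
      also have "\<dots> = 1 / (1 - b)" using b by (intro suminf_geometric) auto
      finally show ?thesis .
    qed
    have "(\<Sum>k\<in>{m..M1}. b ^ k) = (\<Sum>k\<in>{m..M1}. b ^ m * b ^ (k - m))"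
      by (intro sum.cong refl) (simp add: power_add[symmetric])
    also have "\<dots> = b ^ m * (\<Sum>k\<in>(\<lambda>k. k - m) ` {m..M1}. b ^ k)"
      unfolding sum_distrib_left by (subst sum.reindex) (auto simp: inj_on_def)
    also have "\<dots> \<le> b ^ m * (1 / (1 - b))" using b by (intro mult_left_mono g) auto
    finally show ?thesis using g[of "{..M2}"] b B
      by (intro mult_mono mult_nonneg_nonneg sum_nonneg) auto
  qed
  finally show "expectation (\<lambda>\<omega>. modulus_sum q b (\<lambda>i j. s i j \<omega>) M1 M2 m) \<le> B * (1 / (1 - b)) * (1 / (1 - b)) * b ^ m"
    by (simp add: mult_ac)
qed

lemma dyadic_cover:
  assumes "n \<ge> (1::nat)" obtains M where "n \<le> 2 ^ M" "2 ^ M \<le> 2 * n"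
proof -
  define M where "M = (LEAST M. n \<le> 2 ^ M)"
  have ex: "n \<le> 2 ^ n" by (simp add: less_imp_le)
  have 1: "n \<le> 2 ^ M" unfolding M_def by (rule LeastI[of "\<lambda>M. n \<le> 2 ^ M", OF ex])
  have 2: "2 ^ M \<le> 2 * n"
  proof (cases M)
    case 0 then show ?thesis using assms by simp
  next
    case (Suc k)
    then have "\<not> n \<le> 2 ^ k" using not_less_Least[of k "\<lambda>M. n \<le> 2 ^ M"] by (simp add: M_def)
    then show ?thesis by (simp add: Suc)
  qed
  show ?thesis by (rule that[OF 1 2])
qed

text \<open>The distance 2^(-(m + 1)) instead of 2^(-m) leaves room for rounding: the indices differ
  by at most 2^(M - m - 1) + 1, which does not exceed 2^(M - m).\<close>

lemma nat_floor_close: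
  assumes s: "0 \<le> s" "s \<le> t" and close: "t - s \<le> (1/2) ^ Suc m" and n: "real n \<le> 2 ^ M" and m: "Suc m \<le> M"
  shows "nat \<lfloor>real n * s\<rfloor> \<le> nat \<lfloor>real n * t\<rfloor>" "nat \<lfloor>real n * t\<rfloor> \<le> nat \<lfloor>real n * s\<rfloor> + 2 ^ (M - m)"
proof -
  show "nat \<lfloor>real n * s\<rfloor> \<le> nat \<lfloor>real n * t\<rfloor>" using s by (intro nat_mono floor_mono mult_left_mono) auto
  have pw: "(2::real) ^ M * (1/2) ^ Suc m = 2 ^ (M - Suc m)"
    using m by (simp add: power_diff power_one_over field_simps)
  have "real n * (t - s) \<le> 2 ^ M * (1/2) ^ Suc m" using n close s by (intro mult_mono) auto
  then have d: "real n * t \<le> real n * s + 2 ^ (M - Suc m)" unfolding pw by (simp add: algebra_simps)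
  have "0 \<le> real n * s" "0 \<le> real n * t" using s by auto
  then have "real (nat \<lfloor>real n * t\<rfloor>) \<le> real n * t" "real n * s \<le> real (nat \<lfloor>real n * s\<rfloor>) + 1" by linarith+
  with d have "real (nat \<lfloor>real n * t\<rfloor>) \<le> real (nat \<lfloor>real n * s\<rfloor> + (2 ^ (M - Suc m) + 1))" by simp
  then have "nat \<lfloor>real n * t\<rfloor> \<le> nat \<lfloor>real n * s\<rfloor> + (2 ^ (M - Suc m) + 1)" by (simp only: of_nat_le_iff)
  moreover have "2 ^ (M - m) = 2 * (2::nat) ^ (M - Suc m)" using m by (simp add: Suc_diff_le[symmetric] Suc_diff_Suc flip: power_Suc)
  moreover have "(1::nat) \<le> 2 ^ (M - Suc m)" by simp
  ultimately show "nat \<lfloor>real n * t\<rfloor> \<le> nat \<lfloor>real n * s\<rfloor> + 2 ^ (M - m)" by linarith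
qed

lemma nat_floor_le: "0 \<le> t \<Longrightarrow> t \<le> 1 \<Longrightarrow> nat \<lfloor>real n * t\<rfloor> \<le> n"
  using mult_left_mono[of t 1 "real n"] by (simp add: nat_le_iff floor_le_iff)

section \<open>Moments of rectangular increments and the modulus of the partial sums\<close>

context karlin_sheet begin

text \<open>The coefficients at the four corners factor, so the weight of a box is a difference of
  row parities times a difference of column parities, and its square is a product of two block
  parities. The variance given the paths is thus a product of two independent odd box
  counts.\<close>

lemma rect_moment:
  assumes a: "a1 \<le> b1" "a2 \<le> b2" and p: "p \<ge> 1"
  shows "expectation (\<lambda>\<omega>. (rect_inc (\<lambda>i j. S i j \<omega>) a1 b1 a2 b2) ^ (2 * p))
    \<le> 2 * fact (2 * p) * exp 1 * (expectation (\<lambda>\<omega>. num_odd (K1.path \<omega>) {Suc a1..b1} ^ p) *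
        expectation (\<lambda>\<omega>. num_odd (K2.path \<omega>) {Suc a2..b2} ^ p))"
proof -
  \<comment> \<open>The corners are indexed by pairs of booleans and not by points of the plane,
    since they coincide when a side of the rectangle is degenerate.\<close>
  define T where "T = (UNIV :: (bool \<times> bool) set)"
  define k1 where "k1 x = (if fst x then b1 else a1)" for x :: "bool \<times> bool"
  define k2 where "k2 x = (if snd x then b2 else a2)" for x :: "bool \<times> bool"
  define u where "u x = (if fst x then 1 else -1) * (if snd x then 1 else -1 :: real)" for x :: "bool \<times> bool"
  define K where "K = max b1 b2"
  have T: "finite T" "\<forall>x\<in>T. k1 x \<le> K" "\<forall>x\<in>T. k2 x \<le> K" using a by (auto simp: T_def k1_def k2_def K_def)
  have sumT: "(\<Sum>x\<in>T. f x) = f (True, True) + f (True, False) + f (False, True) + f (False, False)" for f :: "_ \<Rightarrow> real"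
    unfolding T_def UNIV_Times_UNIV[symmetric] sum.cartesian_product' by (simp add: UNIV_bool)
  have rect: "(\<Sum>x\<in>T. u x * S (k1 x) (k2 x) \<omega>) = rect_inc (\<lambda>i j. S i j \<omega>) a1 b1 a2 b2" for \<omega>
    unfolding sumT by (simp add: u_def k1_def k2_def rect_inc_def)
  let ?D1 = "\<lambda>\<omega>. num_odd (K1.path \<omega>) {Suc a1..b1}" and ?D2 = "\<lambda>\<omega>. num_odd (K2.path \<omega>) {Suc a2..b2}"
  have diff: "(parity y {1..b} l - parity y {1..a} l)\<^sup>2 = parity y {Suc a..b} l" if "a \<le> b" for y a b l
  proof -
    have U: "{1..a} \<union> {Suc a..b} = {1..b}" using that by auto
    have "\<bar>parity y {1..b} l - parity y {1..a} l\<bar> = parity y {Suc a..b} l"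
      using parity_diff[of "{1..a}" "{Suc a..b}" y l] unfolding U by auto
    then have "(parity y {1..b} l - parity y {1..a} l)\<^sup>2 = (parity y {Suc a..b} l)\<^sup>2" by (metis power2_abs)
    then show ?thesis by (auto simp: parity_def)
  qed
  have W: "(\<Sum>l\<in>boxes K \<omega>. (weight T u k1 k2 \<omega> l)\<^sup>2) = ?D1 \<omega> * ?D2 \<omega>" for \<omega>
  proof -
    let ?F1 = "K1.path \<omega> ` {1..K}" and ?F2 = "K2.path \<omega> ` {1..K}"
    have "weight T u k1 k2 \<omega> l = (parity (K1.path \<omega>) {1..b1} (fst l) - parity (K1.path \<omega>) {1..a1} (fst l)) *
       (parity (K2.path \<omega>) {1..b2} (snd l) - parity (K2.path \<omega>) {1..a2} (snd l))" for l
      unfolding weight_def sumT by (simp add: u_def k1_def k2_def algebra_simps)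
    then have "(weight T u k1 k2 \<omega> l)\<^sup>2 = parity (K1.path \<omega>) {Suc a1..b1} (fst l) * parity (K2.path \<omega>) {Suc a2..b2} (snd l)" for l
      by (simp only: power_mult_distrib diff[OF a(1)] diff[OF a(2)])
    then have "(\<Sum>l\<in>boxes K \<omega>. (weight T u k1 k2 \<omega> l)\<^sup>2) =
      (\<Sum>l1\<in>?F1. parity (K1.path \<omega>) {Suc a1..b1} l1) * (\<Sum>l2\<in>?F2. parity (K2.path \<omega>) {Suc a2..b2} l2)"
      unfolding boxes_def sum_product sum.cartesian_product by (intro sum.cong refl) auto
    also have "(\<Sum>l1\<in>?F1. parity (K1.path \<omega>) {Suc a1..b1} l1) = ?D1 \<omega>"
      by (rule sum_parity[OF _ _ order_trans[OF odds_subset image_mono]]) (auto simp: K_def)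
    also have "(\<Sum>l2\<in>?F2. parity (K2.path \<omega>) {Suc a2..b2} l2) = ?D2 \<omega>"
      by (rule sum_parity[OF _ _ order_trans[OF odds_subset image_mono]]) (auto simp: K_def)
    finally show ?thesis .
  qed
  have m1: "?D1 \<in> borel_measurable M" by (rule K1.num_odd_measurable) auto
  have m2: "?D2 \<in> borel_measurable M" by (rule K2.num_odd_measurable) auto
  have le1: "num_odd y {Suc a1..b1} \<le> real b1" and le2: "num_odd y {Suc a2..b2} \<le> real b2" for y
    using num_odd_le[of "{Suc a1..b1}" y] num_odd_le[of "{Suc a2..b2}" y] by auto
  have int: "integrable M (\<lambda>\<omega>. (\<Sum>l\<in>boxes K \<omega>. (weight T u k1 k2 \<omega> l)\<^sup>2) ^ p)"
    unfolding W
  proof (rule integrable_const_bound[where B = "(real b1 * real b2) ^ p"])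
    show "(\<lambda>\<omega>. (?D1 \<omega> * ?D2 \<omega>) ^ p) \<in> borel_measurable M" using m1 m2 by measurable
    show "AE \<omega> in M. norm ((?D1 \<omega> * ?D2 \<omega>) ^ p) \<le> (real b1 * real b2) ^ p"
      using le1 le2 by (intro AE_I2) (auto simp: abs_mult power_abs intro!: power_mono mult_mono)
  qed
  have "expectation (\<lambda>\<omega>. (rect_inc (\<lambda>i j. S i j \<omega>) a1 b1 a2 b2) ^ (2 * p))
     \<le> 2 * fact (2 * p) * exp 1 * expectation (\<lambda>\<omega>. (?D1 \<omega> * ?D2 \<omega>) ^ p)"
    using expectation_power_combination[OF T p int] unfolding rect W .
  also have "expectation (\<lambda>\<omega>. (?D1 \<omega> * ?D2 \<omega>) ^ p) = expectation (\<lambda>\<omega>. ?D1 \<omega> ^ p) * expectation (\<lambda>\<omega>. ?D2 \<omega> ^ p)"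
    unfolding power_mult_distrib
  proof (rule expectation_indep_mult)
    show "(\<lambda>y. num_odd y {Suc a1..b1} ^ p) \<in> borel_measurable path_space"
      "(\<lambda>y. num_odd y {Suc a2..b2} ^ p) \<in> borel_measurable path_space"
      using num_odd_path_measurable[of "{Suc _.._}"] by (auto intro!: borel_measurable_power)
    show "\<bar>num_odd y {Suc a1..b1} ^ p\<bar> \<le> real b1 ^ p" "\<bar>num_odd y {Suc a2..b2} ^ p\<bar> \<le> real b2 ^ p" for y
      using le1[of y] le2[of y] by (auto intro!: power_mono)
    show "num_odd (\<lambda>n\<in>{1..}. y n) {Suc a1..b1} ^ p = num_odd y {Suc a1..b1} ^ p"
      "num_odd (\<lambda>n\<in>{1..}. y n) {Suc a2..b2} ^ p = num_odd y {Suc a2..b2} ^ p" for y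
      using num_odd_restrict[of "{Suc a1..b1}" y] num_odd_restrict[of "{Suc a2..b2}" y] by auto
  qed
  finally show ?thesis .
qed

lemma rect_integrable: "integrable M (\<lambda>\<omega>. \<bar>rect_inc (\<lambda>i j. S i j \<omega>) a1 b1 a2 b2\<bar> ^ q)"
proof (rule integrable_const_bound[where B = "(real b1 * real b2 + real a1 * real b2 + real b1 * real a2 + real a1 * real a2) ^ q"])
  show "AE \<omega> in M. norm (\<bar>rect_inc (\<lambda>i j. S i j \<omega>) a1 b1 a2 b2\<bar> ^ q) \<le> (real b1 * real b2 + real a1 * real b2 + real b1 * real a2 + real a1 * real a2) ^ q"
  proof (rule AE_I2)
    fix \<omega> assume w: "\<omega> \<in> space M"
    have "\<bar>rect_inc (\<lambda>i j. S i j \<omega>) a1 b1 a2 b2\<bar> \<le> \<bar>S b1 b2 \<omega>\<bar> + \<bar>S a1 b2 \<omega>\<bar> + (\<bar>S b1 a2 \<omega>\<bar> + \<bar>S a1 a2 \<omega>\<bar>)"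
      unfolding rect_inc_def
      by (rule order_trans[OF abs_triangle_ineq4 add_mono[OF abs_triangle_ineq4 abs_triangle_ineq4]])
    also have "\<dots> \<le> real b1 * real b2 + real a1 * real b2 + (real b1 * real a2 + real a1 * real a2)"
      by (intro add_mono S_bound w)
    finally show "norm (\<bar>rect_inc (\<lambda>i j. S i j \<omega>) a1 b1 a2 b2\<bar> ^ q) \<le> (real b1 * real b2 + real a1 * real b2 + real b1 * real a2 + real a1 * real a2) ^ q"
      by (simp add: power_mono add.assoc)
  qed
qed (use S_measurable in \<open>auto simp: rect_inc_def\<close>)

text \<open>By \<open>dyadic_lower\<close> the bound for a block of level k is smaller than that for
  the whole range by 2^(-\<gamma> k), and a sufficiently large power p turns this rate into (1/4)^k.
  One p has to serve both directions, whence the two ceilings in its definition.\<close>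

lemma block_moment:
  obtains p C where "p \<ge> 1" "C > 0" "\<And>M1 M2 k j k' j'. k \<le> M1 \<Longrightarrow> k' \<le> M2 \<Longrightarrow>
    expectation (\<lambda>\<omega>. \<bar>block_inc (\<lambda>i j. S i j \<omega>) M1 M2 k j k' j'\<bar> ^ (2 * p))
      \<le> C * (max 1 (K1.\<nu> (2 ^ M1)) * max 1 (K2.\<nu> (2 ^ M2))) ^ p * (1/4) ^ k * (1/4) ^ k'"
proof -
  define \<gamma>1 where "\<gamma>1 = \<alpha>1 / 2"
  define \<gamma>2 where "\<gamma>2 = \<alpha>2 / 2"
  have \<gamma>: "0 < \<gamma>1" "\<gamma>1 < \<alpha>1" "0 < \<gamma>2" "\<gamma>2 < \<alpha>2" using \<alpha>1 \<alpha>2 by (auto simp: \<gamma>1_def \<gamma>2_def)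
  define p where "p = nat \<lceil>2 / \<gamma>1\<rceil> + nat \<lceil>2 / \<gamma>2\<rceil> + 1"
  have "2 / \<gamma>1 \<le> real p" "2 / \<gamma>2 \<le> real p" unfolding p_def using \<gamma> by linarith+
  then have p: "2 \<le> \<gamma>1 * real p" "2 \<le> \<gamma>2 * real p" using \<gamma> by (auto simp: field_simps)
  have p1: "p \<ge> 1" by (simp add: p_def)
  have decay: "(2 powr - (\<gamma> * real k)) ^ p \<le> (1/4) ^ k" if "2 \<le> \<gamma> * real p" for \<gamma> :: real and k
  proof -
    have "(2 powr - (\<gamma> * real k)) ^ p = 2 powr (- (\<gamma> * real p) * real k)"
      by (simp add: powr_powr powr_realpow[symmetric] mult_ac)
    also have "\<dots> \<le> 2 powr (- 2 * real k)"
      using that by (intro powr_mono mult_right_mono) auto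
    also have "\<dots> = (2 powr -2) ^ k" by (simp add: powr_powr powr_realpow[symmetric])
    also have "(2::real) powr -2 = 1/4" by (simp add: powr_minus)
    finally show ?thesis .
  qed
  obtain C1 where C1: "C1 > 0" "\<And>i j. i \<le> j \<Longrightarrow> max 1 (K1.\<nu> (2 ^ i)) \<le> C1 * 2 powr - (\<gamma>1 * real (j - i)) * max 1 (K1.\<nu> (2 ^ j))"
    using K1.dyadic_lower[OF \<gamma>(2)] by blast
  obtain C2 where C2: "C2 > 0" "\<And>i j. i \<le> j \<Longrightarrow> max 1 (K2.\<nu> (2 ^ i)) \<le> C2 * 2 powr - (\<gamma>2 * real (j - i)) * max 1 (K2.\<nu> (2 ^ j))"
    using K2.dyadic_lower[OF \<gamma>(4)] by blast
  obtain A1 where A1: "A1 > 0" "\<And>I. finite I \<Longrightarrow> I \<subseteq> {1..} \<Longrightarrow>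
      expectation (\<lambda>\<omega>. num_odd (K1.path \<omega>) I ^ p) \<le> A1 * (max 1 (K1.\<nu> (real (card I)))) ^ p"
    using K1.num_odd_moment[of p] by blast
  obtain A2 where A2: "A2 > 0" "\<And>I. finite I \<Longrightarrow> I \<subseteq> {1..} \<Longrightarrow>
      expectation (\<lambda>\<omega>. num_odd (K2.path \<omega>) I ^ p) \<le> A2 * (max 1 (K2.\<nu> (real (card I)))) ^ p"
    using K2.num_odd_moment[of p] by blast
  define C where "C = 2 * fact (2 * p) * exp 1 * ((A1 * C1 ^ p) * (A2 * C2 ^ p))"
  show ?thesis
  proof (rule that[OF p1, of C])
    show "C > 0" unfolding C_def using A1 A2 C1 C2 by simp
    fix M1 M2 k j k' j' :: nat assume k: "k \<le> M1" "k' \<le> M2"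
    define N1 where "N1 = max 1 (K1.\<nu> (2 ^ M1))"
    define N2 where "N2 = max 1 (K2.\<nu> (2 ^ M2))"
    have N: "N1 \<ge> 1" "N2 \<ge> 1" by (auto simp: N1_def N2_def)
    let ?I1 = "{Suc (j * 2 ^ (M1 - k))..Suc j * 2 ^ (M1 - k)}"
    let ?I2 = "{Suc (j' * 2 ^ (M2 - k'))..Suc j' * 2 ^ (M2 - k')}"
    have c1: "card ?I1 = 2 ^ (M1 - k)" and c2: "card ?I2 = 2 ^ (M2 - k')" by auto
    have E1: "expectation (\<lambda>\<omega>. num_odd (K1.path \<omega>) ?I1 ^ p) \<le> A1 * C1 ^ p * (1/4) ^ k * N1 ^ p"
    proof -
      have "expectation (\<lambda>\<omega>. num_odd (K1.path \<omega>) ?I1 ^ p) \<le> A1 * (max 1 (K1.\<nu> (real (card ?I1)))) ^ p"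
        by (rule A1(2)) auto
      also have "\<dots> \<le> A1 * (C1 * 2 powr - (\<gamma>1 * real k) * N1) ^ p"
        using C1(2)[of "M1 - k" M1] k A1(1) unfolding c1 N1_def by (intro mult_left_mono power_mono) auto
      also have "\<dots> = A1 * C1 ^ p * (2 powr - (\<gamma>1 * real k)) ^ p * N1 ^ p" by (simp only: power_mult_distrib mult.assoc)
      also have "\<dots> \<le> A1 * C1 ^ p * (1/4) ^ k * N1 ^ p"
        using A1(1) C1(1) N by (intro mult_right_mono mult_left_mono decay p) auto
      finally show ?thesis .
    qed
    have E2: "expectation (\<lambda>\<omega>. num_odd (K2.path \<omega>) ?I2 ^ p) \<le> A2 * C2 ^ p * (1/4) ^ k' * N2 ^ p"
    proof -
      have "expectation (\<lambda>\<omega>. num_odd (K2.path \<omega>) ?I2 ^ p) \<le> A2 * (max 1 (K2.\<nu> (real (card ?I2)))) ^ p"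
        by (rule A2(2)) auto
      also have "\<dots> \<le> A2 * (C2 * 2 powr - (\<gamma>2 * real k') * N2) ^ p"
        using C2(2)[of "M2 - k'" M2] k A2(1) unfolding c2 N2_def by (intro mult_left_mono power_mono) auto
      also have "\<dots> = A2 * C2 ^ p * (2 powr - (\<gamma>2 * real k')) ^ p * N2 ^ p" by (simp only: power_mult_distrib mult.assoc)
      also have "\<dots> \<le> A2 * C2 ^ p * (1/4) ^ k' * N2 ^ p"
        using A2(1) C2(1) N by (intro mult_right_mono mult_left_mono decay p) auto
      finally show ?thesis .
    qed
    have "expectation (\<lambda>\<omega>. \<bar>block_inc (\<lambda>i j. S i j \<omega>) M1 M2 k j k' j'\<bar> ^ (2 * p))
      = expectation (\<lambda>\<omega>. (block_inc (\<lambda>i j. S i j \<omega>) M1 M2 k j k' j') ^ (2 * p))" by (simp add: power_even_abs)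
    also have "\<dots> \<le> 2 * fact (2 * p) * exp 1 * (expectation (\<lambda>\<omega>. num_odd (K1.path \<omega>) ?I1 ^ p) * expectation (\<lambda>\<omega>. num_odd (K2.path \<omega>) ?I2 ^ p))"
      unfolding block_inc_def by (intro rect_moment p1) auto
    also have "\<dots> \<le> 2 * fact (2 * p) * exp 1 * ((A1 * C1 ^ p * (1/4) ^ k * N1 ^ p) * (A2 * C2 ^ p * (1/4) ^ k' * N2 ^ p))"
      using A1 C1 N by (intro mult_left_mono mult_mono E1 E2 integral_nonneg_AE) auto
    also have "\<dots> = C * (N1 * N2) ^ p * (1/4) ^ k * (1/4) ^ k'" unfolding C_def power_mult_distrib by (simp only: mult_ac)
    finally show "expectation (\<lambda>\<omega>. \<bar>block_inc (\<lambda>i j. S i j \<omega>) M1 M2 k j k' j'\<bar> ^ (2 * p))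
      \<le> C * (max 1 (K1.\<nu> (2 ^ M1)) * max 1 (K2.\<nu> (2 ^ M2))) ^ p * (1/4) ^ k * (1/4) ^ k'"
      by (simp only: N1_def N2_def)
  qed
qed

text \<open>One random variable W dominates all pairs of points simultaneously, so no supremum over
  the square has to be measurable. It depends on n and m, while q, C and b do not. Only large n are
  covered, because the index range must resolve the dyadic level in question.\<close>

lemma X_modulus:
  obtains q C b where "q > 0" "0 \<le> C" "0 < b" "b < 1"
    "\<And>m. \<forall>\<^sub>F n in pair_filter. \<exists>W. integrable M W \<and> (\<forall>\<omega>. 0 \<le> W \<omega>) \<and> expectation W \<le> C * b ^ m \<and>
       (\<forall>\<omega>\<in>space M. \<forall>s\<in>unit_square. \<forall>t\<in>unit_square.
          \<bar>fst s - fst t\<bar> \<le> (1/2) ^ Suc m \<longrightarrow> \<bar>snd s - snd t\<bar> \<le> (1/2) ^ Suc m \<longrightarrow> \<bar>X n s \<omega> - X n t \<omega>\<bar> ^ q \<le> W \<omega>)"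
proof -
  obtain p C0 where p: "p \<ge> 1" and C0: "C0 > 0" and mom: "\<And>M1 M2 k j k' j'. k \<le> M1 \<Longrightarrow> k' \<le> M2 \<Longrightarrow>
    expectation (\<lambda>\<omega>. \<bar>block_inc (\<lambda>i j. S i j \<omega>) M1 M2 k j k' j'\<bar> ^ (2 * p))
      \<le> C0 * (max 1 (K1.\<nu> (2 ^ M1)) * max 1 (K2.\<nu> (2 ^ M2))) ^ p * (1/4) ^ k * (1/4) ^ k'"
    using block_moment by blast
  define q where "q = 2 * p"
  have q: "q > 0" using p by (simp add: q_def)
  \<comment> \<open>Chosen so that b^2 / 2 is the decay rate 1/4 of
    \<open>block_moment\<close>.\<close>
  define b :: real where "b = sqrt (1/2)"
  have b: "0 < b" "b < 1" "b\<^sup>2 / 2 = 1 / 4" by (auto simp: b_def real_sqrt_less_iff[of _ 1, simplified])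
  define c where "c = 2 ^ q * ((1 / (1 - root q b)) ^ q * (1 / (1 - root q b)) ^ q)"
  have c: "c \<ge> 0"
  proof -
    have "root q b < 1" using b q by (simp add: real_root_lt_1_iff)
    then show ?thesis unfolding c_def by (intro mult_nonneg_nonneg) auto
  qed
  obtain A1 where A1: "A1 > 0" "\<forall>\<^sub>F n in sequentially. \<forall>M. 2 ^ M \<le> 2 * n \<longrightarrow> max 1 (K1.\<nu> (2 ^ M)) \<le> A1 * K1.r (real n)"
    using K1.\<nu>_dyadic_le_r by blast
  obtain A2 where A2: "A2 > 0" "\<forall>\<^sub>F n in sequentially. \<forall>M. 2 ^ M \<le> 2 * n \<longrightarrow> max 1 (K2.\<nu> (2 ^ M)) \<le> A2 * K2.r (real n)"
    using K2.\<nu>_dyadic_le_r by blast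
  \<comment> \<open>The outer 2^q comes from splitting a move into one per coordinate, c from
    \<open>modulus_sum_bound\<close>, the 2 from the two directions, \<open>A1\<close> and
    \<open>A2\<close> from comparing the dyadic ranges with the norming, and the factors 1 / (1 - b)
    from the sums over levels.\<close>
  define C where "C = 2 ^ q * c * (2 * (C0 * (A1 * A2) ^ p * (1 / (1 - b)) * (1 / (1 - b))))"
  have C: "0 \<le> C" unfolding C_def using c C0 A1 A2 b by (intro mult_nonneg_nonneg) auto
  show ?thesis
  proof (rule that[OF q C b(1,2)])
    fix m :: nat
    have e1: "\<forall>\<^sub>F n in pair_filter. \<forall>M. 2 ^ M \<le> 2 * fst n \<longrightarrow> max 1 (K1.\<nu> (2 ^ M)) \<le> A1 * K1.r (real (fst n))"
      by (rule eventually_compose_filterlim[OF A1(2) filterlim_fst_pair])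
    have e2: "\<forall>\<^sub>F n in pair_filter. \<forall>M. 2 ^ M \<le> 2 * snd n \<longrightarrow> max 1 (K2.\<nu> (2 ^ M)) \<le> A2 * K2.r (real (snd n))"
      by (rule eventually_compose_filterlim[OF A2(2) filterlim_snd_pair])
    have e3: "\<forall>\<^sub>F n in pair_filter. 2 ^ Suc m \<le> fst n \<and> 2 ^ Suc m \<le> snd n"
      unfolding eventually_pair_filter by (intro exI[of _ "2 ^ Suc m"]) auto
    show "\<forall>\<^sub>F n in pair_filter. \<exists>W. integrable M W \<and> (\<forall>\<omega>. 0 \<le> W \<omega>) \<and> expectation W \<le> C * b ^ m \<and>
       (\<forall>\<omega>\<in>space M. \<forall>s\<in>unit_square. \<forall>t\<in>unit_square.
          \<bar>fst s - fst t\<bar> \<le> (1/2) ^ Suc m \<longrightarrow> \<bar>snd s - snd t\<bar> \<le> (1/2) ^ Suc m \<longrightarrow> \<bar>X n s \<omega> - X n t \<omega>\<bar> ^ q \<le> W \<omega>)"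
      using e1 e2 e3 eventually_pos_pair
    proof eventually_elim
      case (elim n)
      obtain n1 n2 where n: "n = (n1, n2)" by (cases n)
      have n1: "n1 \<ge> 1" "2 ^ Suc m \<le> n1" and n2: "n2 \<ge> 1" "2 ^ Suc m \<le> n2" using elim n by auto
      obtain M1 where M1: "n1 \<le> 2 ^ M1" "2 ^ M1 \<le> 2 * n1" using dyadic_cover[OF n1(1)] .
      obtain M2 where M2: "n2 \<le> 2 ^ M2" "2 ^ M2 \<le> 2 * n2" using dyadic_cover[OF n2(1)] .
      have mM1: "Suc m \<le> M1"
        using order_trans[OF n1(2) M1(1)] by (rule power_le_imp_le_exp[rotated]) simp
      have mM2: "Suc m \<le> M2"
        using order_trans[OF n2(2) M2(1)] by (rule power_le_imp_le_exp[rotated]) simp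
      define N where "N = norming n1 n2"
      have r: "K1.r (real n1) > 0" "K2.r (real n2) > 0" using n1 n2 by (auto intro!: K1.r_pos K2.r_pos)
      have N: "N > 0" "N ^ q = (K1.r (real n1) * K2.r (real n2)) ^ p"
        using r by (auto simp: N_def norming_def q_def power_mult)
      define B where "B = C0 * (max 1 (K1.\<nu> (2 ^ M1)) * max 1 (K2.\<nu> (2 ^ M2))) ^ p"
      have B0: "B \<ge> 0" unfolding B_def using C0 by (intro mult_nonneg_nonneg zero_le_power) auto
      have BN: "B / N ^ q \<le> C0 * (A1 * A2) ^ p"
      proof -
        have "B \<le> C0 * ((A1 * K1.r (real n1)) * (A2 * K2.r (real n2))) ^ p"
          unfolding B_def using elim M1 M2 n C0 A1 A2 r by (intro mult_left_mono power_mono mult_mono) auto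
        also have "\<dots> = C0 * (A1 * A2) ^ p * N ^ q" unfolding N(2) power_mult_distrib by (simp only: mult_ac)
        finally show ?thesis using N(1) by (simp add: divide_le_eq)
      qed
      define s1 where "s1 \<omega> = (\<lambda>i j. S i j \<omega>)" for \<omega>
      \<comment> \<open>\<open>modulus_sum_bound\<close> treats increments in the first coordinate;
        the transposed array yields those in the second.\<close>
      define s2 where "s2 \<omega> = (\<lambda>j i. S i j \<omega>)" for \<omega>
      have s10: "s1 \<omega> i 0 = 0" "s2 \<omega> i 0 = 0" for \<omega> i by (simp_all add: s1_def s2_def karlin_S_def)
      have sw: "block_inc (s2 \<omega>) M2 M1 k j k' j' = block_inc (s1 \<omega>) M1 M2 k' j' k j" for \<omega> k j k' j'
        by (simp add: block_inc_def rect_inc_def s1_def s2_def)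
      have int1: "integrable M (\<lambda>\<omega>. \<bar>block_inc (s1 \<omega>) M1 M2 k j k' j'\<bar> ^ q)" for k j k' j'
        unfolding block_inc_def s1_def by (rule rect_integrable)
      have mom1: "expectation (\<lambda>\<omega>. \<bar>block_inc (s1 \<omega>) M1 M2 k j k' j'\<bar> ^ q) \<le> B * (b\<^sup>2 / 2) ^ k * (b\<^sup>2 / 2) ^ k'"
        if "k \<le> M1" "k' \<le> M2" for k j k' j'
        using mom[OF that] unfolding b(3) s1_def q_def B_def .
      define w1 where "w1 \<omega> = modulus_sum q b (s1 \<omega>) M1 M2 m" for \<omega>
      define w2 where "w2 \<omega> = modulus_sum q b (s2 \<omega>) M2 M1 m" for \<omega>
      have w0: "0 \<le> w1 \<omega>" "0 \<le> w2 \<omega>" for \<omega>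
        unfolding w1_def w2_def modulus_sum_def using b by (auto intro!: sum_nonneg divide_nonneg_nonneg)
      have W1: "integrable M w1" "expectation w1 \<le> B * (1 / (1 - b)) * (1 / (1 - b)) * b ^ m"
        unfolding w1_def[abs_def] s1_def
        by (rule modulus_sum_expectation[OF b(1,2) int1[unfolded s1_def] mom1[unfolded s1_def] B0]; assumption)+
      have W2: "integrable M w2" "expectation w2 \<le> B * (1 / (1 - b)) * (1 / (1 - b)) * b ^ m"
      proof -
        have int2: "integrable M (\<lambda>\<omega>. \<bar>block_inc (s2 \<omega>) M2 M1 k j k' j'\<bar> ^ q)" for k j k' j'
          unfolding sw by (rule int1)
        have mom2: "expectation (\<lambda>\<omega>. \<bar>block_inc (s2 \<omega>) M2 M1 k j k' j'\<bar> ^ q) \<le> B * (b\<^sup>2 / 2) ^ k * (b\<^sup>2 / 2) ^ k'"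
          if "k \<le> M2" "k' \<le> M1" for k j k' j'
          using mom1[OF that(2,1), of j' j] unfolding sw by (simp only: mult_ac)
        show "integrable M w2" "expectation w2 \<le> B * (1 / (1 - b)) * (1 / (1 - b)) * b ^ m"
          unfolding w2_def[abs_def] s2_def
          by (rule modulus_sum_expectation[OF b(1,2) int2[unfolded s2_def] mom2[unfolded s2_def] B0]; assumption)+
      qed
      have osc1: "\<bar>S i j \<omega> - S i' j \<omega>\<bar> ^ q \<le> c * w1 \<omega>"
        if "i \<le> i'" "i' \<le> 2 ^ M1" "i' \<le> i + 2 ^ (M1 - m)" "j \<le> 2 ^ M2" for i i' j \<omega>
        using modulus_sum_bound[OF b(1,2) q, of "s1 \<omega>" i i' M1 m j M2] s10 that mM1
        by (simp add: s1_def w1_def c_def)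
      have osc2: "\<bar>S i j \<omega> - S i j' \<omega>\<bar> ^ q \<le> c * w2 \<omega>"
        if "j \<le> j'" "j' \<le> 2 ^ M2" "j' \<le> j + 2 ^ (M2 - m)" "i \<le> 2 ^ M1" for i j j' \<omega>
        using modulus_sum_bound[OF b(1,2) q, of "s2 \<omega>" j j' M2 m i M1] s10 that mM2
        by (simp add: s2_def w2_def c_def)
      define W where "W \<omega> = 2 ^ q * (c * w1 \<omega> + c * w2 \<omega>) / N ^ q" for \<omega>
      have Wint: "integrable M W" unfolding W_def[abs_def] using W1 W2 by auto
      have W0: "0 \<le> W \<omega>" for \<omega> unfolding W_def using c w0 N(1) by (intro divide_nonneg_nonneg mult_nonneg_nonneg add_nonneg_nonneg) auto
      have EW: "expectation W \<le> C * b ^ m"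
      proof -
        have "expectation W = 2 ^ q * (c * expectation w1 + c * expectation w2) / N ^ q"
          unfolding W_def[abs_def] using W1 W2 by simp
        also have "\<dots> \<le> 2 ^ q * (c * (B * (1 / (1 - b)) * (1 / (1 - b)) * b ^ m) + c * (B * (1 / (1 - b)) * (1 / (1 - b)) * b ^ m)) / N ^ q"
          using c N(1) W1(2) W2(2) by (intro divide_right_mono mult_left_mono add_mono) auto
        also have "\<dots> = 2 ^ q * c * (2 * (B / N ^ q * (1 / (1 - b)) * (1 / (1 - b)))) * b ^ m"
          by (simp add: mult_ac)
        also have "\<dots> \<le> 2 ^ q * c * (2 * (C0 * (A1 * A2) ^ p * (1 / (1 - b)) * (1 / (1 - b)))) * b ^ m"
          using BN b c by (intro mult_right_mono mult_left_mono) auto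
        finally show ?thesis by (simp only: C_def)
      qed
      have coord: "nat \<lfloor>real n1 * x\<rfloor> \<le> 2 ^ M1" "nat \<lfloor>real n2 * x\<rfloor> \<le> 2 ^ M2" if "0 \<le> x" "x \<le> 1" for x
        using order_trans[OF nat_floor_le[OF that] M1(1)] order_trans[OF nat_floor_le[OF that] M2(1)] by blast+
      have Mr: "real n1 \<le> 2 ^ M1" "real n2 \<le> 2 ^ M2"
        using of_nat_mono[OF M1(1), where 'a = real] of_nat_mono[OF M2(1), where 'a = real] by simp_all
      have step1: "\<bar>S (nat \<lfloor>real n1 * x\<rfloor>) j \<omega> - S (nat \<lfloor>real n1 * y\<rfloor>) j \<omega>\<bar> ^ q \<le> c * w1 \<omega>"
        if "x \<in> {0..1}" "y \<in> {0..1}" "\<bar>x - y\<bar> \<le> (1/2) ^ Suc m" "j \<le> 2 ^ M2" for x y j \<omega>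
      proof (cases "x \<le> y")
        case True
        then show ?thesis using that nat_floor_close[OF _ True order_trans[OF abs_ge_minus_self[of "x - y", unfolded minus_diff_eq] that(3)] Mr(1) mM1] coord(1)[of y] by (intro osc1) auto
      next
        case False
        then have le: "y \<le> x" by simp
        have "\<bar>S (nat \<lfloor>real n1 * y\<rfloor>) j \<omega> - S (nat \<lfloor>real n1 * x\<rfloor>) j \<omega>\<bar> ^ q \<le> c * w1 \<omega>"
          using that nat_floor_close[OF _ le order_trans[OF abs_ge_self that(3)] Mr(1) mM1] coord(1)[of x] by (intro osc1) auto
        then show ?thesis by (simp only: abs_minus_commute)
      qed
      have step2: "\<bar>S i (nat \<lfloor>real n2 * x\<rfloor>) \<omega> - S i (nat \<lfloor>real n2 * y\<rfloor>) \<omega>\<bar> ^ q \<le> c * w2 \<omega>"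
        if "x \<in> {0..1}" "y \<in> {0..1}" "\<bar>x - y\<bar> \<le> (1/2) ^ Suc m" "i \<le> 2 ^ M1" for x y i \<omega>
      proof (cases "x \<le> y")
        case True
        then show ?thesis using that nat_floor_close[OF _ True order_trans[OF abs_ge_minus_self[of "x - y", unfolded minus_diff_eq] that(3)] Mr(2) mM2] coord(2)[of y] by (intro osc2) auto
      next
        case False
        then have le: "y \<le> x" by simp
        have "\<bar>S i (nat \<lfloor>real n2 * y\<rfloor>) \<omega> - S i (nat \<lfloor>real n2 * x\<rfloor>) \<omega>\<bar> ^ q \<le> c * w2 \<omega>"
          using that nat_floor_close[OF _ le order_trans[OF abs_ge_self that(3)] Mr(2) mM2] coord(2)[of x] by (intro osc2) auto
        then show ?thesis by (simp only: abs_minus_commute)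
      qed
      have two: "\<bar>x - z\<bar> ^ q \<le> 2 ^ q * (A + B)" if "\<bar>x - y\<bar> ^ q \<le> A" "\<bar>y - z\<bar> ^ q \<le> B" for x y z A B :: real
      proof -
        have A: "0 \<le> A" "0 \<le> B" using order_trans[OF zero_le_power[OF abs_ge_zero] that(1)] order_trans[OF zero_le_power[OF abs_ge_zero] that(2)] by auto
        have mx: "a \<le> p + r \<Longrightarrow> a \<le> 2 * max p r" for a p r :: real by (simp add: max_def)
        have "\<bar>x - z\<bar> \<le> 2 * max \<bar>x - y\<bar> \<bar>y - z\<bar>" by (rule mx) linarith
        then have "\<bar>x - z\<bar> ^ q \<le> (2 * max \<bar>x - y\<bar> \<bar>y - z\<bar>) ^ q" by (intro power_mono) auto
        also have "\<dots> = 2 ^ q * max \<bar>x - y\<bar> \<bar>y - z\<bar> ^ q" by (rule power_mult_distrib)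
        also have "max \<bar>x - y\<bar> \<bar>y - z\<bar> ^ q \<le> A + B" using that A by (auto simp: max_def)
        finally show ?thesis by simp
      qed
      have main: "\<bar>X n s \<omega> - X n t \<omega>\<bar> ^ q \<le> W \<omega>"
        if st: "s \<in> unit_square" "t \<in> unit_square" "\<bar>fst s - fst t\<bar> \<le> (1/2) ^ Suc m" "\<bar>snd s - snd t\<bar> \<le> (1/2) ^ Suc m" for s t \<omega>
      proof -
        let ?i = "\<lambda>s. nat \<lfloor>real n1 * fst s\<rfloor>" and ?j = "\<lambda>s. nat \<lfloor>real n2 * snd s\<rfloor>"
        have u: "fst s \<in> {0..1}" "snd s \<in> {0..1}" "fst t \<in> {0..1}" "snd t \<in> {0..1}" using st by (auto simp: mem_Times_iff)
        have "\<bar>S (?i s) (?j s) \<omega> - S (?i t) (?j t) \<omega>\<bar> ^ q \<le> 2 ^ q * (c * w1 \<omega> + c * w2 \<omega>)"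
          by (rule two[OF step1 step2]) (use u st coord in auto)
        moreover have "X n s \<omega> - X n t \<omega> = (S (?i s) (?j s) \<omega> - S (?i t) (?j t) \<omega>) / N"
          unfolding X_def n by (simp add: N_def diff_divide_distrib)
        ultimately show ?thesis unfolding W_def using N(1)
          by (simp add: power_divide divide_right_mono)
      qed
      show ?case using Wint W0 EW main by blast
    qed
  qed
qed

end

section \<open>Weak convergence in metric spaces\<close>

lemma space_borel_of: "space (borel_of T) = topspace T"
  unfolding borel_of_def by (rule space_measure_of) (auto dest: openin_subset)

lemma sets_borel_of: "sets (borel_of T) = sigma_sets (topspace T) {U. openin T U}"
  unfolding borel_of_def by (rule sets_measure_of) (auto dest: openin_subset)

lemma continuous_map_measurable_borel_of:
  assumes "continuous_map T T' f"
  shows "f \<in> borel_of T \<rightarrow>\<^sub>M borel_of T'"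
proof -
  have "f \<in> borel_of T \<rightarrow>\<^sub>M sigma (topspace T') {U. openin T' U}"
  proof (rule measurable_measure_of)
    show "{U. openin T' U} \<subseteq> Pow (topspace T')" by (auto dest: openin_subset)
    show "f \<in> space (borel_of T) \<rightarrow> topspace T'"
      using assms by (auto simp: space_borel_of continuous_map_def)
    fix U assume "U \<in> {U. openin T' U}"
    then have "openin T {x \<in> topspace T. f x \<in> U}" using assms by (auto simp: continuous_map_def)
    moreover have "f -` U \<inter> space (borel_of T) = {x \<in> topspace T. f x \<in> U}" by (auto simp: space_borel_of)
    ultimately show "f -` U \<inter> space (borel_of T) \<in> sets (borel_of T)"
      unfolding sets_borel_of by auto
  qed
  then show ?thesis by (simp add: borel_of_def)
qed

lemma continuous_map_borel_measurable:
  assumes "continuous_map T euclideanreal f"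
  shows "f \<in> borel_measurable (borel_of T)"
proof (rule borel_measurableI)
  fix U :: "real set" assume "open U"
  then have "openin T {x \<in> topspace T. f x \<in> U}" using assms by (auto simp: continuous_map_def)
  moreover have "f -` U \<inter> space (borel_of T) = {x \<in> topspace T. f x \<in> U}" by (auto simp: space_borel_of)
  ultimately show "f -` U \<inter> space (borel_of T) \<in> sets (borel_of T)" unfolding sets_borel_of by auto
qed

lemma (in Metric_space) lipschitz_continuous_map:
  fixes f :: "'a \<Rightarrow> real"
  assumes "\<And>x y. x \<in> M \<Longrightarrow> y \<in> M \<Longrightarrow> \<bar>f x - f y\<bar> \<le> K * d x y"
  shows "continuous_map mtopology euclideanreal f"
proof -
  have "continuous_map mtopology Met_TC.mtopology f"
    unfolding metric_continuous_map[OF Met_TC.Metric_space_axioms]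
  proof (intro conjI ballI allI impI)
    fix a and e :: real assume a: "a \<in> M" and e: "e > 0"
    show "\<exists>\<delta>>0. \<forall>x. x \<in> M \<and> d a x < \<delta> \<longrightarrow> dist (f a) (f x) < e"
    proof (intro exI[of _ "e / (\<bar>K\<bar> + 1)"] conjI allI impI)
      show "e / (\<bar>K\<bar> + 1) > 0" using e by simp
      fix x assume x: "x \<in> M \<and> d a x < e / (\<bar>K\<bar> + 1)"
      have "\<bar>f a - f x\<bar> \<le> K * d a x" using assms a x by blast
      also have "\<dots> \<le> (\<bar>K\<bar> + 1) * d a x" by (intro mult_right_mono) auto
      also have "\<dots> < e" using x e by (simp add: field_simps)
      finally show "dist (f a) (f x) < e" by (simp add: dist_real_def)
    qed
  qed simp
  then show ?thesis by simp
qed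

text \<open>Bounded continuous functions are increasing limits of their Lipschitz regularizations
  (inf-convolution with multiples of the distance); this reduces weak convergence to Lipschitz
  test functions in an arbitrary metric space.\<close>

definition (in Metric_space) lip_reg :: "('a \<Rightarrow> real) \<Rightarrow> nat \<Rightarrow> 'a \<Rightarrow> real" where
  "lip_reg f k x = (INF y\<in>M. f y + real k * d x y)"

context Metric_space begin

context
  fixes f :: "'a \<Rightarrow> real" and C :: real
  assumes bnd: "\<And>x. x \<in> M \<Longrightarrow> \<bar>f x\<bar> \<le> C"
begin

lemma lip_reg_bdd: "bdd_below ((\<lambda>y. f y + real k * d x y) ` M)"
proof (rule bdd_belowI2)
  fix y assume "y \<in> M"
  then have "- C \<le> f y" using bnd[of y] by linarith
  moreover have "0 \<le> real k * d x y" by simp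
  ultimately show "- C \<le> f y + real k * d x y" by linarith
qed

lemma lip_reg_le: "x \<in> M \<Longrightarrow> lip_reg f k x \<le> f x"
  unfolding lip_reg_def by (rule cINF_lower2[OF lip_reg_bdd, of x]) auto

lemma lip_reg_ge: "x \<in> M \<Longrightarrow> - C \<le> lip_reg f k x"
  unfolding lip_reg_def
proof (rule cINF_greatest)
  fix y assume "y \<in> M"
  then have "- C \<le> f y" using bnd[of y] by linarith
  moreover have "0 \<le> real k * d x y" by simp
  ultimately show "- C \<le> f y + real k * d x y" by linarith
qed auto

lemma lip_reg_abs: "x \<in> M \<Longrightarrow> \<bar>lip_reg f k x\<bar> \<le> C"
  using lip_reg_le[of x k] lip_reg_ge[of x k] bnd[of x] by linarith

lemma lip_reg_lipschitz:
  assumes "x \<in> M" "x' \<in> M" shows "\<bar>lip_reg f k x - lip_reg f k x'\<bar> \<le> real k * d x x'"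
proof -
  have *: "lip_reg f k x - real k * d x x' \<le> lip_reg f k x'" if "x \<in> M" "x' \<in> M" for x x'
    unfolding lip_reg_def[of f k x']
  proof (rule cINF_greatest)
    fix y assume y: "y \<in> M"
    have "lip_reg f k x \<le> f y + real k * d x y"
      unfolding lip_reg_def by (rule cINF_lower[OF lip_reg_bdd y])
    moreover have "real k * d x y \<le> real k * (d x x' + d x' y)"
      using that y triangle[of x x' y] by (intro mult_left_mono) auto
    ultimately show "lip_reg f k x - real k * d x x' \<le> f y + real k * d x' y" by (simp add: distrib_left)
  qed (use that in auto)
  show ?thesis using *[OF assms] *[OF assms(2,1)] by (simp add: commute abs_le_iff)
qed

text \<open>Points within \<delta> of x are controlled by continuity of f; beyond \<delta> the
  penalty is at least k \<delta>, which for large k outweighs the possible drop 2 C of f.\<close>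

lemma lip_reg_tendsto:
  assumes f: "continuous_map mtopology euclideanreal f" and x: "x \<in> M"
  shows "(\<lambda>k. lip_reg f k x) \<longlonglongrightarrow> f x"
proof (rule LIMSEQ_I)
  fix e :: real assume e: "e > 0"
  have "openin mtopology {y \<in> M. f y \<in> {f x - e / 2<..}}"
  proof -
    have op: "openin mtopology {y \<in> M. f y \<in> U}" if "open U" for U
      using f that by (simp add: continuous_map_def)
    show ?thesis by (rule op) simp
  qed
  then obtain \<delta> where \<delta>: "\<delta> > 0" "mball x \<delta> \<subseteq> {y \<in> M. f y \<in> {f x - e / 2<..}}"
    unfolding openin_mtopology using x e by auto
  obtain k0 :: nat where k0: "2 * C / \<delta> < real k0" using reals_Archimedean2 by blast
  have ge: "f x - e / 2 \<le> lip_reg f k x" if k: "k \<ge> k0" for k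
    unfolding lip_reg_def
  proof (rule cINF_greatest)
    fix y assume y: "y \<in> M"
    show "f x - e / 2 \<le> f y + real k * d x y"
    proof (cases "d x y < \<delta>")
      case True
      then have "f y > f x - e / 2" using \<delta>(2) x y by auto
      moreover have "0 \<le> real k * d x y" by simp
      ultimately show ?thesis by linarith
    next
      case False
      have "2 * C \<le> real k0 * \<delta>" using k0 \<delta>(1) by (simp add: divide_less_eq)
      also have "\<dots> \<le> real k * d x y" using False k \<delta>(1) by (intro mult_mono) auto
      finally show ?thesis using bnd[OF x] bnd[OF y] e by linarith
    qed
  qed (use x in auto)
  show "\<exists>k0. \<forall>k\<ge>k0. norm (lip_reg f k x - f x) < e"
  proof (intro exI[of _ k0] allI impI)
    fix k assume "k0 \<le> k"
    from ge[OF this] lip_reg_le[OF x, of k] e show "norm (lip_reg f k x - f x) < e" by auto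
  qed
qed

end

text \<open>A lower bound for the limit inferior suffices, since it applies to f and to -f. The
  regularization lies below the function and its integral along Z is close to the right one for
  large k; one fixed k then carries the bound to the prelimits.\<close>

lemma weak_convergence_lipschitz:
  fixes P :: "'p measure" and Q :: "'q measure" and X :: "'i \<Rightarrow> 'p \<Rightarrow> 'a" and Z :: "'q \<Rightarrow> 'a"
  assumes P: "prob_space P" and Q: "prob_space Q"
    and X: "\<And>i. X i \<in> P \<rightarrow>\<^sub>M borel_of mtopology" and Z: "Z \<in> Q \<rightarrow>\<^sub>M borel_of mtopology"
    and lip: "\<And>g C K. (\<And>x. x \<in> M \<Longrightarrow> \<bar>g x\<bar> \<le> C) \<Longrightarrow> (\<And>x y. x \<in> M \<Longrightarrow> y \<in> M \<Longrightarrow> \<bar>g x - g y\<bar> \<le> K * d x y) \<Longrightarrow>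
      ((\<lambda>i. \<integral>\<omega>. g (X i \<omega>) \<partial>P) \<longlongrightarrow> (\<integral>\<omega>. g (Z \<omega>) \<partial>Q)) F"
    and f: "continuous_map mtopology euclideanreal f" and bf: "bounded (f ` M)"
  shows "((\<lambda>i. \<integral>\<omega>. f (X i \<omega>) \<partial>P) \<longlongrightarrow> (\<integral>\<omega>. f (Z \<omega>) \<partial>Q)) F"
proof -
  interpret P: prob_space P by fact
  interpret Q: prob_space Q by fact
  have XM: "X i \<omega> \<in> M" if "\<omega> \<in> space P" for i \<omega>
    using measurable_space[OF X that] by (simp add: space_borel_of)
  have ZM: "Z \<omega> \<in> M" if "\<omega> \<in> space Q" for \<omega>
    using measurable_space[OF Z that] by (simp add: space_borel_of)
  have lower: "\<forall>\<^sub>F i in F. a < (\<integral>\<omega>. h (X i \<omega>) \<partial>P)"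
    if h: "continuous_map mtopology euclideanreal h" and hb: "\<And>x. x \<in> M \<Longrightarrow> \<bar>h x\<bar> \<le> C" and a: "a < (\<integral>\<omega>. h (Z \<omega>) \<partial>Q)"
    for h C a
  proof -
    let ?g = "lip_reg h"
    have gc: "continuous_map mtopology euclideanreal (?g k)" for k
      by (rule lipschitz_continuous_map[OF lip_reg_lipschitz[OF hb]])
    have gm: "?g k \<in> borel_measurable (borel_of mtopology)" for k
      by (rule continuous_map_borel_measurable[OF gc])
    have hm: "h \<in> borel_measurable (borel_of mtopology)" by (rule continuous_map_borel_measurable[OF h])
    have "(\<lambda>k. \<integral>\<omega>. ?g k (Z \<omega>) \<partial>Q) \<longlonglongrightarrow> (\<integral>\<omega>. h (Z \<omega>) \<partial>Q)"
    proof (rule integral_dominated_convergence[where w = "\<lambda>_. C"])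
      show "AE \<omega> in Q. (\<lambda>k. ?g k (Z \<omega>)) \<longlonglongrightarrow> h (Z \<omega>)"
        using ZM by (intro AE_I2 lip_reg_tendsto[OF hb h]) auto
      show "AE \<omega> in Q. norm (?g k (Z \<omega>)) \<le> C" for k
        unfolding real_norm_def using ZM by (intro AE_I2 lip_reg_abs[OF hb]) auto
    qed (use measurable_compose[OF Z gm] measurable_compose[OF Z hm] in auto)
    then have "\<forall>\<^sub>F k in sequentially. a < (\<integral>\<omega>. ?g k (Z \<omega>) \<partial>Q)" using a by (rule order_tendstoD)
    then obtain k where k: "a < (\<integral>\<omega>. ?g k (Z \<omega>) \<partial>Q)" by (auto simp: eventually_sequentially)
    have "((\<lambda>i. \<integral>\<omega>. ?g k (X i \<omega>) \<partial>P) \<longlongrightarrow> (\<integral>\<omega>. ?g k (Z \<omega>) \<partial>Q)) F"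
      by (rule lip[OF lip_reg_abs[OF hb] lip_reg_lipschitz[OF hb]])
    then have "\<forall>\<^sub>F i in F. a < (\<integral>\<omega>. ?g k (X i \<omega>) \<partial>P)" using k by (rule order_tendstoD)
    then show ?thesis
    proof eventually_elim
      case (elim i)
      have "(\<integral>\<omega>. ?g k (X i \<omega>) \<partial>P) \<le> (\<integral>\<omega>. h (X i \<omega>) \<partial>P)"
      proof (rule integral_mono)
        show "integrable P (\<lambda>\<omega>. ?g k (X i \<omega>))"
          using measurable_compose[OF X gm] XM lip_reg_abs[OF hb]
          by (intro P.integrable_const_bound[where B = C] AE_I2) auto
        show "integrable P (\<lambda>\<omega>. h (X i \<omega>))"
          using measurable_compose[OF X hm] XM hb
          by (intro P.integrable_const_bound[where B = C] AE_I2) auto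
        show "?g k (X i \<omega>) \<le> h (X i \<omega>)" if "\<omega> \<in> space P" for \<omega>
          by (rule lip_reg_le[OF hb XM[OF that]])
      qed
      then show ?case using elim by linarith
    qed
  qed
  obtain C where C: "\<And>x. x \<in> M \<Longrightarrow> \<bar>f x\<bar> \<le> C" using bf unfolding bounded_iff by auto
  have nf: "continuous_map mtopology euclideanreal (\<lambda>x. - f x)" using f by (intro continuous_intros)
  show ?thesis
  proof (rule order_tendstoI)
    fix a assume "a < (\<integral>\<omega>. f (Z \<omega>) \<partial>Q)"
    then show "\<forall>\<^sub>F i in F. a < (\<integral>\<omega>. f (X i \<omega>) \<partial>P)" by (intro lower[OF f, of C]) (use C in auto)
  next
    fix a assume "(\<integral>\<omega>. f (Z \<omega>) \<partial>Q) < a"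
    then have "\<forall>\<^sub>F i in F. - a < (\<integral>\<omega>. - f (X i \<omega>) \<partial>P)" using C by (intro lower[OF nf, of C]) auto
    then show "\<forall>\<^sub>F i in F. (\<integral>\<omega>. f (X i \<omega>) \<partial>P) < a" by eventually_elim simp
  qed
qed

end

section \<open>Step functions\<close>

text \<open>The identity is an admissible time change, so the uniform distance dominates. All
  comparisons of a path with its discretization go through this bound.\<close>

lemma skorohod_dist_le:
  assumes "x \<in> skorohod_space" "y \<in> skorohod_space" "\<And>t. t \<in> unit_square \<Longrightarrow> \<bar>x t - y t\<bar> \<le> e" "0 \<le> e"
  shows "skorohod_dist x y \<le> e"
proof -
  have "skorohod_close x y e"
    by (rule skorohod_closeI[OF time_change_id time_change_id]) (use assms in auto)
  moreover have "bdd_below {e. skorohod_close x y e}"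
    by (rule bdd_belowI[of _ 0]) (auto intro: skorohod_close_nonneg)
  ultimately show ?thesis using assms by (auto simp: skorohod_dist_def intro: cInf_lower)
qed

lemma floor_eventually_const_right:
  fixes a u :: real
  assumes "a \<ge> 0"
  shows "\<exists>e>0. \<forall>s. u \<le> s \<longrightarrow> s < u + e \<longrightarrow> \<lfloor>a * s\<rfloor> = \<lfloor>a * u\<rfloor>"
\<comment> \<open>The gap to the next integer over the slope; a + 1 in place of a also covers slope
  0.\<close>
proof (intro exI[of _ "(of_int \<lfloor>a * u\<rfloor> + 1 - a * u) / (a + 1)"] conjI allI impI)
  have pos: "of_int \<lfloor>a * u\<rfloor> + 1 - a * u > 0" by linarith
  then show "(of_int \<lfloor>a * u\<rfloor> + 1 - a * u) / (a + 1) > 0" using assms by (intro divide_pos_pos) auto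
  fix s assume s: "u \<le> s" "s < u + (of_int \<lfloor>a * u\<rfloor> + 1 - a * u) / (a + 1)"
  have "(s - u) * (a + 1) < of_int \<lfloor>a * u\<rfloor> + 1 - a * u" using s assms by (simp add: field_simps)
  then have "a * (s - u) < of_int \<lfloor>a * u\<rfloor> + 1 - a * u" using s by (simp add: algebra_simps)
  then have "a * s < of_int \<lfloor>a * u\<rfloor> + 1" by (simp add: algebra_simps)
  moreover have "a * u \<le> a * s" using s assms by (intro mult_left_mono) auto
  ultimately show "\<lfloor>a * s\<rfloor> = \<lfloor>a * u\<rfloor>" by linarith
qed

lemma floor_eventually_const_left:
  fixes a u :: real
  assumes "a \<ge> 0"
  shows "\<exists>k. \<exists>e>0. \<forall>s. s < u \<longrightarrow> u - e < s \<longrightarrow> \<lfloor>a * s\<rfloor> = k"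
proof (cases "a = 0")
  case True
  then show ?thesis by (intro exI[of _ 0] exI[of _ 1]) auto
next
  case False
  then have a: "a > 0" using assms by simp
  show ?thesis
  \<comment> \<open>Just left of u the floor is the ceiling at u minus 1. When \<open>a * u\<close>
    is an integer this differs from the floor at u itself.\<close>
  proof (intro exI[of _ "\<lceil>a * u\<rceil> - 1"] exI[of _ "(a * u - of_int \<lceil>a * u\<rceil> + 1) / a"] conjI allI impI)
    have "a * u - of_int \<lceil>a * u\<rceil> + 1 > 0" by linarith
    then show "(a * u - of_int \<lceil>a * u\<rceil> + 1) / a > 0" using a by simp
    fix s assume s: "s < u" "u - (a * u - of_int \<lceil>a * u\<rceil> + 1) / a < s"
    have "a * s < a * u" using s a by simp
    moreover have "of_int \<lceil>a * u\<rceil> - 1 < a * s" using s a by (simp add: field_simps)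
    ultimately show "\<lfloor>a * s\<rfloor> = \<lceil>a * u\<rceil> - 1" by linarith
  qed
qed

lemma floor_eventually_const_quadrant:
  fixes a u :: real
  assumes "a \<ge> 0" "R \<in> {(<), (\<ge>)}"
  shows "\<exists>k. \<exists>e>0. \<forall>s. R s u \<longrightarrow> \<bar>s - u\<bar> < e \<longrightarrow> \<lfloor>a * s\<rfloor> = (k::int)"
proof (cases "R = (<)")
  case True
  obtain k e where "e > 0" "\<forall>s. s < u \<longrightarrow> u - e < s \<longrightarrow> \<lfloor>a * s\<rfloor> = k"
    using floor_eventually_const_left[OF assms(1)] by blast
  moreover have "u - e < s" if "\<bar>s - u\<bar> < e" for s using that by linarith
  ultimately show ?thesis unfolding True by meson
next
  case False
  then have R: "R = (\<ge>)" using assms(2) by auto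
  obtain e where "e > 0" "\<forall>s. u \<le> s \<longrightarrow> s < u + e \<longrightarrow> \<lfloor>a * s\<rfloor> = \<lfloor>a * u\<rfloor>"
    using floor_eventually_const_right[OF assms(1)] by blast
  moreover have "s < u + e" if "\<bar>s - u\<bar> < e" for s using that by linarith
  ultimately show ?thesis unfolding R by meson
qed

text \<open>Near a point both floors are constant on each of the four quadrants. With G arbitrary
  this covers the scaled partial sums as well as dyadic discretizations.\<close>

lemma step_function_in_skorohod_space:
  assumes ab: "a \<ge> 0" "b \<ge> 0"
  shows "(\<lambda>t\<in>unit_square. G \<lfloor>a * fst t\<rfloor> \<lfloor>b * snd t\<rfloor>) \<in> skorohod_space" (is "?x \<in> _")
  unfolding skorohod_space_def
proof (intro CollectI conjI ballI)
  show "?x \<in> extensional unit_square" by simp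
  fix t assume t: "t \<in> unit_square"
  have near: "\<exists>d>0. \<forall>s\<in>quadrant R1 R2 t. dist s t < d \<longrightarrow> \<lfloor>a * fst s\<rfloor> = k1 \<and> \<lfloor>b * snd s\<rfloor> = k2"
    if 1: "e1 > 0" "\<forall>s. R1 s (fst t) \<longrightarrow> \<bar>s - fst t\<bar> < e1 \<longrightarrow> \<lfloor>a * s\<rfloor> = k1"
      and 2: "e2 > 0" "\<forall>s. R2 s (snd t) \<longrightarrow> \<bar>s - snd t\<bar> < e2 \<longrightarrow> \<lfloor>b * s\<rfloor> = k2" for R1 R2 k1 k2 e1 e2
  proof (intro exI[of _ "min e1 e2"] conjI ballI impI)
    show "min e1 e2 > 0" using 1 2 by simp
    fix s assume s: "s \<in> quadrant R1 R2 t" "dist s t < min e1 e2"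
    have "\<bar>fst s - fst t\<bar> < e1" "\<bar>snd s - snd t\<bar> < e2"
      using s(2) dist_fst_le[of s t] dist_snd_le[of s t] by (auto simp: dist_real_def)
    then show "\<lfloor>a * fst s\<rfloor> = k1" "\<lfloor>b * snd s\<rfloor> = k2" using s(1) 1 2 by (auto simp: quadrant_def)
  qed
  have lim: "(?x \<longlongrightarrow> G k1 k2) (at t within quadrant R1 R2 t)"
    if ex: "\<exists>d>0. \<forall>s\<in>quadrant R1 R2 t. dist s t < d \<longrightarrow> \<lfloor>a * fst s\<rfloor> = k1 \<and> \<lfloor>b * snd s\<rfloor> = k2" for R1 R2 k1 k2
  proof (rule tendsto_eventually)
    obtain d where d: "d > 0" "\<And>s. s \<in> quadrant R1 R2 t \<Longrightarrow> dist s t < d \<Longrightarrow> \<lfloor>a * fst s\<rfloor> = k1 \<and> \<lfloor>b * snd s\<rfloor> = k2"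
      using ex by blast
    have "?x s = G k1 k2" if "s \<in> quadrant R1 R2 t" "dist s t < d" for s
    proof -
      have "s \<in> unit_square" using that(1) unfolding quadrant_def by blast
      then show ?thesis using d(2)[OF that] by (simp only: restrict_apply' conjunct1 conjunct2)
    qed
    then show "\<forall>\<^sub>F s in at t within quadrant R1 R2 t. ?x s = G k1 k2"
      unfolding eventually_at using d(1) by blast
  qed
  show "\<exists>l. (?x \<longlongrightarrow> l) (at t within quadrant R1 R2 t)" if R: "R1 \<in> {(<), (\<ge>)}" "R2 \<in> {(<), (\<ge>)}" for R1 R2
  proof -
    obtain k1 e1 where "e1 > 0" "\<forall>s. R1 s (fst t) \<longrightarrow> \<bar>s - fst t\<bar> < e1 \<longrightarrow> \<lfloor>a * s\<rfloor> = k1"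
      using floor_eventually_const_quadrant[OF ab(1) R(1)] by blast
    moreover obtain k2 e2 where "e2 > 0" "\<forall>s. R2 s (snd t) \<longrightarrow> \<bar>s - snd t\<bar> < e2 \<longrightarrow> \<lfloor>b * s\<rfloor> = k2"
      using floor_eventually_const_quadrant[OF ab(2) R(2)] by blast
    ultimately show ?thesis using lim[OF near] by blast
  qed
  show "(?x \<longlongrightarrow> ?x t) (at t within quadrant (\<ge>) (\<ge>) t)"
  proof -
    obtain e1 where e1: "e1 > 0" "\<forall>s. fst t \<le> s \<longrightarrow> s < fst t + e1 \<longrightarrow> \<lfloor>a * s\<rfloor> = \<lfloor>a * fst t\<rfloor>"
      using floor_eventually_const_right[OF ab(1)] by blast
    obtain e2 where e2: "e2 > 0" "\<forall>s. snd t \<le> s \<longrightarrow> s < snd t + e2 \<longrightarrow> \<lfloor>b * s\<rfloor> = \<lfloor>b * snd t\<rfloor>"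
      using floor_eventually_const_right[OF ab(2)] by blast
    have "(?x \<longlongrightarrow> G \<lfloor>a * fst t\<rfloor> \<lfloor>b * snd t\<rfloor>) (at t within quadrant (\<ge>) (\<ge>) t)"
    proof (rule lim[OF near[OF e1(1) _ e2(1)]])
      have lt: "s < x + e" if "\<bar>s - x\<bar> < e" for s x e :: real using that by linarith
      show "\<forall>s. fst t \<le> s \<longrightarrow> \<bar>s - fst t\<bar> < e1 \<longrightarrow> \<lfloor>a * s\<rfloor> = \<lfloor>a * fst t\<rfloor>"
        using e1(2) lt by blast
      show "\<forall>s. snd t \<le> s \<longrightarrow> \<bar>s - snd t\<bar> < e2 \<longrightarrow> \<lfloor>b * s\<rfloor> = \<lfloor>b * snd t\<rfloor>"
        using e2(2) lt by blast
    qed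
    then show ?thesis using t by simp
  qed
qed

section \<open>Trigonometric polynomials\<close>

text \<open>The class is generated by exactly the functions whose expectations are known, shifted
  cosines of linear forms. The phase provides sines and constants, and closure under products
  follows from the product-to-sum formula.\<close>

inductive_set trig_poly :: "'j set \<Rightarrow> (('j \<Rightarrow> real) \<Rightarrow> real) set" for J :: "'j set" where
  cosI: "(\<lambda>x. a * cos ((\<Sum>j\<in>J. u j * x j) + b)) \<in> trig_poly J"
| addI: "f \<in> trig_poly J \<Longrightarrow> g \<in> trig_poly J \<Longrightarrow> (\<lambda>x. f x + g x) \<in> trig_poly J"

lemma trig_poly_const: "(\<lambda>x. a) \<in> trig_poly J"
  using cosI[of a "\<lambda>_. 0" J 0] by simp

lemma trig_poly_sin:
  assumes "finite J" "k \<in> J" shows "(\<lambda>x. sin (x k / A)) \<in> trig_poly J"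
proof -
  have "(\<Sum>j\<in>J. (if j = k then 1 / A else 0) * x j) = x k / A" for x :: "'a \<Rightarrow> real"
    using assms by (subst sum.remove[OF assms]) (auto intro!: sum.neutral)
  then show ?thesis
    using cosI[of 1 "\<lambda>j. if j = k then 1 / A else 0" J "- (pi / 2)"] by (simp add: cos_diff)
qed

lemma trig_poly_cos_mult:
  assumes "f \<in> trig_poly J"
  shows "(\<lambda>x. a * cos ((\<Sum>j\<in>J. u j * x j) + b) * f x) \<in> trig_poly J"
  using assms
proof induction
  case (cosI a' u' b')
  have eq: "a * cos ((\<Sum>j\<in>J. u j * x j) + b) * (a' * cos ((\<Sum>j\<in>J. u' j * x j) + b')) =
     (a * a' / 2) * cos ((\<Sum>j\<in>J. (u j - u' j) * x j) + (b - b')) + (a * a' / 2) * cos ((\<Sum>j\<in>J. (u j + u' j) * x j) + (b + b'))" for x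
  proof -
    have 1: "(\<Sum>j\<in>J. (u j - u' j) * x j) + (b - b') = ((\<Sum>j\<in>J. u j * x j) + b) - ((\<Sum>j\<in>J. u' j * x j) + b')"
      by (simp add: left_diff_distrib sum_subtractf)
    have 2: "(\<Sum>j\<in>J. (u j + u' j) * x j) + (b + b') = ((\<Sum>j\<in>J. u j * x j) + b) + ((\<Sum>j\<in>J. u' j * x j) + b')"
      by (simp add: distrib_right sum.distrib)
    have "a * cos v * (a' * cos w) = (a * a' / 2) * cos (v - w) + (a * a' / 2) * cos (v + w)" for v w :: real
      by (simp add: cos_diff cos_add algebra_simps)
    then show ?thesis unfolding 1 2 .
  qed
  show ?case unfolding eq by (intro trig_poly.addI trig_poly.cosI)
next
  case (addI f g)
  then show ?case unfolding distrib_left by (intro trig_poly.addI)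
qed

lemma trig_poly_mult:
  assumes "f \<in> trig_poly J" "g \<in> trig_poly J" shows "(\<lambda>x. f x * g x) \<in> trig_poly J"
  using assms(1)
proof induction
  case (cosI a u b)
  then show ?case by (rule trig_poly_cos_mult[OF assms(2)])
next
  case (addI f g)
  then show ?case unfolding distrib_right by (intro trig_poly.addI)
qed

lemma trig_poly_bounded:
  assumes "f \<in> trig_poly J" shows "\<exists>C. \<forall>x. \<bar>f x\<bar> \<le> C"
  using assms
proof induction
  case (cosI a u b)
  have "\<bar>a * cos c\<bar> \<le> \<bar>a\<bar>" for c unfolding abs_mult by (simp add: mult_left_le)
  then show ?case by blast
next
  case (addI f g)
  then obtain C C' where "\<And>x. \<bar>f x\<bar> \<le> C" "\<And>x. \<bar>g x\<bar> \<le> C'" by blast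
  then have "\<bar>f x + g x\<bar> \<le> C + C'" for x by (rule order_trans[OF abs_triangle_ineq add_mono])
  then show ?case by blast
qed

lemma trig_poly_measurable:
  assumes "f \<in> trig_poly J" "\<And>j. j \<in> J \<Longrightarrow> (\<lambda>\<omega>. Y \<omega> j) \<in> borel_measurable P"
  shows "(\<lambda>\<omega>. f (Y \<omega>)) \<in> borel_measurable P"
  using assms(1)
proof induction
  case (cosI a u b)
  have "(\<lambda>\<omega>. \<Sum>j\<in>J. u j * Y \<omega> j) \<in> borel_measurable P"
    using assms(2) by (intro borel_measurable_sum borel_measurable_times) auto
  then show ?case by measurable
next
  case (addI f g)
  then show ?case by simp
qed

text \<open>The change of variables y = sin (x / A) turns a function on a large cube into a continuous
  function on a compact cube, where polynomials are dense; polynomials in sin (x / A) are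
  trigonometric polynomials and stay uniformly close even outside the cube.\<close>

lemma trig_poly_approx:
  fixes G :: "('j :: countable \<Rightarrow> real) \<Rightarrow> real"
  assumes J: "finite J" and A: "A > 0" and e: "e > 0"
    and Gb: "\<And>x. \<bar>G x\<bar> \<le> C" and GL: "\<And>x y. \<bar>G x - G y\<bar> \<le> K * (\<Sum>j\<in>J. \<bar>x j - y j\<bar>)" and K: "K \<ge> 0"
  obtains T where "T \<in> trig_poly J" "\<And>x. \<bar>G x - T x\<bar> \<le> e + 2 * C * (\<Sum>j\<in>J. (x j)\<^sup>2) / A\<^sup>2"
proof -
  \<comment> \<open>Coordinates outside J are pinned to 0, so that the cube is compact in the full
    product and distinct points differ in a coordinate of J.\<close>
  define S where "S = (\<Pi>\<^sub>E j\<in>(UNIV :: 'j set). if j \<in> J then {-1..1} else {0::real})"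
  have Smem: "y \<in> S \<longleftrightarrow> (\<forall>j. (j \<in> J \<longrightarrow> y j \<in> {-1..1}) \<and> (j \<notin> J \<longrightarrow> y j = 0))" for y
    unfolding S_def by (auto simp: PiE_def Pi_def split: if_splits)
  have Scomp: "compact S"
  proof -
    have "compactin (product_topology (\<lambda>_. euclidean) UNIV) S"
      unfolding S_def by (subst compactin_PiE) (auto simp: compactin_euclidean_iff)
    then show ?thesis by (simp add: euclidean_product_topology compactin_euclidean_iff)
  qed
  define \<sigma> where "\<sigma> x = (\<lambda>j. if j \<in> J then sin (x j / A) else 0)" for x :: "'j \<Rightarrow> real"
  have \<sigma>S: "\<sigma> x \<in> S" for x unfolding Smem by (auto simp: \<sigma>_def)
  define H where "H y = G (\<lambda>j. if j \<in> J then A * arcsin (y j) else 0)" for y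
  have Hc: "continuous_on S H"
    unfolding continuous_on_def
  proof
    fix y assume y: "y \<in> S"
    let ?B = "\<lambda>z. K * (\<Sum>j\<in>J. \<bar>A * arcsin (z j) - A * arcsin (y j)\<bar>)"
    have "continuous_on S (\<lambda>z. A * arcsin (z j))" if "j \<in> J" for j
    proof (intro continuous_intros)
      show "continuous_on S (\<lambda>z. z j)" by (rule continuous_on_subset[OF continuous_on_product_coordinates]) auto
      show "\<forall>z\<in>S. - 1 \<le> z j \<and> z j \<le> 1" using that by (auto simp: Smem)
    qed
    then have lj: "((\<lambda>z. A * arcsin (z j)) \<longlongrightarrow> A * arcsin (y j)) (at y within S)" if "j \<in> J" for j
      using that y unfolding continuous_on_def by blast
    have "(?B \<longlongrightarrow> K * (\<Sum>j\<in>J. \<bar>A * arcsin (y j) - A * arcsin (y j)\<bar>)) (at y within S)"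
      by (intro tendsto_mult_left tendsto_sum tendsto_rabs tendsto_diff tendsto_const lj)
    then have B: "(?B \<longlongrightarrow> 0) (at y within S)" by simp
    have "((\<lambda>z. H z - H y) \<longlongrightarrow> 0) (at y within S)"
    proof (rule Lim_null_comparison[OF _ B], intro always_eventually allI)
      fix z
      have "\<bar>H z - H y\<bar> \<le> K * (\<Sum>j\<in>J. \<bar>(if j \<in> J then A * arcsin (z j) else 0) - (if j \<in> J then A * arcsin (y j) else 0)\<bar>)"
        unfolding H_def by (rule GL)
      also have "\<dots> = ?B z" by simp
      finally show "norm (H z - H y) \<le> ?B z" by simp
    qed
    then show "(H \<longlongrightarrow> H y) (at y within S)" by (simp only: LIM_zero_iff)
  qed
  define R where "R = {h. continuous_on S h \<and> (\<lambda>x. h (\<sigma> x)) \<in> trig_poly J}"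
  interpret function_ring_on R S
  proof
    show "compact S" by (rule Scomp)
    show "\<And>f. f \<in> R \<Longrightarrow> continuous_on S f" by (simp add: R_def)
    show "\<And>f g. f \<in> R \<Longrightarrow> g \<in> R \<Longrightarrow> (\<lambda>x. f x + g x) \<in> R" by (auto simp: R_def intro: continuous_on_add trig_poly.addI)
    show "\<And>f g. f \<in> R \<Longrightarrow> g \<in> R \<Longrightarrow> (\<lambda>x. f x * g x) \<in> R" by (auto simp: R_def intro: continuous_on_mult trig_poly_mult)
    show "\<And>c. (\<lambda>_. c) \<in> R" by (auto simp: R_def trig_poly_const)
    fix x y assume xy: "x \<in> S" "y \<in> S" "x \<noteq> y"
    then obtain j where j: "x j \<noteq> y j" by auto
    then have jJ: "j \<in> J" using xy by (auto simp: Smem)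
    have "(\<lambda>z. z j) \<in> R"
      unfolding R_def using trig_poly_sin[OF J jJ, of A] jJ
      by (auto simp: \<sigma>_def intro: continuous_on_subset[OF continuous_on_product_coordinates])
    then show "\<exists>f\<in>R. f x \<noteq> f y" using j by (intro bexI[of _ "\<lambda>z. z j"]) auto
  qed
  obtain h where h: "h \<in> R" "\<And>y. y \<in> S \<Longrightarrow> \<bar>H y - h y\<bar> < e"
    using Stone_Weierstrass_basic[OF Hc e] by blast
  define T where "T x = h (\<sigma> x)" for x
  have TT: "T \<in> trig_poly J" using h(1) by (simp add: R_def T_def[abs_def])
  have C0: "C \<ge> 0" using Gb[of undefined] by linarith
  have bound: "\<bar>G x - T x\<bar> \<le> e + 2 * C * (\<Sum>j\<in>J. (x j)\<^sup>2) / A\<^sup>2" for x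
  proof -
    have hT: "\<bar>H (\<sigma> x) - T x\<bar> < e" unfolding T_def by (rule h(2)[OF \<sigma>S])
    have "\<bar>G x - H (\<sigma> x)\<bar> \<le> 2 * C * (\<Sum>j\<in>J. (x j)\<^sup>2) / A\<^sup>2"
    proof (cases "\<forall>j\<in>J. \<bar>x j\<bar> \<le> A")
      case True
      have "A * arcsin (sin (x j / A)) = x j" if "j \<in> J" for j
      proof -
        have "\<bar>x j / A\<bar> \<le> 1" using True that A by (simp add: abs_divide)
        moreover have "1 < pi / 2" using pi_gt3 by simp
        ultimately have "- (pi / 2) \<le> x j / A" "x j / A \<le> pi / 2" by linarith+
        then show ?thesis using A by (simp add: arcsin_sin)
      qed
      then have "\<bar>G x - H (\<sigma> x)\<bar> \<le> K * (\<Sum>j\<in>J. \<bar>x j - x j\<bar>)"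
        unfolding H_def by (intro order_trans[OF GL] mult_left_mono K sum_mono) (auto simp: \<sigma>_def)
      also have "\<dots> \<le> 2 * C * (\<Sum>j\<in>J. (x j)\<^sup>2) / A\<^sup>2" using C0 by (simp add: sum_nonneg)
      finally show ?thesis .
    next
      case False
      then obtain j where j: "j \<in> J" "\<bar>x j\<bar> > A" by auto
      \<comment> \<open>Outside the cube the sum of squares is at least A^2, so its quotient by A^2
        absorbs the crude bound 2 C. Integrated, this is Chebyshev's inequality.\<close>
      have "A\<^sup>2 \<le> (x j)\<^sup>2" using j A by (metis abs_le_square_iff abs_of_pos less_imp_le)
      also have "\<dots> \<le> (\<Sum>j\<in>J. (x j)\<^sup>2)" using j J by (intro member_le_sum[where f = "\<lambda>j. (x j)\<^sup>2"]) auto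
      finally have "1 \<le> (\<Sum>j\<in>J. (x j)\<^sup>2) / A\<^sup>2" using A by (simp add: field_simps)
      then have "2 * C * 1 \<le> 2 * C * ((\<Sum>j\<in>J. (x j)\<^sup>2) / A\<^sup>2)" using C0 by (intro mult_left_mono) auto
      moreover have "\<bar>G x - H (\<sigma> x)\<bar> \<le> 2 * C"
        unfolding H_def using Gb[of x] Gb[of "\<lambda>j. if j \<in> J then A * arcsin (\<sigma> x j) else 0"] by linarith
      ultimately show ?thesis by simp
    qed
    with hT show ?thesis by linarith
  qed
  show ?thesis by (rule that[OF TT bound])
qed

text \<open>G is replaced by a trigonometric polynomial, for which convergence follows by linearity
  from the cosines. The error involves only second moments over A^2, and the eventual bound on these
  makes it uniform in i, in the role of tightness.\<close>

lemma fdd_convergence: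
  fixes P :: "'p measure" and Q :: "'q measure" and X :: "'i \<Rightarrow> 'j :: countable \<Rightarrow> 'p \<Rightarrow> real" and Z :: "'j \<Rightarrow> 'q \<Rightarrow> real"
  assumes P: "prob_space P" and Q: "prob_space Q" and J: "finite J"
    and Xm: "\<And>i j. j \<in> J \<Longrightarrow> X i j \<in> borel_measurable P" and Zm: "\<And>j. j \<in> J \<Longrightarrow> Z j \<in> borel_measurable Q"
    and X2: "\<And>i j. j \<in> J \<Longrightarrow> integrable P (\<lambda>\<omega>. (X i j \<omega>)\<^sup>2)" and Z2: "\<And>j. j \<in> J \<Longrightarrow> integrable Q (\<lambda>\<omega>. (Z j \<omega>)\<^sup>2)"
    and Xbd: "\<And>j. j \<in> J \<Longrightarrow> \<exists>B. \<forall>\<^sub>F i in F. (\<integral>\<omega>. (X i j \<omega>)\<^sup>2 \<partial>P) \<le> B"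
    and cos: "\<And>u b. ((\<lambda>i. \<integral>\<omega>. cos ((\<Sum>j\<in>J. u j * X i j \<omega>) + b) \<partial>P) \<longlongrightarrow> (\<integral>\<omega>. cos ((\<Sum>j\<in>J. u j * Z j \<omega>) + b) \<partial>Q)) F"
    and Gb: "\<And>x. \<bar>G x\<bar> \<le> C" and GL: "\<And>x y. \<bar>G x - G y\<bar> \<le> K * (\<Sum>j\<in>J. \<bar>x j - y j\<bar>)" and K: "K \<ge> 0"
    and GX: "\<And>i. (\<lambda>\<omega>. G (\<lambda>j. X i j \<omega>)) \<in> borel_measurable P" and GZ: "(\<lambda>\<omega>. G (\<lambda>j. Z j \<omega>)) \<in> borel_measurable Q"
  shows "((\<lambda>i. \<integral>\<omega>. G (\<lambda>j. X i j \<omega>) \<partial>P) \<longlongrightarrow> (\<integral>\<omega>. G (\<lambda>j. Z j \<omega>) \<partial>Q)) F"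
proof (rule tendstoI)
  fix e :: real assume e: "e > 0"
  interpret P: prob_space P by fact
  interpret Q: prob_space Q by fact
  have C0: "C \<ge> 0" using Gb[of undefined] by linarith
  obtain B where B: "\<And>j. j \<in> J \<Longrightarrow> \<forall>\<^sub>F i in F. (\<integral>\<omega>. (X i j \<omega>)\<^sup>2 \<partial>P) \<le> B j" using Xbd by metis
  define D where "D = 1 + \<bar>\<Sum>j\<in>J. B j\<bar> + (\<Sum>j\<in>J. \<integral>\<omega>. (Z j \<omega>)\<^sup>2 \<partial>Q)"
  have DZ: "(\<Sum>j\<in>J. \<integral>\<omega>. (Z j \<omega>)\<^sup>2 \<partial>Q) \<le> D" "(\<Sum>j\<in>J. B j) \<le> D" "D \<ge> 1"
  proof -
    have "0 \<le> (\<Sum>j\<in>J. \<integral>\<omega>. (Z j \<omega>)\<^sup>2 \<partial>Q)" by (intro sum_nonneg integral_nonneg_AE) auto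
    then show "(\<Sum>j\<in>J. \<integral>\<omega>. (Z j \<omega>)\<^sup>2 \<partial>Q) \<le> D" "(\<Sum>j\<in>J. B j) \<le> D" "D \<ge> 1"
      unfolding D_def by linarith+
  qed
  define A where "A = sqrt (2 * C * D * 8 / e + 1)"
  have A: "A > 0" "A\<^sup>2 = 2 * C * D * 8 / e + 1"
  proof -
    have "2 * C * D * 8 / e + 1 > 0" using C0 DZ(3) e by (intro add_nonneg_pos divide_nonneg_pos) auto
    then show "A > 0" "A\<^sup>2 = 2 * C * D * 8 / e + 1" by (auto simp: A_def)
  qed
  have small: "2 * C * D / A\<^sup>2 \<le> e / 8"
  proof -
    have "2 * C * D \<le> e / 8 * A\<^sup>2" unfolding A(2) using e by (simp add: field_simps)
    then show ?thesis using A(1) by (simp add: divide_le_eq)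
  qed
  obtain T where T: "T \<in> trig_poly J" "\<And>x. \<bar>G x - T x\<bar> \<le> e / 8 + 2 * C * (\<Sum>j\<in>J. (x j)\<^sup>2) / A\<^sup>2"
    using trig_poly_approx[OF J A(1) _ Gb GL K, of "e / 8"] e by (metis divide_pos_pos zero_less_numeral)
  obtain CT where CT: "\<And>x. \<bar>T x\<bar> \<le> CT" using trig_poly_bounded[OF T(1)] by blast
  have conv: "((\<lambda>i. \<integral>\<omega>. f (\<lambda>j. X i j \<omega>) \<partial>P) \<longlongrightarrow> (\<integral>\<omega>. f (\<lambda>j. Z j \<omega>) \<partial>Q)) F" if "f \<in> trig_poly J" for f
    using that
  proof induction
    case (cosI a u b)
    then show ?case by (simp add: tendsto_mult_left[OF cos])
  next
    case (addI f g)
    have iP: "integrable P (\<lambda>\<omega>. f (\<lambda>j. X i j \<omega>))" if "f \<in> trig_poly J" for f i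
    proof -
      obtain c where "\<And>x. \<bar>f x\<bar> \<le> c" using trig_poly_bounded[OF \<open>f \<in> trig_poly J\<close>] by blast
      then show ?thesis using trig_poly_measurable[OF that Xm] by (intro P.integrable_const_bound[where B = c] AE_I2) auto
    qed
    have iQ: "integrable Q (\<lambda>\<omega>. f (\<lambda>j. Z j \<omega>))" if "f \<in> trig_poly J" for f
    proof -
      obtain c where "\<And>x. \<bar>f x\<bar> \<le> c" using trig_poly_bounded[OF \<open>f \<in> trig_poly J\<close>] by blast
      then show ?thesis using trig_poly_measurable[OF that Zm] by (intro Q.integrable_const_bound[where B = c] AE_I2) auto
    qed
    show ?case using addI by (simp add: iP iQ tendsto_add)
  qed
  have errX: "\<bar>(\<integral>\<omega>. G (\<lambda>j. X i j \<omega>) \<partial>P) - (\<integral>\<omega>. T (\<lambda>j. X i j \<omega>) \<partial>P)\<bar> \<le> e / 8 + 2 * C * (\<Sum>j\<in>J. \<integral>\<omega>. (X i j \<omega>)\<^sup>2 \<partial>P) / A\<^sup>2" for i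
  proof -
    have i1: "integrable P (\<lambda>\<omega>. G (\<lambda>j. X i j \<omega>))" using GX Gb by (intro P.integrable_const_bound[where B = C] AE_I2) auto
    have i2: "integrable P (\<lambda>\<omega>. T (\<lambda>j. X i j \<omega>))"
      using trig_poly_measurable[OF T(1) Xm] CT by (intro P.integrable_const_bound[where B = CT] AE_I2) auto
    have i3: "integrable P (\<lambda>\<omega>. \<Sum>j\<in>J. (X i j \<omega>)\<^sup>2)" using X2 by (intro Bochner_Integration.integrable_sum) auto
    have "\<bar>(\<integral>\<omega>. G (\<lambda>j. X i j \<omega>) \<partial>P) - (\<integral>\<omega>. T (\<lambda>j. X i j \<omega>) \<partial>P)\<bar> = \<bar>\<integral>\<omega>. G (\<lambda>j. X i j \<omega>) - T (\<lambda>j. X i j \<omega>) \<partial>P\<bar>"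
      using i1 i2 by simp
    also have "\<dots> \<le> (\<integral>\<omega>. \<bar>G (\<lambda>j. X i j \<omega>) - T (\<lambda>j. X i j \<omega>)\<bar> \<partial>P)" by (rule integral_abs_bound)
    also have "\<dots> \<le> (\<integral>\<omega>. e / 8 + 2 * C * (\<Sum>j\<in>J. (X i j \<omega>)\<^sup>2) / A\<^sup>2 \<partial>P)"
      by (rule integral_mono) (use i1 i2 i3 T(2) in auto)
    also have "\<dots> = e / 8 + 2 * C * (\<Sum>j\<in>J. \<integral>\<omega>. (X i j \<omega>)\<^sup>2 \<partial>P) / A\<^sup>2" using i3 X2 by (simp add: P.prob_space)
    finally show ?thesis .
  qed
  have errZ: "\<bar>(\<integral>\<omega>. G (\<lambda>j. Z j \<omega>) \<partial>Q) - (\<integral>\<omega>. T (\<lambda>j. Z j \<omega>) \<partial>Q)\<bar> \<le> e / 8 + 2 * C * (\<Sum>j\<in>J. \<integral>\<omega>. (Z j \<omega>)\<^sup>2 \<partial>Q) / A\<^sup>2"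
  proof -
    have i1: "integrable Q (\<lambda>\<omega>. G (\<lambda>j. Z j \<omega>))" using GZ Gb by (intro Q.integrable_const_bound[where B = C] AE_I2) auto
    have i2: "integrable Q (\<lambda>\<omega>. T (\<lambda>j. Z j \<omega>))"
      using trig_poly_measurable[OF T(1) Zm] CT by (intro Q.integrable_const_bound[where B = CT] AE_I2) auto
    have i3: "integrable Q (\<lambda>\<omega>. \<Sum>j\<in>J. (Z j \<omega>)\<^sup>2)" using Z2 by (intro Bochner_Integration.integrable_sum) auto
    have "\<bar>(\<integral>\<omega>. G (\<lambda>j. Z j \<omega>) \<partial>Q) - (\<integral>\<omega>. T (\<lambda>j. Z j \<omega>) \<partial>Q)\<bar> = \<bar>\<integral>\<omega>. G (\<lambda>j. Z j \<omega>) - T (\<lambda>j. Z j \<omega>) \<partial>Q\<bar>"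
      using i1 i2 by simp
    also have "\<dots> \<le> (\<integral>\<omega>. \<bar>G (\<lambda>j. Z j \<omega>) - T (\<lambda>j. Z j \<omega>)\<bar> \<partial>Q)" by (rule integral_abs_bound)
    also have "\<dots> \<le> (\<integral>\<omega>. e / 8 + 2 * C * (\<Sum>j\<in>J. (Z j \<omega>)\<^sup>2) / A\<^sup>2 \<partial>Q)"
      by (rule integral_mono) (use i1 i2 i3 T(2) in auto)
    also have "\<dots> = e / 8 + 2 * C * (\<Sum>j\<in>J. \<integral>\<omega>. (Z j \<omega>)\<^sup>2 \<partial>Q) / A\<^sup>2" using i3 Z2 by (simp add: Q.prob_space)
    finally show ?thesis .
  qed
  have le: "e / 8 + 2 * C * s / A\<^sup>2 \<le> e / 4" if "s \<le> D" for s
  proof -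
    have "2 * C * s / A\<^sup>2 \<le> 2 * C * D / A\<^sup>2" using that C0 by (intro divide_right_mono mult_left_mono) auto
    then show ?thesis using small by linarith
  qed
  have "\<forall>\<^sub>F i in F. \<forall>j\<in>J. (\<integral>\<omega>. (X i j \<omega>)\<^sup>2 \<partial>P) \<le> B j" using B J by (intro eventually_ball_finite) auto
  moreover have "\<forall>\<^sub>F i in F. dist (\<integral>\<omega>. T (\<lambda>j. X i j \<omega>) \<partial>P) (\<integral>\<omega>. T (\<lambda>j. Z j \<omega>) \<partial>Q) < e / 4"
    using tendstoD[OF conv[OF T(1)], of "e / 4"] e by simp
  ultimately show "\<forall>\<^sub>F i in F. dist (\<integral>\<omega>. G (\<lambda>j. X i j \<omega>) \<partial>P) (\<integral>\<omega>. G (\<lambda>j. Z j \<omega>) \<partial>Q) < e"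
  proof eventually_elim
    case (elim i)
    have "(\<Sum>j\<in>J. \<integral>\<omega>. (X i j \<omega>)\<^sup>2 \<partial>P) \<le> (\<Sum>j\<in>J. B j)" using elim by (intro sum_mono) auto
    then have "(\<Sum>j\<in>J. \<integral>\<omega>. (X i j \<omega>)\<^sup>2 \<partial>P) \<le> D" using DZ(2) by linarith
    from order_trans[OF errX le[OF this]] order_trans[OF errZ le[OF DZ(1)]] elim(2) e
    show ?case unfolding dist_real_def by linarith
  qed
qed

section \<open>Weak convergence in the Skorohod space\<close>

lemma lipschitz_coordinates_measurable:
  fixes G :: "('j :: countable \<Rightarrow> real) \<Rightarrow> real"
  assumes J: "finite J" and GL: "\<And>x y. \<bar>G x - G y\<bar> \<le> K * (\<Sum>j\<in>J. \<bar>x j - y j\<bar>)"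
    and Y: "\<And>j. (\<lambda>\<omega>. Y j \<omega>) \<in> borel_measurable P"
  shows "(\<lambda>\<omega>. G (\<lambda>j. Y j \<omega>)) \<in> borel_measurable P"
proof -
  have "continuous_on UNIV G"
    unfolding continuous_on_def
  proof
    fix y :: "'j \<Rightarrow> real"
    have "((\<lambda>z. z j) \<longlongrightarrow> y j) (at y)" for j
      using continuous_on_product_coordinates[of j] unfolding continuous_on_def by auto
    then have "((\<lambda>z. K * (\<Sum>j\<in>J. \<bar>z j - y j\<bar>)) \<longlongrightarrow> K * (\<Sum>j\<in>J. \<bar>y j - y j\<bar>)) (at y)"
      by (intro tendsto_mult_left tendsto_sum tendsto_rabs tendsto_diff tendsto_const)
    then have B: "((\<lambda>z. K * (\<Sum>j\<in>J. \<bar>z j - y j\<bar>)) \<longlongrightarrow> 0) (at y)" by simp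
    have "((\<lambda>z. G z - G y) \<longlongrightarrow> 0) (at y)"
      by (rule Lim_null_comparison[OF _ B], intro always_eventually allI) (use GL in auto)
    then show "(G \<longlongrightarrow> G y) (at y within UNIV)" by (simp only: LIM_zero_iff)
  qed
  then have "G \<in> borel_measurable borel" by (rule borel_measurable_continuous_onI)
  moreover have "(\<lambda>\<omega> j. Y j \<omega>) \<in> borel_measurable P" by (rule measurable_coordinatewise_then_product[OF Y])
  ultimately show ?thesis by (rule measurable_compose[rotated])
qed

section \<open>Dyadic grids and discretized paths\<close>

text \<open>The index \<open>2 ^ m\<close> is included because a coordinate equal to 1 rounds to
  it.\<close>

definition grid :: "nat \<Rightarrow> (nat \<times> nat) set" where "grid m = {..2 ^ m} \<times> {..2 ^ m}"
definition pt :: "nat \<Rightarrow> nat \<times> nat \<Rightarrow> real \<times> real" where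
  "pt m g = (real (fst g) / 2 ^ m, real (snd g) / 2 ^ m)"
definition ix :: "nat \<Rightarrow> real \<times> real \<Rightarrow> nat \<times> nat" where
  "ix m t = (nat \<lfloor>2 ^ m * fst t\<rfloor>, nat \<lfloor>2 ^ m * snd t\<rfloor>)"
definition step :: "nat \<Rightarrow> (nat \<times> nat \<Rightarrow> real) \<Rightarrow> real \<times> real \<Rightarrow> real" where
  "step m x = (\<lambda>t\<in>unit_square. x (ix m t))"

lemma finite_grid: "finite (grid m)" by (simp add: grid_def)

lemma grid_ne: "grid m \<noteq> {}" by (auto simp: grid_def)

lemma pt_nonneg: "pt m g \<in> {0..} \<times> {0..}" by (simp add: pt_def)

lemma pt_unit_square: "g \<in> grid m \<Longrightarrow> pt m g \<in> unit_square"
proof -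
  assume "g \<in> grid m"
  then have "real (fst g) \<le> real (2 ^ m)" "real (snd g) \<le> real (2 ^ m)"
    unfolding grid_def of_nat_le_iff by (auto simp: mem_Times_iff)
  then show ?thesis by (simp add: pt_def)
qed

lemma inj_pt: "inj (pt m)" by (auto simp: inj_def pt_def prod_eq_iff)

lemma ix_grid: "t \<in> unit_square \<Longrightarrow> ix m t \<in> grid m"
proof -
  assume t: "t \<in> unit_square"
  have "nat \<lfloor>2 ^ m * x\<rfloor> \<le> 2 ^ m" if "x \<in> {0..1}" for x :: real
    using nat_floor_le[of x "2 ^ m"] that by simp
  then show ?thesis using t by (simp add: ix_def grid_def mem_Times_iff)
qed

lemma floor_pow_close:
  assumes "0 \<le> (x::real)" shows "\<bar>x - real (nat \<lfloor>2 ^ m * x\<rfloor>) / 2 ^ m\<bar> \<le> (1/2) ^ m"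
proof -
  have 0: "0 \<le> 2 ^ m * x" using assms by simp
  have "real (nat \<lfloor>2 ^ m * x\<rfloor>) \<le> 2 ^ m * x" "2 ^ m * x \<le> real (nat \<lfloor>2 ^ m * x\<rfloor>) + 1" using 0 by linarith+
  then have "real (nat \<lfloor>2 ^ m * x\<rfloor>) / 2 ^ m \<le> x" "x \<le> real (nat \<lfloor>2 ^ m * x\<rfloor>) / 2 ^ m + (1/2) ^ m"
    by (auto simp: field_simps power_one_over)
  then show ?thesis by auto
qed

lemma pt_ix_close:
  assumes "t \<in> unit_square"
  shows "\<bar>fst t - fst (pt m (ix m t))\<bar> \<le> (1/2) ^ m" "\<bar>snd t - snd (pt m (ix m t))\<bar> \<le> (1/2) ^ m"
  using assms floor_pow_close[of "fst t" m] floor_pow_close[of "snd t" m]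
  by (simp_all add: pt_def ix_def mem_Times_iff)

lemma step_in_skorohod_space: "step m x \<in> skorohod_space"
  unfolding step_def ix_def
  by (rule step_function_in_skorohod_space[of "2 ^ m" "2 ^ m" "\<lambda>i j. x (nat i, nat j)"]) auto

lemma step_lipschitz:
  assumes fL: "\<And>x y. x \<in> skorohod_space \<Longrightarrow> y \<in> skorohod_space \<Longrightarrow> \<bar>f x - f y\<bar> \<le> K * skorohod_dist x y" and K: "K \<ge> 0"
  shows "\<bar>f (step m x) - f (step m y)\<bar> \<le> K * (\<Sum>j\<in>grid m. \<bar>x j - y j\<bar>)"
proof -
  have "skorohod_dist (step m x) (step m y) \<le> (\<Sum>j\<in>grid m. \<bar>x j - y j\<bar>)"
  proof (rule skorohod_dist_le[OF step_in_skorohod_space step_in_skorohod_space])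
    fix t assume t: "t \<in> unit_square"
    have "\<bar>x (ix m t) - y (ix m t)\<bar> \<le> (\<Sum>j\<in>grid m. \<bar>x j - y j\<bar>)"
      using ix_grid[OF t] finite_grid by (intro member_le_sum[where f = "\<lambda>j. \<bar>x j - y j\<bar>"]) auto
    then show "\<bar>step m x t - step m y t\<bar> \<le> (\<Sum>j\<in>grid m. \<bar>x j - y j\<bar>)" using t by (simp add: step_def)
  qed (auto intro: sum_nonneg)
  then show ?thesis
    using fL[OF step_in_skorohod_space step_in_skorohod_space, of m x m y] K
    by (meson mult_left_mono order_trans)
qed

text \<open>Points of a coarser level keep an index of the finer one, so that a single family of
  coordinates carries both levels.\<close>

definition coarse :: "nat \<Rightarrow> nat \<times> nat \<Rightarrow> nat \<times> nat" where
  "coarse d g = (fst g div 2 ^ d * 2 ^ d, snd g div 2 ^ d * 2 ^ d)"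

text \<open>The error of the level m step function, seen at the points of level M only. Depending on
  finitely many coordinates, it is within reach of finite-dimensional convergence once it is capped
  at 1.\<close>

definition osc :: "nat \<Rightarrow> nat \<Rightarrow> (nat \<times> nat \<Rightarrow> real) \<Rightarrow> real" where
  "osc m M x = Max ((\<lambda>g. \<bar>x g - x (coarse (M - m) g)\<bar>) ` grid M)"

lemma coarse_grid: "g \<in> grid M \<Longrightarrow> coarse d g \<in> grid M"
  by (auto simp: grid_def coarse_def mem_Times_iff intro: order_trans[OF div_times_less_eq_dividend])

lemma osc_ge: "g \<in> grid M \<Longrightarrow> \<bar>x g - x (coarse (M - m) g)\<bar> \<le> osc m M x"
  unfolding osc_def using finite_grid by (intro Max_ge) auto

lemma osc_le: "(\<And>g. g \<in> grid M \<Longrightarrow> \<bar>x g - x (coarse (M - m) g)\<bar> \<le> c) \<Longrightarrow> osc m M x \<le> c"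
  unfolding osc_def using finite_grid grid_ne by (intro Max.boundedI) auto

lemma osc_nonneg: "osc m M x \<ge> 0"
  using osc_ge[of "(0, 0)" M x m] by (auto simp: grid_def intro: order_trans[OF abs_ge_zero])

lemma osc_lipschitz: "\<bar>min 1 (osc m M x) - min 1 (osc m M y)\<bar> \<le> 2 * (\<Sum>j\<in>grid M. \<bar>x j - y j\<bar>)"
proof -
  have *: "osc m M x \<le> osc m M y + 2 * (\<Sum>j\<in>grid M. \<bar>x j - y j\<bar>)" for x y
  proof (rule osc_le)
    fix g assume g: "g \<in> grid M"
    have mem: "\<bar>x h - y h\<bar> \<le> (\<Sum>j\<in>grid M. \<bar>x j - y j\<bar>)" if "h \<in> grid M" for h
      using that finite_grid by (intro member_le_sum[where f = "\<lambda>j. \<bar>x j - y j\<bar>"]) auto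
    have "\<bar>x g - x (coarse (M - m) g)\<bar> \<le> \<bar>y g - y (coarse (M - m) g)\<bar> + \<bar>x g - y g\<bar> + \<bar>x (coarse (M - m) g) - y (coarse (M - m) g)\<bar>"
      by linarith
    then show "\<bar>x g - x (coarse (M - m) g)\<bar> \<le> osc m M y + 2 * (\<Sum>j\<in>grid M. \<bar>x j - y j\<bar>)"
      using osc_ge[OF g, of y m] mem[OF g] mem[OF coarse_grid[OF g, of "M - m"]] by linarith
  qed
  have "(\<Sum>j\<in>grid M. \<bar>y j - x j\<bar>) = (\<Sum>j\<in>grid M. \<bar>x j - y j\<bar>)" by (simp only: abs_minus_commute)
  then have "\<bar>osc m M x - osc m M y\<bar> \<le> 2 * (\<Sum>j\<in>grid M. \<bar>x j - y j\<bar>)"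
    using *[of x y] *[of y x] by (simp add: abs_le_iff)
  moreover have "\<bar>min 1 a - min 1 b\<bar> \<le> \<bar>a - b\<bar>" for a b :: real by (auto simp: min_def)
  ultimately show ?thesis using order_trans by blast
qed

lemma pt_coarse:
  assumes "m \<le> M" shows "pt M (coarse (M - m) g) = pt m (ix m (pt M g))"
proof -
  have *: "real (a div 2 ^ (M - m) * 2 ^ (M - m)) / 2 ^ M = real (nat \<lfloor>2 ^ m * (real a / 2 ^ M)\<rfloor>) / 2 ^ m" for a :: nat
  proof -
    have e: "(2::real) ^ M = 2 ^ m * 2 ^ (M - m)" using assms by (simp flip: power_add)
    have "\<lfloor>2 ^ m * (real a / 2 ^ M)\<rfloor> = \<lfloor>real a / real (2 ^ (M - m))\<rfloor>" by (simp add: e)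
    also have "\<dots> = int (a div 2 ^ (M - m))" by (rule floor_divide_of_nat_eq)
    finally show ?thesis by (simp add: e)
  qed
  show ?thesis unfolding pt_def coarse_def ix_def fst_conv snd_conv by (simp only: *)
qed

text \<open>Right continuity: the dyadic points approaching t from the upper right determine the value at t.\<close>

lemma discretization_error_le:
  assumes z: "(\<lambda>t\<in>unit_square. z t) \<in> skorohod_space"
    and v: "\<And>M. m \<le> M \<Longrightarrow> min 1 (osc m M (\<lambda>g. z (pt M g))) \<le> v" and t: "t \<in> unit_square"
  shows "min 1 \<bar>z t - z (pt m (ix m t))\<bar> \<le> v"
proof -
  define up where "up M x = real (nat \<lceil>2 ^ M * x\<rceil>) / 2 ^ M" for M and x :: real
  have up: "x \<le> up M x" "up M x \<le> x + (1/2) ^ M" "up M x \<le> 1" "nat \<lceil>2 ^ M * x\<rceil> \<le> 2 ^ M"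
    if x: "x \<in> {0..1}" for M and x :: real
  proof -
    have "0 \<le> 2 ^ M * x" using x by simp
    then have "0 \<le> \<lceil>2 ^ M * x\<rceil>" by linarith
    then have c: "real (nat \<lceil>2 ^ M * x\<rceil>) = of_int \<lceil>2 ^ M * x\<rceil>" by (rule of_nat_nat)
    have "2 ^ M * x \<le> of_int \<lceil>2 ^ M * x\<rceil>" "of_int \<lceil>2 ^ M * x\<rceil> \<le> 2 ^ M * x + 1" by linarith+
    then show "x \<le> up M x" "up M x \<le> x + (1/2) ^ M" unfolding up_def c
      by (auto simp: field_simps power_one_over)
    have "2 ^ M * x \<le> 2 ^ M * 1" using x by (intro mult_left_mono) auto
    then have "\<lceil>2 ^ M * x\<rceil> \<le> 2 ^ M" by (simp add: ceiling_le_iff)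
    then show "nat \<lceil>2 ^ M * x\<rceil> \<le> 2 ^ M" by (simp add: nat_le_iff)
    then have "real (nat \<lceil>2 ^ M * x\<rceil>) \<le> real (2 ^ M)" by (rule of_nat_mono)
    then show "up M x \<le> 1" by (simp add: up_def)
  qed
  have f1: "fst t \<in> {0..1}" and s1: "snd t \<in> {0..1}" using t by (auto simp: mem_Times_iff)
  define g where "g M = (nat \<lceil>2 ^ M * fst t\<rceil>, nat \<lceil>2 ^ M * snd t\<rceil>)" for M
  define tm where "tm M = pt M (g M)" for M
  have tm: "tm M = (up M (fst t), up M (snd t))" for M by (simp add: tm_def pt_def g_def up_def)
  have gg: "g M \<in> grid M" for M using up(4)[OF f1] up(4)[OF s1] by (simp add: g_def grid_def)
  have tmq: "tm M \<in> quadrant (\<ge>) (\<ge>) t" for M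
    using pt_unit_square[OF gg, of M] up(1)[OF f1, of M] up(1)[OF s1, of M] unfolding tm_def[symmetric] quadrant_def
    by (simp add: tm)
  have half: "(\<lambda>M. (1/2::real) ^ M) \<longlonglongrightarrow> 0" by (rule LIMSEQ_power_zero) simp
  have upl: "(\<lambda>M. up M x) \<longlonglongrightarrow> x" if "x \<in> {0..1}" for x
  proof (rule tendsto_sandwich[OF always_eventually always_eventually tendsto_const])
    show "(\<lambda>M. x + (1/2) ^ M) \<longlonglongrightarrow> x" using tendsto_add[OF tendsto_const half, of x] by simp
  qed (use up[OF that] in auto)
  have tml: "tm \<longlonglongrightarrow> t"
    unfolding tm[abs_def] using tendsto_Pair[OF upl[OF f1] upl[OF s1]] by simp
  let ?x = "\<lambda>t\<in>unit_square. z t"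
  have "(?x \<longlongrightarrow> ?x t) (at t within quadrant (\<ge>) (\<ge>) t)" using z t unfolding skorohod_space_def by blast
  then have xq: "(?x \<longlongrightarrow> ?x t) (inf (nhds t) (principal (quadrant (\<ge>) (\<ge>) t)))"
    by (simp only: tendsto_at_iff_tendsto_nhds_within[OF refl])
  have "filterlim tm (inf (nhds t) (principal (quadrant (\<ge>) (\<ge>) t))) sequentially"
    unfolding filterlim_inf filterlim_principal using tml tmq by auto
  from filterlim_compose[OF xq this] have "(\<lambda>M. ?x (tm M)) \<longlonglongrightarrow> ?x t" .
  then have zl: "(\<lambda>M. z (tm M)) \<longlonglongrightarrow> z t"
    using t tmq by (simp add: quadrant_def)
  \<comment> \<open>Slightly to the right of t the index \<open>ix m\<close> is constant, so for
    large M the points \<open>tm M\<close> and t round to the same point of level m.\<close>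
  obtain e1 where e1: "e1 > 0" "\<forall>s. fst t \<le> s \<longrightarrow> s < fst t + e1 \<longrightarrow> \<lfloor>2 ^ m * s\<rfloor> = \<lfloor>2 ^ m * fst t\<rfloor>"
    using floor_eventually_const_right[of "2 ^ m" "fst t"] by auto
  obtain e2 where e2: "e2 > 0" "\<forall>s. snd t \<le> s \<longrightarrow> s < snd t + e2 \<longrightarrow> \<lfloor>2 ^ m * s\<rfloor> = \<lfloor>2 ^ m * snd t\<rfloor>"
    using floor_eventually_const_right[of "2 ^ m" "snd t"] by auto
  have "\<forall>\<^sub>F M in sequentially. (1/2::real) ^ M < min e1 e2" using half e1(1) e2(1) by (intro order_tendstoD) auto
  with eventually_ge_at_top[of m] have "\<forall>\<^sub>F M in sequentially. min 1 \<bar>z (tm M) - z (pt m (ix m t))\<bar> \<le> v"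
  proof eventually_elim
    case (elim M)
    have "up M (fst t) < fst t + e1" "up M (snd t) < snd t + e2"
      using up(2)[OF f1, of M] up(2)[OF s1, of M] elim by auto
    then have "ix m (tm M) = ix m t" unfolding ix_def tm fst_conv snd_conv
      using e1(2) e2(2) up(1)[OF f1, of M] up(1)[OF s1, of M] by metis
    then have "pt M (coarse (M - m) (g M)) = pt m (ix m t)" using pt_coarse[OF elim(1), of "g M"] by (simp add: tm_def)
    then have "\<bar>z (tm M) - z (pt m (ix m t))\<bar> \<le> osc m M (\<lambda>g. z (pt M g))"
      using osc_ge[OF gg[of M], of "\<lambda>g. z (pt M g)" m] by (simp add: tm_def)
    then have "min 1 \<bar>z (tm M) - z (pt m (ix m t))\<bar> \<le> min 1 (osc m M (\<lambda>g. z (pt M g)))" by simp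
    also have "\<dots> \<le> v" by (rule v[OF elim(1)])
    finally show ?case .
  qed
  moreover have "(\<lambda>M. min 1 \<bar>z (tm M) - z (pt m (ix m t))\<bar>) \<longlonglongrightarrow> min 1 \<bar>z t - z (pt m (ix m t))\<bar>"
    by (intro tendsto_intros zl)
  ultimately show ?thesis by (intro tendsto_upperbound) auto
qed

text \<open>Markov's inequality in pointwise form: integrated, it bounds the mean of
  \<open>min 1 w\<close> by \<open>\<eta>\<close> plus a scaled moment.\<close>

lemma le_add_power_div:
  fixes w \<eta> :: real
  assumes "0 \<le> w" "0 < \<eta>" "q > 0" shows "min 1 w \<le> \<eta> + w ^ q / \<eta> ^ q"
proof (cases "w \<le> \<eta>")
  case True
  have "0 \<le> w ^ q / \<eta> ^ q" using assms by simp
  then show ?thesis using True by linarith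
next
  case False
  then have "1 \<le> w ^ q / \<eta> ^ q" using assms by (simp add: power_mono)
  then show ?thesis using assms by linarith
qed

section \<open>Lipschitz test functions on the Skorohod space\<close>

text \<open>Three comparisons: X with its level m step function by the modulus, the two step
  functions by finite-dimensional convergence, and Z with its step function. In the last one m stays
  fixed while the level M, at which the error is observed, tends to infinity.\<close>

lemma skorohod_convergence:
  fixes P :: "'p measure" and Q :: "'q measure"
    and X :: "'i \<Rightarrow> real \<times> real \<Rightarrow> 'p \<Rightarrow> real" and Z :: "real \<times> real \<Rightarrow> 'q \<Rightarrow> real"
  assumes P: "prob_space P" and Q: "prob_space Q" and F: "F \<noteq> bot"
    and Xp: "\<And>i. (\<lambda>\<omega>. \<lambda>t\<in>unit_square. X i t \<omega>) \<in> P \<rightarrow>\<^sub>M borel_of skorohod_topology"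
    and Zp: "(\<lambda>\<omega>. \<lambda>t\<in>unit_square. Z t \<omega>) \<in> Q \<rightarrow>\<^sub>M borel_of skorohod_topology"
    and Xm: "\<And>i t. t \<in> {0..} \<times> {0..} \<Longrightarrow> X i t \<in> borel_measurable P"
    and Zm: "\<And>t. t \<in> {0..} \<times> {0..} \<Longrightarrow> Z t \<in> borel_measurable Q"
    and X2: "\<And>i t. t \<in> {0..} \<times> {0..} \<Longrightarrow> integrable P (\<lambda>\<omega>. (X i t \<omega>)\<^sup>2)"
    and Z2: "\<And>t. t \<in> {0..} \<times> {0..} \<Longrightarrow> integrable Q (\<lambda>\<omega>. (Z t \<omega>)\<^sup>2)"
    and Xbd: "\<And>t. t \<in> {0..} \<times> {0..} \<Longrightarrow> \<exists>B. \<forall>\<^sub>F i in F. (\<integral>\<omega>. (X i t \<omega>)\<^sup>2 \<partial>P) \<le> B"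
    and cos: "\<And>T u b. finite T \<Longrightarrow> T \<subseteq> {0..} \<times> {0..} \<Longrightarrow>
      ((\<lambda>i. \<integral>\<omega>. cos ((\<Sum>t\<in>T. u t * X i t \<omega>) + b) \<partial>P) \<longlongrightarrow> (\<integral>\<omega>. cos ((\<Sum>t\<in>T. u t * Z t \<omega>) + b) \<partial>Q)) F"
    and q: "q > 0" and C': "0 \<le> C'" and r: "0 < r" "r < 1"
    and modulus: "\<And>m. \<forall>\<^sub>F i in F. \<exists>W. integrable P W \<and> (\<forall>\<omega>. 0 \<le> W \<omega>) \<and> (\<integral>\<omega>. W \<omega> \<partial>P) \<le> C' * r ^ m \<and>
       (\<forall>\<omega>\<in>space P. \<forall>s\<in>unit_square. \<forall>t\<in>unit_square.
          \<bar>fst s - fst t\<bar> \<le> (1/2) ^ Suc m \<longrightarrow> \<bar>snd s - snd t\<bar> \<le> (1/2) ^ Suc m \<longrightarrow> \<bar>X i s \<omega> - X i t \<omega>\<bar> ^ q \<le> W \<omega>)"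
    and fb: "\<And>x. x \<in> skorohod_space \<Longrightarrow> \<bar>f x\<bar> \<le> C"
    and fL: "\<And>x y. x \<in> skorohod_space \<Longrightarrow> y \<in> skorohod_space \<Longrightarrow> \<bar>f x - f y\<bar> \<le> K * skorohod_dist x y"
  shows "((\<lambda>i. \<integral>\<omega>. f (\<lambda>t\<in>unit_square. X i t \<omega>) \<partial>P) \<longlongrightarrow> (\<integral>\<omega>. f (\<lambda>t\<in>unit_square. Z t \<omega>) \<partial>Q)) F"
proof (rule tendstoI)
  fix e :: real assume e: "e > 0"
  interpret P: prob_space P by fact
  interpret Q: prob_space Q by fact
  interpret D: Metric_space skorohod_space skorohod_dist by (rule Metric_space_skorohod)
  define k where "k = \<bar>K\<bar>"
  have k0: "k \<ge> 0" by (simp add: k_def)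
  have fk: "\<bar>f x - f y\<bar> \<le> k * skorohod_dist x y" if "x \<in> skorohod_space" "y \<in> skorohod_space" for x y
    using fL[OF that] mult_right_mono[OF abs_ge_self D.nonneg, of K x y] unfolding k_def by (rule order_trans)
  have C0: "C \<ge> 0" using fb[OF step_in_skorohod_space] abs_ge_zero order_trans by blast
  \<comment> \<open>The error on the side of X is then at most e / 16 and the one on the side of Z
    at most e / 8, with e / 4 left for the step functions. The added 1 excludes division by
    0.\<close>
  define \<eta> where "\<eta> = e / (16 * (k + 2 * C + 1))"
  have \<eta>: "\<eta> > 0" unfolding \<eta>_def using e k0 C0 by simp
  have "(\<lambda>m. C' * r ^ m / \<eta> ^ q) \<longlonglongrightarrow> C' * 0 / \<eta> ^ q"
    using \<eta> r by (intro tendsto_intros LIMSEQ_power_zero) auto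
  then have "\<forall>\<^sub>F m in sequentially. C' * r ^ m / \<eta> ^ q < \<eta>" using \<eta> by (intro order_tendstoD(2)) auto
  then obtain m0 where m0: "C' * r ^ m0 / \<eta> ^ q < \<eta>" by (auto simp: eventually_sequentially)
  define m where "m = Suc m0"
  define xp where "xp i \<omega> = (\<lambda>t\<in>unit_square. X i t \<omega>)" for i \<omega>
  define zp where "zp \<omega> = (\<lambda>t\<in>unit_square. Z t \<omega>)" for \<omega>
  define xg where "xg M i \<omega> = (\<lambda>g. X i (pt M g) \<omega>)" for M i \<omega>
  define zg where "zg M \<omega> = (\<lambda>g. Z (pt M g) \<omega>)" for M \<omega>
  have xps: "xp i \<omega> \<in> skorohod_space" if "\<omega> \<in> space P" for i \<omega>
    using measurable_space[OF Xp that] by (simp add: space_borel_of topspace_skorohod_topology xp_def)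
  have zps: "zp \<omega> \<in> skorohod_space" if "\<omega> \<in> space Q" for \<omega>
    using measurable_space[OF Zp that] by (simp add: space_borel_of topspace_skorohod_topology zp_def)
  have fm: "f \<in> borel_measurable (borel_of skorohod_topology)"
    unfolding skorohod_topology_def by (intro continuous_map_borel_measurable D.lipschitz_continuous_map[OF fk])
  have fXm: "(\<lambda>\<omega>. f (xp i \<omega>)) \<in> borel_measurable P" for i
    unfolding xp_def by (rule measurable_compose[OF Xp fm])
  have fZm: "(\<lambda>\<omega>. f (zp \<omega>)) \<in> borel_measurable Q"
    unfolding zp_def by (rule measurable_compose[OF Zp fm])
  have fdd: "((\<lambda>i. \<integral>\<omega>. G (xg M i \<omega>) \<partial>P) \<longlongrightarrow> (\<integral>\<omega>. G (zg M \<omega>) \<partial>Q)) F"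
    and Gx: "\<And>i. (\<lambda>\<omega>. G (xg M i \<omega>)) \<in> borel_measurable P" and Gz: "(\<lambda>\<omega>. G (zg M \<omega>)) \<in> borel_measurable Q"
    if Gb: "\<And>x. \<bar>G x\<bar> \<le> c" and GL: "\<And>x y. \<bar>G x - G y\<bar> \<le> c' * (\<Sum>j\<in>grid M. \<bar>x j - y j\<bar>)" and c': "c' \<ge> 0" for M G c c'
  proof -
    show Gx: "(\<lambda>\<omega>. G (xg M i \<omega>)) \<in> borel_measurable P" for i
      unfolding xg_def by (rule lipschitz_coordinates_measurable[OF finite_grid GL Xm[OF pt_nonneg]])
    show Gz: "(\<lambda>\<omega>. G (zg M \<omega>)) \<in> borel_measurable Q"
      unfolding zg_def by (rule lipschitz_coordinates_measurable[OF finite_grid GL Zm[OF pt_nonneg]])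
    show "((\<lambda>i. \<integral>\<omega>. G (xg M i \<omega>) \<partial>P) \<longlongrightarrow> (\<integral>\<omega>. G (zg M \<omega>) \<partial>Q)) F"
      unfolding xg_def zg_def
    proof (rule fdd_convergence[where X = "\<lambda>i g. X i (pt M g)" and Z = "\<lambda>g. Z (pt M g)", OF P Q finite_grid])
      fix u :: "nat \<times> nat \<Rightarrow> real" and b :: real
      define u' where "u' t = u (inv (pt M) t)" for t
      have re: "(\<Sum>j\<in>grid M. u j * y (pt M j)) = (\<Sum>t\<in>pt M ` grid M. u' t * y t)" for y
        by (subst sum.reindex) (auto simp: u'_def inv_f_f[OF inj_pt] intro: inj_on_subset[OF inj_pt])
      have "((\<lambda>i. \<integral>\<omega>. cos ((\<Sum>t\<in>pt M ` grid M. u' t * X i t \<omega>) + b) \<partial>P) \<longlongrightarrow>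
         (\<integral>\<omega>. cos ((\<Sum>t\<in>pt M ` grid M. u' t * Z t \<omega>) + b) \<partial>Q)) F"
        by (rule cos[OF finite_imageI[OF finite_grid] image_subsetI[OF pt_nonneg]])
      then show "((\<lambda>i. \<integral>\<omega>. cos ((\<Sum>j\<in>grid M. u j * X i (pt M j) \<omega>) + b) \<partial>P) \<longlongrightarrow>
         (\<integral>\<omega>. cos ((\<Sum>j\<in>grid M. u j * Z (pt M j) \<omega>) + b) \<partial>Q)) F"
        using re[of "\<lambda>t. X _ t _"] re[of "\<lambda>t. Z t _"] by (simp only:)
    qed (use Gb GL c' Gx Gz Xm Zm X2 Z2 Xbd pt_nonneg in \<open>auto simp: xg_def zg_def\<close>)
  qed
  have modulus': "\<forall>\<^sub>F i in F. \<exists>W. integrable P W \<and> (\<forall>\<omega>. 0 \<le> W \<omega>) \<and> (\<integral>\<omega>. W \<omega> \<partial>P) \<le> C' * r ^ m0 \<and>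
      (\<forall>\<omega>\<in>space P. \<forall>t\<in>unit_square. \<bar>X i t \<omega> - X i (pt m (ix m t)) \<omega>\<bar> ^ q \<le> W \<omega>)"
    using modulus[of m0]
  proof eventually_elim
    case (elim i)
    then obtain W where W: "integrable P W" "\<forall>\<omega>. 0 \<le> W \<omega>" "(\<integral>\<omega>. W \<omega> \<partial>P) \<le> C' * r ^ m0"
      "\<And>\<omega> s t. \<omega> \<in> space P \<Longrightarrow> s \<in> unit_square \<Longrightarrow> t \<in> unit_square \<Longrightarrow>
          \<bar>fst s - fst t\<bar> \<le> (1/2) ^ Suc m0 \<Longrightarrow> \<bar>snd s - snd t\<bar> \<le> (1/2) ^ Suc m0 \<Longrightarrow> \<bar>X i s \<omega> - X i t \<omega>\<bar> ^ q \<le> W \<omega>"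
      by blast
    have "\<bar>X i t \<omega> - X i (pt m (ix m t)) \<omega>\<bar> ^ q \<le> W \<omega>" if "\<omega> \<in> space P" "t \<in> unit_square" for \<omega> t
      by (rule W(4)[OF that pt_unit_square[OF ix_grid[OF that(2)]]]) (use pt_ix_close[OF that(2), of m] in \<open>simp_all only: m_def\<close>)
    then show ?case using W(1-3) by blast
  qed
  have errX: "\<forall>\<^sub>F i in F. \<bar>(\<integral>\<omega>. f (xp i \<omega>) \<partial>P) - (\<integral>\<omega>. f (step m (xg m i \<omega>)) \<partial>P)\<bar> \<le> (k + 2 * C) * \<eta>"
    using modulus'
  proof eventually_elim
    case (elim i)
    then obtain W where W: "integrable P W" "\<And>\<omega>. 0 \<le> W \<omega>" "(\<integral>\<omega>. W \<omega> \<partial>P) \<le> C' * r ^ m0"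
      "\<And>\<omega> t. \<omega> \<in> space P \<Longrightarrow> t \<in> unit_square \<Longrightarrow> \<bar>X i t \<omega> - X i (pt m (ix m t)) \<omega>\<bar> ^ q \<le> W \<omega>"
      by blast
    have pw: "\<bar>f (xp i \<omega>) - f (step m (xg m i \<omega>))\<bar> \<le> k * \<eta> + 2 * C * (W \<omega> / \<eta> ^ q)" if w: "\<omega> \<in> space P" for \<omega>
    proof (cases "W \<omega> \<le> \<eta> ^ q")
      case True
      have "skorohod_dist (xp i \<omega>) (step m (xg m i \<omega>)) \<le> \<eta>"
      proof (rule skorohod_dist_le[OF xps[OF w] step_in_skorohod_space])
        fix t assume t: "t \<in> unit_square"
        have "\<bar>X i t \<omega> - X i (pt m (ix m t)) \<omega>\<bar> ^ q \<le> \<eta> ^ q" using W(4)[OF w t] True by linarith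
        then have "\<bar>X i t \<omega> - X i (pt m (ix m t)) \<omega>\<bar> \<le> \<eta>" by (rule power_le_base) (use \<eta> q in auto)
        then show "\<bar>xp i \<omega> t - step m (xg m i \<omega>) t\<bar> \<le> \<eta>" using t by (simp add: xp_def step_def xg_def)
      qed (use \<eta> in simp)
      then have "\<bar>f (xp i \<omega>) - f (step m (xg m i \<omega>))\<bar> \<le> k * \<eta>"
        using fk[OF xps[OF w] step_in_skorohod_space, of i m "xg m i \<omega>"] k0 by (meson mult_left_mono order_trans)
      moreover have "0 \<le> 2 * C * (W \<omega> / \<eta> ^ q)" using C0 W(2) \<eta> by simp
      ultimately show ?thesis by linarith
    next
      case False
      then have "1 \<le> W \<omega> / \<eta> ^ q" using \<eta> by simp
      then have "2 * C * 1 \<le> 2 * C * (W \<omega> / \<eta> ^ q)" using C0 by (intro mult_left_mono) auto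
      moreover have "\<bar>f (xp i \<omega>) - f (step m (xg m i \<omega>))\<bar> \<le> 2 * C"
        using fb[OF xps[OF w], of i] fb[OF step_in_skorohod_space, of m "xg m i \<omega>"] by linarith
      moreover have "0 \<le> k * \<eta>" using k0 \<eta> by simp
      ultimately show ?thesis by linarith
    qed
    have i1: "integrable P (\<lambda>\<omega>. f (xp i \<omega>))"
      using fXm fb[OF xps] by (intro P.integrable_const_bound[where B = C] AE_I2) auto
    have i2: "integrable P (\<lambda>\<omega>. f (step m (xg m i \<omega>)))"
      using Gx[of "\<lambda>x. f (step m x)" C k m, OF fb[OF step_in_skorohod_space] step_lipschitz[OF fk k0] k0]
        fb[OF step_in_skorohod_space] by (intro P.integrable_const_bound[where B = C] AE_I2) auto
    have "\<bar>(\<integral>\<omega>. f (xp i \<omega>) \<partial>P) - (\<integral>\<omega>. f (step m (xg m i \<omega>)) \<partial>P)\<bar> = \<bar>\<integral>\<omega>. f (xp i \<omega>) - f (step m (xg m i \<omega>)) \<partial>P\<bar>"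
      using i1 i2 by simp
    also have "\<dots> \<le> (\<integral>\<omega>. \<bar>f (xp i \<omega>) - f (step m (xg m i \<omega>))\<bar> \<partial>P)" by (rule integral_abs_bound)
    also have "\<dots> \<le> (\<integral>\<omega>. k * \<eta> + 2 * C * (W \<omega> / \<eta> ^ q) \<partial>P)"
      by (rule integral_mono) (use i1 i2 W(1) pw in auto)
    also have "\<dots> = k * \<eta> + 2 * C * ((\<integral>\<omega>. W \<omega> \<partial>P) / \<eta> ^ q)" using W(1) by (simp add: P.prob_space)
    also have "\<dots> \<le> k * \<eta> + 2 * C * \<eta>"
    proof (intro add_left_mono mult_left_mono)
      have "(\<integral>\<omega>. W \<omega> \<partial>P) / \<eta> ^ q \<le> C' * r ^ m0 / \<eta> ^ q" using W(3) \<eta> by (intro divide_right_mono) auto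
      then show "(\<integral>\<omega>. W \<omega> \<partial>P) / \<eta> ^ q \<le> \<eta>" using m0 by linarith
    qed (use C0 in auto)
    also have "\<dots> = (k + 2 * C) * \<eta>" by (simp add: distrib_right)
    finally show ?case .
  qed
  \<comment> \<open>The bound is shown for X and passes to Z because \<open>osc\<close> capped at 1
    is bounded and Lipschitz in finitely many coordinates. One \<open>\<eta>\<close> is the
    truncation level, the other bounds the moment of W.\<close>
  have EG: "(\<integral>\<omega>. min 1 (osc m M (zg M \<omega>)) \<partial>Q) \<le> 2 * \<eta>" if M: "m \<le> M" for M
  proof (rule tendsto_upperbound[OF fdd _ F])
    show "\<bar>min 1 (osc m M x)\<bar> \<le> 1" for x using osc_nonneg[of m M x] by auto
    show "\<bar>min 1 (osc m M x) - min 1 (osc m M y)\<bar> \<le> 2 * (\<Sum>j\<in>grid M. \<bar>x j - y j\<bar>)" for x y by (rule osc_lipschitz)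
    show "\<forall>\<^sub>F i in F. (\<integral>\<omega>. min 1 (osc m M (xg M i \<omega>)) \<partial>P) \<le> 2 * \<eta>"
      using modulus'
    proof eventually_elim
      case (elim i)
      then obtain W where W: "integrable P W" "\<And>\<omega>. 0 \<le> W \<omega>" "(\<integral>\<omega>. W \<omega> \<partial>P) \<le> C' * r ^ m0"
        "\<And>\<omega> t. \<omega> \<in> space P \<Longrightarrow> t \<in> unit_square \<Longrightarrow> \<bar>X i t \<omega> - X i (pt m (ix m t)) \<omega>\<bar> ^ q \<le> W \<omega>"
        by blast
      have pw: "min 1 (osc m M (xg M i \<omega>)) \<le> \<eta> + W \<omega> / \<eta> ^ q" if w: "\<omega> \<in> space P" for \<omega>
      proof -
        have "osc m M (xg M i \<omega>) \<le> root q (W \<omega>)"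
        proof (rule osc_le)
          fix g assume g: "g \<in> grid M"
          have "\<bar>X i (pt M g) \<omega> - X i (pt m (ix m (pt M g))) \<omega>\<bar> ^ q \<le> root q (W \<omega>) ^ q"
            using W(4)[OF w pt_unit_square[OF g]] W(2) q by simp
          then have "\<bar>X i (pt M g) \<omega> - X i (pt m (ix m (pt M g))) \<omega>\<bar> \<le> root q (W \<omega>)"
            by (rule power_le_base) (use q W(2) in auto)
          then show "\<bar>xg M i \<omega> g - xg M i \<omega> (coarse (M - m) g)\<bar> \<le> root q (W \<omega>)"
            by (simp add: xg_def pt_coarse[OF M])
        qed
        then have "min 1 (osc m M (xg M i \<omega>)) \<le> min 1 (root q (W \<omega>))" by simp
        also have "\<dots> \<le> \<eta> + root q (W \<omega>) ^ q / \<eta> ^ q" using W(2) q by (intro le_add_power_div \<eta>) auto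
        finally show ?thesis using W(2) q by simp
      qed
      have gm: "(\<lambda>\<omega>. min 1 (osc m M (xg M i \<omega>))) \<in> borel_measurable P"
        by (rule Gx[of "\<lambda>x. min 1 (osc m M x)" 1 2, OF _ osc_lipschitz]) (use osc_nonneg in auto)
      have "(\<integral>\<omega>. min 1 (osc m M (xg M i \<omega>)) \<partial>P) \<le> (\<integral>\<omega>. \<eta> + W \<omega> / \<eta> ^ q \<partial>P)"
      proof (rule integral_mono)
        show "integrable P (\<lambda>\<omega>. min 1 (osc m M (xg M i \<omega>)))"
          using gm osc_nonneg by (intro P.integrable_const_bound[where B = 1] AE_I2) auto
      qed (use W(1) pw in auto)
      also have "\<dots> = \<eta> + (\<integral>\<omega>. W \<omega> \<partial>P) / \<eta> ^ q" using W(1) by (simp add: P.prob_space)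
      also have "\<dots> \<le> \<eta> + C' * r ^ m0 / \<eta> ^ q" using W(3) \<eta> by (intro add_left_mono divide_right_mono) auto
      finally show ?case using m0 by linarith
    qed
  qed simp
  have errZ: "\<bar>(\<integral>\<omega>. f (zp \<omega>) \<partial>Q) - (\<integral>\<omega>. f (step m (zg m \<omega>)) \<partial>Q)\<bar> \<le> (k + 2 * C) * (2 * \<eta>)"
  proof -
    define oc where "oc M \<omega> = min 1 (osc m M (zg M \<omega>))" for M \<omega>
    define v where "v \<omega> = (SUP M. oc (M + m) \<omega>)" for \<omega>
    have o01: "0 \<le> oc M \<omega>" "oc M \<omega> \<le> 1" for M \<omega> unfolding oc_def using osc_nonneg by auto
    have om: "oc M \<in> borel_measurable Q" for M
      unfolding oc_def[abs_def] by (rule Gz[of "\<lambda>x. min 1 (osc m M x)" 1 2, OF _ osc_lipschitz]) (use osc_nonneg in auto)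
    have bdd: "bdd_above (range (\<lambda>M. oc (M + m) \<omega>))" for \<omega> using o01 by (intro bdd_aboveI2) auto
    have ov: "oc M \<omega> \<le> v \<omega>" if "m \<le> M" for M \<omega>
      unfolding v_def using cSUP_upper[OF _ bdd, of "M - m" \<omega>] that by simp
    \<comment> \<open>Every point of level M is a point of level M + 1 with doubled index, and its
      rounding to level m is unchanged, so the oscillation seen at the finer level is at least as
      large.\<close>
    have inc: "incseq (\<lambda>M. oc (M + m) \<omega>)" for \<omega>
    proof (rule incseq_SucI)
      fix M
      define M' where "M' = M + m"
      have mM: "m \<le> M'" "m \<le> Suc M'" by (auto simp: M'_def)
      have "osc m M' (zg M' \<omega>) \<le> osc m (Suc M') (zg (Suc M') \<omega>)"
      proof (rule osc_le)
        fix g assume g: "g \<in> grid M'"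
        define g2 where "g2 = (2 * fst g, 2 * snd g)"
        have g2: "g2 \<in> grid (Suc M')" using g by (auto simp: g2_def grid_def)
        have p2: "pt (Suc M') g2 = pt M' g" by (simp add: pt_def g2_def)
        have "\<bar>zg M' \<omega> g - zg M' \<omega> (coarse (M' - m) g)\<bar> = \<bar>zg (Suc M') \<omega> g2 - zg (Suc M') \<omega> (coarse (Suc M' - m) g2)\<bar>"
          unfolding zg_def pt_coarse[OF mM(1)] pt_coarse[OF mM(2)] p2 ..
        also have "\<dots> \<le> osc m (Suc M') (zg (Suc M') \<omega>)" by (rule osc_ge[OF g2])
        finally show "\<bar>zg M' \<omega> g - zg M' \<omega> (coarse (M' - m) g)\<bar> \<le> osc m (Suc M') (zg (Suc M') \<omega>)" .
      qed
      then show "oc (M + m) \<omega> \<le> oc (Suc M + m) \<omega>" unfolding oc_def M'_def by simp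
    qed
    have lim: "(\<lambda>M. oc (M + m) \<omega>) \<longlonglongrightarrow> v \<omega>" for \<omega>
      unfolding v_def by (rule LIMSEQ_incseq_SUP[OF bdd inc])
    have vm: "v \<in> borel_measurable Q" by (rule borel_measurable_LIMSEQ_real[OF lim om])
    have v01: "0 \<le> v \<omega>" "v \<omega> \<le> 1" for \<omega>
      using order_trans[OF o01(1) ov[OF order_refl]] LIMSEQ_le_const2[OF lim] o01(2) by auto
    have iv: "integrable Q v" using vm v01 by (intro Q.integrable_const_bound[where B = 1] AE_I2) auto
    have "(\<lambda>M. \<integral>\<omega>. oc (M + m) \<omega> \<partial>Q) \<longlonglongrightarrow> (\<integral>\<omega>. v \<omega> \<partial>Q)"
      by (rule integral_dominated_convergence[where w = "\<lambda>_. 1"]) (use om vm lim o01 in auto)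
    then have Ev: "(\<integral>\<omega>. v \<omega> \<partial>Q) \<le> 2 * \<eta>"
      by (rule LIMSEQ_le_const2) (use EG in \<open>auto simp: oc_def\<close>)
    have pw: "\<bar>f (zp \<omega>) - f (step m (zg m \<omega>))\<bar> \<le> (k + 2 * C) * v \<omega>" if w: "\<omega> \<in> space Q" for \<omega>
    proof -
      have d: "min 1 \<bar>Z t \<omega> - Z (pt m (ix m t)) \<omega>\<bar> \<le> v \<omega>" if t: "t \<in> unit_square" for t
      proof (rule discretization_error_le[OF _ _ t])
        show "(\<lambda>t\<in>unit_square. Z t \<omega>) \<in> skorohod_space" using zps[OF w] by (simp add: zp_def)
        show "min 1 (osc m M (\<lambda>g. Z (pt M g) \<omega>)) \<le> v \<omega>" if "m \<le> M" for M
          using ov[OF that, of \<omega>] by (simp add: oc_def zg_def)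
      qed
      show ?thesis
      \<comment> \<open>Below 1 the cap is inactive and \<open>v \<omega>\<close> bounds the uniform
        distance; otherwise \<open>v \<omega>\<close> is 1 and boundedness of f is enough.\<close>
      proof (cases "v \<omega> < 1")
        case True
        have "skorohod_dist (zp \<omega>) (step m (zg m \<omega>)) \<le> v \<omega>"
        proof (rule skorohod_dist_le[OF zps[OF w] step_in_skorohod_space])
          fix t assume t: "t \<in> unit_square"
          have "\<bar>Z t \<omega> - Z (pt m (ix m t)) \<omega>\<bar> \<le> v \<omega>" using d[OF t] True by (simp add: min_def split: if_splits)
          then show "\<bar>zp \<omega> t - step m (zg m \<omega>) t\<bar> \<le> v \<omega>" using t by (simp add: zp_def step_def zg_def)
        qed (rule v01)
        then have "\<bar>f (zp \<omega>) - f (step m (zg m \<omega>))\<bar> \<le> k * v \<omega>"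
          using fk[OF zps[OF w] step_in_skorohod_space, of m "zg m \<omega>"] k0 by (meson mult_left_mono order_trans)
        moreover have "0 \<le> 2 * C * v \<omega>" using C0 v01 by simp
        ultimately show ?thesis by (simp add: distrib_right)
      next
        case False
        then have "v \<omega> = 1" using v01(2)[of \<omega>] by simp
        moreover have "\<bar>f (zp \<omega>) - f (step m (zg m \<omega>))\<bar> \<le> 2 * C"
          using fb[OF zps[OF w]] fb[OF step_in_skorohod_space, of m "zg m \<omega>"] by linarith
        ultimately show ?thesis using k0 by simp
      qed
    qed
    have i1: "integrable Q (\<lambda>\<omega>. f (zp \<omega>))"
      using fZm fb[OF zps] by (intro Q.integrable_const_bound[where B = C] AE_I2) auto
    have i2: "integrable Q (\<lambda>\<omega>. f (step m (zg m \<omega>)))"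
      using Gz[of "\<lambda>x. f (step m x)" C k m, OF fb[OF step_in_skorohod_space] step_lipschitz[OF fk k0] k0]
        fb[OF step_in_skorohod_space] by (intro Q.integrable_const_bound[where B = C] AE_I2) auto
    have "\<bar>(\<integral>\<omega>. f (zp \<omega>) \<partial>Q) - (\<integral>\<omega>. f (step m (zg m \<omega>)) \<partial>Q)\<bar> = \<bar>\<integral>\<omega>. f (zp \<omega>) - f (step m (zg m \<omega>)) \<partial>Q\<bar>"
      using i1 i2 by simp
    also have "\<dots> \<le> (\<integral>\<omega>. \<bar>f (zp \<omega>) - f (step m (zg m \<omega>))\<bar> \<partial>Q)" by (rule integral_abs_bound)
    also have "\<dots> \<le> (\<integral>\<omega>. (k + 2 * C) * v \<omega> \<partial>Q)"
      by (rule integral_mono) (use i1 i2 iv pw in auto)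
    also have "\<dots> = (k + 2 * C) * (\<integral>\<omega>. v \<omega> \<partial>Q)" by simp
    also have "\<dots> \<le> (k + 2 * C) * (2 * \<eta>)" using Ev k0 C0 by (intro mult_left_mono) auto
    finally show ?thesis .
  qed
  have step_lim: "((\<lambda>i. \<integral>\<omega>. f (step m (xg m i \<omega>)) \<partial>P) \<longlongrightarrow> (\<integral>\<omega>. f (step m (zg m \<omega>)) \<partial>Q)) F"
    by (rule fdd[OF fb[OF step_in_skorohod_space] step_lipschitz[OF fk k0] k0])
  have small: "(k + 2 * C) * \<eta> \<le> e / 16"
  proof -
    have "(k + 2 * C) * \<eta> \<le> (k + 2 * C + 1) * \<eta>" using \<eta> by (intro mult_right_mono) auto
    also have "\<dots> = e / 16"
    proof -
      have "x * (e / (16 * x)) = e / 16" if "x \<noteq> 0" for x using that by simp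
      from this[of "k + 2 * C + 1"] show ?thesis unfolding \<eta>_def using k0 C0 by linarith
    qed
    finally show ?thesis .
  qed
  have "\<forall>\<^sub>F i in F. dist (\<integral>\<omega>. f (xp i \<omega>) \<partial>P) (\<integral>\<omega>. f (zp \<omega>) \<partial>Q) < e"
    using errX tendstoD[OF step_lim divide_pos_pos[OF e zero_less_numeral[of "num.Bit0 (num.Bit0 num.One)"]]]
  proof eventually_elim
    case (elim i)
    have "(k + 2 * C) * (2 * \<eta>) \<le> e / 8" using small by simp
    then show ?case using elim errZ small e unfolding dist_real_def by linarith
  qed
  then show "\<forall>\<^sub>F i in F. dist (\<integral>\<omega>. f (\<lambda>t\<in>unit_square. X i t \<omega>) \<partial>P) (\<integral>\<omega>. f (\<lambda>t\<in>unit_square. Z t \<omega>) \<partial>Q) < e"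
    by (simp only: xp_def zp_def)
qed

section \<open>The Gaussian limit\<close>

text \<open>A Dirac law is the case of zero variance. A law with density is reduced to the standard
  normal characteristic function by the scaling with its standard deviation; the centering forces m
  = 0 in both cases.\<close>

lemma normal_law_cos:
  assumes N: "prob_space N" and Y: "Y \<in> borel_measurable N" and n: "normal_law (distr N borel Y)"
    and 0: "(\<integral>\<omega>. Y \<omega> \<partial>N) = 0"
  shows "integrable N (\<lambda>\<omega>. (Y \<omega>)\<^sup>2)"
    and "(\<integral>\<omega>. cos (Y \<omega> + b) \<partial>N) = cos b * exp (- (\<integral>\<omega>. (Y \<omega>)\<^sup>2 \<partial>N) / 2)"
proof -
  interpret N: prob_space N by fact
  note [measurable] = Y
  have "integrable N (\<lambda>\<omega>. (Y \<omega>)\<^sup>2) \<and> (\<integral>\<omega>. cos (Y \<omega> + b) \<partial>N) = cos b * exp (- (\<integral>\<omega>. (Y \<omega>)\<^sup>2 \<partial>N) / 2)"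
    using n unfolding normal_law_def
  proof (elim disjE exE conjE)
    fix m assume d: "distr N borel Y = return borel m"
    have "AE x in distr N borel Y. x = m" unfolding d by (subst AE_return) auto
    then have ae: "AE \<omega> in N. Y \<omega> = m" by (simp add: AE_distr_iff)
    have "(\<integral>\<omega>. Y \<omega> \<partial>N) = (\<integral>\<omega>. m \<partial>N)" by (rule integral_cong_AE) (use ae in auto)
    then have m: "m = 0" using 0 by (simp add: N.prob_space)
    have "integrable N (\<lambda>\<omega>. (Y \<omega>)\<^sup>2) \<longleftrightarrow> integrable N (\<lambda>\<omega>. 0::real)"
      by (rule integrable_cong_AE) (use ae m in auto)
    moreover have "(\<integral>\<omega>. (Y \<omega>)\<^sup>2 \<partial>N) = (\<integral>\<omega>. 0 \<partial>N)" by (rule integral_cong_AE) (use ae m in auto)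
    moreover have "(\<integral>\<omega>. cos (Y \<omega> + b) \<partial>N) = (\<integral>\<omega>. cos b \<partial>N)"
      by (rule integral_cong_AE) (use ae m in auto)
    ultimately show ?thesis by (simp add: N.prob_space)
  next
    fix m s :: real assume s: "s > 0" and d: "distr N borel Y = density lborel (\<lambda>x. ennreal (normal_density m s x))"
    have "distr N lborel Y = distr N borel Y" by (rule distr_cong) auto
    then have D: "distributed N lborel Y (normal_density m s)"
      unfolding distributed_def using d by simp
    have m: "m = 0" using N.normal_distributed_expectation[OF s D] 0 by simp
    have var: "(\<integral>\<omega>. (Y \<omega>)\<^sup>2 \<partial>N) = s\<^sup>2"
      using N.normal_distributed_variance[OF s D] 0 by simp
    have "integrable lborel (\<lambda>x. normal_density m s x * (x - m)\<^sup>2)" by (rule integrable_normal_moment[OF s])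
    then have int: "integrable N (\<lambda>\<omega>. (Y \<omega>)\<^sup>2)"
      using distributed_integrable[OF D, of "\<lambda>x. x\<^sup>2"] m by simp
    have D': "distributed N lborel (\<lambda>\<omega>. Y \<omega> / s) std_normal_density"
      using N.normal_standard_normal_convert[OF s, of Y m] D m by simp
    have ds: "distr N borel (\<lambda>\<omega>. Y \<omega> / s) = std_normal_distribution"
      using distributed_distr_eq_density[OF D'] by (simp cong: distr_cong)
    have "(CLINT \<omega>|N. iexp (Y \<omega>)) = (CLINT x|distr N borel (\<lambda>\<omega>. Y \<omega> / s). iexp (s * x))"
      using s by (subst integral_distr) auto
    also have "\<dots> = complex_of_real (exp (- (s\<^sup>2) / 2))"
      unfolding ds using char_std_normal_distribution[THEN fun_cong, of s] by (simp add: char_def)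
    finally have c: "(CLINT \<omega>|N. iexp (Y \<omega>)) = complex_of_real (exp (- (s\<^sup>2) / 2))" .
    have i: "integrable N (\<lambda>\<omega>. iexp (Y \<omega>))"
      by (rule N.integrable_const_bound[where B = 1]) auto
    have "(\<integral>\<omega>. cos (Y \<omega> + b) \<partial>N) = (\<integral>\<omega>. Re (iexp b * iexp (Y \<omega>)) \<partial>N)"
      by (simp add: cis_conv_exp[symmetric] cis_mult add.commute)
    also have "\<dots> = Re (CLINT \<omega>|N. iexp b * iexp (Y \<omega>))" using i by (intro integral_Re) auto
    also have "\<dots> = cos b * exp (- (s\<^sup>2) / 2)" using c i by (simp add: Re_exp)
    finally show ?thesis using int var by simp
  qed
  then show "integrable N (\<lambda>\<omega>. (Y \<omega>)\<^sup>2)"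
    "(\<integral>\<omega>. cos (Y \<omega> + b) \<partial>N) = cos b * exp (- (\<integral>\<omega>. (Y \<omega>)\<^sup>2 \<partial>N) / 2)" by auto
qed

text \<open>Square integrability is read off the normal laws of single coordinates. The variance of
  a combination then expands into covariances, because the means vanish.\<close>

lemma gaussian_process_cos:
  assumes G: "gaussian_process N A B" and 0: "\<And>t. t \<in> A \<Longrightarrow> (\<integral>\<omega>. B t \<omega> \<partial>N) = 0"
  shows "t \<in> A \<Longrightarrow> integrable N (\<lambda>\<omega>. (B t \<omega>)\<^sup>2)"
    and "finite T \<Longrightarrow> T \<subseteq> A \<Longrightarrow> (\<integral>\<omega>. cos ((\<Sum>t\<in>T. u t * B t \<omega>) + b) \<partial>N)
      = cos b * exp (- (\<Sum>s\<in>T. \<Sum>t\<in>T. u s * u t * covariance N (B s) (B t)) / 2)"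
proof -
  interpret N: prob_space N using G by (simp add: gaussian_process_def)
  have Bm: "B t \<in> borel_measurable N" if "t \<in> A" for t using G that by (simp add: gaussian_process_def)
  have nl: "normal_law (distr N borel (\<lambda>\<omega>. \<Sum>t\<in>T. c t * B t \<omega>))" if "finite T" "T \<subseteq> A" for T c
    using G that by (simp add: gaussian_process_def)
  show sq: "integrable N (\<lambda>\<omega>. (B t \<omega>)\<^sup>2)" if t: "t \<in> A" for t
    using normal_law_cos(1)[OF N.prob_space_axioms Bm[OF t] _ 0[OF t]] nl[of "{t}" "\<lambda>_. 1"] t by simp
  assume T: "finite T" "T \<subseteq> A"
  then have tA: "t \<in> A" if "t \<in> T" for t using that by auto
  have i1: "integrable N (B t)" if "t \<in> A" for t
    by (rule N.square_integrable_imp_integrable[OF Bm sq]) (rule that)+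
  have i2: "integrable N (\<lambda>\<omega>. B s \<omega> * B t \<omega>)" if "s \<in> A" "t \<in> A" for s t
  proof (rule Bochner_Integration.integrable_bound[of N "\<lambda>\<omega>. (B s \<omega>)\<^sup>2 + (B t \<omega>)\<^sup>2"])
    show "integrable N (\<lambda>\<omega>. (B s \<omega>)\<^sup>2 + (B t \<omega>)\<^sup>2)" using sq that by simp
    show "(\<lambda>\<omega>. B s \<omega> * B t \<omega>) \<in> borel_measurable N" using Bm that by simp
    have "\<bar>x * y\<bar> \<le> x\<^sup>2 + y\<^sup>2" for x y :: real
      using zero_le_power2[of "\<bar>x\<bar> - \<bar>y\<bar>"] abs_ge_zero[of "x * y"]
      unfolding power2_diff abs_mult power2_abs by linarith
    then show "AE \<omega> in N. norm (B s \<omega> * B t \<omega>) \<le> norm ((B s \<omega>)\<^sup>2 + (B t \<omega>)\<^sup>2)" by simp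
  qed
  define Y where "Y \<omega> = (\<Sum>t\<in>T. u t * B t \<omega>)" for \<omega>
  have Ym: "Y \<in> borel_measurable N" unfolding Y_def[abs_def] using Bm tA by simp
  have "(\<integral>\<omega>. Y \<omega> \<partial>N) = (\<Sum>t\<in>T. u t * (\<integral>\<omega>. B t \<omega> \<partial>N))" unfolding Y_def using i1 tA by simp
  then have Y0: "(\<integral>\<omega>. Y \<omega> \<partial>N) = 0" using 0 tA by simp
  have "(Y \<omega>)\<^sup>2 = (\<Sum>s\<in>T. \<Sum>t\<in>T. u s * u t * (B s \<omega> * B t \<omega>))" for \<omega>
    unfolding Y_def power2_eq_square sum_product by (simp add: mult_ac)
  then have "(\<integral>\<omega>. (Y \<omega>)\<^sup>2 \<partial>N) = (\<Sum>s\<in>T. \<Sum>t\<in>T. u s * u t * (\<integral>\<omega>. B s \<omega> * B t \<omega> \<partial>N))"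
    using i2 tA by simp
  also have "\<dots> = (\<Sum>s\<in>T. \<Sum>t\<in>T. u s * u t * covariance N (B s) (B t))"
    using 0 tA by (simp add: covariance_def)
  finally have v: "(\<integral>\<omega>. (Y \<omega>)\<^sup>2 \<partial>N) = (\<Sum>s\<in>T. \<Sum>t\<in>T. u s * u t * covariance N (B s) (B t))" .
  have "(\<integral>\<omega>. cos (Y \<omega> + b) \<partial>N) = cos b * exp (- (\<integral>\<omega>. (Y \<omega>)\<^sup>2 \<partial>N) / 2)"
    by (rule normal_law_cos(2)[OF N.prob_space_axioms Ym _ Y0]) (use nl[OF T] in \<open>simp add: Y_def[abs_def]\<close>)
  then show "(\<integral>\<omega>. cos ((\<Sum>t\<in>T. u t * B t \<omega>) + b) \<partial>N)
      = cos b * exp (- (\<Sum>s\<in>T. \<Sum>t\<in>T. u s * u t * covariance N (B s) (B t)) / 2)"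
    unfolding v by (simp add: Y_def)
qed

section \<open>Measurability of the paths\<close>

text \<open>A map with finitely many values is measurable into any sigma-algebra once its fibres are
  measurable sets. This makes the partial-sum paths random elements without a description of the
  Borel sets by coordinates.\<close>

lemma measurable_finite_range:
  assumes fin: "finite (V ` space M)" and V: "\<And>\<omega>. \<omega> \<in> space M \<Longrightarrow> V -` {V \<omega>} \<inter> space M \<in> sets M"
    and g: "\<And>\<omega>. \<omega> \<in> space M \<Longrightarrow> g (V \<omega>) \<in> space N"
  shows "(\<lambda>\<omega>. g (V \<omega>)) \<in> M \<rightarrow>\<^sub>M N"
proof -
  have "V \<in> M \<rightarrow>\<^sub>M count_space (V ` space M)"
    unfolding measurable_count_space_eq2[OF fin] using V by auto
  moreover have "g \<in> count_space (V ` space M) \<rightarrow>\<^sub>M N" using g by auto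
  ultimately show ?thesis by (rule measurable_compose)
qed

section \<open>Scaling of paths\<close>

lemma skorohod_space_scale:
  assumes x: "x \<in> skorohod_space" shows "(\<lambda>t\<in>unit_square. a * x t) \<in> skorohod_space"
proof -
  have eq: "((\<lambda>t\<in>unit_square. a * x t) \<longlongrightarrow> l) (at t within quadrant R1 R2 t) \<longleftrightarrow>
      ((\<lambda>t. a * x t) \<longlongrightarrow> l) (at t within quadrant R1 R2 t)" for l t R1 R2
    by (rule Lim_cong_within) (auto simp: quadrant_def)
  show ?thesis
    unfolding skorohod_space_def
  proof (intro CollectI conjI ballI restrict_extensional)
    fix t :: "real \<times> real" assume t: "t \<in> unit_square"
    then have xt: "(x \<longlongrightarrow> x t) (at t within quadrant (\<ge>) (\<ge>) t)" using x unfolding skorohod_space_def by blast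
    show "((\<lambda>t\<in>unit_square. a * x t) \<longlongrightarrow> (\<lambda>t\<in>unit_square. a * x t) t) (at t within quadrant (\<ge>) (\<ge>) t)"
      unfolding eq restrict_apply'[OF t] by (intro tendsto_mult_left xt)
    fix R1 R2 :: "real \<Rightarrow> real \<Rightarrow> bool" assume "R1 \<in> {(<), (\<ge>)}" "R2 \<in> {(<), (\<ge>)}"
    then obtain l where "(x \<longlongrightarrow> l) (at t within quadrant R1 R2 t)" using x t unfolding skorohod_space_def by blast
    then have "((\<lambda>t. a * x t) \<longlongrightarrow> a * l) (at t within quadrant R1 R2 t)" by (rule tendsto_mult_left)
    then show "\<exists>l. ((\<lambda>t\<in>unit_square. a * x t) \<longlongrightarrow> l) (at t within quadrant R1 R2 t)" unfolding eq by blast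
  qed
qed

text \<open>The same time changes serve for the scaled paths. Values scale with |a|, but the
  displacement of time does not, whence the maximum with 1.\<close>

lemma skorohod_dist_scale:
  assumes x: "x \<in> skorohod_space" "y \<in> skorohod_space"
  shows "skorohod_dist (\<lambda>t\<in>unit_square. a * x t) (\<lambda>t\<in>unit_square. a * y t) \<le> max 1 \<bar>a\<bar> * skorohod_dist x y"
proof -
  define c where "c = max 1 \<bar>a\<bar>"
  have c: "c > 0" "c \<ge> 1" "c \<ge> \<bar>a\<bar>" by (auto simp: c_def)
  have le: "skorohod_dist (\<lambda>t\<in>unit_square. a * x t) (\<lambda>t\<in>unit_square. a * y t) \<le> c * e" if e: "skorohod_close x y e" for e
  proof -
    obtain f1 f2 where f: "f1 \<in> time_changes" "f2 \<in> time_changes"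
      and cl: "\<And>t. t \<in> unit_square \<Longrightarrow>
        \<bar>x t - y (f1 (fst t), f2 (snd t))\<bar> \<le> e \<and> dist (f1 (fst t), f2 (snd t)) t \<le> e"
      using e unfolding skorohod_close_def by blast
    have e0: "0 \<le> e" by (rule skorohod_close_nonneg[OF e])
    have "skorohod_close (\<lambda>t\<in>unit_square. a * x t) (\<lambda>t\<in>unit_square. a * y t) (c * e)"
    proof (rule skorohod_closeI[OF f], rule conjI)
      fix t :: "real \<times> real" assume t: "t \<in> unit_square"
      then have ft: "(f1 (fst t), f2 (snd t)) \<in> unit_square" using f time_change_in by (auto simp: mem_Times_iff)
      have "\<bar>a * x t - a * y (f1 (fst t), f2 (snd t))\<bar> = \<bar>a\<bar> * \<bar>x t - y (f1 (fst t), f2 (snd t))\<bar>"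
        by (simp flip: right_diff_distrib abs_mult)
      also have "\<dots> \<le> c * e" using cl[OF t] c e0 by (intro mult_mono) auto
      finally show "\<bar>(\<lambda>t\<in>unit_square. a * x t) t - (\<lambda>t\<in>unit_square. a * y t) (f1 (fst t), f2 (snd t))\<bar> \<le> c * e"
        unfolding restrict_apply'[OF t] restrict_apply'[OF ft] .
      have "1 * e \<le> c * e" using c e0 by (intro mult_right_mono)
      then show "dist (f1 (fst t), f2 (snd t)) t \<le> c * e" using cl[OF t] by linarith
    qed
    moreover have "bdd_below {e. skorohod_close (\<lambda>t\<in>unit_square. a * x t) (\<lambda>t\<in>unit_square. a * y t) e}"
      by (rule bdd_belowI[of _ 0]) (auto intro: skorohod_close_nonneg)
    ultimately show ?thesis
      using skorohod_space_scale[OF x(1), of a] skorohod_space_scale[OF x(2), of a]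
      by (auto simp: skorohod_dist_def intro: cInf_lower)
  qed
  have "skorohod_dist (\<lambda>t\<in>unit_square. a * x t) (\<lambda>t\<in>unit_square. a * y t) / c \<le> Inf {e. skorohod_close x y e}"
    by (rule cInf_greatest) (use skorohod_close_exists[OF x] le c in \<open>auto simp: field_simps\<close>)
  then show ?thesis using x c by (simp add: skorohod_dist_def field_simps c_def)
qed

text \<open>Only the path of \<open>B\<close> itself is given as a random element; continuity of
  scaling transfers this to the limit with its constant.\<close>

lemma skorohod_scale_measurable:
  "(\<lambda>x. \<lambda>t\<in>unit_square. a * x t) \<in> borel_of skorohod_topology \<rightarrow>\<^sub>M borel_of skorohod_topology"
proof (rule continuous_map_measurable_borel_of)
  interpret D: Metric_space skorohod_space skorohod_dist by (rule Metric_space_skorohod)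
  show "continuous_map skorohod_topology skorohod_topology (\<lambda>x. \<lambda>t\<in>unit_square. a * x t)"
    unfolding skorohod_topology_def D.metric_continuous_map[OF Metric_space_skorohod]
  proof (intro conjI ballI allI impI image_subsetI skorohod_space_scale)
    fix x and e :: real assume x: "x \<in> skorohod_space" and e: "e > 0"
    define c where "c = max 1 \<bar>a\<bar>"
    have c: "c > 0" by (simp add: c_def)
    have "skorohod_dist (\<lambda>t\<in>unit_square. a * x t) (\<lambda>t\<in>unit_square. a * y t) < e"
      if "y \<in> skorohod_space \<and> skorohod_dist x y < e / c" for y
    proof (rule order_le_less_trans)
      show "skorohod_dist (\<lambda>t\<in>unit_square. a * x t) (\<lambda>t\<in>unit_square. a * y t) \<le> c * skorohod_dist x y"
        unfolding c_def by (rule skorohod_dist_scale) (use x that in auto)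
      show "c * skorohod_dist x y < e" using that c by (simp add: pos_less_divide_eq mult.commute)
    qed
    then show "\<exists>\<delta>>0. \<forall>y. y \<in> skorohod_space \<and> skorohod_dist x y < \<delta> \<longrightarrow>
        skorohod_dist (\<lambda>t\<in>unit_square. a * x t) (\<lambda>t\<in>unit_square. a * y t) < e"
      using e c by (intro exI[of _ "e / c"]) auto
  qed auto
qed

section \<open>Convergence of the scaled partial sums\<close>

context karlin_sheet begin

lemma X_measurable: "X n t \<in> borel_measurable M"
  unfolding X_def[abs_def] using S_measurable by simp

lemma X_square_integrable: "integrable M (\<lambda>\<omega>. (X n t \<omega>)\<^sup>2)"
proof -
  define a b where "a = nat \<lfloor>real (fst n) * fst t\<rfloor>" and "b = nat \<lfloor>real (snd n) * snd t\<rfloor>"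
  have "integrable M (\<lambda>\<omega>. (S a b \<omega>)\<^sup>2)"
  proof (rule integrable_const_bound[where B = "(real a * real b)\<^sup>2"])
    show "AE \<omega> in M. norm ((S a b \<omega>)\<^sup>2) \<le> (real a * real b)\<^sup>2"
      using S_bound power_mono[of "\<bar>S a b _\<bar>" "real a * real b" 2] by (intro AE_I2) simp
  qed (use S_measurable in simp)
  then show ?thesis unfolding X_def a_def[symmetric] b_def[symmetric] power_divide by simp
qed

text \<open>Integer values within the bound of \<open>S_bound\<close> leave finitely many
  possibilities for the whole array of partial sums, as \<open>measurable_finite_range\<close>
  requires.\<close>

lemma S_Ints: "\<omega> \<in> space M \<Longrightarrow> S n1 n2 \<omega> \<in> \<int>"
proof -
  assume w: "\<omega> \<in> space M"
  have "\<epsilon> (Y1 i \<omega>, Y2 j \<omega>) \<omega> \<in> \<int>" if "i \<ge> 1" "j \<ge> 1" for i j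
  proof -
    have "\<bar>\<epsilon> (Y1 i \<omega>, Y2 j \<omega>) \<omega>\<bar> = 1" using Y_pos[OF w] that w by (intro R.e_abs) auto
    then have "\<epsilon> (Y1 i \<omega>, Y2 j \<omega>) \<omega> = 1 \<or> \<epsilon> (Y1 i \<omega>, Y2 j \<omega>) \<omega> = - 1" by linarith
    then show ?thesis by auto
  qed
  then show ?thesis unfolding karlin_S_def karlin_X_def Let_def
    by (intro Ints_sum Ints_mult Ints_power) auto
qed

lemma X_path_measurable: "(\<lambda>\<omega>. \<lambda>t\<in>unit_square. X n t \<omega>) \<in> M \<rightarrow>\<^sub>M borel_of skorohod_topology"
proof -
  define D where "D = {..fst n} \<times> {..snd n}"
  define V where "V \<omega> = (\<lambda>p\<in>D. S (fst p) (snd p) \<omega>)" for \<omega>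
  define g where "g v = (\<lambda>t\<in>unit_square. v (nat \<lfloor>real (fst n) * fst t\<rfloor>, nat \<lfloor>real (snd n) * snd t\<rfloor>) / norming (fst n) (snd n))"
    for v :: "nat \<times> nat \<Rightarrow> real"
  have gV: "g (V \<omega>) = (\<lambda>t\<in>unit_square. X n t \<omega>)" for \<omega>
    unfolding g_def
  proof (rule restrict_ext)
    fix t :: "real \<times> real" assume "t \<in> unit_square"
    then have "(nat \<lfloor>real (fst n) * fst t\<rfloor>, nat \<lfloor>real (snd n) * snd t\<rfloor>) \<in> D"
      unfolding D_def mem_Times_iff fst_conv snd_conv atMost_iff
      by (intro conjI nat_floor_le) (auto simp: mem_Times_iff)
    then show "V \<omega> (nat \<lfloor>real (fst n) * fst t\<rfloor>, nat \<lfloor>real (snd n) * snd t\<rfloor>) / norming (fst n) (snd n) = X n t \<omega>"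
      by (simp add: V_def X_def)
  qed
  define B where "B = (real (fst n) * real (snd n))"
  have "V ` space M \<subseteq> D \<rightarrow>\<^sub>E {x \<in> \<int>. \<bar>x\<bar> \<le> B}"
  proof (intro image_subsetI PiE_I)
    fix \<omega> p assume w: "\<omega> \<in> space M" and p: "p \<in> D"
    have "\<bar>S (fst p) (snd p) \<omega>\<bar> \<le> real (fst p) * real (snd p)" by (rule S_bound[OF w])
    also have "\<dots> \<le> B" unfolding B_def using p by (intro mult_mono) (auto simp: D_def)
    finally show "V \<omega> p \<in> {x \<in> \<int>. \<bar>x\<bar> \<le> B}" using S_Ints[OF w] p by (simp add: V_def)
  qed (simp add: V_def)
  moreover have "finite (D \<rightarrow>\<^sub>E {x \<in> \<int>. \<bar>x\<bar> \<le> B})"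
    by (intro finite_PiE finite_abs_int_segment) (simp add: D_def)
  ultimately have fin: "finite (V ` space M)" by (rule finite_subset)
  have "(\<lambda>\<omega>. g (V \<omega>)) \<in> M \<rightarrow>\<^sub>M borel_of skorohod_topology"
  proof (rule measurable_finite_range[OF fin])
    fix \<omega>0 assume "\<omega>0 \<in> space M"
    have "V -` {V \<omega>0} \<inter> space M = {\<omega> \<in> space M. \<forall>p\<in>D. S (fst p) (snd p) \<omega> = S (fst p) (snd p) \<omega>0}"
    proof -
      have "V \<omega> = V \<omega>0 \<longleftrightarrow> (\<forall>p\<in>D. S (fst p) (snd p) \<omega> = S (fst p) (snd p) \<omega>0)" for \<omega>
      proof
        assume eq: "V \<omega> = V \<omega>0"
        show "\<forall>p\<in>D. S (fst p) (snd p) \<omega> = S (fst p) (snd p) \<omega>0"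
        proof
          fix p assume "p \<in> D"
          then show "S (fst p) (snd p) \<omega> = S (fst p) (snd p) \<omega>0"
            using fun_cong[OF eq, of p] by (simp add: V_def)
        qed
      qed (unfold V_def, rule restrict_ext, blast)
      then show ?thesis by auto
    qed
    moreover have "{\<omega> \<in> space M. \<forall>p\<in>D. S (fst p) (snd p) \<omega> = S (fst p) (snd p) \<omega>0} \<in> sets M"
      using S_measurable by (intro sets.sets_Collect_finite_All') (auto simp: D_def)
    ultimately show "V -` {V \<omega>0} \<inter> space M \<in> sets M" by simp
    show "g (V \<omega>0) \<in> space (borel_of skorohod_topology)"
      unfolding space_borel_of topspace_skorohod_topology g_def
      by (rule step_function_in_skorohod_space[of "real (fst n)" "real (snd n)" "\<lambda>i j. V \<omega>0 (nat i, nat j) / norming (fst n) (snd n)"]) auto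
  qed
  then show ?thesis unfolding gV .
qed

lemma X_converges_in_distribution:
  assumes B: "fractional_brownian_sheet N (\<alpha>1 / 2, \<alpha>2 / 2) B"
    and Bm: "(\<lambda>\<omega>. \<lambda>t\<in>unit_square. B t \<omega>) \<in> N \<rightarrow>\<^sub>M borel_of skorohod_topology"
  shows "converges_in_distribution skorohod_topology M (\<lambda>n \<omega>. \<lambda>t\<in>unit_square. X n t \<omega>)
    N (\<lambda>\<omega>. \<lambda>t\<in>unit_square. sqrt (K1.c * K2.c) * B t \<omega>) pair_filter"
proof -
  interpret D: Metric_space skorohod_space skorohod_dist by (rule Metric_space_skorohod)
  define \<sigma> where "\<sigma> = sqrt (K1.c * K2.c)"
  have \<sigma>2: "\<sigma> * \<sigma> = K1.c * K2.c" using K1.c_pos K2.c_pos by (simp add: \<sigma>_def)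
  have G: "gaussian_process N ({0..} \<times> {0..}) B"
    and B0: "\<And>t. t \<in> {0..} \<times> {0..} \<Longrightarrow> (\<integral>\<omega>. B t \<omega> \<partial>N) = 0"
    and cov: "\<And>s t. s \<in> {0..} \<times> {0..} \<Longrightarrow> t \<in> {0..} \<times> {0..} \<Longrightarrow>
      covariance N (B s) (B t) = K1.cov_fbm (fst s) (fst t) * K2.cov_fbm (snd s) (snd t)"
  proof -
    have H: "2 * fst (\<alpha>1 / 2, \<alpha>2 / 2) = \<alpha>1" "2 * snd (\<alpha>1 / 2, \<alpha>2 / 2) = \<alpha>2" by simp_all
    show "gaussian_process N ({0..} \<times> {0..}) B"
      using B unfolding fractional_brownian_sheet_def by blast
    show "(\<integral>\<omega>. B t \<omega> \<partial>N) = 0" if "t \<in> {0..} \<times> {0..}" for t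
      using B that unfolding fractional_brownian_sheet_def by blast
    show "covariance N (B s) (B t) = K1.cov_fbm (fst s) (fst t) * K2.cov_fbm (snd s) (snd t)"
      if "s \<in> {0..} \<times> {0..}" "t \<in> {0..} \<times> {0..}" for s t
      using B that unfolding fractional_brownian_sheet_def K1.cov_fbm_def K2.cov_fbm_def H by blast
  qed
  interpret N: prob_space N using G by (simp add: gaussian_process_def)
  have Zm: "(\<lambda>\<omega>. \<sigma> * B t \<omega>) \<in> borel_measurable N" if "t \<in> {0..} \<times> {0..}" for t
  proof -
    have "B t \<in> borel_measurable N" using G that unfolding gaussian_process_def by blast
    then show ?thesis by simp
  qed
  have "(\<lambda>\<omega>. \<lambda>t\<in>unit_square. \<sigma> * (\<lambda>t\<in>unit_square. B t \<omega>) t) \<in> N \<rightarrow>\<^sub>M borel_of skorohod_topology"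
    by (rule measurable_compose[OF Bm skorohod_scale_measurable])
  moreover have "(\<lambda>t\<in>unit_square. \<sigma> * (\<lambda>t\<in>unit_square. B t \<omega>) t) = (\<lambda>t\<in>unit_square. \<sigma> * B t \<omega>)" for \<omega>
    by (rule restrict_ext) simp
  ultimately have Zp: "(\<lambda>\<omega>. \<lambda>t\<in>unit_square. \<sigma> * B t \<omega>) \<in> N \<rightarrow>\<^sub>M borel_of skorohod_topology" by simp
  have Z2: "integrable N (\<lambda>\<omega>. (\<sigma> * B t \<omega>)\<^sup>2)" if "t \<in> {0..} \<times> {0..}" for t
    using gaussian_process_cos(1)[OF G B0 that] by (simp add: power_mult_distrib)
  have cos: "((\<lambda>n. expectation (\<lambda>\<omega>. cos ((\<Sum>t\<in>T. u t * X n t \<omega>) + b))) \<longlongrightarrow>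
      (\<integral>\<omega>. cos ((\<Sum>t\<in>T. u t * (\<sigma> * B t \<omega>)) + b) \<partial>N)) pair_filter"
    if T: "finite T" "T \<subseteq> {0..} \<times> {0..}" for T u b
  proof -
    \<comment> \<open>The scalar \<open>\<sigma>\<close> is absorbed into the coefficients; its
      square is the product of the two limit constants, which turns the covariance of
      \<open>B\<close> into \<open>cov_sheet\<close>.\<close>
    have "(\<Sum>s\<in>T. \<Sum>t\<in>T. (u s * \<sigma>) * (u t * \<sigma>) * covariance N (B s) (B t)) = form T u"
      unfolding form_def
    proof (intro sum.cong refl)
      fix s t assume "s \<in> T" "t \<in> T"
      then have c: "covariance N (B s) (B t) = K1.cov_fbm (fst s) (fst t) * K2.cov_fbm (snd s) (snd t)"
        using T(2) by (intro cov) auto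
      have "(u s * \<sigma>) * (u t * \<sigma>) * covariance N (B s) (B t) = u s * u t * ((\<sigma> * \<sigma>) * covariance N (B s) (B t))"
        by (simp only: mult_ac)
      also have "\<dots> = u s * u t * cov_sheet s t" unfolding \<sigma>2 c cov_sheet_def by (simp only: mult_ac)
      finally show "(u s * \<sigma>) * (u t * \<sigma>) * covariance N (B s) (B t) = u s * u t * cov_sheet s t" .
    qed
    then have "(\<integral>\<omega>. cos ((\<Sum>t\<in>T. u t * \<sigma> * B t \<omega>) + b) \<partial>N) = cos b * exp (- (form T u / 2))"
      using gaussian_process_cos(2)[OF G B0 T, of "\<lambda>t. u t * \<sigma>" b] by simp
    then show ?thesis using fdd_cos[OF T, of u b] by (simp only: mult.assoc)
  qed
  obtain q C b where qcb: "q > 0" "0 \<le> C" "0 < b" "b < 1"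
    and mod: "\<And>m. \<forall>\<^sub>F n in pair_filter. \<exists>W. integrable M W \<and> (\<forall>\<omega>. 0 \<le> W \<omega>) \<and> expectation W \<le> C * b ^ m \<and>
       (\<forall>\<omega>\<in>space M. \<forall>s\<in>unit_square. \<forall>t\<in>unit_square.
          \<bar>fst s - fst t\<bar> \<le> (1/2) ^ Suc m \<longrightarrow> \<bar>snd s - snd t\<bar> \<le> (1/2) ^ Suc m \<longrightarrow> \<bar>X n s \<omega> - X n t \<omega>\<bar> ^ q \<le> W \<omega>)"
    by (rule X_modulus) blast
  have bd: "\<exists>B. \<forall>\<^sub>F n in pair_filter. expectation (\<lambda>\<omega>. (X n t \<omega>)\<^sup>2) \<le> B" if "t \<in> {0..} \<times> {0..}" for t
    using X_second_moment[OF that] by blast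
  show ?thesis
    unfolding converges_in_distribution_def \<sigma>_def[symmetric]
  proof (intro conjI allI impI X_path_measurable Zp, elim conjE)
    fix f assume f: "continuous_map skorohod_topology euclideanreal f" "bounded (f ` topspace skorohod_topology)"
    show "((\<lambda>n. expectation (\<lambda>\<omega>. f (\<lambda>t\<in>unit_square. X n t \<omega>))) \<longlongrightarrow>
        (\<integral>\<omega>. f (\<lambda>t\<in>unit_square. \<sigma> * B t \<omega>) \<partial>N)) pair_filter"
    proof (rule D.weak_convergence_lipschitz[where f = f and X = "\<lambda>n \<omega>. \<lambda>t\<in>unit_square. X n t \<omega>"
          and Z = "\<lambda>\<omega>. \<lambda>t\<in>unit_square. \<sigma> * B t \<omega>", OF prob_space_axioms N.prob_space_axioms])
      fix g C' K assume g: "\<And>x. x \<in> skorohod_space \<Longrightarrow> \<bar>g x\<bar> \<le> C'"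
        "\<And>x y. x \<in> skorohod_space \<Longrightarrow> y \<in> skorohod_space \<Longrightarrow> \<bar>g x - g y\<bar> \<le> K * skorohod_dist x y"
      show "((\<lambda>n. expectation (\<lambda>\<omega>. g (\<lambda>t\<in>unit_square. X n t \<omega>))) \<longlongrightarrow>
        (\<integral>\<omega>. g (\<lambda>t\<in>unit_square. \<sigma> * B t \<omega>) \<partial>N)) pair_filter"
        by (rule skorohod_convergence[where Z = "\<lambda>t \<omega>. \<sigma> * B t \<omega>",
              OF prob_space_axioms N.prob_space_axioms pair_filter_nonbot X_path_measurable Zp X_measurable Zm
                X_square_integrable Z2 bd cos qcb mod g])
    qed (use f X_path_measurable Zp in \<open>simp_all add: skorohod_topology_def[symmetric] topspace_skorohod_topology\<close>)
  qed
qed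

end

theorem theorem2p2:
  fixes M :: "'a measure" and N :: "'b measure"
    and \<mu>1 \<mu>2 :: "nat measure"
    and Y1 Y2 :: "nat \<Rightarrow> 'a \<Rightarrow> nat"
    and \<epsilon> :: "nat \<times> nat \<Rightarrow> 'a \<Rightarrow> real"
    and \<alpha>1 \<alpha>2 :: real
    and L1 L2 :: "real \<Rightarrow> real"
    and B :: "real \<times> real \<Rightarrow> 'b \<Rightarrow> real"
  assumes "randomized_karlin_model M \<mu>1 \<mu>2 Y1 Y2 \<epsilon>"
    and "\<alpha>1 \<in> {0<..<1}" and "\<alpha>2 \<in> {0<..<1}"
    and "regular_variation_condition \<mu>1 \<alpha>1 L1"
    and "regular_variation_condition \<mu>2 \<alpha>2 L2"
    and "fractional_brownian_sheet N (\<alpha>1 / 2, \<alpha>2 / 2) B"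
    and "(\<lambda>\<omega>. \<lambda>t\<in>unit_square. B t \<omega>) \<in> measurable N (borel_of skorohod_topology)"
  shows
    "converges_in_distribution skorohod_topology
       M (\<lambda>(n1, n2) \<omega>. \<lambda>(t1, t2)\<in>unit_square.
            karlin_S Y1 Y2 \<epsilon> (nat \<lfloor>real n1 * t1\<rfloor>) (nat \<lfloor>real n2 * t2\<rfloor>) \<omega> /
            (real n1 powr (\<alpha>1 / 2) * real n2 powr (\<alpha>2 / 2) *
              (L1 (real n1) * L2 (real n2)) powr (1 / 2)))
       N (\<lambda>\<omega>. \<lambda>t\<in>unit_square.
            sqrt ((Gamma (1 - \<alpha>1) * 2 powr (\<alpha>1 - 1)) * (Gamma (1 - \<alpha>2) * 2 powr (\<alpha>2 - 1))) *
            B t \<omega>)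
       (filtercomap (\<lambda>(n1, n2). min n1 n2) at_top)"
proof -
  interpret randomized_karlin_model M \<mu>1 \<mu>2 Y1 Y2 \<epsilon> by fact
  interpret karlin_sheet M \<mu>1 \<mu>2 Y1 Y2 \<epsilon> \<alpha>1 \<alpha>2 L1 L2
    by unfold_locales (use assms in auto)
  have "(\<lambda>(n1, n2) \<omega>. \<lambda>(t1, t2)\<in>unit_square.
      karlin_S Y1 Y2 \<epsilon> (nat \<lfloor>real n1 * t1\<rfloor>) (nat \<lfloor>real n2 * t2\<rfloor>) \<omega> /
      (real n1 powr (\<alpha>1 / 2) * real n2 powr (\<alpha>2 / 2) * (L1 (real n1) * L2 (real n2)) powr (1 / 2)))
    = (\<lambda>n \<omega>. \<lambda>t\<in>unit_square. X n t \<omega>)"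
    unfolding norming_eq by (auto simp: fun_eq_iff X_def restrict_def)
  with X_converges_in_distribution[OF assms(6,7)] show ?thesis
    unfolding K1.c_def K2.c_def pair_filter_def by simp
qed

end
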